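(* Let $X$ be a smooth vector field on $M=\mathbb R^d$ satisfying $$\forall k\in\mathbb N,\qquad\sup_M|\nabla^kX|_I<\infty ,$$ where $I$ is the standard Euclidean metric. With $$P:=\tfrac1iX+\tfrac1{2i}\operatorname{div}X ,$$ we have $P=\mathrm{Op}^{\mathrm W}(p)$ with $p(x,\xi)=\xi.X(x)$. Moreover $p$ satisfies Assumption A, and satisfies Assumption B with the metric $$g_{(x,\xi)}=\langle\xi\rangle_I^{2\alpha_1}\,dx^2+\langle\xi\rangle_I^{-2\alpha_2}\,d\xi^2 ,$$ for any parameters $\alpha_1,\alpha_2$ subject to $$0\le\alpha_1\le\alpha_2\le1,\qquad\alpha_1+\alpha_2\ge1\quad\text{and}\quad\alpha_1<1 .$$ (Assumptions A and B are stated in the context.)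
   Context: **Notation.** $X$ acts on functions as a first-order differential operator, $\operatorname{div}X=\operatorname{tr}\nabla X$, $\xi.X(x)$ is the duality pairing, $dx^2+d\xi^2$ is the standard Euclidean metric on $\mathbb R^{2d}$. **Phase space and metrics.** $T^\star M=\mathbb R^d\times\mathbb R^d\ni\rho=(x,\xi)$; $W\cong\mathbb R^{2d}$ is the space of translations. $\sigma=d\xi\wedge dx$, i.e. $\sigma((y,\eta),(y',\eta'))=\eta\cdot y'-\eta'\cdot y$. $\nabla$ is the flat derivative. $\langle\cdot\rangle=\sqrt{1+|\cdot|^2}$, with the norm indicated as a subscript. A Riemannian metric $g$ on $T^\star M$ is a smooth family of positive definite quadratic forms $g_\rho$ on $W$, $|\zeta|_{g_\rho}=g_\rho(\zeta,\zeta)^{1/2}$; for a tensor $B$ acting on $k$ vectors, $|B|_g(\rho)=\sup_{|X_j|_{g_\rho}\le1}|B_\rho(X_1,\dots,X_k)|$. $|\zeta|_{g^\sigma_\rho}=\sup_{\zeta'\ne0}|\sigma(\zeta,\zeta')|/|\zeta'|_{g_\rho}$. $h_g(\rho)=\sup_{\zeta\ne0}|\zeta|_{g_\rho}/|\zeta|_{g^\sigma_\rho}$, $\underline h_g=\sup h_g$. $g$ is *admissible* if there are $r,C,N>0$ with: $|\rho-\rho_0|_{g_{\rho_0}}\le r\Rightarrow C^{-2}g_{\rho_0}\le g_\rho\le C^2g_{\rho_0}$; $g_\rho\le C^2g_{\rho_0}\langle\rho-\rho_0\rangle_{g^\sigma_\rho}^{2N}$ for all $\rho_0,\rho$; and $h_g\le1$.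 $S(m,g)$ ($m>0$ a function) is the space of smooth functions (or tensors) $a$ with $\sup_\rho|\nabla^ja|_g(\rho)/m(\rho)<\infty$ for all $j$. $\theta_g(\rho)=\sup_{\zeta\ne0}|\zeta|_{g_\rho^\sigma}/|\zeta|_{\mathsf g}$, $\mathsf g$ a fixed Euclidean metric on $W$ with $\mathsf g=\mathsf g^\sigma$. **Weyl quantization.** $[\mathrm{Op}^{\mathrm W}(a)u](x)=(2\pi)^{-d}\iint e^{i\xi\cdot(x-y)}a(\tfrac{x+y}2,\xi)u(y)\,dy\,d\xi$, extended to $a\in\mathcal S'(T^\star M)$. **Assumptions.** $H_p$: $\sigma(H_p,Y)=-dp\cdot Y$, with flow $\phi^t$. *Assumption A*: $p\in\mathcal S'(T^\star M)$ is a real-valued $C^\infty$ function, $(\phi^t)_{t\in\mathbb R}$ is complete, and $\mathrm{Op}^{\mathrm W}(p)$ with domain $\mathcal S(M)$ is essentially self-adjoint on $L^2(M)$. *Assumption B*: $g$ is admissible and (i) $\Lambda:=\frac12\sup|\mathcal L_{H_p}g|_g<\infty$, $\mathcal L_{H_p}g=\frac{d}{dt}|_{t=0}(\phi^t)^*g$; (ii) there is $\epsilon\in(0,1/2]$ with $\nabla^3p\in S((\theta_g\underline h_g^{1/2})^{-\epsilon}(h_g/\underline h_g)^{-3},g)\cap S((h_g/\underline h_g)^{-1},g)$; (iii) there are $\Upsilon\ge0$, $C_\Upsilon>0$ with $g_{\phi^t(\rho)}\le C_\Upsilon^2e^{2\Upsilon|t|}g_\rho$ for all $\rho\in T^\star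 M$, $t\in\mathbb R$. *)

theory Defs
  imports "HOL-Analysis.Analysis"
begin

section \<open>Tensor fields and the flat derivative\<close>

text \<open>A covariant tensor field of rank k is a map B taking a base point and a list of k
  vectors; a function f is the rank 0 field \<open>\<lambda>x _. f x\<close>. The argument of the
  new derivative is the head of the list.\<close>

definition nabla ::
  "('a::real_normed_vector \<Rightarrow> 'a list \<Rightarrow> 'b::real_normed_vector) \<Rightarrow> 'a \<Rightarrow> 'a list \<Rightarrow> 'b" where
  "nabla B x Xs = frechet_derivative (\<lambda>y. B y (tl Xs)) (at x) (hd Xs)"

definition nabla_pow ::
  "nat \<Rightarrow> ('a::real_normed_vector \<Rightarrow> 'b::real_normed_vector) \<Rightarrow> 'a \<Rightarrow> 'a list \<Rightarrow> 'b" where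
  "nabla_pow k f = (nabla ^^ k) (\<lambda>x _. f x)"

text \<open>All iterated directional derivatives exist and are Frechet differentiable (hence
  continuous) everywhere; on a finite-dimensional space this is the class of
  infinitely differentiable functions.\<close>

definition smooth :: "('a::real_normed_vector \<Rightarrow> 'b::real_normed_vector) \<Rightarrow> bool" where
  "smooth f \<longleftrightarrow>
     (\<forall>k Xs x. length Xs = k \<longrightarrow> (\<lambda>y. nabla_pow k f y Xs) differentiable (at x))"

definition multilinear ::
  "nat \<Rightarrow> ('a::real_normed_vector list \<Rightarrow> 'b::real_normed_vector) \<Rightarrow> bool" where
  "multilinear k B \<longleftrightarrow> (\<forall>Xs i. length Xs = k \<and> i < k \<longrightarrow> linear (\<lambda>v. B (Xs[i := v])))"

definition japanese :: "'a::real_normed_vector \<Rightarrow> real" where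
  "japanese x = sqrt (1 + (norm x)\<^sup>2)"

section \<open>Metrics on phase space\<close>

text \<open>Phase space is \<open>'a \<times> 'a\<close>; the second component is a covector,
  identified with a vector by the Euclidean inner product, so that the duality pairing
  is \<open>inner\<close>. A quadratic form is represented by its polar bilinear form.\<close>

definition sigma :: "'a::euclidean_space \<times> 'a \<Rightarrow> 'a \<times> 'a \<Rightarrow> real" where
  "sigma \<zeta> \<zeta>' = snd \<zeta> \<bullet> fst \<zeta>' - snd \<zeta>' \<bullet> fst \<zeta>"

definition euclidean_form :: "('w::real_vector \<Rightarrow> 'w \<Rightarrow> real) \<Rightarrow> bool" where
  "euclidean_form q \<longleftrightarrow>
     (\<forall>\<zeta>. linear (q \<zeta>)) \<and> (\<forall>\<zeta> \<zeta>'. q \<zeta> \<zeta>' = q \<zeta>' \<zeta>) \<and> (\<forall>\<zeta>. \<zeta> \<noteq> 0 \<longrightarrow> q \<zeta> \<zeta> > 0)"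

definition riemannian_metric :: "('w::euclidean_space \<Rightarrow> 'w \<Rightarrow> 'w \<Rightarrow> real) \<Rightarrow> bool" where
  "riemannian_metric g \<longleftrightarrow>
     (\<forall>\<rho>. euclidean_form (g \<rho>)) \<and> (\<forall>\<zeta> \<zeta>'. smooth (\<lambda>\<rho>. g \<rho> \<zeta> \<zeta>'))"

definition form_norm :: "('w \<Rightarrow> 'w \<Rightarrow> real) \<Rightarrow> 'w \<Rightarrow> real" where
  "form_norm q \<zeta> = sqrt (q \<zeta> \<zeta>)"

text \<open>The suprema in the next three definitions and in \<open>theta\<close> below are
  taken over bounded nonempty sets when the forms are positive definite and the tensor is
  multilinear, by finite dimensionality. Suprema over all of phase space may be infinite; where
  their finiteness is part of a condition, it is stated with \<open>bdd_above\<close>.\<close>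

definition tensor_norm ::
  "('w::real_normed_vector \<Rightarrow> 'w \<Rightarrow> 'w \<Rightarrow> real) \<Rightarrow> nat \<Rightarrow>
   ('w \<Rightarrow> 'w list \<Rightarrow> 'b::real_normed_vector) \<Rightarrow> 'w \<Rightarrow> real" where
  "tensor_norm g k B \<rho> =
     Sup {norm (B \<rho> Xs) | Xs. length Xs = k \<and> (\<forall>X \<in> set Xs. form_norm (g \<rho>) X \<le> 1)}"

definition dual_norm ::
  "('a::euclidean_space \<times> 'a \<Rightarrow> 'a \<times> 'a \<Rightarrow> real) \<Rightarrow> 'a \<times> 'a \<Rightarrow> real" where
  "dual_norm q \<zeta> = Sup {\<bar>sigma \<zeta> \<zeta>'\<bar> / form_norm q \<zeta>' | \<zeta>'. \<zeta>' \<noteq> 0}"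

definition gain ::
  "('a::euclidean_space \<times> 'a \<Rightarrow> 'a \<times> 'a \<Rightarrow> 'a \<times> 'a \<Rightarrow> real) \<Rightarrow> 'a \<times> 'a \<Rightarrow> real" where
  "gain g \<rho> = Sup {form_norm (g \<rho>) \<zeta> / dual_norm (g \<rho>) \<zeta> | \<zeta>. \<zeta> \<noteq> 0}"

definition gain_sup ::
  "('a::euclidean_space \<times> 'a \<Rightarrow> 'a \<times> 'a \<Rightarrow> 'a \<times> 'a \<Rightarrow> real) \<Rightarrow> real" where
  "gain_sup g = Sup (range (gain g))"

definition self_dual_form ::
  "('a::euclidean_space \<times> 'a \<Rightarrow> 'a \<times> 'a \<Rightarrow> real) \<Rightarrow> bool" where
  "self_dual_form e \<longleftrightarrow> euclidean_form e \<and> (\<forall>\<zeta>. dual_norm e \<zeta> = form_norm e \<zeta>)"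

definition theta ::
  "('a::euclidean_space \<times> 'a \<Rightarrow> 'a \<times> 'a \<Rightarrow> real) \<Rightarrow>
   ('a \<times> 'a \<Rightarrow> 'a \<times> 'a \<Rightarrow> 'a \<times> 'a \<Rightarrow> real) \<Rightarrow> 'a \<times> 'a \<Rightarrow> real" where
  "theta e g \<rho> = Sup {dual_norm (g \<rho>) \<zeta> / form_norm e \<zeta> | \<zeta>. \<zeta> \<noteq> 0}"

definition admissible ::
  "('a::euclidean_space \<times> 'a \<Rightarrow> 'a \<times> 'a \<Rightarrow> 'a \<times> 'a \<Rightarrow> real) \<Rightarrow> bool" where
  "admissible g \<longleftrightarrow> riemannian_metric g \<and>
     (\<exists>r>0. \<exists>C>0. \<exists>N>0::real.
        (\<forall>\<rho>\<^sub>0 \<rho>. form_norm (g \<rho>\<^sub>0) (\<rho> - \<rho>\<^sub>0) \<le> r \<longrightarrow>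
           (\<forall>\<zeta>. g \<rho>\<^sub>0 \<zeta> \<zeta> / C\<^sup>2 \<le> g \<rho> \<zeta> \<zeta> \<and> g \<rho> \<zeta> \<zeta> \<le> C\<^sup>2 * g \<rho>\<^sub>0 \<zeta> \<zeta>)) \<and>
        (\<forall>\<rho>\<^sub>0 \<rho> \<zeta>. g \<rho> \<zeta> \<zeta> \<le> C\<^sup>2 * g \<rho>\<^sub>0 \<zeta> \<zeta> *
           sqrt (1 + (dual_norm (g \<rho>) (\<rho> - \<rho>\<^sub>0))\<^sup>2) powr (2 * N))) \<and>
     (\<forall>\<rho>. gain g \<rho> \<le> 1)"

definition symbol_class ::
  "nat \<Rightarrow> ('w::euclidean_space \<Rightarrow> real) \<Rightarrow> ('w \<Rightarrow> 'w \<Rightarrow> 'w \<Rightarrow> real) \<Rightarrow>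
   ('w \<Rightarrow> 'w list \<Rightarrow> real) set" where
  "symbol_class k m g =
     {a. (\<forall>\<rho>. multilinear k (a \<rho>)) \<and>
         (\<forall>Xs. length Xs = k \<longrightarrow> smooth (\<lambda>\<rho>. a \<rho> Xs)) \<and>
         (\<forall>j. bdd_above (range (\<lambda>\<rho>. tensor_norm g (j + k) ((nabla ^^ j) a) \<rho> / m \<rho>)))}"

section \<open>Hamiltonian flow\<close>

definition hamiltonian_field :: "('a::euclidean_space \<times> 'a \<Rightarrow> real) \<Rightarrow> 'a \<times> 'a \<Rightarrow> 'a \<times> 'a" where
  "hamiltonian_field p \<rho> = (THE H. \<forall>Y. sigma H Y = - frechet_derivative p (at \<rho>) Y)"

text \<open>For smooth p such a global flow is unique, so that quantifying it existentially
  or universally amounts to the same.\<close>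

definition hamiltonian_flow ::
  "('a::euclidean_space \<times> 'a \<Rightarrow> real) \<Rightarrow> (real \<Rightarrow> 'a \<times> 'a \<Rightarrow> 'a \<times> 'a) \<Rightarrow> bool" where
  "hamiltonian_flow p \<phi> \<longleftrightarrow>
     (\<forall>\<rho>. \<phi> 0 \<rho> = \<rho> \<and>
       (\<forall>t. ((\<lambda>s. \<phi> s \<rho>) has_vector_derivative hamiltonian_field p (\<phi> t \<rho>)) (at t)))"

definition metric_pullback ::
  "('w::real_normed_vector \<Rightarrow> 'w) \<Rightarrow> ('w \<Rightarrow> 'w \<Rightarrow> 'w \<Rightarrow> real) \<Rightarrow> 'w \<Rightarrow> 'w \<Rightarrow> 'w \<Rightarrow> real" where
  "metric_pullback f g \<rho> \<zeta> \<zeta>' =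
     g (f \<rho>) (frechet_derivative f (at \<rho>) \<zeta>) (frechet_derivative f (at \<rho>) \<zeta>')"

definition lie_derivative_metric ::
  "(real \<Rightarrow> 'w::real_normed_vector \<Rightarrow> 'w) \<Rightarrow> ('w \<Rightarrow> 'w \<Rightarrow> 'w \<Rightarrow> real) \<Rightarrow>
   'w \<Rightarrow> 'w list \<Rightarrow> real" where
  "lie_derivative_metric \<phi> g \<rho> Xs =
     deriv (\<lambda>t. metric_pullback (\<phi> t) g \<rho> (Xs ! 0) (Xs ! 1)) 0"

section \<open>Schwartz functions and tempered distributions\<close>

definition schwartz_weighted :: "nat \<Rightarrow> nat \<Rightarrow> ('a::euclidean_space \<Rightarrow> complex) \<Rightarrow> 'a \<Rightarrow> real" where
  "schwartz_weighted N k u x =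
     japanese x ^ N * tensor_norm (\<lambda>_. inner) k (nabla_pow k u) x"

definition schwartz :: "('a::euclidean_space \<Rightarrow> complex) set" where
  "schwartz = {u. smooth u \<and> (\<forall>N k. bdd_above (range (schwartz_weighted N k u)))}"

definition schwartz_seminorm :: "nat \<Rightarrow> nat \<Rightarrow> ('a::euclidean_space \<Rightarrow> complex) \<Rightarrow> real" where
  "schwartz_seminorm N k u = Sup (range (schwartz_weighted N k u))"

definition test_function :: "('a::euclidean_space \<Rightarrow> complex) \<Rightarrow> bool" where
  "test_function u \<longleftrightarrow> smooth u \<and> (\<exists>K. compact K \<and> (\<forall>x. x \<notin> K \<longrightarrow> u x = 0))"

text \<open>A distribution is a functional of which only the values on Schwartz functions matter.\<close>

definition tempered_distribution ::
  "(('a::euclidean_space \<Rightarrow> complex) \<Rightarrow> complex) \<Rightarrow> bool" where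
  "tempered_distribution T \<longleftrightarrow>
     (\<forall>u\<in>schwartz. \<forall>v\<in>schwartz. T (\<lambda>x. u x + v x) = T u + T v) \<and>
     (\<forall>c. \<forall>u\<in>schwartz. T (\<lambda>x. c * u x) = c * T u) \<and>
     (\<exists>C N. \<forall>u\<in>schwartz. cmod (T u) \<le> C * (\<Sum>k\<le>N. schwartz_seminorm N k u))"

text \<open>The function a, viewed as a distribution, is (the restriction of) the tempered
  distribution T. This requires agreement on compactly supported test functions only, as the
  integral against a general Schwartz function need not converge; by density, T is nevertheless
  determined on Schwartz functions.\<close>

definition is_distribution_of ::
  "(('a::euclidean_space \<Rightarrow> complex) \<Rightarrow> complex) \<Rightarrow> ('a \<Rightarrow> complex) \<Rightarrow> bool" where
  "is_distribution_of T a \<longleftrightarrow> tempered_distribution T \<and>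
     (\<forall>u. test_function u \<longrightarrow> T u = (LINT x|lborel. a x * u x))"

section \<open>Weyl quantization\<close>

definition weyl_integral ::
  "('a::euclidean_space \<times> 'a \<Rightarrow> complex) \<Rightarrow> ('a \<Rightarrow> complex) \<Rightarrow> 'a \<Rightarrow> complex" where
  "weyl_integral a u x = of_real (1 / (2 * pi) ^ DIM('a)) *
     (LINT (y, \<xi>)|lborel. exp (\<i> * of_real (\<xi> \<bullet> (x - y))) * a ((1/2) *\<^sub>R (x + y), \<xi>) * u y)"

definition wigner ::
  "('a::euclidean_space \<Rightarrow> complex) \<Rightarrow> ('a \<Rightarrow> complex) \<Rightarrow> 'a \<times> 'a \<Rightarrow> complex" where
  "wigner u v = (\<lambda>(x, \<xi>). of_real (1 / (2 * pi) ^ DIM('a)) *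
     (LINT z|lborel. exp (\<i> * of_real (\<xi> \<bullet> z)) * u (x - (1/2) *\<^sub>R z) * v (x + (1/2) *\<^sub>R z)))"

text \<open>For a tempered symbol the quantization maps Schwartz functions to tempered
  distributions; \<open>weyl_op T u\<close> is that distribution, acting on test functions v
  through the bilinear (not sesquilinear) pairing. It extends \<open>weyl_integral\<close> by duality,
  see \<open>weyl_op_extends_weyl_integral\<close> below.\<close>

definition weyl_op ::
  "(('a::euclidean_space \<times> 'a \<Rightarrow> complex) \<Rightarrow> complex) \<Rightarrow> ('a \<Rightarrow> complex) \<Rightarrow>
   ('a \<Rightarrow> complex) \<Rightarrow> complex" where
  "weyl_op T u v = T (wigner u v)"

lemma japanese_ge_1: "1 \<le> japanese x"
  by (simp add: japanese_def)

lemma japanese_Pair_le: "japanese (x, y) \<le> japanese x * japanese y"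
proof -
  have "1 + (norm (x, y))\<^sup>2 \<le> (1 + (norm x)\<^sup>2) * (1 + (norm y)\<^sup>2)"
    by (simp add: norm_Pair algebra_simps)
  then show ?thesis
    unfolding japanese_def real_sqrt_mult[symmetric] by (rule real_sqrt_le_mono)
qed

lemma japanese_snd_le: "japanese y \<le> japanese (x, y)"
  by (simp add: japanese_def norm_Pair)

lemma japanese_diff_le: "japanese (x - y) \<le> 2 * (japanese x * japanese y)"
proof -
  have "norm (x - y) \<le> norm x + norm y" by (rule norm_triangle_ineq4)
  then have "(norm (x - y))\<^sup>2 \<le> (norm x + norm y)\<^sup>2" by (simp add: power_mono)
  also have "\<dots> \<le> 2 * (norm x)\<^sup>2 + 2 * (norm y)\<^sup>2"
    using sum_squares_bound[of "norm x" "norm y"] by (simp add: power2_sum)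
  finally have "1 + (norm (x - y))\<^sup>2 \<le> 4 * ((1 + (norm x)\<^sup>2) * (1 + (norm y)\<^sup>2))"
    by (simp add: algebra_simps add_increasing2)
       (smt (verit) mult_nonneg_nonneg zero_le_power2)
  then have "japanese (x - y) \<le> sqrt (4 * ((1 + (norm x)\<^sup>2) * (1 + (norm y)\<^sup>2)))"
    unfolding japanese_def by (rule real_sqrt_le_mono)
  then show ?thesis
    by (simp add: japanese_def real_sqrt_mult)
qed

lemma integrable_lborel_if_decay:
  fixes f :: "'a::euclidean_space \<Rightarrow> complex"
  assumes f: "continuous_on UNIV f"
    and bound: "\<And>x. cmod (f x) * japanese x ^ (DIM('a) + 2) \<le> C"
  shows "integrable lborel f"
proof -
  define n where "n = DIM('a)"
  define V where "V = unit_ball_vol (real n)"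
  have C: "0 \<le> C"
    using bound[of 0] by (smt (verit) japanese_ge_1 mult_nonneg_nonneg norm_ge_zero zero_le_power)
  have V: "0 \<le> V" by (simp add: V_def)
  define c where "c k = C * 2 ^ (n + 2) / real (Suc k) ^ (n + 2)" for k
  have c: "0 \<le> c k" for k using C by (simp add: c_def)
  have pw: "ennreal (cmod (f x)) \<le> (\<Sum>k. ennreal (c k) * indicator (ball 0 (real (Suc k))) x)" for x
  proof -
    define k where "k = nat \<lfloor>norm x\<rfloor>"
    have k: "real k \<le> norm x" "norm x < real (Suc k)"
      unfolding k_def by (simp_all add: of_nat_nat) linarith
    have "norm x \<le> japanese x"
      unfolding japanese_def by (rule real_le_rsqrt) simp
    then have "real (Suc k) / 2 \<le> japanese x"
      using k japanese_ge_1[of x] by simp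
    then have "(real (Suc k) / 2) ^ (n + 2) \<le> japanese x ^ (n + 2)"
      by (intro power_mono) auto
    then have "cmod (f x) * (real (Suc k) / 2) ^ (n + 2) \<le> C"
      using bound[of x] by (smt (verit) mult_left_mono norm_ge_zero n_def)
    moreover have "0 < real (Suc k) ^ (n + 2)" by simp
    ultimately have "cmod (f x) \<le> c k"
      unfolding c_def power_divide times_divide_eq_right
      by (simp only: pos_le_divide_eq pos_divide_le_eq zero_less_power zero_less_numeral)
    then have "ennreal (cmod (f x)) \<le> ennreal (c k) * indicator (ball 0 (real (Suc k))) x"
      using k by (simp add: ennreal_leI)
    also have "\<dots> \<le> (\<Sum>k. ennreal (c k) * indicator (ball 0 (real (Suc k))) x)"
      using sum_le_suminf[of "\<lambda>k. ennreal (c k) * indicator (ball 0 (real (Suc k))) x" "{k}",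
          OF summableI finite.insertI[OF finite.emptyI]]
      by (simp del: sum_mult_indicator of_nat_Suc mem_ball mem_ball_0)
    finally show ?thesis .
  qed
  have sm: "summable (\<lambda>k. c k * (V * real (Suc k) ^ n))"
  proof -
    have "c k * (V * real (Suc k) ^ n) = C * 2 ^ (n + 2) * V * (1 / real (Suc k) ^ 2)" for k
      by (simp add: c_def power_add power2_eq_square field_simps del: of_nat_Suc)
    moreover have "summable (\<lambda>k. 1 / real (Suc k) ^ 2)"
      using inverse_power_summable[of 2, where 'a=real]
      by (subst summable_Suc_iff) (simp add: inverse_eq_divide)
    ultimately show ?thesis by (simp only: summable_mult)
  qed
  have "(\<integral>\<^sup>+x. ennreal (cmod (f x)) \<partial>lborel) \<le>
    (\<integral>\<^sup>+x. (\<Sum>k. ennreal (c k) * indicator (ball 0 (real (Suc k)) :: 'a set) x) \<partial>lborel)"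
    by (intro nn_integral_mono pw)
  also have "\<dots> = (\<Sum>k. \<integral>\<^sup>+x. ennreal (c k) * indicator (ball 0 (real (Suc k)) :: 'a set) x \<partial>lborel)"
    by (rule nn_integral_suminf) (intro borel_measurable_times_ennreal borel_measurable_indicator, auto)
  also have "\<dots> = (\<Sum>k. ennreal (c k * (V * real (Suc k) ^ n)))"
    using V c by (intro suminf_cong)
      (simp add: nn_integral_cmult_indicator emeasure_ball V_def n_def ennreal_mult' del: of_nat_Suc)
  also have "\<dots> < \<infinity>"
    using sm V c by (simp add: ennreal_suminf_neq_top less_top[symmetric])
  finally show ?thesis
    using f by (intro integrableI_bounded) (auto intro: borel_measurable_continuous_onI)
qed

lemma schwartz_decay:
  assumes "u \<in> schwartz"
  shows "\<exists>C\<ge>0. \<forall>x. cmod (u x) * japanese x ^ N \<le> C"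
proof -
  have "bdd_above (range (schwartz_weighted N 0 u))"
    using assms by (simp add: schwartz_def)
  then obtain C where C: "\<And>x. schwartz_weighted N 0 u x \<le> C"
    by (auto simp: bdd_above_def)
  have "schwartz_weighted N 0 u x = cmod (u x) * japanese x ^ N" for x
    by (simp add: schwartz_weighted_def tensor_norm_def nabla_pow_def)
  then have C: "cmod (u x) * japanese x ^ N \<le> C" for x using C[of x] by simp
  moreover have "0 \<le> C"
    using C[of 0] by (smt (verit) japanese_ge_1 mult_nonneg_nonneg norm_ge_zero zero_le_power)
  ultimately show ?thesis by blast
qed

lemma schwartz_continuous:
  assumes "u \<in> schwartz"
  shows "continuous_on S u"
proof -
  have "(\<lambda>y. nabla_pow 0 u y []) differentiable (at x)" for x
    using assms unfolding schwartz_def smooth_def by blast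
  then have "u differentiable (at x)" for x by (simp add: nabla_pow_def)
  then have "continuous_on UNIV u"
    by (simp add: differentiable_imp_continuous_within continuous_at_imp_continuous_on)
  then show ?thesis by (rule continuous_on_subset) simp
qed

lemma integral_lborel_translate:
  fixes f :: "'a::euclidean_space \<Rightarrow> complex"
  assumes [measurable]: "f \<in> borel_measurable borel"
  shows "(LINT x|lborel. f (x + c)) = (LINT x|lborel. f x)"
proof -
  have "(LINT x|lborel. f x) = (LINT x|distr lborel borel (\<lambda>x. c + 1 *\<^sub>R x). f x)"
    using lborel_affine[of 1 c] by (simp add: density_1)
  also have "\<dots> = (LINT x|lborel. f (x + c))"
    by (subst integral_distr) (simp_all add: add.commute)
  finally show ?thesis by simp
qed

lemma integral_lborel_reflect:
  fixes f :: "'a::euclidean_space \<Rightarrow> complex"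
  assumes [measurable]: "f \<in> borel_measurable borel"
  shows "(LINT x|lborel. f (- x)) = (LINT x|lborel. f x)"
proof -
  have "(LINT x|lborel. f x) = (LINT x|distr lborel borel (\<lambda>x. 0 + (-1) *\<^sub>R x). f x)"
    using lborel_affine[of "-1" "0::'a"] by (simp add: density_1)
  also have "\<dots> = (LINT x|lborel. f (- x))"
    by (subst integral_distr) simp_all
  finally show ?thesis by simp
qed

lemma weyl_op_extends_weyl_integral:
  fixes a :: "'a::euclidean_space \<times> 'a \<Rightarrow> complex"
  assumes a: "a \<in> schwartz" and u: "u \<in> schwartz" and v: "v \<in> schwartz"
  shows "weyl_op (\<lambda>b. LINT \<rho>|lborel. a \<rho> * b \<rho>) u v = (LINT x|lborel. weyl_integral a u x * v x)"
proof -
  define K where "K = DIM('a \<times> ('a \<times> 'a)) + 2"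
  define c where "c = complex_of_real (1 / (2 * pi) ^ DIM('a))"
  define G where "G = (\<lambda>(x, z, \<xi>). exp (\<i> * of_real (\<xi> \<bullet> - z)) *
      a (x + (1/2) *\<^sub>R z, \<xi>) * u (x + z) * v x)"
  define H where "H = (\<lambda>(m, z, \<xi>). exp (\<i> * of_real (\<xi> \<bullet> - z)) *
      a (m, \<xi>) * u (m + (1/2) *\<^sub>R z) * v (m - (1/2) *\<^sub>R z))"
  note cont [continuous_intros] =
    schwartz_continuous[OF a, of UNIV, THEN continuous_on_compose2]
    schwartz_continuous[OF u, of UNIV, THEN continuous_on_compose2]
    schwartz_continuous[OF v, of UNIV, THEN continuous_on_compose2]
  have contG: "continuous_on UNIV G"
    unfolding G_def case_prod_unfold by (intro continuous_intros) auto
  have contH: "continuous_on UNIV H"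
    unfolding H_def case_prod_unfold by (intro continuous_intros) auto
  obtain A where A: "0 \<le> A" "\<And>x. cmod (a x) * japanese x ^ K \<le> A"
    using schwartz_decay[OF a, of "K"] by blast
  obtain U where U: "0 \<le> U" "\<And>x. cmod (u x) * japanese x ^ K \<le> U"
    using schwartz_decay[OF u, of "K"] by blast
  obtain V where V: "0 \<le> V" "\<And>x. cmod (v x) * japanese x ^ K \<le> V"
    using schwartz_decay[OF v, of "K"] by blast
  obtain V' where V': "0 \<le> V'" "\<And>x. cmod (v x) * japanese x ^ (2 * K) \<le> V'"
    using schwartz_decay[OF v, of "2 * K"] by blast
  have j0: "0 \<le> japanese x" for x :: "'c::real_normed_vector"
    using japanese_ge_1[of x] by simp
  have boundG: "cmod (G w) * japanese w ^ K \<le> 2 ^ K * (A * U * V')" for w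
  proof -
    obtain x z \<xi> where w: "w = (x, z, \<xi>)" by (cases w)
    have "japanese w \<le> japanese x * (japanese z * japanese \<xi>)"
      unfolding w using japanese_Pair_le[of x "(z, \<xi>)"]
        mult_left_mono[OF japanese_Pair_le[of z \<xi>] j0[of x]] by (rule order_trans)
    also have "\<dots> \<le> japanese x * ((2 * (japanese (x + z) * japanese x)) * japanese (x + (1/2) *\<^sub>R z, \<xi>))"
    proof -
      have "japanese z \<le> 2 * (japanese (x + z) * japanese x)"
        using japanese_diff_le[of "x + z" x] by simp
      then show ?thesis
        by (intro mult_left_mono[OF mult_mono[OF _ japanese_snd_le]]) (simp_all add: j0)
    qed
    finally have "japanese w ^ K \<le>
       (japanese x * ((2 * (japanese (x + z) * japanese x)) * japanese (x + (1/2) *\<^sub>R z, \<xi>))) ^ K"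
      by (intro power_mono j0)
    then have "cmod (G w) * japanese w ^ K \<le> cmod (G w) *
       (japanese x * ((2 * (japanese (x + z) * japanese x)) * japanese (x + (1/2) *\<^sub>R z, \<xi>))) ^ K"
      by (rule mult_left_mono) (rule norm_ge_zero)
    also have "\<dots> =
       2 ^ K * ((cmod (a (x + (1/2) *\<^sub>R z, \<xi>)) * japanese (x + (1/2) *\<^sub>R z, \<xi>) ^ K) *
        (cmod (u (x + z)) * japanese (x + z) ^ K) * (cmod (v x) * japanese x ^ (2 * K)))"
    proof -
      have "cmod (G w) = cmod (a (x + (1/2) *\<^sub>R z, \<xi>)) * cmod (u (x + z)) * cmod (v x)"
        by (simp only: w G_def prod.case norm_mult norm_exp_i_times mult_1_left)
      then show ?thesis
        unfolding mult_2[of K] power_add by (simp only: power_mult_distrib mult_ac)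
    qed
    also have "\<dots> \<le> 2 ^ K * (A * U * V')"
      by (rule mult_left_mono[OF mult_mono[OF mult_mono[OF A(2) U(2)] V'(2)]])
        (simp_all add: A U V' j0)
    finally show ?thesis .
  qed
  have boundH: "cmod (H w) * japanese w ^ K \<le> 2 ^ K * (A * U * V)" 
    and boundH': "cmod (H w) * japanese ((fst w, snd (snd w)), fst (snd w)) ^ K \<le> 2 ^ K * (A * U * V)" for w
  proof -
    obtain m z \<xi> where w: "w = (m, z, \<xi>)" by (cases w)
    have eq: "japanese w = japanese ((m, \<xi>), z)"
      by (simp add: w japanese_def norm_Pair add_ac)
    have "japanese ((m, \<xi>), z) \<le> japanese (m, \<xi>) * japanese z"
      by (rule japanese_Pair_le)
    also have "\<dots> \<le> japanese (m, \<xi>) * (2 * (japanese (m + (1/2) *\<^sub>R z) * japanese (m - (1/2) *\<^sub>R z)))"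
    proof (rule mult_left_mono[OF _ j0])
      have "(m + (1/2) *\<^sub>R z) - (m - (1/2) *\<^sub>R z) = z"
        by (simp add: scaleR_add_left[symmetric])
      with japanese_diff_le[of "m + (1/2) *\<^sub>R z" "m - (1/2) *\<^sub>R z"]
      show "japanese z \<le> 2 * (japanese (m + (1/2) *\<^sub>R z) * japanese (m - (1/2) *\<^sub>R z))"
        by (simp only:)
    qed
    finally have "japanese ((m, \<xi>), z) ^ K \<le>
      (japanese (m, \<xi>) * (2 * (japanese (m + (1/2) *\<^sub>R z) * japanese (m - (1/2) *\<^sub>R z)))) ^ K"
      by (intro power_mono j0)
    then have "cmod (H w) * japanese ((m, \<xi>), z) ^ K \<le> cmod (H w) *
      (japanese (m, \<xi>) * (2 * (japanese (m + (1/2) *\<^sub>R z) * japanese (m - (1/2) *\<^sub>R z)))) ^ K"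
      by (rule mult_left_mono) (rule norm_ge_zero)
    also have "\<dots> =
       2 ^ K * ((cmod (a (m, \<xi>)) * japanese (m, \<xi>) ^ K) *
        (cmod (u (m + (1/2) *\<^sub>R z)) * japanese (m + (1/2) *\<^sub>R z) ^ K) *
        (cmod (v (m - (1/2) *\<^sub>R z)) * japanese (m - (1/2) *\<^sub>R z) ^ K))"
    proof -
      have "cmod (H w) =
          cmod (a (m, \<xi>)) * cmod (u (m + (1/2) *\<^sub>R z)) * cmod (v (m - (1/2) *\<^sub>R z))"
        by (simp only: w H_def prod.case norm_mult norm_exp_i_times mult_1_left)
      then show ?thesis
        by (simp only: power_mult_distrib mult_ac)
    qed
    also have "\<dots> \<le> 2 ^ K * (A * U * V)"
      by (rule mult_left_mono[OF mult_mono[OF mult_mono[OF A(2) U(2)] V(2)]])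
        (simp_all add: A U V j0)
    finally have *: "cmod (H w) * japanese ((m, \<xi>), z) ^ K \<le> 2 ^ K * (A * U * V)" .
    then show "cmod (H w) * japanese w ^ K \<le> 2 ^ K * (A * U * V)" by (simp add: eq)
    from * show "cmod (H w) * japanese ((fst w, snd (snd w)), fst (snd w)) ^ K \<le> 2 ^ K * (A * U * V)"
      by (simp add: w)
  qed
  have intG: "integrable (lborel \<Otimes>\<^sub>M lborel) G"
    unfolding lborel_prod by (rule integrable_lborel_if_decay[OF contG boundG[unfolded K_def]])
  have intH: "integrable (lborel \<Otimes>\<^sub>M lborel) H"
    unfolding lborel_prod by (rule integrable_lborel_if_decay[OF contH boundH[unfolded K_def]])
  define L where "L = (\<lambda>((m, \<xi>), z). H (m, z, \<xi>))"
  have intL: "integrable (lborel \<Otimes>\<^sub>M lborel) L"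
    unfolding lborel_prod
  proof (rule integrable_lborel_if_decay)
    show "continuous_on UNIV L"
      unfolding L_def case_prod_unfold
      by (intro continuous_on_compose2[OF contH] continuous_intros) auto
    show "cmod (L w) * japanese w ^ (DIM(('a \<times> 'a) \<times> 'a) + 2) \<le> 2 ^ K * (A * U * V)" for w
      using boundH'[of "(fst (fst w), snd w, snd (fst w))"]
      by (simp add: L_def K_def case_prod_unfold add_ac)
  qed
  have intH1: "integrable (lborel \<Otimes>\<^sub>M lborel) (\<lambda>w. H (m, w))" for m
    unfolding lborel_prod
  proof (rule integrable_lborel_if_decay)
    show "continuous_on UNIV (\<lambda>w. H (m, w))"
      by (intro continuous_on_compose2[OF contH] continuous_intros) auto
    show "cmod (H (m, w)) * japanese w ^ (DIM('a \<times> 'a) + 2) \<le> 2 ^ K * (A * U * V)" for w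
    proof -
      have "japanese w ^ (DIM('a \<times> 'a) + 2) \<le> japanese (m, w) ^ (DIM('a \<times> 'a) + 2)"
        by (intro power_mono j0 japanese_snd_le)
      also have "\<dots> \<le> japanese (m, w) ^ K"
        by (intro power_increasing japanese_ge_1) (simp add: K_def)
      finally have "cmod (H (m, w)) * japanese w ^ (DIM('a \<times> 'a) + 2) \<le>
          cmod (H (m, w)) * japanese (m, w) ^ K"
        by (rule mult_left_mono) simp
      with boundH[of "(m, w)"] show ?thesis by simp
    qed
  qed
  have "(LINT x|lborel. weyl_integral a u x * v x) = c * (LINT x|lborel. LINT w|lborel. G (x, w))"
  proof -
    have "weyl_integral a u x * v x = c * (LINT w|lborel. G (x, w))" for x
    proof -
      let ?F = "\<lambda>(y, \<xi>). exp (\<i> * of_real (\<xi> \<bullet> (x - y))) * a ((1/2) *\<^sub>R (x + y), \<xi>) * u y"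
      have F: "?F \<in> borel_measurable borel"
        unfolding case_prod_unfold
        by (intro borel_measurable_continuous_onI continuous_intros) auto
      have "G (x, w) = ?F (w + (x, 0)) * v x" for w
      proof -
        have "(1/2) *\<^sub>R (x + fst (w + (x, 0))) = (1/2) *\<^sub>R ((x + x) + fst w)"
          by (simp add: add_ac)
        also have "\<dots> = x + (1/2) *\<^sub>R fst w"
          by (simp only: scaleR_right_distrib[of _ "x + x"] scaleR_half_double)
        finally show ?thesis
          by (simp add: G_def case_prod_unfold add.commute)
      qed
      then have "(LINT w|lborel. G (x, w)) = (LINT w|lborel. ?F (w + (x, 0))) * v x"
        by simp
      also have "(LINT w|lborel. ?F (w + (x, 0))) = (LINT w|lborel. ?F w)"
        by (rule integral_lborel_translate[OF F])
      finally show ?thesis by (simp add: weyl_integral_def c_def)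
    qed
    then show ?thesis by simp
  qed
  also have "(LINT x|lborel. LINT w|lborel. G (x, w)) = (LINT w|lborel. LINT x|lborel. G (x, w))"
    using lborel_pair.Fubini_integral[of "\<lambda>x w. G (x, w)"] intG by simp
  also have "\<dots> = (LINT w|lborel. LINT m|lborel. H (m, w))"
  proof (rule Bochner_Integration.integral_cong[OF refl])
    fix w :: "'a \<times> 'a"
    have GH: "G (m + - ((1/2) *\<^sub>R fst w), w) = H (m, w)" for m
    proof -
      have "fst w - (1/2) *\<^sub>R fst w = (1/2) *\<^sub>R fst w"
        by (simp add: scaleR_left_diff_distrib[of 1 "1/2", simplified, symmetric])
      then have eq: "m - (1/2) *\<^sub>R fst w + fst w = m + (1/2) *\<^sub>R fst w"
        unfolding diff_add_eq add_diff_eq[symmetric] by (rule arg_cong)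
      show ?thesis
        by (simp add: G_def H_def case_prod_unfold eq)
    qed
    have "(\<lambda>x. G (x, w)) \<in> borel_measurable borel"
      by (intro borel_measurable_continuous_onI continuous_on_compose2[OF contG] continuous_intros) auto
    from integral_lborel_translate[OF this, of "- ((1/2) *\<^sub>R fst w)"]
    have "(LINT x|lborel. G (x, w)) = (LINT m|lborel. G (m + - ((1/2) *\<^sub>R fst w), w))"
      by (rule sym)
    then show "(LINT x|lborel. G (x, w)) = (LINT m|lborel. H (m, w))" by (simp only: GH)
  qed
  also have "\<dots> = (LINT m|lborel. LINT w|lborel. H (m, w))"
    using lborel_pair.Fubini_integral[of "\<lambda>x w. H (x, w)"] intH by simp
  also have "\<dots> = (LINT m|lborel. LINT \<xi>|lborel. LINT z|lborel. H (m, z, \<xi>))"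
    using lborel_pair.integral_snd[of "\<lambda>z \<xi>. H (_, z, \<xi>)"] intH1
    by (simp add: case_prod_unfold lborel_prod)
  also have "\<dots> = (LINT m|lborel. LINT \<xi>|lborel. LINT z|lborel. L ((m, \<xi>), z))"
    by (simp add: L_def)
  also have "\<dots> = (LINT \<rho>|lborel. LINT z|lborel. L (\<rho>, z))"
    using lborel_pair.integral_fst'[OF lborel_pair.integrable_fst'[OF intL, unfolded lborel_prod[symmetric]]]
    by (simp add: lborel_prod)
  also have "c * \<dots> = (LINT \<rho>|lborel. a \<rho> * wigner u v \<rho>)"
  proof -
    have "c * (LINT z|lborel. L (\<rho>, z)) = a \<rho> * wigner u v \<rho>" for \<rho>
    proof -
      obtain m \<xi> where \<rho>: "\<rho> = (m, \<xi>)" by (cases \<rho>)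
      let ?F = "\<lambda>z. exp (\<i> * of_real (\<xi> \<bullet> z)) * u (m - (1/2) *\<^sub>R z) * v (m + (1/2) *\<^sub>R z)"
      have F: "?F \<in> borel_measurable borel"
        by (intro borel_measurable_continuous_onI continuous_intros) auto
      have "L (\<rho>, z) = a \<rho> * ?F (- z)" for z
        by (simp add: L_def H_def \<rho>)
      then show ?thesis
        using integral_lborel_reflect[OF F] by (simp add: wigner_def \<rho> c_def)
    qed
    then show ?thesis by (simp flip: integral_mult_right_zero)
  qed
  finally show ?thesis by (simp add: weyl_op_def)
qed

section \<open>Unbounded operators on the space of square-integrable functions\<close>

text \<open>Elements of the Hilbert space are represented by functions, without passing to classes modulo
  almost everywhere equality; operators are represented by their graphs. Closures and
  adjoints of graphs are invariant under almost everywhere equality, so that comparing them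
  as sets of pairs of functions is the same as comparing the operators.\<close>

definition L2 :: "('a::euclidean_space \<Rightarrow> complex) set" where
  "L2 = {f \<in> borel_measurable lborel. integrable lborel (\<lambda>x. (cmod (f x))\<^sup>2)}"

definition L2_inner :: "('a::euclidean_space \<Rightarrow> complex) \<Rightarrow> ('a \<Rightarrow> complex) \<Rightarrow> complex" where
  "L2_inner f g = (LINT x|lborel. f x * cnj (g x))"

definition L2_dist :: "('a::euclidean_space \<Rightarrow> complex) \<Rightarrow> ('a \<Rightarrow> complex) \<Rightarrow> real" where
  "L2_dist f g = sqrt (LINT x|lborel. (cmod (f x - g x))\<^sup>2)"

definition graph_closure ::
  "(('a::euclidean_space \<Rightarrow> complex) \<times> ('a \<Rightarrow> complex)) set \<Rightarrow>
   (('a \<Rightarrow> complex) \<times> ('a \<Rightarrow> complex)) set" where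
  "graph_closure G = {(u, f). u \<in> L2 \<and> f \<in> L2 \<and>
     (\<exists>us fs. (\<forall>n. (us n, fs n) \<in> G) \<and>
        (\<lambda>n::nat. L2_dist (us n) u) \<longlonglongrightarrow> 0 \<and> (\<lambda>n. L2_dist (fs n) f) \<longlonglongrightarrow> 0)}"

definition graph_adjoint ::
  "(('a::euclidean_space \<Rightarrow> complex) \<times> ('a \<Rightarrow> complex)) set \<Rightarrow>
   (('a \<Rightarrow> complex) \<times> ('a \<Rightarrow> complex)) set" where
  "graph_adjoint G = {(v, w). v \<in> L2 \<and> w \<in> L2 \<and>
     (\<forall>(u, f) \<in> G. L2_inner f v = L2_inner u w)}"

definition L2_dense :: "('a::euclidean_space \<Rightarrow> complex) set \<Rightarrow> bool" where
  "L2_dense D \<longleftrightarrow> D \<subseteq> L2 \<and>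
     (\<forall>u\<in>L2. \<exists>us. (\<forall>n. us n \<in> D) \<and> (\<lambda>n::nat. L2_dist (us n) u) \<longlonglongrightarrow> 0)"

definition self_adjoint ::
  "(('a::euclidean_space \<Rightarrow> complex) \<times> ('a \<Rightarrow> complex)) set \<Rightarrow> bool" where
  "self_adjoint G \<longleftrightarrow> L2_dense (Domain G) \<and> graph_adjoint G = G"

definition essentially_self_adjoint ::
  "(('a::euclidean_space \<Rightarrow> complex) \<times> ('a \<Rightarrow> complex)) set \<Rightarrow> bool" where
  "essentially_self_adjoint G \<longleftrightarrow> L2_dense (Domain G) \<and> self_adjoint (graph_closure G)"

text \<open>Graph of the quantization, restricted to those Schwartz functions that it maps
  to square-integrable functions.\<close>

definition weyl_graph ::
  "(('a::euclidean_space \<times> 'a \<Rightarrow> complex) \<Rightarrow> complex) \<Rightarrow>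
   (('a \<Rightarrow> complex) \<times> ('a \<Rightarrow> complex)) set" where
  "weyl_graph T = {(u, f). u \<in> schwartz \<and> f \<in> L2 \<and>
     (\<forall>v\<in>schwartz. weyl_op T u v = (LINT x|lborel. f x * v x))}"

section \<open>The two assumptions\<close>

definition assumption_A :: "('a::euclidean_space \<times> 'a \<Rightarrow> real) \<Rightarrow> bool" where
  "assumption_A p \<longleftrightarrow> smooth p \<and> (\<exists>\<phi>. hamiltonian_flow p \<phi>) \<and>
     (\<exists>T. is_distribution_of T (\<lambda>\<rho>. complex_of_real (p \<rho>)) \<and>
          Domain (weyl_graph T) = schwartz \<and> essentially_self_adjoint (weyl_graph T))"

text \<open>The parameter e is the fixed self-dual Euclidean metric entering \<open>theta\<close>.\<close>

definition assumption_B ::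
  "('a::euclidean_space \<times> 'a \<Rightarrow> 'a \<times> 'a \<Rightarrow> real) \<Rightarrow> ('a \<times> 'a \<Rightarrow> real) \<Rightarrow>
   ('a \<times> 'a \<Rightarrow> 'a \<times> 'a \<Rightarrow> 'a \<times> 'a \<Rightarrow> real) \<Rightarrow> bool" where
  "assumption_B e p g \<longleftrightarrow> admissible g \<and>
     (\<exists>\<phi>. hamiltonian_flow p \<phi> \<and>
        bdd_above (range (tensor_norm g 2 (lie_derivative_metric \<phi> g))) \<and>
        (\<exists>\<Upsilon>\<ge>0. \<exists>C>0. \<forall>\<rho> t \<zeta>. g (\<phi> t \<rho>) \<zeta> \<zeta> \<le> C\<^sup>2 * exp (2 * \<Upsilon> * \<bar>t\<bar>) * g \<rho> \<zeta> \<zeta>)) \<and>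
     (\<exists>\<epsilon>. 0 < \<epsilon> \<and> \<epsilon> \<le> 1/2 \<and>
        nabla_pow 3 p \<in>
          symbol_class 3 (\<lambda>\<rho>. (theta e g \<rho> * sqrt (gain_sup g)) powr (- \<epsilon>) *
                              (gain g \<rho> / gain_sup g) powi (- 3)) g \<inter>
          symbol_class 3 (\<lambda>\<rho>. (gain g \<rho> / gain_sup g) powi (- 1)) g)"

section \<open>Vector fields\<close>

definition divergence :: "(real ^ 'd \<Rightarrow> real ^ 'd) \<Rightarrow> real ^ 'd \<Rightarrow> real" where
  "divergence X x = trace (jacobian X (at x))"

definition vector_field_op ::
  "(real ^ 'd \<Rightarrow> real ^ 'd) \<Rightarrow> (real ^ 'd \<Rightarrow> complex) \<Rightarrow> real ^ 'd \<Rightarrow> complex" where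
  "vector_field_op X u x =
     (1 / \<i>) * frechet_derivative u (at x) (X x) +
     (1 / (2 * \<i>)) * of_real (divergence X x) * u x"

definition vector_field_symbol :: "(real ^ 'd \<Rightarrow> real ^ 'd) \<Rightarrow> (real ^ 'd) \<times> (real ^ 'd) \<Rightarrow> real" where
  "vector_field_symbol X = (\<lambda>(x, \<xi>). \<xi> \<bullet> X x)"

definition anisotropic_metric ::
  "real \<Rightarrow> real \<Rightarrow> 'a::euclidean_space \<times> 'a \<Rightarrow> 'a \<times> 'a \<Rightarrow> 'a \<times> 'a \<Rightarrow> real" where
  "anisotropic_metric \<alpha>\<^sub>1 \<alpha>\<^sub>2 = (\<lambda>(x, \<xi>) (y, \<eta>) (y', \<eta>').
     japanese \<xi> powr (2 * \<alpha>\<^sub>1) * (y \<bullet> y') + japanese \<xi> powr (- 2 * \<alpha>\<^sub>2) * (\<eta> \<bullet> \<eta>'))"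

end

theory Submission
  imports Defs "HOL-Probability.Characteristic_Functions"
begin

text \<open>The distribution of the symbol p = linear_symbol X is integration against p, and inserting
  the Wigner function of u and v turns its Weyl quantization into the transport operator by Fourier
  inversion in the momentum variable.

  The Hamiltonian flow of p is the cotangent lift of the flow of X: the momentum obeys a linear
  equation with bounded coefficients, so it grows at most exponentially, and the powers of its
  Japanese bracket entering the metric change by bounded factors.  Since p is linear in the momentum,
  counting powers bounds its derivatives along g-unit vectors: a derivative in position
  contributes the factor bracket^(-\<open>\<alpha>\<^sub>1\<close>), one in momentum contributes bracket^\<open>\<alpha>\<^sub>2\<close> and
  occurs at most once.

  Essential self-adjointness is Friedrichs' argument.  If v and w satisfy the adjoint relation, the
  convolution of v with a Gaussian mollifier, cut off by a wide Gaussian, is a Schwartz function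
  converging to v; the commutator of the transport operator with mollification has a kernel dominated
  by an integrable Gaussian profile uniformly in the scale, hence is uniformly bounded on square-integrable
  functions and tends to 0 strongly, so the images converge to w.\<close>

section \<open>Iterated directional derivatives\<close>

text \<open>Higher derivatives are never computed: a function is controlled by placing it in a
  family stable under one directional differentiation whose members satisfy the bounds of order
  zero.

  The Hamiltonian field is not globally Lipschitz, since its derivative grows with the momentum.
  Existence of the flow exploits its triangular form, and differentiability is proved on slabs of
  bounded momentum, large enough to hold the nearby trajectories up to a given time.

  On functions of rapid decay the distribution of the symbol is an absolutely convergent integral,
  so decay is what has to be known of the Wigner function. Multiplication by a momentum coordinate
  becomes a difference of derivatives of u and v; this yields both the decay and the transport
  operator.

  Gaussians serve as mollifier and cutoff because their derivatives and Fourier transform are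
  explicit and they are Schwartz functions: mollifying a square-integrable function makes its
  derivatives bounded, and the cutoff adds decay.\<close>

definition ddir :: "'a::real_normed_vector \<Rightarrow> ('a \<Rightarrow> 'b::real_normed_vector) \<Rightarrow> 'a \<Rightarrow> 'b" where
  "ddir v f x = frechet_derivative f (at x) v"

text \<open>The head of the list is differentiated first, so that induction on the list replaces f
  by \<open>ddir v f\<close>. In \<open>nabla_pow\<close> the head is the last derivative taken,
  hence the \<open>rev\<close> in \<open>nabla_pow_eq_iter_ddir\<close>.\<close>

fun iter_ddir :: "'a::real_normed_vector list \<Rightarrow> ('a \<Rightarrow> 'b::real_normed_vector) \<Rightarrow> 'a \<Rightarrow> 'b" where
  "iter_ddir [] f = f"
| "iter_ddir (v # vs) f = iter_ddir vs (ddir v f)"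

lemma nabla_pow_snoc:
  "length Xs = k \<Longrightarrow> nabla_pow (Suc k) f x (Xs @ [v]) = nabla_pow k (ddir v f) x Xs"
proof (induction k arbitrary: Xs x)
  case 0
  then show ?case by (simp add: nabla_pow_def nabla_def ddir_def)
next
  case (Suc k)
  then obtain a Ys where Xs: "Xs = a # Ys" and Ys: "length Ys = k"
    by (cases Xs) auto
  have "nabla_pow (Suc (Suc k)) f x (Xs @ [v]) = nabla (nabla_pow (Suc k) f) x (Xs @ [v])"
    by (simp add: nabla_pow_def)
  also have "\<dots> = frechet_derivative (\<lambda>y. nabla_pow k (ddir v f) y Ys) (at x) a"
    by (simp add: nabla_def Xs Suc.IH[OF Ys])
  also have "\<dots> = nabla_pow (Suc k) (ddir v f) x Xs"
    by (simp add: nabla_pow_def nabla_def Xs)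
  finally show ?case .
qed

lemma nabla_pow_eq_iter_ddir: "nabla_pow (length Xs) f x Xs = iter_ddir (rev Xs) f x"
proof (induction Xs arbitrary: f rule: rev_induct)
  case Nil
  then show ?case by (simp add: nabla_pow_def)
next
  case (snoc v Xs)
  then show ?case by (simp add: nabla_pow_snoc)
qed

lemma smooth_iff: "smooth f \<longleftrightarrow> (\<forall>vs x. iter_ddir vs f differentiable (at x))"
  unfolding smooth_def
proof safe
  fix vs x assume *: "\<forall>k Xs x. length Xs = k \<longrightarrow> (\<lambda>y. nabla_pow k f y Xs) differentiable at x"
  have "(\<lambda>y. nabla_pow (length (rev vs)) f y (rev vs)) differentiable at x"
    using * by blast
  then show "iter_ddir vs f differentiable at x"
    by (simp only: nabla_pow_eq_iter_ddir rev_rev_ident)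
next
  fix Xs and x :: 'a assume "\<forall>vs x. iter_ddir vs f differentiable at x"
  then show "(\<lambda>y. nabla_pow (length Xs) f y Xs) differentiable at x"
    by (simp add: nabla_pow_eq_iter_ddir)
qed

lemma smooth_differentiable: "smooth f \<Longrightarrow> f differentiable (at x)"
  using smooth_iff[of f] by (metis iter_ddir.simps(1))

lemma smooth_ddir: "smooth f \<Longrightarrow> smooth (ddir v f)"
  unfolding smooth_iff by (metis iter_ddir.simps(2))

lemma smooth_iter_ddir: "smooth f \<Longrightarrow> smooth (iter_ddir vs f)"
  by (induction vs arbitrary: f) (auto intro: smooth_ddir)

lemma smooth_continuous: "smooth f \<Longrightarrow> continuous_on S f"
  by (meson continuous_at_imp_continuous_on differentiable_imp_continuous_within smooth_differentiable)

lemma has_derivative_ddir: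
  "f differentiable (at x) \<Longrightarrow> (f has_derivative (\<lambda>v. ddir v f x)) (at x)"
  unfolding ddir_def by (simp add: frechet_derivative_works[symmetric])

lemma smooth_has_derivative: "smooth f \<Longrightarrow> (f has_derivative (\<lambda>v. ddir v f x)) (at x)"
  by (intro has_derivative_ddir smooth_differentiable)

lemma ddir_eqI: "(f has_derivative f') (at x) \<Longrightarrow> ddir v f x = f' v"
  unfolding ddir_def using frechet_derivative_at by metis

lemma linear_ddir: "f differentiable (at x) \<Longrightarrow> linear (\<lambda>v. ddir v f x)"
  using has_derivative_ddir has_derivative_linear by blast

lemma ddir_vec:
  assumes "f differentiable (at x)"
  shows "ddir (v + w) f x = ddir v f x + ddir w f x" "ddir (c *\<^sub>R v) f x = c *\<^sub>R ddir v f x"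
  using linear_add[OF linear_ddir[OF assms]] linear_cmul[OF linear_ddir[OF assms]] by blast+

lemma ddir_expand:
  fixes f :: "'a::euclidean_space \<Rightarrow> 'b::real_normed_vector"
  assumes "f differentiable (at x)"
  shows "ddir v f x = (\<Sum>b\<in>Basis. (v \<bullet> b) *\<^sub>R ddir b f x)"
proof -
  have "ddir (\<Sum>b\<in>Basis. (v \<bullet> b) *\<^sub>R b) f x = (\<Sum>b\<in>Basis. (v \<bullet> b) *\<^sub>R ddir b f x)"
    unfolding linear_sum[OF linear_ddir[OF assms]] linear_cmul[OF linear_ddir[OF assms]] ..
  then show ?thesis by (simp add: euclidean_representation)
qed

text \<open>A set of weighted suprema of derivatives. The weights \<open>\<lambda>_. 1\<close> give the functions with
  bounded derivatives, the powers of \<open>japanese\<close> the Schwartz functions, and indicator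
  functions of points all smooth functions.\<close>

definition tame ::
  "('a::real_normed_vector \<Rightarrow> real) set \<Rightarrow> ('a \<Rightarrow> 'b::real_normed_vector) \<Rightarrow> bool" where
  "tame W f \<longleftrightarrow> smooth f \<and> (\<forall>vs. \<forall>w\<in>W. \<exists>C. \<forall>x. norm (iter_ddir vs f x) * w x \<le> C)"

text \<open>Stability of S under one derivative puts all iterated derivatives back into S, where
  differentiability and the order zero bound are known. It suffices to guess a stable family; no
  formula for higher derivatives is needed.\<close>

lemma tame_coinduct [consumes 1, case_names differentiable bounded ddir]:
  assumes "f \<in> S" and dif: "\<And>f x. f \<in> S \<Longrightarrow> f differentiable (at x)"
    and bd: "\<And>f w. f \<in> S \<Longrightarrow> w \<in> W \<Longrightarrow> \<exists>C. \<forall>x. norm (f x) * w x \<le> C"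
    and dd: "\<And>f v. f \<in> S \<Longrightarrow> ddir v f \<in> S"
  shows "tame W f"
proof -
  have "iter_ddir vs f \<in> S" for vs
    using \<open>f \<in> S\<close> by (induction vs arbitrary: f) (auto intro: dd)
  then show ?thesis unfolding tame_def smooth_iff by (blast intro: dif bd)
qed

lemma tame_smooth: "tame W f \<Longrightarrow> smooth f"
  by (simp add: tame_def)

lemma tame_iter_bounded: "tame W f \<Longrightarrow> w \<in> W \<Longrightarrow> \<exists>C. \<forall>x. norm (iter_ddir vs f x) * w x \<le> C"
  by (simp add: tame_def)

lemma tame_empty: "tame {} f \<longleftrightarrow> smooth f"
  by (simp add: tame_def)

lemma tame_bounded: "tame W f \<Longrightarrow> w \<in> W \<Longrightarrow> \<exists>C. \<forall>x. norm (f x) * w x \<le> C"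
  unfolding tame_def by (metis iter_ddir.simps(1))

lemma tame_ddir: "tame W f \<Longrightarrow> tame W (ddir v f)"
  unfolding tame_def by (metis iter_ddir.simps(2) smooth_ddir)

lemma tame_mono: "tame W f \<Longrightarrow> V \<subseteq> W \<Longrightarrow> tame V f"
  unfolding tame_def by blast

section \<open>Stability under linear maps, affine substitution, sums and products\<close>

lemma ddir_bounded_linear:
  assumes "bounded_linear T" "f differentiable (at x)"
  shows "(\<lambda>x. T (f x)) differentiable (at x)" "ddir v (\<lambda>x. T (f x)) x = T (ddir v f x)"
proof -
  have *: "((\<lambda>x. T (f x)) has_derivative (\<lambda>v. T (ddir v f x))) (at x)"
    by (rule bounded_linear.has_derivative[OF assms(1) has_derivative_ddir[OF assms(2)]])
  then show "(\<lambda>x. T (f x)) differentiable (at x)" by (rule differentiableI)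
  show "ddir v (\<lambda>x. T (f x)) x = T (ddir v f x)" by (rule ddir_eqI[OF *])
qed

lemma iter_ddir_bounded_linear:
  assumes "bounded_linear T" "smooth f"
  shows "iter_ddir vs (\<lambda>x. T (f x)) = (\<lambda>x. T (iter_ddir vs f x))"
  using assms(2)
proof (induction vs arbitrary: f)
  case (Cons v vs)
  have "ddir v (\<lambda>x. T (f x)) = (\<lambda>x. T (ddir v f x))"
    using ddir_bounded_linear(2)[OF assms(1)] smooth_differentiable[OF Cons.prems] by blast
  then show ?case using Cons.IH[OF smooth_ddir[OF Cons.prems]] by simp
qed simp

lemma ddir_affine:
  assumes "bounded_linear L" "f differentiable (at (L x + c))"
  shows "(\<lambda>x. f (L x + c)) differentiable (at x)"
    "ddir v (\<lambda>x. f (L x + c)) x = ddir (L v) f (L x + c)"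
proof -
  have *: "((\<lambda>x. f (L x + c)) has_derivative (\<lambda>v. ddir (L v) f (L x + c))) (at x)"
    by (rule has_derivative_compose[where g = f and f = "\<lambda>x. L x + c", OF _ has_derivative_ddir[OF assms(2)]])
      (auto intro!: derivative_eq_intros bounded_linear.has_derivative[OF assms(1)])
  then show "(\<lambda>x. f (L x + c)) differentiable (at x)" by (rule differentiableI)
  show "ddir v (\<lambda>x. f (L x + c)) x = ddir (L v) f (L x + c)" by (rule ddir_eqI[OF *])
qed

lemma iter_ddir_affine:
  assumes "bounded_linear L" "smooth f"
  shows "iter_ddir vs (\<lambda>x. f (L x + c)) = (\<lambda>x. iter_ddir (map L vs) f (L x + c))"
  using assms(2)
proof (induction vs arbitrary: f)
  case (Cons v vs)
  have "ddir v (\<lambda>x. f (L x + c)) = (\<lambda>x. ddir (L v) f (L x + c))"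
    using ddir_affine(2)[OF assms(1)] smooth_differentiable[OF Cons.prems] by blast
  then show ?case using Cons.IH[OF smooth_ddir[OF Cons.prems]] by simp
qed simp

lemma smooth_affine:
  assumes "bounded_linear L" "smooth f"
  shows "smooth (\<lambda>x. f (L x + c))"
  unfolding smooth_iff iter_ddir_affine[OF assms]
  using ddir_affine(1)[OF assms(1)] assms(2) smooth_iff by blast

lemma tame_bounded_linear:
  assumes T: "bounded_linear T" and f: "tame W f" and W: "\<And>w x. w \<in> W \<Longrightarrow> 0 \<le> w x"
  shows "tame W (\<lambda>x. T (f x))"
proof -
  obtain K where K: "\<And>x. norm (T x) \<le> norm x * K" "0 \<le> K"
    using bounded_linear.nonneg_bounded[OF T] by blast
  have "\<exists>C. \<forall>x. norm (iter_ddir vs (\<lambda>x. T (f x)) x) * w x \<le> C" if "w \<in> W" for vs w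
  proof -
    obtain C where C: "\<And>x. norm (iter_ddir vs f x) * w x \<le> C"
      using tame_iter_bounded[OF f \<open>w \<in> W\<close>] by blast
    have "norm (T (iter_ddir vs f x)) * w x \<le> C * K" for x
    proof -
      have "norm (T (iter_ddir vs f x)) * w x \<le> norm (iter_ddir vs f x) * K * w x"
        by (intro mult_right_mono K W that)
      also have "\<dots> = (norm (iter_ddir vs f x) * w x) * K" by simp
      also have "\<dots> \<le> C * K" by (intro mult_right_mono C K)
      finally show ?thesis .
    qed
    then show ?thesis
      by (auto simp: iter_ddir_bounded_linear[OF T tame_smooth[OF f]])
  qed
  moreover have "smooth (\<lambda>x. T (f x))"
    unfolding smooth_iff iter_ddir_bounded_linear[OF T tame_smooth[OF f]]
    using ddir_bounded_linear(1)[OF T] f tame_smooth smooth_iff by blast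
  ultimately show ?thesis by (simp add: tame_def)
qed

text \<open>With an empty set of weights tameness is smoothness, so closure properties of
  \<open>tame\<close> specialize to \<open>smooth\<close>.\<close>

lemmas smooth_bounded_linear = tame_bounded_linear[of _ "{}", unfolded tame_empty, simplified]

lemma ddir_add:
  assumes "f differentiable (at x)" "g differentiable (at x)"
  shows "ddir v (\<lambda>x. f x + g x) x = ddir v f x + ddir v g x"
  by (rule ddir_eqI) (intro has_derivative_add has_derivative_ddir assms)

lemma ddir_bilinear:
  assumes "bounded_bilinear B" "f differentiable (at x)" "g differentiable (at x)"
  shows "(\<lambda>x. B (f x) (g x)) differentiable (at x)"
    "ddir v (\<lambda>x. B (f x) (g x)) x = B (f x) (ddir v g x) + B (ddir v f x) (g x)"
proof -
  have *: "((\<lambda>x. B (f x) (g x)) has_derivative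
      (\<lambda>v. B (f x) (ddir v g x) + B (ddir v f x) (g x))) (at x)"
    by (rule bounded_bilinear.FDERIV[OF assms(1)]) (intro has_derivative_ddir assms)+
  then show "(\<lambda>x. B (f x) (g x)) differentiable (at x)" by (rule differentiableI)
  show "ddir v (\<lambda>x. B (f x) (g x)) x = B (f x) (ddir v g x) + B (ddir v f x) (g x)"
    by (rule ddir_eqI[OF *])
qed

lemma iter_ddir_add:
  assumes "smooth f" "smooth g"
  shows "iter_ddir vs (\<lambda>x. f x + g x) = (\<lambda>x. iter_ddir vs f x + iter_ddir vs g x)"
  using assms
proof (induction vs arbitrary: f g)
  case (Cons v vs)
  have "ddir v (\<lambda>x. f x + g x) = (\<lambda>x. ddir v f x + ddir v g x)"
    by (intro ext ddir_add smooth_differentiable Cons.prems)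
  then show ?case using Cons.IH[OF smooth_ddir smooth_ddir] Cons.prems by simp
qed simp

lemma tame_add:
  assumes f: "tame W f" and g: "tame W g"
  shows "tame W (\<lambda>x. f x + g x)"
proof -
  have *: "\<exists>C. \<forall>x. norm (iter_ddir vs (\<lambda>x. f x + g x) x) * w x \<le> C" if "w \<in> W" for vs w
  proof -
    obtain C where C: "\<And>x. norm (iter_ddir vs f x) * w x \<le> C"
      using tame_iter_bounded[OF f \<open>w \<in> W\<close>] by blast
    obtain D where D: "\<And>x. norm (iter_ddir vs g x) * w x \<le> D"
      using tame_iter_bounded[OF g \<open>w \<in> W\<close>] by blast
    \<comment> \<open>Weights are arbitrary real functions. Where w is negative the left side is
      nonpositive, and the absolute values keep the right side nonnegative.\<close>
    have "norm (iter_ddir vs f x + iter_ddir vs g x) * w x \<le> \<bar>C\<bar> + \<bar>D\<bar>" for x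
    proof (cases "0 \<le> w x")
      case True
      then have "norm (iter_ddir vs f x + iter_ddir vs g x) * w x \<le>
          (norm (iter_ddir vs f x) + norm (iter_ddir vs g x)) * w x"
        by (intro mult_right_mono norm_triangle_ineq)
      then show ?thesis using C[of x] D[of x] by (simp add: algebra_simps)
    next
      case False
      then have "norm (iter_ddir vs f x + iter_ddir vs g x) * w x \<le> 0"
        by (simp add: mult_nonneg_nonpos)
      then show ?thesis by linarith
    qed
    then show ?thesis
      by (auto simp: iter_ddir_add[OF tame_smooth[OF f] tame_smooth[OF g]])
  qed
  have "(\<lambda>x. iter_ddir vs f x + iter_ddir vs g x) differentiable (at x)" for vs x
    by (intro differentiable_add smooth_differentiable smooth_iter_ddir tame_smooth[OF f] tame_smooth[OF g])
  then have "smooth (\<lambda>x. f x + g x)"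
    unfolding smooth_iff iter_ddir_add[OF tame_smooth[OF f] tame_smooth[OF g]] by blast
  with * show ?thesis by (simp add: tame_def)
qed

lemmas smooth_add = tame_add[of "{}", unfolded tame_empty]

lemma iter_ddir_const: "vs \<noteq> [] \<Longrightarrow> iter_ddir vs (\<lambda>x. c) = (\<lambda>x. 0)"
proof (induction vs arbitrary: c)
  case (Cons v vs)
  have "ddir v (\<lambda>x. c) = (\<lambda>x. 0)" by (rule ext, rule ddir_eqI) simp
  then show ?case using Cons.IH[of 0] by (cases vs) auto
qed simp

lemma tame_zero: "tame W (\<lambda>x. 0)"
proof -
  have "(\<lambda>x. 0) \<in> {\<lambda>x. 0}" by simp
  then show ?thesis
  proof (rule tame_coinduct)
    show "ddir v f \<in> {\<lambda>x. 0}" if "f \<in> {\<lambda>x. 0}" for f v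
    proof -
      have "ddir v (\<lambda>x. 0) = (\<lambda>x. 0)" by (rule ext, rule ddir_eqI) simp
      then show ?thesis using that by simp
    qed
  qed auto
qed

lemma tame_sum: "(\<And>i. i \<in> I \<Longrightarrow> tame W (f i)) \<Longrightarrow> tame W (\<lambda>x. \<Sum>i\<in>I. f i x)"
  by (induction I rule: infinite_finite_induct) (auto intro!: tame_zero tame_add)

lemmas smooth_sum = tame_sum[of _ "{}", unfolded tame_empty]

text \<open>The derivative of L in a fixed direction is constant and that of a constant vanishes, so
  L together with the constants is a stable family.\<close>

lemma smooth_linear:
  assumes L: "bounded_linear L"
  shows "smooth L"
proof -
  have "L \<in> insert L (range (\<lambda>c x. c))" by simp
  then have "tame {} L"
  proof (rule tame_coinduct)
    show "f differentiable (at x)" if "f \<in> insert L (range (\<lambda>c x. c))" for f x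
      using that bounded_linear_imp_differentiable[OF L] by auto
    show "ddir v f \<in> insert L (range (\<lambda>c x. c))" if "f \<in> insert L (range (\<lambda>c x. c))" for f v
    proof -
      have "ddir v L = (\<lambda>x. L v)"
        by (rule ext, rule ddir_eqI) (rule bounded_linear_imp_has_derivative[OF L])
      moreover have "ddir v (\<lambda>x. c) = (\<lambda>x. 0)" for c
        by (rule ext, rule ddir_eqI) simp
      ultimately show ?thesis using that by auto
    qed
  qed auto
  then show ?thesis by (simp add: tame_empty)
qed

text \<open>The Leibniz rule turns one product into a sum of two. Single products are therefore not
  stable under differentiation, but their finite sums are.\<close>

inductive_set product_span ::
  "('b::real_normed_vector \<Rightarrow> 'c::real_normed_vector \<Rightarrow> 'd::real_normed_vector) \<Rightarrow>
   ('a::real_normed_vector \<Rightarrow> 'b) set \<Rightarrow> ('a \<Rightarrow> 'c) set \<Rightarrow> ('a \<Rightarrow> 'd) set"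
  for B F G where
  prod: "f \<in> F \<Longrightarrow> g \<in> G \<Longrightarrow> (\<lambda>x. B (f x) (g x)) \<in> product_span B F G"
| add: "f \<in> product_span B F G \<Longrightarrow> g \<in> product_span B F G \<Longrightarrow> (\<lambda>x. f x + g x) \<in> product_span B F G"

text \<open>All weights are carried by f, while g contributes only bounds on its derivatives. This
  covers Schwartz times bounded as well as bounded times bounded.\<close>

lemma tame_bilinear:
  assumes B: "bounded_bilinear B" and f: "tame W f" and g: "tame {\<lambda>x. 1} g"
  shows "tame W (\<lambda>x. B (f x) (g x))"
proof -
  let ?S = "product_span B {f. tame W f} {g. tame {\<lambda>x. 1} g}"
  have dif: "h differentiable (at x)" if "h \<in> ?S" for h x
    using that by induction
      (auto intro!: ddir_bilinear(1)[OF B] differentiable_add intro: smooth_differentiable tame_smooth)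
  have "(\<lambda>x. B (f x) (g x)) \<in> ?S"
    using f g by (intro product_span.prod) auto
  then show ?thesis
  proof (rule tame_coinduct)
    show "h differentiable (at x)" if "h \<in> ?S" for h x by (rule dif[OF that])
  next
    fix h w assume "h \<in> ?S" "w \<in> W"
    from this(1) show "\<exists>C. \<forall>x. norm (h x) * w x \<le> C"
    proof induction
      case (prod f g)
      obtain K where K: "\<And>a b. norm (B a b) \<le> norm a * norm b * K" "0 \<le> K"
        using bounded_bilinear.nonneg_bounded[OF B] by blast
      obtain C where C: "\<And>x. norm (f x) * w x \<le> C"
        using tame_bounded[of W f w] prod \<open>w \<in> W\<close> by auto
      obtain D where D: "\<And>x. norm (g x) \<le> D"
        using tame_bounded[of "{\<lambda>x. 1}" g "\<lambda>x. 1"] prod by auto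
      have D0: "0 \<le> D" using D[of undefined] norm_ge_zero order_trans by blast
      have "norm (B (f x) (g x)) * w x \<le> \<bar>C\<bar> * D * K" for x
      proof (cases "0 \<le> w x")
        case True
        then have "norm (B (f x) (g x)) * w x \<le> (norm (f x) * norm (g x) * K) * w x"
          by (intro mult_right_mono K)
        also have "\<dots> = (norm (f x) * w x) * norm (g x) * K" by simp
        also have "\<dots> \<le> \<bar>C\<bar> * D * K"
          using C[of x] by (intro mult_right_mono mult_mono D K) auto
        finally show ?thesis .
      next
        case False
        then have "norm (B (f x) (g x)) * w x \<le> 0" by (simp add: mult_nonneg_nonpos)
        moreover have "0 \<le> \<bar>C\<bar> * D * K" using K D0 by simp
        ultimately show ?thesis by linarith
      qed
      then show ?case by blast
    next
      case (add f g)
      then obtain C D where C: "\<And>x. norm (f x) * w x \<le> C" and D: "\<And>x. norm (g x) * w x \<le> D"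
        by blast
      have "norm (f x + g x) * w x \<le> \<bar>C\<bar> + \<bar>D\<bar>" for x
      proof (cases "0 \<le> w x")
        case True
        then have "norm (f x + g x) * w x \<le> (norm (f x) + norm (g x)) * w x"
          by (intro mult_right_mono norm_triangle_ineq)
        then show ?thesis using C[of x] D[of x] by (simp add: algebra_simps)
      next
        case False
        then have "norm (f x + g x) * w x \<le> 0" by (simp add: mult_nonneg_nonpos)
        then show ?thesis by linarith
      qed
      then show ?case by blast
    qed
  next
    fix h v assume "h \<in> ?S"
    then show "ddir v h \<in> ?S"
    proof induction
      case (prod f g)
      then have "ddir v (\<lambda>x. B (f x) (g x)) = (\<lambda>x. B (f x) (ddir v g x) + B (ddir v f x) (g x))"
        by (intro ext ddir_bilinear(2)[OF B]) (auto intro: smooth_differentiable tame_smooth)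
      also have "\<dots> \<in> ?S"
        using prod by (intro product_span.intros) (auto intro: tame_ddir)
      finally show ?case .
    next
      case (add f g)
      then have "ddir v (\<lambda>x. f x + g x) = (\<lambda>x. ddir v f x + ddir v g x)"
        by (intro ext ddir_add dif)
      then show ?case using add by (auto intro: product_span.add)
    qed
  qed
qed

text \<open>This is not an instance of \<open>tame_bilinear\<close>, whose second factor must have
  bounded derivatives; the stable family is the same with arbitrary smooth factors.\<close>

lemma smooth_bilinear:
  assumes B: "bounded_bilinear B" and f: "smooth f" and g: "smooth g"
  shows "smooth (\<lambda>x. B (f x) (g x))"
proof -
  let ?S = "product_span B {f. smooth f} {g. smooth g}"
  have dif: "h differentiable (at x)" if "h \<in> ?S" for h x
    using that by induction
      (auto intro!: ddir_bilinear(1)[OF B] differentiable_add intro: smooth_differentiable)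
  have "(\<lambda>x. B (f x) (g x)) \<in> ?S"
    using f g by (intro product_span.prod) auto
  then have "tame {} (\<lambda>x. B (f x) (g x))"
  proof (rule tame_coinduct)
    show "h differentiable (at x)" if "h \<in> ?S" for h x by (rule dif[OF that])
  next
    fix h v assume "h \<in> ?S"
    then show "ddir v h \<in> ?S"
    proof induction
      case (prod f g)
      then have "ddir v (\<lambda>x. B (f x) (g x)) = (\<lambda>x. B (f x) (ddir v g x) + B (ddir v f x) (g x))"
        by (intro ext ddir_bilinear(2)[OF B]) (auto intro: smooth_differentiable)
      also have "\<dots> \<in> ?S"
        using prod by (intro product_span.intros) (auto intro: smooth_ddir)
      finally show ?case .
    next
      case (add f g)
      then have "ddir v (\<lambda>x. f x + g x) = (\<lambda>x. ddir v f x + ddir v g x)"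
        by (intro ext ddir_add dif)
      then show ?case using add by (auto intro: product_span.add)
    qed
  qed auto
  then show ?thesis by (simp add: tame_empty)
qed

section \<open>Multilinearity in the directions and bounds uniform over balls\<close>

lemma iter_ddir_vec:
  assumes "smooth f"
  shows "iter_ddir ((v + w) # vs) f x = iter_ddir (v # vs) f x + iter_ddir (w # vs) f x"
    "iter_ddir ((c *\<^sub>R v) # vs) f x = c *\<^sub>R iter_ddir (v # vs) f x"
proof -
  have 1: "ddir (v + w) f = (\<lambda>x. ddir v f x + ddir w f x)" "ddir (c *\<^sub>R v) f = (\<lambda>x. c *\<^sub>R ddir v f x)"
    using ddir_vec[OF smooth_differentiable[OF assms]] by auto
  show "iter_ddir ((v + w) # vs) f x = iter_ddir (v # vs) f x + iter_ddir (w # vs) f x"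
    by (simp add: 1 iter_ddir_add smooth_ddir assms)
  show "iter_ddir ((c *\<^sub>R v) # vs) f x = c *\<^sub>R iter_ddir (v # vs) f x"
    by (simp add: 1 iter_ddir_bounded_linear[OF bounded_linear_scaleR_right] smooth_ddir assms)
qed

lemma iter_ddir_expand:
  fixes f :: "'a::euclidean_space \<Rightarrow> 'b::real_normed_vector"
  assumes "smooth f"
  shows "iter_ddir (v # vs) f x = (\<Sum>b\<in>Basis. (v \<bullet> b) *\<^sub>R iter_ddir (b # vs) f x)"
proof -
  have L: "linear (\<lambda>v. iter_ddir (v # vs) f x)"
    using iter_ddir_vec[OF assms] by (intro linearI) auto
  have "iter_ddir ((\<Sum>b\<in>Basis. (v \<bullet> b) *\<^sub>R b) # vs) f x =
      (\<Sum>b\<in>Basis. (v \<bullet> b) *\<^sub>R iter_ddir (b # vs) f x)"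
    unfolding linear_sum[OF L] linear_cmul[OF L] ..
  then show ?thesis by (simp only: euclidean_representation)
qed

lemma iter_ddir_scaleR_list:
  assumes "smooth f"
  shows "iter_ddir (map ((*\<^sub>R) c) vs) f x = c ^ length vs *\<^sub>R iter_ddir vs f x"
  using assms
proof (induction vs arbitrary: f)
  case (Cons v vs)
  then show ?case using Cons.IH[OF smooth_ddir[OF Cons.prems]]
    by (simp add: iter_ddir_vec(2)[OF Cons.prems, simplified])
qed simp

lemma linear_iter_ddir_nth:
  assumes "smooth f" "i < length vs"
  shows "linear (\<lambda>v. iter_ddir (vs[i := v]) f x)"
  using assms
proof (induction vs arbitrary: f i)
  case (Cons a vs)
  show ?case
  proof (cases i)
    case 0
    then show ?thesis using iter_ddir_vec[OF Cons.prems(1)] by (intro linearI) auto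
  next
    case (Suc j)
    then show ?thesis using Cons.IH[of "ddir a f" j] Cons.prems by (simp add: smooth_ddir)
  qed
qed simp

lemma multilinear_nabla_pow:
  assumes "smooth f"
  shows "multilinear k (nabla_pow k f x)"
  unfolding multilinear_def
proof safe
  fix Xs :: "'a list" and i assume "i < length Xs" "k = length Xs"
  then have "nabla_pow k f x (Xs[i := v]) = iter_ddir ((rev Xs)[length Xs - 1 - i := v]) f x" for v
    using nabla_pow_eq_iter_ddir[of "Xs[i := v]" f x] by (simp add: rev_update)
  then show "linear (\<lambda>v. nabla_pow (length Xs) f x (Xs[i := v]))"
    using linear_iter_ddir_nth[OF assms, of "length Xs - 1 - i" "rev Xs" x] \<open>i < length Xs\<close>
    by (simp add: \<open>k = _\<close>)
qed

text \<open>Bounds for each fixed list of directions become uniform over unit vectors by expanding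
  one slot at a time over the finite basis, with coefficients of modulus at most 1.\<close>

lemma tame_uniform:
  fixes f :: "'a::euclidean_space \<Rightarrow> 'b::real_normed_vector"
  assumes f: "tame W f" and w: "w \<in> W" "\<And>x. 0 \<le> w x"
  shows "\<exists>C\<ge>0. \<forall>vs x. length vs = k \<and> (\<forall>v\<in>set vs. norm v \<le> 1) \<longrightarrow> norm (iter_ddir vs f x) * w x \<le> C"
  using f
proof (induction k arbitrary: f)
  case 0
  from tame_bounded[OF this w(1)] obtain C where C: "\<forall>x. norm (f x) * w x \<le> C" by blast
  moreover from C have "0 \<le> C"
    using w(2)[of undefined] by (meson mult_nonneg_nonneg norm_ge_zero order_trans)
  ultimately show ?case by auto
next
  case (Suc k)
  have "\<exists>C\<ge>0. \<forall>vs x. length vs = k \<and> (\<forall>v\<in>set vs. norm v \<le> 1) \<longrightarrow>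
      norm (iter_ddir (b # vs) f x) * w x \<le> C" for b
    using Suc.IH[OF tame_ddir[OF Suc.prems, of b]] by simp
  then obtain C where C: "\<And>b. 0 \<le> C b" "\<And>b vs x. length vs = k \<Longrightarrow> \<forall>v\<in>set vs. norm v \<le> 1 \<Longrightarrow>
      norm (iter_ddir (b # vs) f x) * w x \<le> C b" by metis
  have "norm (iter_ddir (v # vs) f x) * w x \<le> (\<Sum>b\<in>Basis. C b)"
    if "length vs = k" "\<forall>v\<in>set vs. norm v \<le> 1" "norm v \<le> 1" for v vs x
  proof -
    have "norm (iter_ddir (v # vs) f x) \<le> (\<Sum>b\<in>Basis. norm (iter_ddir (b # vs) f x))"
      unfolding iter_ddir_expand[OF tame_smooth[OF Suc.prems], of v]
    proof (rule sum_norm_le)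
      fix b :: 'a assume "b \<in> Basis"
      then have "\<bar>v \<bullet> b\<bar> \<le> 1" using that(3) Basis_le_norm order_trans by blast
      then show "norm ((v \<bullet> b) *\<^sub>R iter_ddir (b # vs) f x) \<le> norm (iter_ddir (b # vs) f x)"
        by (simp add: mult_left_le_one_le)
    qed
    then have "norm (iter_ddir (v # vs) f x) * w x \<le> (\<Sum>b\<in>Basis. norm (iter_ddir (b # vs) f x)) * w x"
      by (rule mult_right_mono[OF _ w(2)])
    also have "\<dots> \<le> (\<Sum>b\<in>Basis. C b)"
      unfolding sum_distrib_right by (intro sum_mono C that)
    finally show ?thesis .
  qed
  then have "\<forall>vs x. length vs = Suc k \<and> (\<forall>v\<in>set vs. norm v \<le> 1) \<longrightarrow>
      norm (iter_ddir vs f x) * w x \<le> (\<Sum>b\<in>Basis. C b)"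
    by (auto simp: length_Suc_conv simp del: iter_ddir.simps)
  moreover have "0 \<le> (\<Sum>b\<in>Basis. C b)" by (intro sum_nonneg C)
  ultimately show ?case by blast
qed

text \<open>The radius r is kept explicit because the unit balls of the anisotropic metric have
  extents that depend on the momentum.\<close>

lemma tame_uniform_norm:
  fixes f :: "'a::euclidean_space \<Rightarrow> 'b::real_normed_vector"
  assumes f: "tame W f" and w: "w \<in> W" "\<And>x. 0 \<le> w x"
  shows "\<exists>C\<ge>0. \<forall>vs x r. length vs = k \<and> 0 < r \<and> (\<forall>v\<in>set vs. norm v \<le> r) \<longrightarrow>
    norm (iter_ddir vs f x) * w x \<le> C * r ^ k"
proof -
  obtain C where C: "0 \<le> C" "\<And>vs x. length vs = k \<Longrightarrow> \<forall>v\<in>set vs. norm v \<le> 1 \<Longrightarrow>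
      norm (iter_ddir vs f x) * w x \<le> C"
    using tame_uniform[OF f w, of k] by blast
  have "norm (iter_ddir vs f x) * w x \<le> C * r ^ k"
    if "length vs = k" "0 < r" "\<forall>v\<in>set vs. norm v \<le> r" for vs x r
  proof -
    let ?vs = "map ((*\<^sub>R) (1 / r)) vs"
    have "norm (iter_ddir ?vs f x) * w x \<le> C"
      using that by (intro C) auto
    moreover have "norm (iter_ddir vs f x) = r ^ k * norm (iter_ddir ?vs f x)"
      using that by (simp add: iter_ddir_scaleR_list[OF tame_smooth[OF f]] power_divide)
    ultimately show ?thesis
      using mult_left_mono[of "norm (iter_ddir ?vs f x) * w x" C "r ^ k"] that
      by (simp add: mult_ac)
  qed
  with C(1) show ?thesis by blast
qed

text \<open>A weight supported at one point imposes only a bound at that point. Through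
  \<open>tame_uniform\<close> it shows that the supremum in a tensor norm at x is taken over a
  bounded set.\<close>

lemma tame_indicator:
  fixes f :: "'a::real_normed_vector \<Rightarrow> 'b::real_normed_vector"
  shows "smooth f \<Longrightarrow> tame {indicator {x}} f"
  unfolding tame_def
proof (intro conjI allI ballI)
  fix vs and w :: "'a \<Rightarrow> real" assume "w \<in> {indicator {x}}"
  then have "\<forall>y. norm (iter_ddir vs f y) * w y \<le> norm (iter_ddir vs f x)"
    by (auto simp: indicator_def)
  then show "\<exists>C. \<forall>x. norm (iter_ddir vs f x) * w x \<le> C" by blast
qed

section \<open>Comparison with tensor norms\<close>

lemma tensor_norm_iter_ddir_le:
  fixes f :: "'a::euclidean_space \<Rightarrow> 'b::real_normed_vector"
  assumes f: "smooth f" and vs: "length vs = k" "\<forall>v\<in>set vs. norm v \<le> 1"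
  shows "norm (iter_ddir vs f x) \<le> tensor_norm (\<lambda>_. inner) k (nabla_pow k f) x"
  unfolding tensor_norm_def
proof (rule cSup_upper)
  have "norm (iter_ddir vs f x) = norm (nabla_pow k f x (rev vs))"
    using nabla_pow_eq_iter_ddir[of "rev vs" f x] vs(1) by simp
  then show "norm (iter_ddir vs f x) \<in> {norm (nabla_pow k f x Xs) |Xs. length Xs = k \<and>
      (\<forall>X\<in>set Xs. form_norm inner X \<le> 1)}"
    using vs by (auto simp: form_norm_def norm_eq_sqrt_inner intro!: exI[of _ "rev vs"])
next
  obtain C where C: "\<And>vs y. length vs = k \<Longrightarrow> \<forall>v\<in>set vs. norm v \<le> 1 \<Longrightarrow>
      norm (iter_ddir vs f y) * indicator {x} y \<le> C"
    using tame_uniform[OF tame_indicator[OF f], of "indicator {x}" x k] by auto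
  have "norm (nabla_pow k f x Xs) \<le> C" if "length Xs = k" "\<forall>X\<in>set Xs. form_norm inner X \<le> 1" for Xs
    using C[of "rev Xs" x] that nabla_pow_eq_iter_ddir[of Xs f x]
    by (simp add: form_norm_def norm_eq_sqrt_inner)
  then show "bdd_above {norm (nabla_pow k f x Xs) |Xs. length Xs = k \<and>
      (\<forall>X\<in>set Xs. form_norm inner X \<le> 1)}"
    by (auto simp: bdd_above_def)
qed

lemma tame_if_tensor_norm:
  fixes f :: "'a::euclidean_space \<Rightarrow> 'b::real_normed_vector"
  assumes f: "smooth f" and w: "\<And>w x. w \<in> W \<Longrightarrow> 0 \<le> w x"
    and bd: "\<And>k w. w \<in> W \<Longrightarrow> bdd_above (range (\<lambda>x. w x * tensor_norm (\<lambda>_. inner) k (nabla_pow k f) x))"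
  shows "tame W f"
  unfolding tame_def
proof (intro conjI f allI ballI)
  fix vs :: "'a list" and w assume W: "w \<in> W"
  let ?k = "length vs"
  obtain C where C: "\<And>x. w x * tensor_norm (\<lambda>_. inner) ?k (nabla_pow ?k f) x \<le> C"
    using bd[OF W, of ?k] by (auto simp: bdd_above_def)
  \<comment> \<open>Dividing by r brings all directions into the unit ball; the summand 1 keeps r
    positive even if all directions vanish.\<close>
  define r where "r = 1 + (\<Sum>v\<leftarrow>vs. norm v)"
  have r: "norm v \<le> r" if "v \<in> set vs" for v
    using member_le_sum_list[of "norm v" "map norm vs"] that by (fastforce simp: r_def)
  have r0: "0 < r" unfolding r_def by (intro add_pos_nonneg sum_list_nonneg) auto
  have "norm (iter_ddir vs f x) * w x \<le> r ^ ?k * C" for x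
  proof -
    let ?vs = "map ((*\<^sub>R) (1 / r)) vs"
    have "norm (iter_ddir ?vs f x) \<le> tensor_norm (\<lambda>_. inner) ?k (nabla_pow ?k f) x"
      using r r0 by (intro tensor_norm_iter_ddir_le[OF f]) auto
    then have "norm (iter_ddir ?vs f x) * w x \<le> C"
      using C[of x] w[OF W, of x] 
      by (smt (verit, best) mult.commute mult_left_mono)
    moreover have "norm (iter_ddir vs f x) = r ^ ?k * norm (iter_ddir ?vs f x)"
      using r0 by (simp add: iter_ddir_scaleR_list[OF f] power_divide)
    ultimately show ?thesis using r0 by simp
  qed
  then show "\<exists>C. \<forall>x. norm (iter_ddir vs f x) * w x \<le> C" by blast
qed

lemma tensor_norm_le_if_tame:
  fixes f :: "'a::euclidean_space \<Rightarrow> 'b::real_normed_vector"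
  assumes f: "tame W f" and w: "w \<in> W" "\<And>x. 0 \<le> w x"
  shows "bdd_above (range (\<lambda>x. w x * tensor_norm (\<lambda>_. inner) k (nabla_pow k f) x))"
proof -
  obtain C where C: "0 \<le> C" "\<And>vs x. length vs = k \<Longrightarrow> \<forall>v\<in>set vs. norm v \<le> 1 \<Longrightarrow>
      norm (iter_ddir vs f x) * w x \<le> C"
    using tame_uniform[OF f w, of k] by blast
  have "w x * tensor_norm (\<lambda>_. inner) k (nabla_pow k f) x \<le> C" for x
  proof (cases "w x = 0")
    case False
    then have pos: "0 < w x" using w(2)[of x] by simp
    have "tensor_norm (\<lambda>_. inner) k (nabla_pow k f) x \<le> C / w x"
      unfolding tensor_norm_def
    proof (rule cSup_least)
      show "{norm (nabla_pow k f x Xs) |Xs. length Xs = k \<and> (\<forall>X\<in>set Xs. form_norm inner X \<le> 1)} \<noteq> {}"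
        by (auto simp: form_norm_def intro!: exI[of _ "replicate k 0"])
    next
      fix y assume "y \<in> {norm (nabla_pow k f x Xs) |Xs. length Xs = k \<and> (\<forall>X\<in>set Xs. form_norm inner X \<le> 1)}"
      then obtain Xs where Xs: "y = norm (nabla_pow k f x Xs)" "length Xs = k"
        "\<forall>X\<in>set Xs. norm X \<le> 1" by (auto simp: form_norm_def norm_eq_sqrt_inner)
      have "norm (iter_ddir (rev Xs) f x) * w x \<le> C" using Xs by (intro C) auto
      then show "y \<le> C / w x"
        using Xs nabla_pow_eq_iter_ddir[of Xs f x] pos by (simp add: pos_le_divide_eq)
    qed
    then show ?thesis using pos by (simp add: pos_le_divide_eq mult.commute)
  qed (simp add: C)
  then show ?thesis by (auto simp: bdd_above_def)
qed

section \<open>Ordinary differential equations\<close>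

text \<open>The norm is not differentiable at 0, so it is replaced by h = sqrt (e^2 + |f|^2), which
  satisfies h' \<le> L h + c. Then exp (- L s) h(s) - c s is nonincreasing, and e is sent to 0 at
  the end.\<close>

lemma gronwall_forward:
  fixes f :: "real \<Rightarrow> 'a::real_inner"
  assumes f': "\<And>s. 0 \<le> s \<Longrightarrow> s \<le> t \<Longrightarrow> (f has_vector_derivative f' s) (at s)"
    and bound: "\<And>s. 0 \<le> s \<Longrightarrow> s \<le> t \<Longrightarrow> norm (f' s) \<le> L * norm (f s) + c"
    and L: "0 \<le> L" and c: "0 \<le> c" and t: "0 \<le> t"
  shows "norm (f t) \<le> exp (L * t) * (norm (f 0) + c * t)"
proof -
  have approx: "norm (f t) \<le> exp (L * t) * (e + norm (f 0) + c * t)" if e: "0 < e" for e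
  proof -
    define h where "h s = sqrt (e\<^sup>2 + f s \<bullet> f s)" for s
    define k where "k s = exp (- L * s) * h s - c * s" for s
    have h_pos: "0 < h s" for s
      unfolding h_def using e by (simp add: add_pos_nonneg)
    have fh: "norm (f s) \<le> h s" for s
      unfolding h_def norm_eq_sqrt_inner by (intro real_sqrt_le_mono) simp
    have h': "(h has_real_derivative (f s \<bullet> f' s) / h s) (at s)" if "0 \<le> s" "s \<le> t" for s
    proof -
      have "((\<lambda>s. f s \<bullet> f s) has_real_derivative 2 * (f s \<bullet> f' s)) (at s)"
        using has_derivative_inner[OF f'[OF that, unfolded has_vector_derivative_def]
            f'[OF that, unfolded has_vector_derivative_def]]
        unfolding has_field_derivative_def
        by (rule has_derivative_eq_rhs) (auto simp: inner_commute algebra_simps fun_eq_iff)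
      then have "(h has_real_derivative 2 * (f s \<bullet> f' s) * (inverse (h s) / 2)) (at s)"
        using h_pos[of s] unfolding h_def
        by (auto intro!: derivative_eq_intros)
      then show ?thesis by (simp add: field_simps)
    qed
    have "k t \<le> k 0"
    proof (rule DERIV_nonpos_imp_nonincreasing[OF t])
      fix s assume s: "0 \<le> s" "s \<le> t"
      have "f s \<bullet> f' s \<le> h s * norm (f' s)"
        by (rule order_trans[OF norm_cauchy_schwarz]) (intro mult_right_mono fh norm_ge_zero)
      then have "(f s \<bullet> f' s) / h s \<le> norm (f' s)"
        using h_pos[of s] by (simp add: pos_divide_le_eq mult.commute)
      also have "\<dots> \<le> L * h s + c"
        using bound[OF s] mult_left_mono[OF fh[of s] L] by linarith
      finally have "(f s \<bullet> f' s) / h s - L * h s \<le> c" by simp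
      then have "exp (- L * s) * ((f s \<bullet> f' s) / h s - L * h s) \<le> exp (- L * s) * c"
        by (intro mult_left_mono) auto
      also have "\<dots> \<le> 1 * c" using s L by (intro mult_right_mono c) (auto simp: mult_nonneg_nonneg)
      finally have "exp (- L * s) * ((f s \<bullet> f' s) / h s - L * h s) - c \<le> 0" by simp
      moreover have "(k has_real_derivative exp (- L * s) * ((f s \<bullet> f' s) / h s - L * h s) - c) (at s)"
        unfolding k_def by (auto intro!: derivative_eq_intros h'[OF s] simp: algebra_simps)
      ultimately show "\<exists>y. (k has_real_derivative y) (at s) \<and> y \<le> 0" by blast
    qed
    then have "exp (- L * t) * h t \<le> h 0 + c * t" by (simp add: k_def)
    then have "exp (L * t) * (exp (- L * t) * h t) \<le> exp (L * t) * (h 0 + c * t)"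
      by (intro mult_left_mono) auto
    then have "h t \<le> exp (L * t) * (h 0 + c * t)"
      by (simp add: mult.assoc[symmetric] exp_add[symmetric])
    moreover have "h 0 \<le> e + norm (f 0)"
      unfolding h_def using e sqrt_add_le_add_sqrt[of "e\<^sup>2" "f 0 \<bullet> f 0"]
      by (simp add: norm_eq_sqrt_inner)
    ultimately show ?thesis
      using fh[of t] by (smt (verit) exp_ge_zero mult_left_mono)
  qed
  show ?thesis
  proof (rule field_le_epsilon)
    fix e :: real assume "0 < e"
    then have "norm (f t) \<le> exp (L * t) * (e / exp (L * t) + norm (f 0) + c * t)"
      by (intro approx) auto
    also have "\<dots> = exp (L * t) * (norm (f 0) + c * t) + e"
      by (simp add: field_simps)
    finally show "norm (f t) \<le> exp (L * t) * (norm (f 0) + c * t) + e" .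
  qed
qed

lemma has_vector_derivative_reflect:
  assumes "(f has_vector_derivative f') (at (- s))"
  shows "((\<lambda>t. f (- t)) has_vector_derivative - f') (at s)"
proof -
  have "((\<lambda>t. - t) has_vector_derivative - 1) (at s)"
    by (intro has_vector_derivative_minus has_vector_derivative_id)
  from vector_diff_chain_at[OF this assms] show ?thesis by (simp add: o_def)
qed

lemma gronwall:
  fixes f :: "real \<Rightarrow> 'a::real_inner"
  assumes f': "\<And>s. \<bar>s\<bar> \<le> \<bar>t\<bar> \<Longrightarrow> (f has_vector_derivative f' s) (at s)"
    and bound: "\<And>s. \<bar>s\<bar> \<le> \<bar>t\<bar> \<Longrightarrow> norm (f' s) \<le> L * norm (f s) + c"
    and L: "0 \<le> L" and c: "0 \<le> c"
  shows "norm (f t) \<le> exp (L * \<bar>t\<bar>) * (norm (f 0) + c * \<bar>t\<bar>)"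
proof (cases "0 \<le> t")
  case True
  then show ?thesis using gronwall_forward[of t f f' L c] assms by auto
next
  case False
  have d: "((\<lambda>s. f (- s)) has_vector_derivative - f' (- s)) (at s)" if "0 \<le> s" "s \<le> - t" for s
    using that by (intro has_vector_derivative_reflect f') auto
  have b: "norm (- f' (- s)) \<le> L * norm (f (- s)) + c" if "0 \<le> s" "s \<le> - t" for s
    using bound[of "- s"] that by simp
  show ?thesis
    using gronwall_forward[of "- t" "\<lambda>s. f (- s)" "\<lambda>s. - f' (- s)" L c, OF d b L c] False by simp
qed

text \<open>The assumed bound is the derivative of A exp (a s), and the -1 is the value of the
  primitive at time 0. The estimate measures one Picard step in an exponentially weighted
  norm.\<close>

lemma exp_bound_forward:
  fixes f :: "real \<Rightarrow> 'a::real_normed_vector"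
  assumes f': "\<And>s. (f has_vector_derivative f' s) (at s)" and "f 0 = 0"
    and bound: "\<And>s. 0 \<le> s \<Longrightarrow> s \<le> t \<Longrightarrow> norm (f' s) \<le> a * A * exp (a * s)"
    and "0 \<le> t"
  shows "norm (f t) \<le> A * (exp (a * t) - 1)"
proof (cases "t = 0")
  case False
  then have "norm (f t - f 0) \<le> A * exp (a * t) - A * exp (a * 0)"
  proof (intro differentiable_bound_general[where f' = f' and \<phi>' = "\<lambda>s. a * A * exp (a * s)"])
    show "continuous_on {0..t} f"
      using f' by (meson continuous_at_imp_continuous_on has_vector_derivative_continuous)
    show "((\<lambda>s. A * exp (a * s)) has_vector_derivative a * A * exp (a * s)) (at s)" for s
      unfolding has_real_derivative_iff_has_vector_derivative[symmetric]
      by (auto intro!: derivative_eq_intros)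
  qed (use assms in \<open>auto intro!: continuous_intros\<close>)
  then show ?thesis using \<open>f 0 = 0\<close> by (simp add: algebra_simps)
qed (use assms in auto)

lemma exp_bound:
  fixes f :: "real \<Rightarrow> 'a::real_normed_vector"
  assumes f': "\<And>s. (f has_vector_derivative f' s) (at s)" and "f 0 = 0"
    and bound: "\<And>s. \<bar>s\<bar> \<le> \<bar>t\<bar> \<Longrightarrow> norm (f' s) \<le> a * A * exp (a * \<bar>s\<bar>)"
  shows "norm (f t) \<le> A * (exp (a * \<bar>t\<bar>) - 1)"
proof (cases "0 \<le> t")
  case True
  have b: "norm (f' s) \<le> a * A * exp (a * s)" if "0 \<le> s" "s \<le> t" for s
    using bound[of s] that by simp
  show ?thesis using exp_bound_forward[of f f' t a A, OF f' assms(2) b True] True by simp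
next
  case False
  have b: "norm (- f' (- s)) \<le> a * A * exp (a * s)" if "0 \<le> s" "s \<le> - t" for s
    using bound[of "- s"] that by simp
  show ?thesis
    using exp_bound_forward[of "\<lambda>s. f (- s)" "\<lambda>s. - f' (- s)" "- t" a A, OF has_vector_derivative_reflect[OF f'] _ b]
      False assms(2) by simp
qed

lemma geometric_limit:
  fixes x :: "nat \<Rightarrow> 'a::banach"
  assumes "\<And>n. norm (x (Suc n) - x n) \<le> C / 2 ^ n"
  shows "\<exists>l. x \<longlonglongrightarrow> l \<and> (\<forall>n. norm (x n - l) \<le> 2 * C / 2 ^ n)"
proof -
  have step: "norm (x (n + k) - x n) \<le> 2 * C / 2 ^ n" for n k
  proof -
    \<comment> \<open>Subtracting the tail of the geometric series beyond n + k makes the induction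
      on k close.\<close>
    have "norm (x (n + k) - x n) \<le> 2 * C / 2 ^ n - 2 * C / 2 ^ (n + k)"
    proof (induction k)
      case (Suc k)
      have "norm (x (n + Suc k) - x n) \<le> norm (x (Suc (n + k)) - x (n + k)) + norm (x (n + k) - x n)"
        using norm_triangle_ineq[of "x (Suc (n + k)) - x (n + k)" "x (n + k) - x n"] by simp
      also have "\<dots> \<le> C / 2 ^ (n + k) + (2 * C / 2 ^ n - 2 * C / 2 ^ (n + k))"
        by (intro add_mono assms Suc.IH)
      finally show ?case by (simp add: field_simps)
    qed simp
    moreover have "0 \<le> C" using order_trans[OF norm_ge_zero assms[of 0]] by simp
    then have "0 \<le> 2 * C / 2 ^ (n + k)" by simp
    ultimately show ?thesis by linarith
  qed
  have "Cauchy x"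
  proof (rule metric_CauchyI)
    fix e :: real assume "0 < e"
    have "(\<lambda>n. (4 * C) * (1 / 2) ^ n) \<longlonglongrightarrow> (4 * C) * 0"
      by (intro tendsto_mult tendsto_const LIMSEQ_power_zero) simp
    then have "eventually (\<lambda>n. (4 * C) * (1 / 2) ^ n < e) sequentially"
      using \<open>0 < e\<close> by (auto elim: order_tendstoD)
    then obtain N where N: "4 * C / 2 ^ N < e"
      by (auto simp: eventually_sequentially power_one_over)
    have "dist (x m) (x n) < e" if "N \<le> m" "N \<le> n" for m n
    proof -
      have "dist (x m) (x n) \<le> dist (x m) (x N) + dist (x n) (x N)" by (rule dist_triangle2)
      also have "\<dots> \<le> 2 * C / 2 ^ N + 2 * C / 2 ^ N"
        using step[of N "m - N"] step[of N "n - N"] that by (intro add_mono) (auto simp: dist_norm)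
      finally show ?thesis using N by simp
    qed
    then show "\<exists>M. \<forall>m\<ge>M. \<forall>n\<ge>M. dist (x m) (x n) < e" by blast
  qed
  then obtain l where l: "x \<longlonglongrightarrow> l" using Cauchy_convergent_iff convergent_def by blast
  have "norm (x n - l) \<le> 2 * C / 2 ^ n" for n
  proof (rule LIMSEQ_le_const2)
    show "(\<lambda>k. norm (x n - x (k + n))) \<longlonglongrightarrow> norm (x n - l)"
      by (intro tendsto_norm tendsto_diff tendsto_const LIMSEQ_ignore_initial_segment l)
    show "\<exists>N. \<forall>k\<ge>N. norm (x n - x (k + n)) \<le> 2 * C / 2 ^ n"
      using step[of n] by (auto simp: norm_minus_commute add.commute)
  qed
  with l show ?thesis by blast
qed

section \<open>Global solutions by Picard iteration\<close>

lemma antiderivative_exists: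
  fixes f :: "real \<Rightarrow> 'a::euclidean_space"
  assumes "continuous_on UNIV f"
  shows "\<exists>P. P 0 = z0 \<and> (\<forall>t. (P has_vector_derivative f t) (at t))"
proof -
  have "isCont f x" for x using assms by (simp add: continuous_on_eq_continuous_at)
  then obtain F where F: "\<And>t. (F has_vector_derivative f t) (at t)"
    using einterval_antiderivative[of "-\<infinity>" "\<infinity>" f] by auto
  have "((\<lambda>t. F t - F 0 + z0) has_vector_derivative f t) (at t)" for t
    by (auto intro!: derivative_eq_intros F)
  then show ?thesis by (intro exI[of _ "\<lambda>t. F t - F 0 + z0"]) auto
qed

text \<open>The Lipschitz constant is uniform in z and depends only on the time interval. Measured
  against exp (2 L |t|), each Picard step halves the distance on the whole of [-T, T], so no gluing
  of short intervals is needed.\<close>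

theorem picard_global:
  fixes G :: "real \<Rightarrow> 'a::euclidean_space \<Rightarrow> 'a"
  assumes cont: "continuous_on UNIV (\<lambda>(t, z). G t z)"
    and lip: "\<And>T. \<exists>L. \<forall>t z z'. \<bar>t\<bar> \<le> T \<longrightarrow> norm (G t z - G t z') \<le> L * norm (z - z')"
  shows "\<exists>z. z 0 = z0 \<and> (\<forall>t. (z has_vector_derivative G t (z t)) (at t))"
proof -
  have contG: "continuous_on S (\<lambda>t. G t (z t))" if "continuous_on S z" for z S
  proof -
    have "continuous_on S (\<lambda>t. (t, z t))" using that by (intro continuous_intros)
    from continuous_on_compose2[OF cont this] show ?thesis by simp
  qed
  define step where "step z = (SOME P. P 0 = z0 \<and>
      (\<forall>t. (P has_vector_derivative G t (z t)) (at t)))" for z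
  define Z where "Z n = (step ^^ n) (\<lambda>_. z0)" for n
  have step: "step z 0 = z0 \<and> (\<forall>t. (step z has_vector_derivative G t (z t)) (at t))"
    if "continuous_on UNIV z" for z
    using someI_ex[OF antiderivative_exists[OF contG[OF that], of z0]] unfolding step_def .
  have step_cont: "continuous_on UNIV (step z)" if "continuous_on UNIV z" for z
    using step[OF that] by (meson continuous_at_imp_continuous_on has_vector_derivative_continuous)
  have Z_cont: "continuous_on UNIV (Z n)" for n
    by (induction n) (auto simp: Z_def intro: step_cont)
  have Z_0: "Z n 0 = z0" for n
    using step[OF Z_cont[of "n - 1"]] by (cases n) (auto simp: Z_def)
  have Z': "(Z (Suc n) has_vector_derivative G t (Z n t)) (at t)" for n t
    using step[OF Z_cont[of n]] by (simp add: Z_def)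
  have local: "\<exists>C. \<forall>n t. \<bar>t\<bar> \<le> T \<longrightarrow> norm (Z (Suc n) t - Z n t) \<le> C / 2 ^ n" for T
  proof -
    obtain L' where L': "\<And>t z z'. \<bar>t\<bar> \<le> T \<Longrightarrow> norm (G t z - G t z') \<le> L' * norm (z - z')"
      using lip[of T] by blast
    define L where "L = \<bar>L'\<bar> + 1"
    have L: "norm (G t z - G t z') \<le> L * norm (z - z')" if "\<bar>t\<bar> \<le> T" for t z z'
    proof -
      have "L' * norm (z - z') \<le> L * norm (z - z')" by (intro mult_right_mono) (auto simp: L_def)
      then show ?thesis using L'[OF that, of z z'] by linarith
    qed
    have "compact ((\<lambda>t. Z (Suc 0) t - Z 0 t) ` {-T..T})"
      by (intro compact_continuous_image continuous_intros continuous_on_subset[OF Z_cont]) auto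
    then obtain K where "\<forall>x\<in>(\<lambda>t. Z (Suc 0) t - Z 0 t) ` {-T..T}. norm x \<le> K"
      using compact_imp_bounded bounded_iff by blast
    then have K: "norm (Z (Suc 0) t - Z 0 t) \<le> K" if "\<bar>t\<bar> \<le> T" for t
      using that by (auto simp: abs_le_iff minus_le_iff)
    \<comment> \<open>The gain of 1/2 per step comes from the factor 2 in the exponent: the
      primitive of L exp (2 L s) is exp (2 L s) / 2.\<close>
    have main: "norm (Z (Suc n) t - Z n t) \<le> K / 2 ^ n * exp (2 * L * \<bar>t\<bar>)" if "\<bar>t\<bar> \<le> T" for n t
      using that
    proof (induction n arbitrary: t)
      case 0
      have "0 \<le> K" using K[OF 0] norm_ge_zero order_trans by blast
      then have "K * 1 \<le> K * exp (2 * L * \<bar>t\<bar>)" by (intro mult_left_mono) (auto simp: L_def)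
      then show ?case using K[OF 0] by simp
    next
      case (Suc n)
      have "0 \<le> K" using K[OF Suc.prems] norm_ge_zero order_trans by blast
      have "norm (Z (Suc (Suc n)) t - Z (Suc n) t) \<le> K / 2 ^ Suc n * (exp (2 * L * \<bar>t\<bar>) - 1)"
      proof (rule exp_bound[where f' = "\<lambda>s. G s (Z (Suc n) s) - G s (Z n s)"])
        show "((\<lambda>t. Z (Suc (Suc n)) t - Z (Suc n) t) has_vector_derivative
            G s (Z (Suc n) s) - G s (Z n s)) (at s)" for s
          by (intro has_vector_derivative_diff Z')
        show "Z (Suc (Suc n)) 0 - Z (Suc n) 0 = 0" by (simp add: Z_0)
      next
        fix s assume "\<bar>s\<bar> \<le> \<bar>t\<bar>"
        then have s: "\<bar>s\<bar> \<le> T" using Suc.prems by simp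
        have "norm (G s (Z (Suc n) s) - G s (Z n s)) \<le> L * norm (Z (Suc n) s - Z n s)"
          by (rule L[OF s])
        also have "\<dots> \<le> L * (K / 2 ^ n * exp (2 * L * \<bar>s\<bar>))"
          by (intro mult_left_mono Suc.IH s) (simp add: L_def)
        finally show "norm (G s (Z (Suc n) s) - G s (Z n s)) \<le> 2 * L * (K / 2 ^ Suc n) * exp (2 * L * \<bar>s\<bar>)"
          by (simp add: field_simps)
      qed
      also have "\<dots> \<le> K / 2 ^ Suc n * exp (2 * L * \<bar>t\<bar>)"
        using \<open>0 \<le> K\<close> by (intro mult_left_mono) auto
      finally show ?case .
    qed
    have "norm (Z (Suc n) t - Z n t) \<le> K * exp (2 * L * T) / 2 ^ n" if "\<bar>t\<bar> \<le> T" for n t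
    proof -
      have "0 \<le> K" using K[OF that] norm_ge_zero order_trans by blast
      have "K / 2 ^ n * exp (2 * L * \<bar>t\<bar>) \<le> K / 2 ^ n * exp (2 * L * T)"
        using that \<open>0 \<le> K\<close> mult_left_mono[OF that, of "2 * L"] by (intro mult_left_mono) (auto simp: L_def)
      then show ?thesis using main[OF that, of n] by simp
    qed
    then show ?thesis by blast
  qed
  have "\<exists>l. (\<lambda>n. Z n t) \<longlonglongrightarrow> l" for t
    using local[of "\<bar>t\<bar>"] geometric_limit[of "\<lambda>n. Z n t"] by blast
  then obtain z where z: "\<And>t. (\<lambda>n. Z n t) \<longlonglongrightarrow> z t" by metis
  have "z 0 = z0" using LIMSEQ_unique[OF z[of 0]] by (simp add: Z_0)
  moreover have "(z has_vector_derivative G t (z t)) (at t)" for t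
  proof -
    \<comment> \<open>The margin 1 puts t into the interior of [-T, T], where a derivative within
      the interval is a derivative at t.\<close>
    define T where "T = \<bar>t\<bar> + 1"
    obtain C where C: "\<And>n t. \<bar>t\<bar> \<le> T \<Longrightarrow> norm (Z (Suc n) t - Z n t) \<le> C / 2 ^ n"
      using local by blast
    obtain L' where L': "\<And>t z z'. \<bar>t\<bar> \<le> T \<Longrightarrow> norm (G t z - G t z') \<le> L' * norm (z - z')"
      using lip[of T] by blast
    have conv: "norm (Z n s - z s) \<le> 2 * C / 2 ^ n" if "\<bar>s\<bar> \<le> T" for n s
      using geometric_limit[of "\<lambda>n. Z n s", OF C[OF that]] z[of s] LIMSEQ_unique by blast
    \<comment> \<open>Termwise differentiation: the derivatives converge uniformly on [-T, T] by the
      geometric rate. The index is shifted because the derivative of Z (Suc n) is expressed through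
      Z n.\<close>
    have "\<exists>g. \<forall>s\<in>{-T..T}. (\<lambda>n. Z (Suc n) s) \<longlonglongrightarrow> g s \<and>
        (g has_derivative (\<lambda>h. h *\<^sub>R G s (z s))) (at s within {-T..T})"
    proof (rule has_derivative_sequence)
      show "(Z (Suc n) has_derivative (\<lambda>h. h *\<^sub>R G s (Z n s))) (at s within {-T..T})" for n s
        using Z'[of n s] unfolding has_vector_derivative_def by (rule has_derivative_at_withinI)
      show "(\<lambda>n. Z (Suc n) 0) \<longlonglongrightarrow> z 0" by (intro LIMSEQ_Suc z)
      show "(0::real) \<in> {-T..T}" by (simp add: T_def)
      fix e :: real assume "0 < e"
      have "(\<lambda>n. (\<bar>L'\<bar> * (2 * C)) * (1 / 2) ^ n) \<longlonglongrightarrow> (\<bar>L'\<bar> * (2 * C)) * 0"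
        by (intro tendsto_mult tendsto_const LIMSEQ_power_zero) simp
      then have "eventually (\<lambda>n. (\<bar>L'\<bar> * (2 * C)) * (1 / 2) ^ n < e) sequentially"
        using \<open>0 < e\<close> by (auto elim: order_tendstoD)
      then show "eventually (\<lambda>n. \<forall>s\<in>{-T..T}. \<forall>h. norm (h *\<^sub>R G s (Z n s) - h *\<^sub>R G s (z s)) \<le> e * norm h)
          sequentially"
      proof eventually_elim
        case (elim n)
        show ?case
        proof safe
          fix s h :: real assume "s \<in> {-T..T}"
          then have s: "\<bar>s\<bar> \<le> T" by auto
          have "norm (G s (Z n s) - G s (z s)) \<le> L' * norm (Z n s - z s)" by (rule L'[OF s])
          also have "\<dots> \<le> \<bar>L'\<bar> * (2 * C / 2 ^ n)"
            by (intro mult_mono conv s) auto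
          also have "\<dots> = (\<bar>L'\<bar> * (2 * C)) * (1 / 2) ^ n" by (simp add: power_one_over)
          finally have "norm (G s (Z n s) - G s (z s)) \<le> e" using elim by linarith
          then have "\<bar>h\<bar> * norm (G s (Z n s) - G s (z s)) \<le> \<bar>h\<bar> * e" by (intro mult_left_mono) auto
          then show "norm (h *\<^sub>R G s (Z n s) - h *\<^sub>R G s (z s)) \<le> e * norm h"
            by (simp add: scaleR_diff_right[symmetric] mult.commute)
        qed
      qed
    qed auto
    then obtain g where g: "\<And>s. s \<in> {-T..T} \<Longrightarrow> (\<lambda>n. Z (Suc n) s) \<longlonglongrightarrow> g s"
        "\<And>s. s \<in> {-T..T} \<Longrightarrow> (g has_derivative (\<lambda>h. h *\<^sub>R G s (z s))) (at s within {-T..T})"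
      by blast
    have gz: "g s = z s" if "s \<in> {-T..T}" for s
      using LIMSEQ_unique[OF g(1)[OF that] LIMSEQ_Suc[OF z]] by simp
    have t: "t \<in> interior {-T..T}" by (auto simp: T_def interior_atLeastAtMost_real)
    then have "(g has_vector_derivative G t (z t)) (at t)"
      using g(2)[of t] interior_subset[of "{-T..T}"] at_within_interior[OF t]
      unfolding has_vector_derivative_def by auto
    then show ?thesis
      by (rule has_vector_derivative_transform_within_open[OF _ open_interior t])
        (use gz interior_subset in blast)
  qed
  ultimately show ?thesis by blast
qed

section \<open>Differentiability of flows\<close>

lemma segment_mean_value:
  assumes f: "smooth f" and B: "\<And>s. 0 \<le> s \<Longrightarrow> s \<le> 1 \<Longrightarrow> norm (ddir v f (x + s *\<^sub>R v)) \<le> B"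
  shows "norm (f (x + v) - f x) \<le> B"
proof -
  have d: "((\<lambda>s. f (x + s *\<^sub>R v)) has_vector_derivative ddir v f (x + s *\<^sub>R v)) (at s)" for s :: real
  proof -
    have "((\<lambda>s. x + s *\<^sub>R v) has_derivative (\<lambda>h. h *\<^sub>R v)) (at s)"
      by (auto intro!: derivative_eq_intros)
    from has_derivative_compose[OF this smooth_has_derivative[OF f]]
    show ?thesis
      unfolding has_vector_derivative_def
      by (simp add: ddir_vec(2)[OF smooth_differentiable[OF f]])
  qed
  have "norm (f (x + 1 *\<^sub>R v) - f (x + 0 *\<^sub>R v)) \<le> B * 1 - B * 0"
  proof (rule differentiable_bound_general[where f' = "\<lambda>s. ddir v f (x + s *\<^sub>R v)" and \<phi>' = "\<lambda>s. B"])
    show "continuous_on {0..1} (\<lambda>s. f (x + s *\<^sub>R v))"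
      using d by (meson continuous_at_imp_continuous_on has_vector_derivative_continuous)
    show "((\<lambda>s. B * s) has_vector_derivative B) (at s)" for s
      unfolding has_real_derivative_iff_has_vector_derivative[symmetric]
      by (auto intro!: derivative_eq_intros)
  qed (use d B in \<open>auto intro!: continuous_intros\<close>)
  then show ?thesis by simp
qed

text \<open>The mean value inequality is used twice, for f minus its linear part at x and then for
  \<open>ddir v f\<close>. This loses the usual factor 1/2, which is harmless for the estimates
  here.\<close>

lemma segment_taylor:
  assumes f: "smooth f"
    and K: "\<And>s. 0 \<le> s \<Longrightarrow> s \<le> 1 \<Longrightarrow> norm (ddir v (ddir v f) (x + s *\<^sub>R v)) \<le> K"
  shows "norm (f (x + v) - f x - ddir v f x) \<le> K"
proof -
  let ?D = "\<lambda>y. ddir y f x"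
  have D: "bounded_linear ?D"
    using smooth_has_derivative[OF f] has_derivative_bounded_linear by blast
  let ?g = "\<lambda>y. f y + - ?D y"
  have mD: "bounded_linear (\<lambda>y. - ?D y)" by (rule bounded_linear_minus[OF D])
  have g: "smooth ?g" by (intro smooth_add f smooth_linear mD)
  have dD: "ddir v (\<lambda>y. - ?D y) y = - ?D v" for y
    by (rule ddir_eqI) (rule bounded_linear_imp_has_derivative[OF mD])
  have dg: "ddir v ?g y = ddir v f y - ddir v f x" for y
    using ddir_add[of f y "\<lambda>y. - ?D y" v] smooth_differentiable[OF f]
      bounded_linear_imp_differentiable[OF mD] by (simp add: dD)
  have bound: "norm (?g (x + v) - ?g x) \<le> K"
  proof (rule segment_mean_value[OF g])
    fix s :: real assume s: "0 \<le> s" "s \<le> 1"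
    have "norm (ddir v f (x + s *\<^sub>R v) - ddir v f x) \<le> K"
    proof (rule segment_mean_value[OF smooth_ddir[OF f]])
      fix r :: real assume r: "0 \<le> r" "r \<le> 1"
      have "ddir (s *\<^sub>R v) (ddir v f) (x + r *\<^sub>R s *\<^sub>R v) = s *\<^sub>R ddir v (ddir v f) (x + (r * s) *\<^sub>R v)"
        by (simp add: ddir_vec(2)[OF smooth_differentiable[OF smooth_ddir[OF f]]])
      moreover have "norm (ddir v (ddir v f) (x + (r * s) *\<^sub>R v)) \<le> K"
        using r s by (intro K) (auto simp: mult_le_one)
      ultimately show "norm (ddir (s *\<^sub>R v) (ddir v f) (x + r *\<^sub>R s *\<^sub>R v)) \<le> K"
        using s by (simp add: mult_left_le_one_le order_trans[OF mult_left_le_one_le])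
    qed
    then show "norm (ddir v ?g (x + s *\<^sub>R v)) \<le> K" unfolding dg .
  qed
  have "?g (x + v) - ?g x = f (x + v) - f x - ddir v f x"
    unfolding ddir_vec(1)[OF smooth_differentiable[OF f], of x v x] by simp
  with bound show ?thesis by (simp only:)
qed

lemma lipschitz_if_ddir_bounded:
  assumes "smooth f" "convex S" "x \<in> S" "y \<in> S"
    and L: "\<And>z v. z \<in> S \<Longrightarrow> norm (ddir v f z) \<le> L * norm v"
  shows "norm (f y - f x) \<le> L * norm (y - x)"
proof -
  have "x + s *\<^sub>R (y - x) \<in> S" if "0 \<le> s" "s \<le> 1" for s
  proof -
    have "(1 - s) *\<^sub>R x + s *\<^sub>R y \<in> S" using assms that by (intro convexD) auto
    then show ?thesis by (simp add: algebra_simps)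
  qed
  then show ?thesis using segment_mean_value[OF assms(1), of "y - x" x] L by simp
qed

text \<open>The derivatives of H need bounds only on a convex set that holds all nearby trajectories
  up to time T; convexity allows Taylor's formula between two trajectories. Gronwall's inequality,
  applied to the difference of trajectories minus the solution of the linearized equation, leaves an
  error quadratic in the initial displacement.\<close>

theorem flow_has_derivative:
  fixes H :: "'a::euclidean_space \<Rightarrow> 'a"
  assumes H: "smooth H"
    and \<Phi>0: "\<And>\<rho>. \<Phi> 0 \<rho> = \<rho>"
    and \<Phi>: "\<And>t \<rho>. ((\<lambda>t. \<Phi> t \<rho>) has_vector_derivative H (\<Phi> t \<rho>)) (at t)"
    and ex: "\<And>T. \<exists>S L K d. convex S \<and> 0 < d \<and> 0 \<le> L \<and> 0 \<le> K \<and>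
        (\<forall>t \<rho>'. \<bar>t\<bar> \<le> T \<longrightarrow> norm (\<rho>' - \<rho>) < d \<longrightarrow> \<Phi> t \<rho>' \<in> S) \<and>
        (\<forall>z\<in>S. \<forall>v. norm (ddir v H z) \<le> L * norm v \<and> norm (ddir v (ddir v H) z) \<le> K * (norm v)\<^sup>2)"
  shows "\<exists>V. (\<forall>t. (\<Phi> t has_derivative V t) (at \<rho>)) \<and>
      (\<forall>t \<zeta>. V 0 \<zeta> = \<zeta> \<and> ((\<lambda>t. V t \<zeta>) has_vector_derivative ddir (V t \<zeta>) H (\<Phi> t \<rho>)) (at t))"
proof -
  have \<Phi>_cont: "continuous_on UNIV (\<lambda>t. \<Phi> t \<rho>)"
    using \<Phi> by (meson continuous_at_imp_continuous_on has_vector_derivative_continuous)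
  have lin: "ddir (z + w) H x = ddir z H x + ddir w H x" "ddir (c *\<^sub>R z) H x = c *\<^sub>R ddir z H x"
    "ddir (z - w) H x = ddir z H x - ddir w H x" for z w x c
    using ddir_vec[OF smooth_differentiable[OF H]] linear_diff[OF linear_ddir[OF smooth_differentiable[OF H]]]
    by blast+
  have "\<exists>V. V 0 = \<zeta> \<and> (\<forall>t. (V has_vector_derivative ddir (V t) H (\<Phi> t \<rho>)) (at t))" for \<zeta>
  proof (rule picard_global)
    \<comment> \<open>Smoothness is stated for fixed directions, so joint continuity in time and
      direction is read off the expansion over the basis.\<close>
    have "continuous_on UNIV (\<lambda>p. \<Sum>b\<in>Basis. (snd p \<bullet> b) *\<^sub>R ddir b H (\<Phi> (fst p) \<rho>))"
      by (intro continuous_intros continuous_on_compose2[OF smooth_continuous[OF smooth_ddir[OF H]]]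
          continuous_on_compose2[OF \<Phi>_cont]) auto
    then show "continuous_on UNIV (\<lambda>(t, z). ddir z H (\<Phi> t \<rho>))"
      unfolding case_prod_unfold ddir_expand[OF smooth_differentiable[OF H], of "snd _"] .
    fix T
    obtain S L d where "\<forall>t \<rho>'. \<bar>t\<bar> \<le> T \<longrightarrow> norm (\<rho>' - \<rho>) < d \<longrightarrow> \<Phi> t \<rho>' \<in> S" "0 < d"
      "\<forall>z\<in>S. \<forall>v. norm (ddir v H z) \<le> L * norm v" using ex[of T] by blast
    then have "norm (ddir v H (\<Phi> t \<rho>)) \<le> L * norm v" if "\<bar>t\<bar> \<le> T" for t v
      using that by simp
    then show "\<exists>L. \<forall>t z z'. \<bar>t\<bar> \<le> T \<longrightarrow>
        norm (ddir z H (\<Phi> t \<rho>) - ddir z' H (\<Phi> t \<rho>)) \<le> L * norm (z - z')"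
      unfolding lin(3)[symmetric] by blast
  qed
  then obtain W where W0: "\<And>\<zeta>. W \<zeta> 0 = \<zeta>"
    and W: "\<And>\<zeta> t. (W \<zeta> has_vector_derivative ddir (W \<zeta> t) H (\<Phi> t \<rho>)) (at t)"
    by metis
  have "(\<Phi> t has_derivative (\<lambda>\<zeta>. W \<zeta> t)) (at \<rho>)" for t
  proof -
    obtain S L K d where S: "convex S" and d: "0 < d" and L: "0 \<le> L" and K: "0 \<le> K"
      and in_S: "\<And>s \<rho>'. \<bar>s\<bar> \<le> \<bar>t\<bar> \<Longrightarrow> norm (\<rho>' - \<rho>) < d \<Longrightarrow> \<Phi> s \<rho>' \<in> S"
      and HL: "\<And>z v. z \<in> S \<Longrightarrow> norm (ddir v H z) \<le> L * norm v"
      and HK: "\<And>z v. z \<in> S \<Longrightarrow> norm (ddir v (ddir v H) z) \<le> K * (norm v)\<^sup>2"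
      using ex[of "\<bar>t\<bar>"] by metis
    have in_S': "\<Phi> s \<rho> \<in> S" if "\<bar>s\<bar> \<le> \<bar>t\<bar>" for s using in_S[OF that, of \<rho>] d by simp
    have unique: "f t = 0" if f: "\<And>s. (f has_vector_derivative ddir (f s) H (\<Phi> s \<rho>)) (at s)" and "f 0 = 0" for f
      using gronwall[of t f "\<lambda>s. ddir (f s) H (\<Phi> s \<rho>)" L 0] f HL in_S' L \<open>f 0 = 0\<close> by simp
    \<comment> \<open>Each defect of linearity solves the linearized equation with initial value 0
      and hence vanishes.\<close>
    have "linear (\<lambda>\<zeta>. W \<zeta> t)"
    proof (rule linearI)
      fix a b :: 'a and c :: real
      have "((\<lambda>s. W (a + b) s - (W a s + W b s)) has_vector_derivative
          ddir (W (a + b) s - (W a s + W b s)) H (\<Phi> s \<rho>)) (at s)" for s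
        unfolding lin by (intro has_vector_derivative_diff has_vector_derivative_add W)
      from unique[OF this] show "W (a + b) t = W a t + W b t" by (simp add: W0)
      have "((\<lambda>s. W (c *\<^sub>R a) s - c *\<^sub>R W a s) has_vector_derivative
          ddir (W (c *\<^sub>R a) s - c *\<^sub>R W a s) H (\<Phi> s \<rho>)) (at s)" for s
        unfolding lin
        by (intro has_vector_derivative_diff W
            bounded_linear.has_vector_derivative[OF bounded_linear_scaleR_right])
      from unique[OF this] show "W (c *\<^sub>R a) t = c *\<^sub>R W a t" by (simp add: W0)
    qed
    then have bl: "bounded_linear (\<lambda>\<zeta>. W \<zeta> t)" by (simp add: linear_conv_bounded_linear)
    define E where "E = exp (L * \<bar>t\<bar>)"
    \<comment> \<open>E bounds the growth of the distance between trajectories; K E^2 |t|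
      accumulates the Taylor remainder over time, and the outer E is its amplification by Gronwall's
      inequality.\<close>
    define M where "M = E * (K * E\<^sup>2 * \<bar>t\<bar>)"
    have error: "norm (\<Phi> t \<rho>' - \<Phi> t \<rho> - W (\<rho>' - \<rho>) t) \<le> M * (norm (\<rho>' - \<rho>))\<^sup>2"
      if \<rho>': "norm (\<rho>' - \<rho>) < d" for \<rho>'
    proof -
      define \<zeta> where "\<zeta> = \<rho>' - \<rho>"
      define D where "D s = \<Phi> s \<rho>' - \<Phi> s \<rho>" for s
      have D': "(D has_vector_derivative H (\<Phi> s \<rho>') - H (\<Phi> s \<rho>)) (at s)" for s
        unfolding D_def by (intro has_vector_derivative_diff \<Phi>)
      have D_bound: "norm (D s) \<le> E * norm \<zeta>" if s: "\<bar>s\<bar> \<le> \<bar>t\<bar>" for s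
      proof -
        have "norm (D s) \<le> exp (L * \<bar>s\<bar>) * (norm (D 0) + 0 * \<bar>s\<bar>)"
        proof (rule gronwall[OF D'])
          fix r assume "\<bar>r\<bar> \<le> \<bar>s\<bar>"
          then have r: "\<bar>r\<bar> \<le> \<bar>t\<bar>" using s by simp
          show "norm (H (\<Phi> r \<rho>') - H (\<Phi> r \<rho>)) \<le> L * norm (D r) + 0"
            unfolding D_def using lipschitz_if_ddir_bounded[OF H S in_S'[OF r] in_S[OF r \<rho>'] HL] by simp
        qed (use L in auto)
        also have "\<dots> \<le> E * norm \<zeta>"
          unfolding E_def D_def \<zeta>_def \<Phi>0 using s L by (auto intro!: mult_right_mono mult_left_mono)
        finally show ?thesis .
      qed
      define w where "w s = D s - W \<zeta> s" for s
      have w': "(w has_vector_derivative H (\<Phi> s \<rho>') - H (\<Phi> s \<rho>) - ddir (W \<zeta> s) H (\<Phi> s \<rho>)) (at s)" for s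
        unfolding w_def by (intro has_vector_derivative_diff D' W)
      have "norm (w t) \<le> exp (L * \<bar>t\<bar>) * (norm (w 0) + (K * (E * norm \<zeta>)\<^sup>2) * \<bar>t\<bar>)"
      proof (rule gronwall[OF w'])
        fix s assume s: "\<bar>s\<bar> \<le> \<bar>t\<bar>"
        have seg: "\<Phi> s \<rho> + r *\<^sub>R D s \<in> S" if "0 \<le> r" "r \<le> 1" for r
        proof -
          have "(1 - r) *\<^sub>R \<Phi> s \<rho> + r *\<^sub>R \<Phi> s \<rho>' \<in> S"
            using S in_S[OF s \<rho>'] in_S'[OF s] that by (intro convexD) auto
          then show ?thesis by (simp add: D_def algebra_simps)
        qed
        have "norm (H (\<Phi> s \<rho> + D s) - H (\<Phi> s \<rho>) - ddir (D s) H (\<Phi> s \<rho>)) \<le> K * (norm (D s))\<^sup>2"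
          by (rule segment_taylor[OF H]) (intro HK seg)
        also have "\<dots> \<le> K * (E * norm \<zeta>)\<^sup>2"
          by (intro mult_left_mono power_mono D_bound s K) simp
        finally have "norm (H (\<Phi> s \<rho>') - H (\<Phi> s \<rho>) - ddir (D s) H (\<Phi> s \<rho>)) \<le> K * (E * norm \<zeta>)\<^sup>2"
          by (simp add: D_def)
        moreover have "norm (ddir (w s) H (\<Phi> s \<rho>)) \<le> L * norm (w s)" by (intro HL in_S' s)
        moreover have "H (\<Phi> s \<rho>') - H (\<Phi> s \<rho>) - ddir (W \<zeta> s) H (\<Phi> s \<rho>) =
            (H (\<Phi> s \<rho>') - H (\<Phi> s \<rho>) - ddir (D s) H (\<Phi> s \<rho>)) + ddir (w s) H (\<Phi> s \<rho>)"
          by (simp add: w_def lin)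
        ultimately show "norm (H (\<Phi> s \<rho>') - H (\<Phi> s \<rho>) - ddir (W \<zeta> s) H (\<Phi> s \<rho>)) \<le>
            L * norm (w s) + K * (E * norm \<zeta>)\<^sup>2"
          by (metis add.commute norm_triangle_mono)
      qed (use L K in auto)
      then show ?thesis
        by (simp add: w_def D_def W0 \<Phi>0 \<zeta>_def M_def E_def power_mult_distrib mult_ac)
    qed
    show ?thesis
    proof (rule has_derivativeI_sandwich[OF d bl])
      fix y assume y: "y \<noteq> \<rho>" "dist y \<rho> < d"
      then have "norm (\<Phi> t y - \<Phi> t \<rho> - W (y - \<rho>) t) \<le> M * (norm (y - \<rho>))\<^sup>2"
        by (intro error) (simp add: dist_norm)
      then show "norm (\<Phi> t y - \<Phi> t \<rho> - W (y - \<rho>) t) / norm (y - \<rho>) \<le> M * norm (y - \<rho>)"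
        using y by (simp add: pos_divide_le_eq power2_eq_square mult.assoc)
    next
      show "((\<lambda>y. M * norm (y - \<rho>)) \<longlongrightarrow> 0) (at \<rho>)"
        by (auto intro!: tendsto_eq_intros)
    qed
  qed
  then show ?thesis using W0 W by (intro exI[of _ "\<lambda>t \<zeta>. W \<zeta> t"]) auto
qed

section \<open>Powers of the Japanese bracket\<close>

text \<open>Derivatives of bracket powers and of Gaussians are such functions multiplied by
  coordinates. Closing F under polynomial multiples gives the stable family that
  \<open>tame_coinduct\<close> asks for.\<close>

inductive_set poly_span :: "('a::euclidean_space \<Rightarrow> real) set \<Rightarrow> ('a \<Rightarrow> real) set" for F where
  base: "f \<in> F \<Longrightarrow> f \<in> poly_span F"
| coord: "f \<in> poly_span F \<Longrightarrow> (\<lambda>x. (x \<bullet> v) * f x) \<in> poly_span F"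
| scale: "f \<in> poly_span F \<Longrightarrow> (\<lambda>x. c * f x) \<in> poly_span F"
| add: "f \<in> poly_span F \<Longrightarrow> g \<in> poly_span F \<Longrightarrow> (\<lambda>x. f x + g x) \<in> poly_span F"

lemma inner_left_differentiable: "(\<lambda>x. x \<bullet> v) differentiable (at x)" "ddir w (\<lambda>x. x \<bullet> v) x = w \<bullet> v"
proof -
  have *: "((\<lambda>x. x \<bullet> v) has_derivative (\<lambda>w. w \<bullet> v)) (at x)"
    by (auto intro!: derivative_eq_intros)
  then show "(\<lambda>x. x \<bullet> v) differentiable (at x)" by (rule differentiableI)
  show "ddir w (\<lambda>x. x \<bullet> v) x = w \<bullet> v" by (rule ddir_eqI[OF *])
qed

lemma poly_span_ddir:
  assumes F: "\<And>f x. f \<in> F \<Longrightarrow> f differentiable (at x)" "\<And>f v. f \<in> F \<Longrightarrow> ddir v f \<in> poly_span F"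
    and f: "f \<in> poly_span F"
  shows "\<forall>x. f differentiable (at x)" "ddir v f \<in> poly_span F"
proof -
  have "(\<forall>x. f differentiable (at x)) \<and> ddir v f \<in> poly_span F"
    using f
  proof induction
    case (base f)
    then show ?case using F by blast
  next
    case (coord f w)
    have "ddir v (\<lambda>x. (x \<bullet> w) * f x) = (\<lambda>x. (x \<bullet> w) * ddir v f x + (v \<bullet> w) * f x)"
      using coord by (intro ext)
        (simp add: ddir_bilinear(2)[OF bounded_bilinear_mult inner_left_differentiable(1)]
          inner_left_differentiable(2))
    then show ?case
      using coord ddir_bilinear(1)[OF bounded_bilinear_mult inner_left_differentiable(1)]
      by (auto intro: poly_span.intros)
  next
    case (scale f c)
    have "ddir v (\<lambda>x. c * f x) = (\<lambda>x. c * ddir v f x)"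
      using ddir_bounded_linear(2)[OF bounded_linear_mult_right] scale by blast
    then show ?case using scale by (auto intro: poly_span.intros)
  next
    case (add f g)
    have "ddir v (\<lambda>x. f x + g x) = (\<lambda>x. ddir v f x + ddir v g x)"
      using ddir_add add by blast
    then show ?case using add by (auto intro: poly_span.intros)
  qed
  then show "\<forall>x. f differentiable (at x)" "ddir v f \<in> poly_span F" by auto
qed

lemma japanese_pos: "0 < japanese x"
  using japanese_ge_1[of x] by linarith

lemma japanese_sq: "(japanese x)\<^sup>2 = 1 + (norm x)\<^sup>2"
  by (simp add: japanese_def)

lemma norm_le_japanese: "norm x \<le> japanese x"
  unfolding japanese_def by (rule real_le_rsqrt) simp

lemma japanese_powr: "japanese x powr s = (1 + x \<bullet> x) powr (s / 2)"
  for x :: "'a::real_inner"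
proof -
  have "0 < 1 + x \<bullet> x" by (simp add: add_pos_nonneg)
  then show ?thesis
    by (simp add: japanese_def powr_half_sqrt[symmetric] powr_powr power2_norm_eq_inner)
qed

lemma japanese_powr_derivative:
  fixes f :: "real \<Rightarrow> 'a::real_inner"
  assumes "(f has_vector_derivative f') (at t)"
  shows "((\<lambda>t. japanese (f t) powr s) has_real_derivative
    s * japanese (f t) powr (s - 2) * (f t \<bullet> f')) (at t)"
proof -
  have pos: "0 < 1 + f t \<bullet> f t" by (simp add: add_pos_nonneg)
  have "((\<lambda>t. 1 + f t \<bullet> f t) has_real_derivative 2 * (f t \<bullet> f')) (at t)"
    using has_derivative_add[OF has_derivative_const has_derivative_inner[OF
      assms[unfolded has_vector_derivative_def] assms[unfolded has_vector_derivative_def]], of 1]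
    unfolding has_field_derivative_def
    by (rule has_derivative_eq_rhs) (auto simp: inner_commute algebra_simps fun_eq_iff)
  from DERIV_powr[OF this pos DERIV_const[of "s / 2"]] show ?thesis
    unfolding japanese_powr
    by (rule DERIV_cong) (use pos in \<open>simp add: diff_divide_distrib powr_diff\<close>)
qed

text \<open>A derivative lowers the exponent by 2 and produces a coordinate, so the polynomial span
  of all real powers together is stable, though that of a single power is not shown to be.\<close>

lemma smooth_japanese_powr: "smooth (\<lambda>x::'a::euclidean_space. japanese x powr s)"
proof -
  let ?J = "\<lambda>s x::'a. japanese x powr s"
  have d: "(?J s has_derivative (\<lambda>v. s * ((x \<bullet> v) * japanese x powr (s - 2)))) (at x)" for s x
  proof -
    have pos: "0 < 1 + x \<bullet> x" by (simp add: add_pos_nonneg)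
    have "((\<lambda>x. 1 + x \<bullet> x) has_derivative (\<lambda>v. 2 * (x \<bullet> v))) (at x)"
      by (auto intro!: derivative_eq_intros simp: inner_commute)
    from has_derivative_powr[OF this has_derivative_const[of "s / 2"] pos UNIV_I]
    show ?thesis unfolding japanese_powr
      by (rule has_derivative_eq_rhs) (use pos in \<open>simp add: fun_eq_iff diff_divide_distrib powr_diff\<close>)
  qed
  have F: "f differentiable (at x)" "ddir v f \<in> poly_span (range ?J)" if "f \<in> range ?J" for f x v
  proof -
    from that obtain s where f: "f = ?J s" by blast
    show "f differentiable (at x)" unfolding f by (rule differentiableI[OF d])
    have "ddir v f = (\<lambda>x. s * ((x \<bullet> v) * japanese x powr (s - 2)))"
      unfolding f by (rule ext, rule ddir_eqI[OF d])
    also have "\<dots> \<in> poly_span (range ?J)"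
      by (intro poly_span.scale poly_span.coord poly_span.base rangeI)
    finally show "ddir v f \<in> poly_span (range ?J)" .
  qed
  have "?J s \<in> poly_span (range ?J)" by (intro poly_span.base rangeI)
  then have "tame {} (?J s)"
    by (rule tame_coinduct) (use poly_span_ddir[OF F] in auto)
  then show ?thesis by (simp add: tame_empty)
qed

lemma japanese_le_if_norm_le:
  assumes "norm x \<le> M * norm y" "1 \<le> M"
  shows "japanese x \<le> M * japanese y"
proof -
  have "1 + (norm x)\<^sup>2 \<le> M\<^sup>2 * (1 + (norm y)\<^sup>2)"
    using power_mono[OF assms(1), of 2] one_le_power[OF assms(2), of 2]
    by (simp add: power_mult_distrib algebra_simps)
  then have "japanese x \<le> sqrt (M\<^sup>2 * (1 + (norm y)\<^sup>2))"
    unfolding japanese_def by (rule real_sqrt_le_mono)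
  also have "\<dots> = M * japanese y" using assms(2) by (simp add: japanese_def real_sqrt_mult)
  finally show ?thesis .
qed

text \<open>The bracket of x is the Euclidean norm of the pair (1, x), so the triangle inequality
  makes it Lipschitz with constant 1.\<close>

lemma japanese_triangle: "japanese x \<le> japanese y + norm (x - y)"
proof -
  have "japanese x = norm (1::real, x)" "japanese y = norm (1::real, y)"
    by (simp_all add: japanese_def norm_Pair)
  moreover have "norm (1::real, x) \<le> norm (1::real, y) + norm (0::real, x - y)"
    using norm_triangle_ineq[of "(1::real, y)" "(0::real, x - y)"] by simp
  ultimately show ?thesis by simp
qed

section \<open>The anisotropic metric\<close>

text \<open>The coefficients enter squared, so that norm, dual norm and gain are expressed in a and
  b themselves.\<close>

definition split_form :: "real \<Rightarrow> real \<Rightarrow> 'a::euclidean_space \<times> 'a \<Rightarrow> 'a \<times> 'a \<Rightarrow> real" where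
  "split_form a b \<zeta> \<zeta>' = a\<^sup>2 * (fst \<zeta> \<bullet> fst \<zeta>') + b\<^sup>2 * (snd \<zeta> \<bullet> snd \<zeta>')"

lemma anisotropic_metric_eq:
  "anisotropic_metric \<alpha>\<^sub>1 \<alpha>\<^sub>2 \<rho> =
    split_form (japanese (snd \<rho>) powr \<alpha>\<^sub>1) (japanese (snd \<rho>) powr - \<alpha>\<^sub>2)"
proof -
  have "japanese (snd \<rho>) powr (2 * \<alpha>) = (japanese (snd \<rho>) powr \<alpha>)\<^sup>2" for \<alpha>
    by (simp add: power2_eq_square powr_add[symmetric])
  from this[of \<alpha>\<^sub>1] this[of "- \<alpha>\<^sub>2"] show ?thesis
    by (auto simp: anisotropic_metric_def split_form_def fun_eq_iff split: prod.splits)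
qed

lemma form_norm_split_form:
  "form_norm (split_form a b) \<zeta> = norm (a *\<^sub>R fst \<zeta>, b *\<^sub>R snd \<zeta>)"
  by (simp add: form_norm_def split_form_def norm_Pair power_mult_distrib power2_norm_eq_inner)

lemma split_form_self: "split_form a b \<zeta> \<zeta> = a\<^sup>2 * (norm (fst \<zeta>))\<^sup>2 + b\<^sup>2 * (norm (snd \<zeta>))\<^sup>2"
  by (simp add: split_form_def power2_norm_eq_inner)

lemma euclidean_form_split_form:
  assumes "0 < a" "0 < b"
  shows "euclidean_form (split_form a b :: 'a::euclidean_space \<times> 'a \<Rightarrow> _)"
  unfolding euclidean_form_def
proof (intro conjI allI impI)
  show "linear (split_form a b \<zeta>)" for \<zeta> :: "'a \<times> 'a"
    by (intro linearI) (auto simp: split_form_def inner_add_right algebra_simps)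
  show "split_form a b \<zeta> \<zeta>' = split_form a b \<zeta>' \<zeta>" for \<zeta> \<zeta>' :: "'a \<times> 'a"
    by (simp add: split_form_def inner_commute)
  show "0 < split_form a b \<zeta> \<zeta>" if "\<zeta> \<noteq> 0" for \<zeta> :: "'a \<times> 'a"
  proof -
    have "0 < a\<^sup>2 * (norm (fst \<zeta>))\<^sup>2 \<or> 0 < b\<^sup>2 * (norm (snd \<zeta>))\<^sup>2"
      using that assms by (auto simp: prod_eq_iff)
    then show ?thesis unfolding split_form_self
      by (meson add_nonneg_pos add_pos_nonneg mult_nonneg_nonneg zero_le_power2)
  qed
qed

text \<open>In the coordinates rescaled by a and b, sigma \<zeta> is the inner product with the
  vector u, so Cauchy-Schwarz gives the supremum. Since sigma pairs positions with momenta, the two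
  coefficients are inverted and change places.\<close>

lemma dual_norm_split_form:
  fixes \<zeta> :: "'a::euclidean_space \<times> 'a"
  assumes "0 < a" "0 < b"
  shows "dual_norm (split_form a b) \<zeta> = norm ((1 / b) *\<^sub>R fst \<zeta>, (1 / a) *\<^sub>R snd \<zeta>)"
proof -
  define u where "u = ((1 / a) *\<^sub>R snd \<zeta>, - ((1 / b) *\<^sub>R fst \<zeta>))"
  have sigma: "sigma \<zeta> \<zeta>' = u \<bullet> (a *\<^sub>R fst \<zeta>', b *\<^sub>R snd \<zeta>')" for \<zeta>'
    using assms by (simp add: sigma_def u_def inner_commute)
  have u_norm: "norm u = norm ((1 / b) *\<^sub>R fst \<zeta>, (1 / a) *\<^sub>R snd \<zeta>)"
    by (simp add: u_def norm_Pair add.commute)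
  have pos: "0 < form_norm (split_form a b) \<zeta>'" if "\<zeta>' \<noteq> 0" for \<zeta>' :: "'a \<times> 'a"
  proof -
    have "0 < split_form a b \<zeta>' \<zeta>'"
      using euclidean_form_split_form[OF assms] that unfolding euclidean_form_def by blast
    then show ?thesis by (simp add: form_norm_def)
  qed
  have "dual_norm (split_form a b) \<zeta> = norm u"
    unfolding dual_norm_def
  proof (rule cSup_eq_maximum)
    fix r assume "r \<in> {\<bar>sigma \<zeta> \<zeta>'\<bar> / form_norm (split_form a b) \<zeta>' |\<zeta>'. \<zeta>' \<noteq> 0}"
    then obtain \<zeta>' where r: "r = \<bar>sigma \<zeta> \<zeta>'\<bar> / form_norm (split_form a b) \<zeta>'" and "\<zeta>' \<noteq> 0" by blast
    have "\<bar>sigma \<zeta> \<zeta>'\<bar> \<le> norm u * form_norm (split_form a b) \<zeta>'"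
      unfolding sigma form_norm_split_form by (rule Cauchy_Schwarz_ineq2)
    then show "r \<le> norm u" using pos[OF \<open>\<zeta>' \<noteq> 0\<close>] by (simp add: r pos_divide_le_eq)
  next
    show "norm u \<in> {\<bar>sigma \<zeta> \<zeta>'\<bar> / form_norm (split_form a b) \<zeta>' |\<zeta>'. \<zeta>' \<noteq> 0}"
    proof (cases "\<zeta> = 0")
      case True
      obtain b' :: "'a \<times> 'a" where "b' \<noteq> 0" using nonzero_Basis nonempty_Basis by blast
      moreover have "\<bar>sigma \<zeta> b'\<bar> / form_norm (split_form a b) b' = norm u"
        using True by (simp add: sigma_def u_def)
      ultimately show ?thesis by (smt (verit) mem_Collect_eq)
    next
      case False
      \<comment> \<open>This is the case of equality: the rescaled coordinates of this vector form
        u.\<close>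
      let ?\<zeta>' = "((1 / a\<^sup>2) *\<^sub>R snd \<zeta>, - (1 / b\<^sup>2) *\<^sub>R fst \<zeta>)"
      have eq: "(a *\<^sub>R fst ?\<zeta>', b *\<^sub>R snd ?\<zeta>') = u"
        using assms by (simp add: u_def power2_eq_square)
      have "?\<zeta>' \<noteq> 0" using False assms by (auto simp: prod_eq_iff zero_prod_def)
      moreover have "\<bar>sigma \<zeta> ?\<zeta>'\<bar> / form_norm (split_form a b) ?\<zeta>' = norm u"
        unfolding sigma form_norm_split_form eq
        by (simp add: power2_norm_eq_inner[symmetric] power2_eq_square)
      ultimately show ?thesis by (smt (verit) mem_Collect_eq)
    qed
  qed
  then show ?thesis by (simp add: u_norm)
qed

text \<open>The rescaled vectors defining the norm and the dual norm are proportional with factor a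
  * b, so the quotient is the same for all nonzero vectors.\<close>

lemma gain_split_form:
  fixes g :: "'a::euclidean_space \<times> 'a \<Rightarrow> 'a \<times> 'a \<Rightarrow> 'a \<times> 'a \<Rightarrow> real"
  assumes g: "g \<rho> = split_form a b" and ab: "0 < a" "0 < b"
  shows "gain g \<rho> = a * b"
proof -
  have ratio: "form_norm (g \<rho>) \<zeta> / dual_norm (g \<rho>) \<zeta> = a * b" if "\<zeta> \<noteq> 0" for \<zeta>
  proof -
    have "(a *\<^sub>R fst \<zeta>, b *\<^sub>R snd \<zeta>) = (a * b) *\<^sub>R ((1 / b) *\<^sub>R fst \<zeta>, (1 / a) *\<^sub>R snd \<zeta>)"
      using ab by simp
    then have "form_norm (g \<rho>) \<zeta> = a * b * dual_norm (g \<rho>) \<zeta>"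
      unfolding g form_norm_split_form dual_norm_split_form[OF ab] using ab
      by (simp only: norm_scaleR) simp
    moreover have "dual_norm (g \<rho>) \<zeta> \<noteq> 0"
      using that ab by (auto simp: g dual_norm_split_form prod_eq_iff zero_prod_def)
    ultimately show ?thesis by simp
  qed
  obtain b' :: "'a \<times> 'a" where b': "b' \<noteq> 0" using nonzero_Basis nonempty_Basis by blast
  have "{form_norm (g \<rho>) \<zeta> / dual_norm (g \<rho>) \<zeta> |\<zeta>. \<zeta> \<noteq> 0} = {a * b}"
  proof (rule set_eqI, rule iffI)
    show "r \<in> {a * b}" if "r \<in> {form_norm (g \<rho>) \<zeta> / dual_norm (g \<rho>) \<zeta> |\<zeta>. \<zeta> \<noteq> 0}" for r
      using that ratio by auto
    show "r \<in> {form_norm (g \<rho>) \<zeta> / dual_norm (g \<rho>) \<zeta> |\<zeta>. \<zeta> \<noteq> 0}" if "r \<in> {a * b}" for r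
      using that ratio[OF b', symmetric] b' by (simp only: singleton_iff mem_Collect_eq) blast
  qed
  then show ?thesis by (simp add: gain_def)
qed

text \<open>The exponents lie in [0, 1], so brackets comparable up to M \<ge> 1 have powers
  comparable up to M as well.\<close>

lemma split_form_le:
  assumes "0 \<le> \<alpha>\<^sub>1" "\<alpha>\<^sub>1 \<le> 1" "0 \<le> \<alpha>\<^sub>2" "\<alpha>\<^sub>2 \<le> 1" "0 < J" "0 < J'" "1 \<le> M"
    and "J' \<le> M * J" "J \<le> M * J'"
  shows "split_form (J' powr \<alpha>\<^sub>1) (J' powr - \<alpha>\<^sub>2) \<zeta> \<zeta> \<le> M\<^sup>2 * split_form (J powr \<alpha>\<^sub>1) (J powr - \<alpha>\<^sub>2) \<zeta> \<zeta>"
proof -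
  have M: "M powr \<alpha> \<le> M" if "\<alpha> \<le> 1" for \<alpha>
    using powr_mono[OF that \<open>1 \<le> M\<close>] \<open>1 \<le> M\<close> by simp
  have "J' powr \<alpha>\<^sub>1 \<le> (M * J) powr \<alpha>\<^sub>1" using assms by (intro powr_mono2) auto
  also have "\<dots> = M powr \<alpha>\<^sub>1 * J powr \<alpha>\<^sub>1" by (rule powr_mult)
  also have "\<dots> \<le> M * J powr \<alpha>\<^sub>1" by (intro mult_right_mono M assms) auto
  finally have 1: "(J' powr \<alpha>\<^sub>1)\<^sup>2 \<le> (M * J powr \<alpha>\<^sub>1)\<^sup>2" by (intro power_mono) auto
  have "J powr \<alpha>\<^sub>2 \<le> (M * J') powr \<alpha>\<^sub>2" using assms by (intro powr_mono2) auto
  also have "\<dots> = M powr \<alpha>\<^sub>2 * J' powr \<alpha>\<^sub>2" by (rule powr_mult)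
  also have "\<dots> \<le> M * J' powr \<alpha>\<^sub>2" by (intro mult_right_mono M assms) auto
  finally have "J' powr - \<alpha>\<^sub>2 \<le> M * J powr - \<alpha>\<^sub>2"
    using assms by (simp add: powr_minus field_simps)
  then have 2: "(J' powr - \<alpha>\<^sub>2)\<^sup>2 \<le> (M * J powr - \<alpha>\<^sub>2)\<^sup>2" by (intro power_mono) auto
  have "split_form (J' powr \<alpha>\<^sub>1) (J' powr - \<alpha>\<^sub>2) \<zeta> \<zeta> \<le>
      (M * J powr \<alpha>\<^sub>1)\<^sup>2 * (norm (fst \<zeta>))\<^sup>2 + (M * J powr - \<alpha>\<^sub>2)\<^sup>2 * (norm (snd \<zeta>))\<^sup>2"
    unfolding split_form_self by (intro add_mono mult_right_mono 1 2) auto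
  then show ?thesis by (simp add: split_form_self power_mult_distrib algebra_simps)
qed

text \<open>Each constraint has its place: \<open>\<alpha>\<^sub>1 \<le> \<alpha>\<^sub>2\<close>
  bounds the gain by 1, \<open>\<alpha>\<^sub>2 \<le> 1\<close> gives slow variation,
  \<open>\<alpha>\<^sub>1 < 1\<close> gives temperance, and
  \<open>1 \<le> \<alpha>\<^sub>1 + \<alpha>\<^sub>2\<close> makes a position derivative of the
  symbol no larger than a momentum derivative.\<close>

locale anisotropy =
  fixes \<alpha>\<^sub>1 \<alpha>\<^sub>2 :: real
  assumes \<alpha>: "0 \<le> \<alpha>\<^sub>1" "\<alpha>\<^sub>1 \<le> \<alpha>\<^sub>2" "\<alpha>\<^sub>2 \<le> 1" "1 \<le> \<alpha>\<^sub>1 + \<alpha>\<^sub>2" "\<alpha>\<^sub>1 < 1"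
begin

abbreviation aniso :: "'a::euclidean_space \<times> 'a \<Rightarrow> 'a \<times> 'a \<Rightarrow> 'a \<times> 'a \<Rightarrow> real" where
  "aniso \<equiv> anisotropic_metric \<alpha>\<^sub>1 \<alpha>\<^sub>2"

lemma aniso_powr_pos: "0 < japanese \<xi> powr \<alpha>"
  using japanese_pos[of \<xi>] by simp

lemma gain_aniso: "gain aniso \<rho> = japanese (snd \<rho>) powr (\<alpha>\<^sub>1 - \<alpha>\<^sub>2)"
  by (subst gain_split_form[OF anisotropic_metric_eq aniso_powr_pos aniso_powr_pos])
    (simp add: powr_add[symmetric])

lemma gain_aniso_le_1: "gain aniso \<rho> \<le> 1"
  unfolding gain_aniso using powr_mono[of "\<alpha>\<^sub>1 - \<alpha>\<^sub>2" 0 "japanese (snd \<rho>)"] \<alpha> japanese_ge_1[of "snd \<rho>"]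
  by simp

lemma gain_sup_aniso: "gain_sup (aniso :: 'a::euclidean_space \<times> 'a \<Rightarrow> _) = 1"
  unfolding gain_sup_def
proof (rule cSup_eq_maximum)
  have "gain aniso (0 :: 'a \<times> 'a) = 1" by (simp add: gain_aniso japanese_def)
  then show "1 \<in> range (gain (aniso :: 'a \<times> 'a \<Rightarrow> _))" by (metis rangeI)
qed (use gain_aniso_le_1 in auto)

lemma riemannian_aniso: "riemannian_metric (aniso :: 'a::euclidean_space \<times> 'a \<Rightarrow> _)"
  unfolding riemannian_metric_def
proof (intro conjI allI)
  show "euclidean_form (aniso \<rho>)" for \<rho> :: "'a \<times> 'a"
    unfolding anisotropic_metric_eq by (intro euclidean_form_split_form aniso_powr_pos)
  fix \<zeta> \<zeta>' :: "'a \<times> 'a"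
  have J: "smooth (\<lambda>\<rho>::'a \<times> 'a. japanese (snd \<rho>) powr s)" for s
    using smooth_affine[OF bounded_linear_snd smooth_japanese_powr[of s], of 0] by simp
  have eq: "(\<lambda>\<rho>. aniso \<rho> \<zeta> \<zeta>') = (\<lambda>\<rho>. japanese (snd \<rho>) powr (2 * \<alpha>\<^sub>1) * (fst \<zeta> \<bullet> fst \<zeta>') +
      japanese (snd \<rho>) powr (- 2 * \<alpha>\<^sub>2) * (snd \<zeta> \<bullet> snd \<zeta>'))"
    by (auto simp: anisotropic_metric_def split: prod.splits)
  show "smooth (\<lambda>\<rho>. aniso \<rho> \<zeta> \<zeta>')"
    unfolding eq by (intro smooth_add smooth_bounded_linear[OF bounded_linear_mult_left] J)
qed

lemma aniso_le:
  assumes "1 \<le> M" "japanese (snd \<rho>') \<le> M * japanese (snd \<rho>)" "japanese (snd \<rho>) \<le> M * japanese (snd \<rho>')"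
  shows "aniso \<rho>' \<zeta> \<zeta> \<le> M\<^sup>2 * aniso \<rho> \<zeta> \<zeta>"
  unfolding anisotropic_metric_eq using \<alpha> assms japanese_pos by (intro split_form_le) auto

text \<open>Both conditions reduce to comparing the brackets J and I of the two momenta. On a g-ball
  of radius 1/2 the momenta differ by at most I / 2. For temperance, if the momenta differ by more
  than J / 2, then the dual norm, which weighs momenta by \<open>J powr - \<alpha>\<^sub>1\<close>,
  forces \<open>J powr (1 - \<alpha>\<^sub>1) \<le> 2 * s\<close>; this is the origin of the
  exponent n = 1 / (1 - \<alpha>) with \<alpha> the position exponent.\<close>

lemma admissible_aniso: "admissible (aniso :: 'a::euclidean_space \<times> 'a \<Rightarrow> _)"
proof -
  define n where "n = 1 / (1 - \<alpha>\<^sub>1)"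
  have n: "1 \<le> n" "(1 - \<alpha>\<^sub>1) * n = 1" using \<alpha> by (auto simp: n_def)
  \<comment> \<open>With this choice \<open>(2 * s) powr n\<close> is C times
    \<open>s powr n\<close>; moreover C is at least the factor 2 of slow variation.\<close>
  define C where "C = 2 powr n"
  have C2: "2 \<le> C" unfolding C_def using powr_mono[of 1 n "2::real"] n by simp
  have slow: "aniso \<rho>\<^sub>0 \<zeta> \<zeta> / C\<^sup>2 \<le> aniso \<rho> \<zeta> \<zeta> \<and> aniso \<rho> \<zeta> \<zeta> \<le> C\<^sup>2 * aniso \<rho>\<^sub>0 \<zeta> \<zeta>"
    if *: "form_norm (aniso \<rho>\<^sub>0) (\<rho> - \<rho>\<^sub>0) \<le> 1 / 2" for \<rho> \<rho>\<^sub>0 \<zeta> :: "'a \<times> 'a"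
  proof -
    let ?J = "japanese (snd \<rho>)" and ?I = "japanese (snd \<rho>\<^sub>0)"
    have "?I powr - \<alpha>\<^sub>2 * norm (snd \<rho> - snd \<rho>\<^sub>0) \<le> 1 / 2"
      using * norm_snd_le[of "?I powr - \<alpha>\<^sub>2 *\<^sub>R snd (\<rho> - \<rho>\<^sub>0)" "?I powr \<alpha>\<^sub>1 *\<^sub>R fst (\<rho> - \<rho>\<^sub>0)"]
      unfolding anisotropic_metric_eq form_norm_split_form by simp
    then have "norm (snd \<rho> - snd \<rho>\<^sub>0) \<le> ?I powr \<alpha>\<^sub>2 / 2"
      using aniso_powr_pos[of "snd \<rho>\<^sub>0" \<alpha>\<^sub>2] by (simp add: powr_minus field_simps)
    also have "\<dots> \<le> ?I / 2"
      using powr_mono[of \<alpha>\<^sub>2 1 ?I] \<alpha> japanese_ge_1[of "snd \<rho>\<^sub>0"] by simp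
    finally have d: "norm (snd \<rho> - snd \<rho>\<^sub>0) \<le> ?I / 2" .
    have "?J \<le> 2 * ?I"
      using japanese_triangle[of "snd \<rho>" "snd \<rho>\<^sub>0"] d japanese_pos[of "snd \<rho>\<^sub>0"] by linarith
    moreover have "?I \<le> 2 * ?J"
      using japanese_triangle[of "snd \<rho>\<^sub>0" "snd \<rho>"] d japanese_pos[of "snd \<rho>\<^sub>0"]
      by (simp add: norm_minus_commute)
    ultimately have J: "?J \<le> C * ?I" "?I \<le> C * ?J"
      using C2 mult_right_mono[OF C2] japanese_pos by (smt (verit) less_imp_le)+
    have "1 \<le> C" using C2 by simp
    from aniso_le[OF this J] aniso_le[OF this J(2,1)]
    have "aniso \<rho> \<zeta> \<zeta> \<le> C\<^sup>2 * aniso \<rho>\<^sub>0 \<zeta> \<zeta>" "aniso \<rho>\<^sub>0 \<zeta> \<zeta> \<le> C\<^sup>2 * aniso \<rho> \<zeta> \<zeta>" .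
    then show ?thesis using C2 by (simp add: pos_divide_le_eq mult.commute)
  qed
  have temperate: "aniso \<rho> \<zeta> \<zeta> \<le> C\<^sup>2 * aniso \<rho>\<^sub>0 \<zeta> \<zeta> *
      sqrt (1 + (dual_norm (aniso \<rho>) (\<rho> - \<rho>\<^sub>0))\<^sup>2) powr (2 * n)" for \<rho> \<rho>\<^sub>0 \<zeta> :: "'a \<times> 'a"
  proof -
    let ?J = "japanese (snd \<rho>)" and ?I = "japanese (snd \<rho>\<^sub>0)" and ?d = "norm (snd \<rho> - snd \<rho>\<^sub>0)"
    define s where "s = sqrt (1 + (dual_norm (aniso \<rho>) (\<rho> - \<rho>\<^sub>0))\<^sup>2)"
    have s1: "1 \<le> s" by (simp add: s_def)
    have "?d / ?J powr \<alpha>\<^sub>1 \<le> dual_norm (aniso \<rho>) (\<rho> - \<rho>\<^sub>0)"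
      unfolding anisotropic_metric_eq dual_norm_split_form[OF aniso_powr_pos aniso_powr_pos]
      using norm_snd_le[of "(1 / ?J powr \<alpha>\<^sub>1) *\<^sub>R snd (\<rho> - \<rho>\<^sub>0)"] by simp
    also have "\<dots> \<le> s" unfolding s_def by (intro real_le_rsqrt) simp
    finally have d: "?d \<le> ?J powr \<alpha>\<^sub>1 * s"
      using aniso_powr_pos[of "snd \<rho>" \<alpha>\<^sub>1] by (simp add: pos_divide_le_eq mult.commute)
    define M where "M = (2 * s) powr n"
    have M: "2 * s \<le> M" unfolding M_def using powr_mono[of 1 n "2 * s"] n s1 by simp
    have J0: "?I \<le> M * ?J"
    proof -
      have "?J powr \<alpha>\<^sub>1 \<le> ?J"
        using powr_mono[of \<alpha>\<^sub>1 1 ?J] \<alpha> japanese_ge_1[of "snd \<rho>"] by simp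
      then have "?d \<le> ?J * s" using d s1 by (smt (verit) mult_right_mono)
      then have "?I \<le> ?J * 1 + ?J * s"
        using japanese_triangle[of "snd \<rho>\<^sub>0" "snd \<rho>"] by (simp add: norm_minus_commute)
      also have "\<dots> \<le> ?J * s + ?J * s" using s1 japanese_pos[of "snd \<rho>"] by simp
      also have "\<dots> = (2 * s) * ?J" by simp
      also have "\<dots> \<le> M * ?J" using M japanese_pos[of "snd \<rho>"] by (intro mult_right_mono) auto
      finally show ?thesis .
    qed
    have J: "?J \<le> M * ?I"
    proof (cases "?d \<le> ?J / 2")
      case True
      then have "?J \<le> 2 * ?I" using japanese_triangle[of "snd \<rho>" "snd \<rho>\<^sub>0"] by linarith
      also have "\<dots> \<le> M * ?I"
        using M s1 japanese_pos[of "snd \<rho>\<^sub>0"] by (intro mult_right_mono) auto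
      finally show ?thesis .
    next
      case False
      then have "?J \<le> ?J powr \<alpha>\<^sub>1 * (2 * s)" using d by simp
      then have "?J powr 1 * ?J powr - \<alpha>\<^sub>1 \<le> 2 * s"
        using aniso_powr_pos[of "snd \<rho>" \<alpha>\<^sub>1] japanese_pos[of "snd \<rho>"]
        by (simp add: powr_minus field_simps)
      then have "?J powr (1 - \<alpha>\<^sub>1) \<le> 2 * s"
        unfolding powr_add[symmetric] by simp
      then have "(?J powr (1 - \<alpha>\<^sub>1)) powr n \<le> (2 * s) powr n" using n by (intro powr_mono2) auto
      then have "?J \<le> M" using n japanese_pos[of "snd \<rho>"] by (simp add: powr_powr M_def)
      also have "M * 1 \<le> M * ?I"
        using M s1 japanese_ge_1[of "snd \<rho>\<^sub>0"] by (intro mult_left_mono) auto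
      finally show ?thesis by simp
    qed
    have "aniso \<rho> \<zeta> \<zeta> \<le> M\<^sup>2 * aniso \<rho>\<^sub>0 \<zeta> \<zeta>"
      using M s1 J J0 by (intro aniso_le) auto
    also have "M\<^sup>2 = C\<^sup>2 * s powr (2 * n)"
      using s1 by (simp add: M_def C_def powr_mult power_mult_distrib)
        (simp add: power2_eq_square powr_add[symmetric])
    finally show ?thesis by (simp add: s_def mult_ac)
  qed
  show ?thesis
    unfolding admissible_def
  proof (intro conjI riemannian_aniso allI gain_aniso_le_1)
    show "\<exists>r>0. \<exists>C>0. \<exists>N>0::real.
        (\<forall>\<rho>\<^sub>0 \<rho>::'a \<times> 'a. form_norm (aniso \<rho>\<^sub>0) (\<rho> - \<rho>\<^sub>0) \<le> r \<longrightarrow>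
           (\<forall>\<zeta>. aniso \<rho>\<^sub>0 \<zeta> \<zeta> / C\<^sup>2 \<le> aniso \<rho> \<zeta> \<zeta> \<and> aniso \<rho> \<zeta> \<zeta> \<le> C\<^sup>2 * aniso \<rho>\<^sub>0 \<zeta> \<zeta>)) \<and>
        (\<forall>(\<rho>\<^sub>0::'a \<times> 'a) \<rho> \<zeta>. aniso \<rho> \<zeta> \<zeta> \<le> C\<^sup>2 * aniso \<rho>\<^sub>0 \<zeta> \<zeta> *
           sqrt (1 + (dual_norm (aniso \<rho>) (\<rho> - \<rho>\<^sub>0))\<^sup>2) powr (2 * N))"
      using slow temperate C2 n by (intro exI[of _ "1/2"] conjI exI[of _ C] exI[of _ n]) auto
  qed
qed

end

section \<open>Linear Hamiltonians and their flow\<close>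

definition linear_symbol :: "('a::euclidean_space \<Rightarrow> 'a) \<Rightarrow> 'a \<times> 'a \<Rightarrow> real" where
  "linear_symbol Y \<rho> = snd \<rho> \<bullet> Y (fst \<rho>)"

lemma iter_ddir_fst:
  assumes "smooth f"
  shows "smooth (\<lambda>\<rho>. f (fst \<rho>))" "iter_ddir vs (\<lambda>\<rho>. f (fst \<rho>)) = (\<lambda>\<rho>. iter_ddir (map fst vs) f (fst \<rho>))"
  using smooth_affine[OF bounded_linear_fst assms, of 0] iter_ddir_affine[OF bounded_linear_fst assms, of vs 0]
  by simp_all

lemma smooth_linear_symbol: "smooth Y \<Longrightarrow> smooth (linear_symbol Y)"
  unfolding linear_symbol_def
  by (rule smooth_bilinear[OF bounded_bilinear_inner smooth_linear[OF bounded_linear_snd] iter_ddir_fst(1)])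

lemma ddir_linear_symbol:
  assumes "smooth Y"
  shows "ddir v (linear_symbol Y) = (\<lambda>\<rho>. snd v \<bullet> Y (fst \<rho>) + linear_symbol (ddir (fst v) Y) \<rho>)"
proof
  fix \<rho>
  have 1: "ddir v snd \<rho> = snd v" for \<rho> :: "'a \<times> 'a"
    by (rule ddir_eqI) (rule bounded_linear_imp_has_derivative[OF bounded_linear_snd])
  have 2: "ddir v (\<lambda>\<rho>. Y (fst \<rho>)) \<rho> = ddir (fst v) Y (fst \<rho>)"
    using fun_cong[OF iter_ddir_fst(2)[OF assms, of "[v]"], of \<rho>] by simp
  show "ddir v (linear_symbol Y) \<rho> = snd v \<bullet> Y (fst \<rho>) + linear_symbol (ddir (fst v) Y) \<rho>"
    unfolding linear_symbol_def
    by (subst ddir_bilinear(2)[OF bounded_bilinear_inner bounded_linear_imp_differentiable[OF bounded_linear_snd]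
        smooth_differentiable[OF iter_ddir_fst(1)[OF assms]]])
      (simp add: 1 2)
qed

text \<open>In \<open>c\<close> below, k stands for the number of derivatives of Y, each along a vector of
  length at most a.\<close>

lemma iter_ddir_linear_symbol_bound:
  fixes a b :: real and c :: "nat \<Rightarrow> real"
  assumes "smooth Y"
    and c: "\<And>ys. \<forall>y\<in>set ys. norm y \<le> a \<Longrightarrow> norm (iter_ddir ys Y x) \<le> c (length ys)"
    and \<zeta>: "\<forall>\<zeta>\<in>set \<zeta>s. norm (fst \<zeta>) \<le> a \<and> norm (snd \<zeta>) \<le> b"
  shows "norm (iter_ddir \<zeta>s (linear_symbol Y) (x, \<xi>)) \<le>
    norm \<xi> * c (length \<zeta>s) + length \<zeta>s * (b * c (length \<zeta>s - 1))"
  using assms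
proof (induction \<zeta>s arbitrary: Y c)
  case Nil
  have "\<bar>\<xi> \<bullet> Y x\<bar> \<le> norm \<xi> * norm (Y x)" by (rule Cauchy_Schwarz_ineq2)
  also have "\<dots> \<le> norm \<xi> * c 0" using Nil(2)[of "[]"] by (intro mult_left_mono) auto
  finally show ?case by (simp add: linear_symbol_def)
next
  case (Cons \<zeta> \<zeta>s)
  have Y': "smooth (ddir (fst \<zeta>) Y)" by (intro smooth_ddir Cons.prems)
  have inner: "smooth (\<lambda>\<rho>::'a \<times> 'a. snd \<zeta> \<bullet> Y (fst \<rho>))"
    by (intro smooth_bounded_linear[OF bounded_linear_inner_right] iter_ddir_fst(1) Cons.prems)
  \<comment> \<open>The first derivative falls either on the momentum, leaving a function of the
    position alone, or on Y, leaving a linear symbol for the derivative of Y, to which the induction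
    hypothesis applies.\<close>
  have "iter_ddir (\<zeta> # \<zeta>s) (linear_symbol Y) (x, \<xi>) =
      snd \<zeta> \<bullet> iter_ddir (map fst \<zeta>s) Y x + iter_ddir \<zeta>s (linear_symbol (ddir (fst \<zeta>) Y)) (x, \<xi>)"
    using Cons.prems
    by (simp add: ddir_linear_symbol iter_ddir_add[OF inner smooth_linear_symbol[OF Y']]
        iter_ddir_bounded_linear[OF bounded_linear_inner_right iter_ddir_fst(1)] iter_ddir_fst(2))
  moreover have "norm (snd \<zeta> \<bullet> iter_ddir (map fst \<zeta>s) Y x) \<le> b * c (length \<zeta>s)"
  proof -
    have "norm (snd \<zeta> \<bullet> iter_ddir (map fst \<zeta>s) Y x) \<le> norm (snd \<zeta>) * norm (iter_ddir (map fst \<zeta>s) Y x)"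
      by (simp add: Cauchy_Schwarz_ineq2)
    also have "\<dots> \<le> b * c (length \<zeta>s)"
    proof (rule mult_mono)
      show b: "norm (snd \<zeta>) \<le> b" using Cons.prems(3) by simp
      show "0 \<le> b" by (rule order_trans[OF norm_ge_zero b])
      show "norm (iter_ddir (map fst \<zeta>s) Y x) \<le> c (length \<zeta>s)"
        using Cons.prems(2)[of "map fst \<zeta>s"] Cons.prems(3) by simp
    qed simp
    finally show ?thesis .
  qed
  moreover have "norm (iter_ddir \<zeta>s (linear_symbol (ddir (fst \<zeta>) Y)) (x, \<xi>)) \<le>
      norm \<xi> * c (Suc (length \<zeta>s)) + length \<zeta>s * (b * c (Suc (length \<zeta>s - 1)))"
  proof (rule Cons.IH[OF Y', of "\<lambda>k. c (Suc k)"])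
    show "norm (iter_ddir ys (ddir (fst \<zeta>) Y) x) \<le> c (Suc (length ys))" if "\<forall>y\<in>set ys. norm y \<le> a" for ys
      using Cons.prems(2)[of "fst \<zeta> # ys"] Cons.prems(3) that by simp
  qed (use Cons.prems in auto)
  \<comment> \<open>For the empty list the factor \<open>length \<zeta>s\<close> is 0, so the
    truncated subtraction does no harm.\<close>
  moreover have "length \<zeta>s * (b * c (Suc (length \<zeta>s - 1))) = length \<zeta>s * (b * c (length \<zeta>s))"
    by (cases \<zeta>s) auto
  ultimately have "norm (iter_ddir (\<zeta> # \<zeta>s) (linear_symbol Y) (x, \<xi>)) \<le>
      b * c (length \<zeta>s) + (norm \<xi> * c (Suc (length \<zeta>s)) + length \<zeta>s * (b * c (length \<zeta>s)))"
    by (metis norm_triangle_le add_mono)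
  then show ?case by (simp add: algebra_simps)
qed

text \<open>Position and momentum extents a and b stay separate because the unit balls of the metric
  have different sizes in the two directions.\<close>

lemma tame_linear_symbol_bound:
  fixes Y :: "'a::euclidean_space \<Rightarrow> 'a"
  assumes Y: "tame {\<lambda>x. 1} Y"
  shows "\<exists>C\<ge>0. \<forall>\<zeta>s x \<xi> a b. length \<zeta>s = Suc k \<and> 0 < a \<and> 0 \<le> b \<and>
      (\<forall>\<zeta>\<in>set \<zeta>s. norm (fst \<zeta>) \<le> a \<and> norm (snd \<zeta>) \<le> b) \<longrightarrow>
    norm (iter_ddir \<zeta>s (linear_symbol Y) (x, \<xi>)) \<le> C * (norm \<xi> * a ^ Suc k + b * a ^ k)"
proof -
  have "\<exists>C\<ge>0. \<forall>vs x r. length vs = j \<and> 0 < r \<and> (\<forall>v\<in>set vs. norm v \<le> r) \<longrightarrow>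
      norm (iter_ddir vs Y x) \<le> C * r ^ j" for j
    using tame_uniform_norm[OF Y, of "\<lambda>x. 1" j] by simp
  then obtain A where A0: "\<And>j. 0 \<le> A j" and A: "\<And>vs x r. 0 < r \<Longrightarrow> \<forall>v\<in>set vs. norm v \<le> r \<Longrightarrow>
      norm (iter_ddir vs Y x) \<le> A (length vs) * r ^ length vs"
    by metis
  \<comment> \<open>The first summand counts the term with all derivatives on Y, the second the Suc
    k choices of a direction that falls on the momentum.\<close>
  define C where "C = A (Suc k) + Suc k * A k"
  have "norm (iter_ddir \<zeta>s (linear_symbol Y) (x, \<xi>)) \<le> C * (norm \<xi> * a ^ Suc k + b * a ^ k)"
    if *: "length \<zeta>s = Suc k" "0 < a" "0 \<le> b" "\<forall>\<zeta>\<in>set \<zeta>s. norm (fst \<zeta>) \<le> a \<and> norm (snd \<zeta>) \<le> b"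
    for \<zeta>s x \<xi> a b
  proof -
    have "norm (iter_ddir \<zeta>s (linear_symbol Y) (x, \<xi>)) \<le>
        norm \<xi> * (A (Suc k) * a ^ Suc k) + Suc k * (b * (A k * a ^ k))"
      using iter_ddir_linear_symbol_bound[OF tame_smooth[OF Y] A[OF *(2)] *(4), of x \<xi>] *(1) by simp
    also have "\<dots> \<le> C * (norm \<xi> * a ^ Suc k) + C * (b * a ^ k)"
    proof (rule add_mono)
      have "A (Suc k) * (norm \<xi> * a ^ Suc k) \<le> C * (norm \<xi> * a ^ Suc k)"
        using * A0 by (intro mult_right_mono) (auto simp: C_def)
      then show "norm \<xi> * (A (Suc k) * a ^ Suc k) \<le> C * (norm \<xi> * a ^ Suc k)" by (simp add: mult_ac)
      have "(Suc k * A k) * (b * a ^ k) \<le> C * (b * a ^ k)"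
        using * A0 by (intro mult_right_mono) (auto simp: C_def)
      then show "Suc k * (b * (A k * a ^ k)) \<le> C * (b * a ^ k)" by (simp add: mult_ac)
    qed
    finally show ?thesis by (simp add: algebra_simps)
  qed
  moreover have "0 \<le> C" unfolding C_def using A0 by (intro add_nonneg_nonneg mult_nonneg_nonneg) auto
  ultimately show ?thesis by blast
qed

text \<open>This is minus the transpose of the derivative of X at the position, applied to the
  momentum.\<close>

definition cotangent_force :: "('a::euclidean_space \<Rightarrow> 'a) \<Rightarrow> 'a \<times> 'a \<Rightarrow> 'a" where
  "cotangent_force X \<rho> = (\<Sum>b\<in>Basis. linear_symbol (ddir b X) \<rho> *\<^sub>R (- b))"

definition cotangent_field :: "('a::euclidean_space \<Rightarrow> 'a) \<Rightarrow> 'a \<times> 'a \<Rightarrow> 'a \<times> 'a" where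
  "cotangent_field X \<rho> = (X (fst \<rho>), cotangent_force X \<rho>)"

text \<open>Pairing with momentum directions determines the position component and conversely, so
  sigma is nondegenerate and the definite description has a unique solution.\<close>

lemma hamiltonian_field_linear_symbol:
  assumes X: "smooth X"
  shows "hamiltonian_field (linear_symbol X) \<rho> = cotangent_field X \<rho>"
  unfolding hamiltonian_field_def
proof (rule the_equality)
  have "sigma (cotangent_field X \<rho>) Y = - ddir Y (linear_symbol X) \<rho>" for Y
  proof -
    have "linear_symbol (ddir (fst Y) X) \<rho> = (\<Sum>b\<in>Basis. (fst Y \<bullet> b) * linear_symbol (ddir b X) \<rho>)"
      unfolding linear_symbol_def ddir_expand[OF smooth_differentiable[OF X], of "fst Y"]
      by (simp add: inner_sum_right)
    then show ?thesis
      by (simp add: sigma_def cotangent_field_def cotangent_force_def ddir_linear_symbol[OF X]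
          inner_sum_left inner_sum_right sum_negf inner_commute mult.commute)
  qed
  then show *: "\<forall>Y. sigma (cotangent_field X \<rho>) Y = - frechet_derivative (linear_symbol X) (at \<rho>) Y"
    by (simp add: ddir_def)
  fix H assume "\<forall>Y. sigma H Y = - frechet_derivative (linear_symbol X) (at \<rho>) Y"
  then have eq: "sigma H Y = sigma (cotangent_field X \<rho>) Y" for Y using * by metis
  have "(fst H - fst (cotangent_field X \<rho>)) \<bullet> y = 0" for y
    using eq[of "(0, y)"] by (simp add: sigma_def inner_diff_left inner_diff_right inner_commute)
  moreover have "(snd H - snd (cotangent_field X \<rho>)) \<bullet> y = 0" for y
    using eq[of "(y, 0)"] by (simp add: sigma_def inner_diff_left)
  ultimately show "H = cotangent_field X \<rho>"
    by (metis inner_eq_zero_iff eq_iff_diff_eq_0 prod_eq_iff)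
qed

lemma hamiltonian_flow_linear_symbol:
  assumes "smooth X"
  shows "hamiltonian_flow (linear_symbol X) \<Phi> \<longleftrightarrow>
    (\<forall>\<rho>. \<Phi> 0 \<rho> = \<rho> \<and> (\<forall>t. ((\<lambda>t. \<Phi> t \<rho>) has_vector_derivative cotangent_field X (\<Phi> t \<rho>)) (at t)))"
  unfolding hamiltonian_flow_def hamiltonian_field_linear_symbol[OF assms] ..

lemma iter_ddir_sum:
  assumes "\<And>i. i \<in> I \<Longrightarrow> smooth (f i)"
  shows "iter_ddir vs (\<lambda>x. \<Sum>i\<in>I. f i x) = (\<lambda>x. \<Sum>i\<in>I. iter_ddir vs (f i) x)"
  using assms
proof (induction I rule: infinite_finite_induct)
  case (insert i I)
  then show ?case by (simp add: iter_ddir_add smooth_sum)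
qed (cases "vs = []"; simp add: iter_ddir_const)+

lemma cotangent_field_derivatives:
  assumes X: "smooth X"
  shows "smooth (cotangent_field X)"
    "iter_ddir vs (cotangent_field X) \<rho> =
      (iter_ddir (map fst vs) X (fst \<rho>), \<Sum>b\<in>Basis. iter_ddir vs (linear_symbol (ddir b X)) \<rho> *\<^sub>R (- b))"
proof -
  let ?F = "\<lambda>b \<rho>. linear_symbol (ddir b X) \<rho> *\<^sub>R (- b)"
  have P: "bounded_linear (\<lambda>x::'a. (x, 0::'a))" "bounded_linear (\<lambda>x::'a. (0::'a, x))"
    by (intro bounded_linear_Pair bounded_linear_ident bounded_linear_zero)+
  have F: "smooth (?F b)" for b
    by (intro smooth_bounded_linear[OF bounded_linear_scaleR_left] smooth_linear_symbol smooth_ddir X)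
  then have F': "smooth (cotangent_force X)"
    unfolding cotangent_force_def by (intro smooth_sum)
  have eq: "cotangent_field X = (\<lambda>\<rho>. (X (fst \<rho>), 0) + (0, cotangent_force X \<rho>))"
    by (auto simp: cotangent_field_def)
  have s: "smooth (\<lambda>\<rho>. (X (fst \<rho>), 0::'a))" "smooth (\<lambda>\<rho>. (0::'a, cotangent_force X \<rho>))"
    by (intro smooth_bounded_linear[OF P(1)] smooth_bounded_linear[OF P(2)] iter_ddir_fst(1) X F')+
  show "smooth (cotangent_field X)" unfolding eq by (intro smooth_add s)
  have "iter_ddir vs (cotangent_force X) \<rho> =
      (\<Sum>b\<in>Basis. iter_ddir vs (linear_symbol (ddir b X)) \<rho> *\<^sub>R (- b))"
    unfolding cotangent_force_def iter_ddir_sum[OF F]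
    by (simp only: iter_ddir_bounded_linear[OF bounded_linear_scaleR_left smooth_linear_symbol[OF smooth_ddir[OF X]]])
  then show "iter_ddir vs (cotangent_field X) \<rho> =
      (iter_ddir (map fst vs) X (fst \<rho>), \<Sum>b\<in>Basis. iter_ddir vs (linear_symbol (ddir b X)) \<rho> *\<^sub>R (- b))"
    unfolding eq iter_ddir_add[OF s] iter_ddir_bounded_linear[OF P(1) iter_ddir_fst(1)[OF X]]
      iter_ddir_bounded_linear[OF P(2) F'] iter_ddir_fst(2)[OF X]
    by simp
qed

section \<open>Existence, growth and differentiability of the cotangent flow\<close>

context
  fixes X :: "'a::euclidean_space \<Rightarrow> 'a"
  assumes X: "tame {\<lambda>x. 1} X"
begin

lemma X_smooth: "smooth X"
  by (rule tame_smooth[OF X])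

text \<open>The position component of the field does not involve the momentum, while the momentum
  component is linear in it; only the second bound therefore depends on \<xi>.\<close>

lemma cotangent_field_bound:
  "\<exists>C\<ge>0. \<forall>\<zeta>s x \<xi> a b. length \<zeta>s = Suc k \<and> 0 < a \<and> 0 \<le> b \<and>
      (\<forall>\<zeta>\<in>set \<zeta>s. norm (fst \<zeta>) \<le> a \<and> norm (snd \<zeta>) \<le> b) \<longrightarrow>
    norm (fst (iter_ddir \<zeta>s (cotangent_field X) (x, \<xi>))) \<le> C * a ^ Suc k \<and>
    norm (snd (iter_ddir \<zeta>s (cotangent_field X) (x, \<xi>))) \<le> C * (norm \<xi> * a ^ Suc k + b * a ^ k)"
proof -
  obtain A where A: "0 \<le> A" "\<And>vs x r. length vs = Suc k \<Longrightarrow> 0 < r \<Longrightarrow> \<forall>v\<in>set vs. norm v \<le> r \<Longrightarrow>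
      norm (iter_ddir vs X x) \<le> A * r ^ Suc k"
    using tame_uniform_norm[OF X, of "\<lambda>x. 1" "Suc k"] by auto
  obtain B where B0: "\<And>b'. 0 \<le> B b'" and B: "\<And>b' \<zeta>s x \<xi> a b. length \<zeta>s = Suc k \<Longrightarrow> 0 < a \<Longrightarrow> 0 \<le> b \<Longrightarrow>
      \<forall>\<zeta>\<in>set \<zeta>s. norm (fst \<zeta>) \<le> a \<and> norm (snd \<zeta>) \<le> b \<Longrightarrow>
      norm (iter_ddir \<zeta>s (linear_symbol (ddir b' X)) (x, \<xi>)) \<le> B b' * (norm \<xi> * a ^ Suc k + b * a ^ k)"
    using tame_linear_symbol_bound[OF tame_ddir[OF X], of k] by metis
  define C where "C = A + sum B Basis"
  have sB: "0 \<le> sum B Basis" by (intro sum_nonneg B0)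
  have "norm (fst (iter_ddir \<zeta>s (cotangent_field X) (x, \<xi>))) \<le> C * a ^ Suc k \<and>
    norm (snd (iter_ddir \<zeta>s (cotangent_field X) (x, \<xi>))) \<le> C * (norm \<xi> * a ^ Suc k + b * a ^ k)"
    if *: "length \<zeta>s = Suc k" "0 < a" "0 \<le> b" "\<forall>\<zeta>\<in>set \<zeta>s. norm (fst \<zeta>) \<le> a \<and> norm (snd \<zeta>) \<le> b"
    for \<zeta>s x \<xi> a b
  proof
    have "norm (iter_ddir (map fst \<zeta>s) X x) \<le> A * a ^ Suc k" using * by (intro A) auto
    also have "\<dots> \<le> C * a ^ Suc k" using * sB by (intro mult_right_mono) (auto simp: C_def)
    finally show "norm (fst (iter_ddir \<zeta>s (cotangent_field X) (x, \<xi>))) \<le> C * a ^ Suc k"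
      by (simp add: cotangent_field_derivatives(2)[OF X_smooth])
    have "norm (snd (iter_ddir \<zeta>s (cotangent_field X) (x, \<xi>))) \<le>
        (\<Sum>b'\<in>Basis. B b' * (norm \<xi> * a ^ Suc k + b * a ^ k))"
      unfolding cotangent_field_derivatives(2)[OF X_smooth] snd_conv
      by (rule sum_norm_le) (use B[OF *] in simp)
    also have "\<dots> \<le> C * (norm \<xi> * a ^ Suc k + b * a ^ k)"
      unfolding sum_distrib_right[symmetric] using A * by (intro mult_right_mono) (auto simp: C_def)
    finally show "norm (snd (iter_ddir \<zeta>s (cotangent_field X) (x, \<xi>))) \<le> C * (norm \<xi> * a ^ Suc k + b * a ^ k)" .
  qed
  moreover have "0 \<le> C" using A sB by (simp add: C_def)
  ultimately show ?thesis by blast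
qed

lemma cotangent_force_bound: "\<exists>K\<ge>0. \<forall>x \<xi>. norm (cotangent_force X (x, \<xi>)) \<le> K * norm \<xi>"
proof -
  have "\<exists>C\<ge>0. \<forall>x. norm (ddir b X x) \<le> C" for b
  proof -
    obtain C where "\<forall>x. norm (ddir b X x) * 1 \<le> C"
      using tame_bounded[OF tame_ddir[OF X], of "\<lambda>x. 1" b] by auto
    then show ?thesis using order_trans[OF norm_ge_zero] by (intro exI[of _ C]) auto
  qed
  then obtain C where C: "\<And>b. 0 \<le> C b" "\<And>b x. norm (ddir b X x) \<le> C b" by metis
  have "norm (cotangent_force X (x, \<xi>)) \<le> (\<Sum>b\<in>Basis. norm \<xi> * C b)" for x \<xi>
    unfolding cotangent_force_def
  proof (rule sum_norm_le)
    fix b :: 'a assume "b \<in> Basis"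
    then have "norm (linear_symbol (ddir b X) (x, \<xi>) *\<^sub>R (- b)) = \<bar>\<xi> \<bullet> ddir b X x\<bar>"
      by (simp add: linear_symbol_def)
    also have "\<dots> \<le> norm \<xi> * norm (ddir b X x)" by (rule Cauchy_Schwarz_ineq2)
    also have "\<dots> \<le> norm \<xi> * C b" by (intro mult_left_mono C) simp
    finally show "norm (linear_symbol (ddir b X) (x, \<xi>) *\<^sub>R (- b)) \<le> norm \<xi> * C b" .
  qed
  then show ?thesis
    by (intro exI[of _ "sum C Basis"]) (auto intro: sum_nonneg C simp: sum_distrib_left mult.commute)
qed

lemma X_lipschitz: "\<exists>L. \<forall>x y. norm (X x - X y) \<le> L * norm (x - y)"
proof -
  obtain A where A: "0 \<le> A" "\<And>vs x r. length vs = 1 \<Longrightarrow> 0 < r \<Longrightarrow> \<forall>v\<in>set vs. norm v \<le> r \<Longrightarrow>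
      norm (iter_ddir vs X x) \<le> A * r"
    using tame_uniform_norm[OF X, of "\<lambda>x. 1" 1] by auto
  have "norm (ddir v X x) \<le> A * norm v" for v x
  proof (cases "v = 0")
    case True
    then show ?thesis using ddir_vec(2)[OF smooth_differentiable[OF X_smooth], of 0 v x] by simp
  next
    case False
    then show ?thesis using A(2)[of "[v]" "norm v" x] by simp
  qed
  then show ?thesis
    using lipschitz_if_ddir_bounded[OF X_smooth convex_UNIV] by blast
qed

text \<open>The field is triangular: the position solves an autonomous Lipschitz equation, and along
  that solution the momentum equation is linear with bounded coefficients.
  \<open>picard_global\<close> applies to each in turn, although it does not apply to the whole
  field.\<close>

lemma cotangent_flow_exists:
  "\<exists>\<Phi>. \<forall>\<rho>. \<Phi> 0 \<rho> = \<rho> \<and> (\<forall>t. ((\<lambda>t. \<Phi> t \<rho>) has_vector_derivative cotangent_field X (\<Phi> t \<rho>)) (at t))"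
proof -
  have "\<exists>\<gamma>. \<gamma> 0 = \<rho> \<and> (\<forall>t. (\<gamma> has_vector_derivative cotangent_field X (\<gamma> t)) (at t))" for \<rho>
  proof -
    have "\<exists>x. x 0 = fst \<rho> \<and> (\<forall>t. (x has_vector_derivative X (x t)) (at t))"
    proof (rule picard_global)
      show "continuous_on UNIV (\<lambda>(t::real, z). X z)"
        unfolding case_prod_unfold
        by (intro continuous_on_compose2[OF smooth_continuous[OF X_smooth]] continuous_intros) auto
    qed (use X_lipschitz in blast)
    then obtain x where x: "x 0 = fst \<rho>" "\<And>t. (x has_vector_derivative X (x t)) (at t)" by blast
    then have x_cont: "continuous_on UNIV x"
      by (meson continuous_at_imp_continuous_on has_vector_derivative_continuous)
    obtain K where K: "\<And>x \<xi>. norm (cotangent_force X (x, \<xi>)) \<le> K * norm \<xi>"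
      using cotangent_force_bound by blast
    have "cotangent_force X (x t, \<eta>) - cotangent_force X (x t, \<eta>') = cotangent_force X (x t, \<eta> - \<eta>')" for t \<eta> \<eta>'
      by (simp add: cotangent_force_def linear_symbol_def inner_diff_left algebra_simps sum_subtractf[symmetric])
    then have lip: "norm (cotangent_force X (x t, \<eta>) - cotangent_force X (x t, \<eta>')) \<le> K * norm (\<eta> - \<eta>')" for t \<eta> \<eta>'
      using K by simp
    have "\<exists>\<xi>. \<xi> 0 = snd \<rho> \<and> (\<forall>t. (\<xi> has_vector_derivative cotangent_force X (x t, \<xi> t)) (at t))"
    proof (rule picard_global)
      show "continuous_on UNIV (\<lambda>(t, z). cotangent_force X (x t, z))"
        unfolding case_prod_unfold cotangent_force_def linear_symbol_def fst_conv snd_conv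
        by (intro continuous_intros continuous_on_compose2[OF smooth_continuous[OF smooth_ddir[OF X_smooth]]]
            continuous_on_compose2[OF x_cont]) auto
    qed (use lip in blast)
    then obtain \<xi> where \<xi>: "\<xi> 0 = snd \<rho>" "\<And>t. (\<xi> has_vector_derivative cotangent_force X (x t, \<xi> t)) (at t)"
      by blast
    show ?thesis
      using x \<xi> by (intro exI[of _ "\<lambda>t. (x t, \<xi> t)"])
        (auto simp: cotangent_field_def intro: has_vector_derivative_Pair)
  qed
  then obtain \<gamma> where "\<And>\<rho>. \<gamma> \<rho> 0 = \<rho> \<and> (\<forall>t. (\<gamma> \<rho> has_vector_derivative cotangent_field X (\<gamma> \<rho> t)) (at t))"
    by metis
  then show ?thesis by (intro exI[of _ "\<lambda>t \<rho>. \<gamma> \<rho> t"]) auto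
qed

context
  fixes \<Phi> :: "real \<Rightarrow> 'a \<times> 'a \<Rightarrow> 'a \<times> 'a"
  assumes \<Phi>0: "\<And>\<rho>. \<Phi> 0 \<rho> = \<rho>"
    and \<Phi>: "\<And>t \<rho>. ((\<lambda>t. \<Phi> t \<rho>) has_vector_derivative cotangent_field X (\<Phi> t \<rho>)) (at t)"
begin

lemma snd_flow: "((\<lambda>t. snd (\<Phi> t \<rho>)) has_vector_derivative cotangent_force X (\<Phi> t \<rho>)) (at t)"
  using bounded_linear.has_vector_derivative[OF bounded_linear_snd \<Phi>] by (simp add: cotangent_field_def)

lemma snd_flow_growth:
  assumes K: "0 \<le> K" "\<And>x \<xi>. norm (cotangent_force X (x, \<xi>)) \<le> K * norm \<xi>"
  shows "norm (snd (\<Phi> t \<rho>)) \<le> exp (K * \<bar>t\<bar>) * norm (snd \<rho>)"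
    "norm (snd \<rho>) \<le> exp (K * \<bar>t\<bar>) * norm (snd (\<Phi> t \<rho>))"
proof -
  have K': "norm (cotangent_force X \<rho>) \<le> K * norm (snd \<rho>) + 0" for \<rho>
    using K(2)[of "fst \<rho>" "snd \<rho>"] by simp
  show "norm (snd (\<Phi> t \<rho>)) \<le> exp (K * \<bar>t\<bar>) * norm (snd \<rho>)"
    using gronwall[of t "\<lambda>t. snd (\<Phi> t \<rho>)", OF snd_flow K' K(1)] by (simp add: \<Phi>0)
  \<comment> \<open>The lower bound on the momentum at time t is the same Gronwall estimate along
    the reversed path from time t back to time 0.\<close>
  have "((\<lambda>s. snd (\<Phi> (t - s) \<rho>)) has_vector_derivative - cotangent_force X (\<Phi> (t - s) \<rho>)) (at s)" for s
  proof -
    have "((\<lambda>s. t - s) has_vector_derivative - 1) (at s)"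
      by (auto intro!: derivative_eq_intros)
    from vector_diff_chain_at[OF this snd_flow] show ?thesis by (simp add: o_def)
  qed
  from gronwall[of t, OF this, of K 0] K' K(1)
  show "norm (snd \<rho>) \<le> exp (K * \<bar>t\<bar>) * norm (snd (\<Phi> t \<rho>))" by (simp add: \<Phi>0)
qed

lemma cotangent_flow_derivative:
  "\<exists>V. (\<forall>t. (\<Phi> t has_derivative V t) (at \<rho>)) \<and>
      (\<forall>t \<zeta>. V 0 \<zeta> = \<zeta> \<and> ((\<lambda>t. V t \<zeta>) has_vector_derivative ddir (V t \<zeta>) (cotangent_field X) (\<Phi> t \<rho>)) (at t))"
proof (rule flow_has_derivative[OF cotangent_field_derivatives(1)[OF X_smooth] \<Phi>0 \<Phi>])
  fix T :: real
  obtain K where K: "0 \<le> K" "\<And>x \<xi>. norm (cotangent_force X (x, \<xi>)) \<le> K * norm \<xi>"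
    using cotangent_force_bound by blast
  obtain C1 where C1: "0 \<le> C1" "\<And>\<zeta> x \<xi> r. 0 < r \<Longrightarrow> norm \<zeta> \<le> r \<Longrightarrow>
      norm (fst (ddir \<zeta> (cotangent_field X) (x, \<xi>))) \<le> C1 * r \<and>
      norm (snd (ddir \<zeta> (cotangent_field X) (x, \<xi>))) \<le> C1 * (norm \<xi> * r + r)"
  proof -
    obtain C where C: "0 \<le> C" "\<And>\<zeta>s x \<xi> a b. length \<zeta>s = Suc 0 \<and> 0 < a \<and> 0 \<le> b \<and>
      (\<forall>\<zeta>\<in>set \<zeta>s. norm (fst \<zeta>) \<le> a \<and> norm (snd \<zeta>) \<le> b) \<longrightarrow>
      norm (fst (iter_ddir \<zeta>s (cotangent_field X) (x, \<xi>))) \<le> C * a ^ Suc 0 \<and>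
      norm (snd (iter_ddir \<zeta>s (cotangent_field X) (x, \<xi>))) \<le> C * (norm \<xi> * a ^ Suc 0 + b * a ^ 0)"
      using cotangent_field_bound[of 0] by blast
    show ?thesis
    proof (rule that[OF C(1)])
      fix \<zeta> :: "'a \<times> 'a" and x \<xi> :: 'a and r :: real assume "0 < r" "norm \<zeta> \<le> r"
      then show "norm (fst (ddir \<zeta> (cotangent_field X) (x, \<xi>))) \<le> C * r \<and>
          norm (snd (ddir \<zeta> (cotangent_field X) (x, \<xi>))) \<le> C * (norm \<xi> * r + r)"
        using C(2)[of "[\<zeta>]" r r x \<xi>] norm_fst_le[of "fst \<zeta>" "snd \<zeta>"] norm_snd_le[of "snd \<zeta>" "fst \<zeta>"] by simp
    qed
  qed
  obtain C2 where C2: "0 \<le> C2" "\<And>\<zeta> x \<xi> r. 0 < r \<Longrightarrow> norm \<zeta> \<le> r \<Longrightarrow>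
      norm (fst (ddir \<zeta> (ddir \<zeta> (cotangent_field X)) (x, \<xi>))) \<le> C2 * r\<^sup>2 \<and>
      norm (snd (ddir \<zeta> (ddir \<zeta> (cotangent_field X)) (x, \<xi>))) \<le> C2 * (norm \<xi> * r\<^sup>2 + r\<^sup>2)"
  proof -
    obtain C where C: "0 \<le> C" "\<And>\<zeta>s x \<xi> a b. length \<zeta>s = Suc 1 \<and> 0 < a \<and> 0 \<le> b \<and>
      (\<forall>\<zeta>\<in>set \<zeta>s. norm (fst \<zeta>) \<le> a \<and> norm (snd \<zeta>) \<le> b) \<longrightarrow>
      norm (fst (iter_ddir \<zeta>s (cotangent_field X) (x, \<xi>))) \<le> C * a ^ Suc 1 \<and>
      norm (snd (iter_ddir \<zeta>s (cotangent_field X) (x, \<xi>))) \<le> C * (norm \<xi> * a ^ Suc 1 + b * a ^ 1)"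
      using cotangent_field_bound[of 1] by blast
    show ?thesis
    proof (rule that[OF C(1)])
      fix \<zeta> :: "'a \<times> 'a" and x \<xi> :: 'a and r :: real assume "0 < r" "norm \<zeta> \<le> r"
      then show "norm (fst (ddir \<zeta> (ddir \<zeta> (cotangent_field X)) (x, \<xi>))) \<le> C * r\<^sup>2 \<and>
          norm (snd (ddir \<zeta> (ddir \<zeta> (cotangent_field X)) (x, \<xi>))) \<le> C * (norm \<xi> * r\<^sup>2 + r\<^sup>2)"
        using C(2)[of "[\<zeta>, \<zeta>]" r r x \<xi>] norm_fst_le[of "fst \<zeta>" "snd \<zeta>"] norm_snd_le[of "snd \<zeta>" "fst \<zeta>"]
        by (simp add: power2_eq_square)
    qed
  qed
  \<comment> \<open>R bounds the momentum up to time T on trajectories starting within distance 1 of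
    \<rho>. On the slab of this width the momentum component of a derivative contributes R + 1 and
    the position component 1, whence the factor R + 2.\<close>
  define R where "R = exp (K * T) * (norm (snd \<rho>) + 1)"
  have R: "0 \<le> R" by (simp add: R_def)
  let ?S = "{z::'a \<times> 'a. norm (snd z) \<le> R}"
  let ?L = "C1 * (R + 2)" and ?M = "C2 * (R + 2)"
  have "convex ?S"
  proof -
    have "?S = snd -` cball 0 R" by auto
    then show ?thesis using convex_linear_vimage[OF linear_snd convex_cball] by metis
  qed
  moreover have "\<Phi> t \<rho>' \<in> ?S" if "\<bar>t\<bar> \<le> T" "norm (\<rho>' - \<rho>) < 1" for t \<rho>'
  proof -
    have "norm (snd (\<rho>' - \<rho>)) \<le> norm (\<rho>' - \<rho>)" by (metis norm_snd_le prod.collapse)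
    then have "norm (snd \<rho>') \<le> norm (snd \<rho>) + 1"
      using that(2) norm_triangle_ineq2[of "snd \<rho>'" "snd \<rho>"] by simp
    moreover have "K * \<bar>t\<bar> \<le> K * T" using K that by (intro mult_left_mono) auto
    ultimately have "exp (K * \<bar>t\<bar>) * norm (snd \<rho>') \<le> R"
      unfolding R_def by (intro mult_mono) auto
    then show ?thesis using snd_flow_growth(1)[OF K, of t \<rho>'] by simp
  qed
  moreover have "norm (ddir v (cotangent_field X) z) \<le> ?L * norm v \<and>
      norm (ddir v (ddir v (cotangent_field X)) z) \<le> ?M * (norm v)\<^sup>2" if z: "z \<in> ?S" for z v
  proof (cases "v = 0")
    case True
    have H: "smooth (cotangent_field X)" by (rule cotangent_field_derivatives(1)[OF X_smooth])
    show ?thesis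
      using True ddir_vec(2)[OF smooth_differentiable[OF H], of 0 v]
        ddir_vec(2)[OF smooth_differentiable[OF smooth_ddir[OF H]], of 0 v] by simp
  next
    case False
    then have v: "0 < norm v" by simp
    have split: "norm w \<le> norm (fst w) + norm (snd w)" for w :: "'a \<times> 'a"
      using norm_Pair_le[of "fst w" "snd w"] by simp
    have "norm (snd z) * norm v \<le> R * norm v" "norm (snd z) * (norm v)\<^sup>2 \<le> R * (norm v)\<^sup>2"
      using z by (intro mult_right_mono; simp)+
    then have m: "C1 * (norm (snd z) * norm v + norm v) \<le> C1 * (R * norm v + norm v)"
      "C2 * (norm (snd z) * (norm v)\<^sup>2 + (norm v)\<^sup>2) \<le> C2 * (R * (norm v)\<^sup>2 + (norm v)\<^sup>2)"
      using C1(1) C2(1) by (intro mult_left_mono add_right_mono; simp)+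
    from C1(2)[OF v order_refl, of "fst z" "snd z"] C2(2)[OF v order_refl, of "fst z" "snd z"] m
    show ?thesis
      using split[of "ddir v (cotangent_field X) z"] split[of "ddir v (ddir v (cotangent_field X)) z"]
      by (simp add: algebra_simps)
  qed
  ultimately show "\<exists>S L K d. convex S \<and> 0 < d \<and> 0 \<le> L \<and> 0 \<le> K \<and>
        (\<forall>t \<rho>'. \<bar>t\<bar> \<le> T \<longrightarrow> norm (\<rho>' - \<rho>) < d \<longrightarrow> \<Phi> t \<rho>' \<in> S) \<and>
        (\<forall>z\<in>S. \<forall>v. norm (ddir v (cotangent_field X) z) \<le> L * norm v \<and>
          norm (ddir v (ddir v (cotangent_field X)) z) \<le> K * (norm v)\<^sup>2)"
    using C1(1) C2(1) R
    by (intro exI[of _ ?S] exI[of _ ?L] exI[of _ ?M] exI[of _ 1]) auto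
qed

end

end

section \<open>Assumption B\<close>

text \<open>The form attains a positive minimum m on the compact unit sphere, and homogeneity gives
  the constant 1 / sqrt m.\<close>

lemma euclidean_form_norm_bound:
  fixes e :: "'w::euclidean_space \<Rightarrow> 'w \<Rightarrow> real"
  assumes e: "euclidean_form e"
  shows "\<exists>C>0. \<forall>\<zeta>. norm \<zeta> \<le> C * form_norm e \<zeta>"
proof -
  have lin: "linear (e \<zeta>)" and sym: "e \<zeta> \<zeta>' = e \<zeta>' \<zeta>" and pos: "\<zeta> \<noteq> 0 \<Longrightarrow> 0 < e \<zeta> \<zeta>" for \<zeta> \<zeta>'
    using e unfolding euclidean_form_def by blast+
  have "e \<zeta> \<zeta> = (\<Sum>b\<in>Basis. (\<zeta> \<bullet> b) * e b \<zeta>)" for \<zeta>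
  proof -
    have "e \<zeta> (\<Sum>b\<in>Basis. (\<zeta> \<bullet> b) *\<^sub>R b) = (\<Sum>b\<in>Basis. (\<zeta> \<bullet> b) *\<^sub>R e \<zeta> b)"
      unfolding linear_sum[OF lin] linear_cmul[OF lin] ..
    then show ?thesis by (simp add: euclidean_representation sym)
  qed
  moreover have "continuous_on S (e b)" for S b
    using lin linear_continuous_on linear_conv_bounded_linear by blast
  ultimately have cont: "continuous_on (sphere 0 1) (\<lambda>\<zeta>. e \<zeta> \<zeta>)"
    by (auto intro!: continuous_intros)
  obtain b :: 'w where b: "b \<in> Basis" using nonempty_Basis by blast
  then have "sphere (0::'w) 1 \<noteq> {}" by (metis (mono_tags) mem_sphere_0 norm_Basis empty_iff)
  from continuous_attains_inf[OF compact_sphere this cont]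
  obtain z where z: "norm z = 1" "\<And>\<zeta>. norm \<zeta> = 1 \<Longrightarrow> e z z \<le> e \<zeta> \<zeta>" by auto
  define m where "m = e z z"
  have "z \<noteq> 0" using z(1) by (metis norm_zero zero_neq_one)
  then have m: "0 < m" using pos[of z] by (simp add: m_def)
  have scale: "e (c *\<^sub>R \<zeta>) (c *\<^sub>R \<zeta>) = c\<^sup>2 * e \<zeta> \<zeta>" for c \<zeta>
    using linear_cmul[OF lin] sym by (simp add: power2_eq_square)
  have "m * (norm \<zeta>)\<^sup>2 \<le> e \<zeta> \<zeta>" for \<zeta>
  proof (cases "\<zeta> = 0")
    case True
    then show ?thesis using linear_0[OF lin] by simp
  next
    case False
    then have "m \<le> e ((1 / norm \<zeta>) *\<^sub>R \<zeta>) ((1 / norm \<zeta>) *\<^sub>R \<zeta>)" unfolding m_def by (intro z) simp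
    then show ?thesis using False by (simp add: scale power_divide pos_le_divide_eq)
  qed
  then have "sqrt (m * (norm \<zeta>)\<^sup>2) \<le> form_norm e \<zeta>" for \<zeta>
    unfolding form_norm_def by (intro real_sqrt_le_mono)
  then have "norm \<zeta> \<le> (1 / sqrt m) * form_norm e \<zeta>" for \<zeta>
    using m by (simp add: real_sqrt_mult field_simps)
  then show ?thesis using m by (intro exI[of _ "1 / sqrt m"]) auto
qed

context anisotropy
begin

lemma japanese_powr_mono: "s \<le> t \<Longrightarrow> japanese \<xi> powr s \<le> japanese \<xi> powr t"
  by (rule powr_mono[OF _ japanese_ge_1])

text \<open>An upper bound is what matters: \<open>theta\<close> enters the symbol weight with the
  negative exponent -\<epsilon>, and positivity makes that power monotone. The constant compares the
  form e with the product norm.\<close>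

lemma theta_aniso:
  fixes e :: "'a::euclidean_space \<times> 'a \<Rightarrow> 'a \<times> 'a \<Rightarrow> real"
  assumes e: "euclidean_form e"
  shows "\<exists>C>0. \<forall>\<rho>. 0 < theta e aniso \<rho> \<and> theta e aniso \<rho> \<le> C * japanese (snd \<rho>) powr \<alpha>\<^sub>2"
proof -
  obtain C where C: "0 < C" "\<And>\<zeta>. norm \<zeta> \<le> C * form_norm e \<zeta>"
    using euclidean_form_norm_bound[OF e] by blast
  have "0 < theta e aniso \<rho> \<and> theta e aniso \<rho> \<le> C * japanese (snd \<rho>) powr \<alpha>\<^sub>2" for \<rho>
  proof -
    let ?J = "japanese (snd \<rho>)"
    let ?A = "{dual_norm (aniso \<rho>) \<zeta> / form_norm e \<zeta> |\<zeta>. \<zeta> \<noteq> 0}"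
    have J: "0 < ?J powr s" for s using japanese_pos[of "snd \<rho>"] by simp
    have dual: "dual_norm (aniso \<rho>) \<zeta> = norm (?J powr \<alpha>\<^sub>2 *\<^sub>R fst \<zeta>, ?J powr - \<alpha>\<^sub>1 *\<^sub>R snd \<zeta>)" for \<zeta>
      unfolding anisotropic_metric_eq dual_norm_split_form[OF J J] by (simp add: powr_minus inverse_eq_divide)
    have pos: "0 < form_norm e \<zeta>" if "\<zeta> \<noteq> 0" for \<zeta>
      using e that unfolding euclidean_form_def form_norm_def real_sqrt_gt_0_iff by blast
    have le: "dual_norm (aniso \<rho>) \<zeta> \<le> ?J powr \<alpha>\<^sub>2 * norm \<zeta>" for \<zeta>
    proof -
      have "(?J powr - \<alpha>\<^sub>1)\<^sup>2 * (norm (snd \<zeta>))\<^sup>2 \<le> (?J powr \<alpha>\<^sub>2)\<^sup>2 * (norm (snd \<zeta>))\<^sup>2"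
        using \<alpha> by (intro mult_right_mono power_mono japanese_powr_mono) auto
      then have "dual_norm (aniso \<rho>) \<zeta> \<le> sqrt ((?J powr \<alpha>\<^sub>2)\<^sup>2 * ((norm (fst \<zeta>))\<^sup>2 + (norm (snd \<zeta>))\<^sup>2))"
        unfolding dual norm_Pair by (intro real_sqrt_le_mono) (simp add: power_mult_distrib algebra_simps)
      then show ?thesis by (simp add: real_sqrt_mult norm_prod_def)
    qed
    have bound: "r \<le> C * ?J powr \<alpha>\<^sub>2" if "r \<in> ?A" for r
    proof -
      obtain \<zeta> where \<zeta>: "r = dual_norm (aniso \<rho>) \<zeta> / form_norm e \<zeta>" "\<zeta> \<noteq> 0" using \<open>r \<in> ?A\<close> by blast
      have "dual_norm (aniso \<rho>) \<zeta> \<le> ?J powr \<alpha>\<^sub>2 * (C * form_norm e \<zeta>)"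
        by (rule order_trans[OF le]) (intro mult_left_mono C powr_ge_zero)
      then show ?thesis using pos[OF \<zeta>(2)] by (simp add: \<zeta>(1) pos_divide_le_eq mult_ac)
    qed
    obtain b :: "'a \<times> 'a" where b: "b \<noteq> 0" using nonzero_Basis nonempty_Basis by blast
    then have in_A: "dual_norm (aniso \<rho>) b / form_norm e b \<in> ?A" by blast
    have "0 < dual_norm (aniso \<rho>) b"
      using b J[of \<alpha>\<^sub>2] J[of "- \<alpha>\<^sub>1"] unfolding dual by (auto simp: prod_eq_iff zero_prod_def)
    then have "0 < dual_norm (aniso \<rho>) b / form_norm e b" using pos[OF b] by simp
    also have "\<dots> \<le> Sup ?A" by (rule cSup_upper[OF in_A]) (use bound in \<open>auto simp: bdd_above_def\<close>)
    finally have "0 < theta e aniso \<rho>" by (simp add: theta_def)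
    moreover have "theta e aniso \<rho> \<le> C * ?J powr \<alpha>\<^sub>2"
      unfolding theta_def by (rule cSup_least) (use in_A bound in blast)+
    ultimately show ?thesis ..
  qed
  with C(1) show ?thesis by blast
qed

lemma unit_ball_aniso:
  fixes \<zeta> :: "'a::euclidean_space \<times> 'a"
  assumes "form_norm (aniso (x, \<xi>)) \<zeta> \<le> 1"
  shows "norm (fst \<zeta>) \<le> japanese \<xi> powr - \<alpha>\<^sub>1" "norm (snd \<zeta>) \<le> japanese \<xi> powr \<alpha>\<^sub>2"
proof -
  have J: "0 < japanese \<xi> powr s" for s using japanese_pos[of \<xi>] by simp
  have "norm (japanese \<xi> powr \<alpha>\<^sub>1 *\<^sub>R fst \<zeta>) \<le> 1" "norm (japanese \<xi> powr - \<alpha>\<^sub>2 *\<^sub>R snd \<zeta>) \<le> 1"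
    using assms norm_fst_le norm_snd_le order_trans
    unfolding anisotropic_metric_eq form_norm_split_form snd_conv by blast+
  then show "norm (fst \<zeta>) \<le> japanese \<xi> powr - \<alpha>\<^sub>1" "norm (snd \<zeta>) \<le> japanese \<xi> powr \<alpha>\<^sub>2"
    using J[of \<alpha>\<^sub>1] J[of \<alpha>\<^sub>2] by (simp_all add: powr_minus field_simps)
qed

lemma unit_ball_aniso_nonempty:
  "{norm (B Xs :: real) |Xs. length Xs = k \<and> (\<forall>\<zeta>\<in>set Xs. form_norm (aniso \<rho>) (\<zeta> :: 'a::euclidean_space \<times> 'a) \<le> 1)} \<noteq> {}"
  by (auto simp: anisotropic_metric_eq form_norm_split_form zero_prod_def[symmetric] intro!: exI[of _ "replicate k 0"])

section \<open>Symbol estimates and the Lie derivative of the metric\<close>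

context
  fixes X :: "'a::euclidean_space \<Rightarrow> 'a"
  assumes X: "tame {\<lambda>x. 1} X"
begin

text \<open>With all derivatives in position the factor is |\<xi>| times k + 1 powers of
  \<open>japanese \<xi> powr - \<alpha>\<^sub>1\<close>; with one in momentum it is \<open>japanese
  \<xi> powr (\<alpha>\<^sub>2 - k * \<alpha>\<^sub>1)\<close>. Both are at most the stated power
  because k \<ge> 2, the first also because
  \<open>1 \<le> \<alpha>\<^sub>1 + \<alpha>\<^sub>2\<close>.\<close>

lemma nabla_linear_symbol_bound:
  assumes "2 \<le> k"
  shows "\<exists>C\<ge>0. \<forall>\<rho>. tensor_norm aniso (Suc k) (nabla_pow (Suc k) (linear_symbol X)) \<rho> \<le>
    C * japanese (snd \<rho>) powr (\<alpha>\<^sub>2 - 2 * \<alpha>\<^sub>1)"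
proof -
  obtain C where C: "0 \<le> C" "\<And>\<zeta>s x \<xi> a b. length \<zeta>s = Suc k \<and> 0 < a \<and> 0 \<le> b \<and>
      (\<forall>\<zeta>\<in>set \<zeta>s. norm (fst \<zeta>) \<le> a \<and> norm (snd \<zeta>) \<le> b) \<Longrightarrow>
    norm (iter_ddir \<zeta>s (linear_symbol X) (x, \<xi>)) \<le> C * (norm \<xi> * a ^ Suc k + b * a ^ k)"
    using tame_linear_symbol_bound[OF X, of k] by metis
  have "tensor_norm aniso (Suc k) (nabla_pow (Suc k) (linear_symbol X)) (x, \<xi>) \<le>
      (2 * C) * japanese \<xi> powr (\<alpha>\<^sub>2 - 2 * \<alpha>\<^sub>1)" for x \<xi>
    unfolding tensor_norm_def
  proof (rule cSup_least[OF unit_ball_aniso_nonempty])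
    fix r assume "r \<in> {norm (nabla_pow (Suc k) (linear_symbol X) (x, \<xi>) Xs) |Xs. length Xs = Suc k \<and>
        (\<forall>\<zeta>\<in>set Xs. form_norm (aniso (x, \<xi>)) \<zeta> \<le> 1)}"
    then obtain Xs where Xs: "r = norm (nabla_pow (Suc k) (linear_symbol X) (x, \<xi>) Xs)" "length Xs = Suc k"
      "\<forall>\<zeta>\<in>set Xs. form_norm (aniso (x, \<xi>)) \<zeta> \<le> 1" by blast
    let ?J = "japanese \<xi>"
    let ?a = "?J powr - \<alpha>\<^sub>1" and ?b = "?J powr \<alpha>\<^sub>2"
    have J: "0 < ?J powr s" for s using japanese_pos[of \<xi>] by simp
    have pow: "?a ^ j = ?J powr (- (j * \<alpha>\<^sub>1))" for j
      by (simp only: powr_realpow[OF J, symmetric] powr_powr) (simp add: mult.commute)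
    have k: "2 * \<alpha>\<^sub>1 \<le> k * \<alpha>\<^sub>1" using assms \<alpha> by (intro mult_right_mono) auto
    have "norm \<xi> * ?a ^ Suc k \<le> ?J powr 1 * ?J powr (- (Suc k * \<alpha>\<^sub>1))"
      unfolding pow using norm_le_japanese[of \<xi>] by (intro mult_right_mono) auto
    also have "\<dots> \<le> ?J powr (\<alpha>\<^sub>2 - 2 * \<alpha>\<^sub>1)"
      unfolding powr_add[symmetric] using \<alpha> k by (intro japanese_powr_mono) (auto simp: algebra_simps)
    finally have 1: "norm \<xi> * ?a ^ Suc k \<le> ?J powr (\<alpha>\<^sub>2 - 2 * \<alpha>\<^sub>1)" .
    have 2: "?b * ?a ^ k \<le> ?J powr (\<alpha>\<^sub>2 - 2 * \<alpha>\<^sub>1)"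
      unfolding pow powr_add[symmetric] using k by (intro japanese_powr_mono) auto
    have "norm (iter_ddir (rev Xs) (linear_symbol X) (x, \<xi>)) \<le> C * (norm \<xi> * ?a ^ Suc k + ?b * ?a ^ k)"
    proof (intro C(2) conjI)
      show "\<forall>\<zeta>\<in>set (rev Xs). norm (fst \<zeta>) \<le> ?a \<and> norm (snd \<zeta>) \<le> ?b"
      proof
        fix \<zeta> assume "\<zeta> \<in> set (rev Xs)"
        then have "form_norm (aniso (x, \<xi>)) \<zeta> \<le> 1" using Xs(3) by simp
        from unit_ball_aniso[OF this] show "norm (fst \<zeta>) \<le> ?a \<and> norm (snd \<zeta>) \<le> ?b" ..
      qed
    qed (use Xs(2) J in auto)
    also have "\<dots> \<le> C * (?J powr (\<alpha>\<^sub>2 - 2 * \<alpha>\<^sub>1) + ?J powr (\<alpha>\<^sub>2 - 2 * \<alpha>\<^sub>1))"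
      by (intro mult_left_mono add_mono 1 2 C)
    finally show "r \<le> (2 * C) * ?J powr (\<alpha>\<^sub>2 - 2 * \<alpha>\<^sub>1)"
      using nabla_pow_eq_iter_ddir[of Xs "linear_symbol X" "(x, \<xi>)"] by (simp add: Xs(1,2))
  qed
  then show ?thesis using C(1) by (intro exI[of _ "2 * C"]) auto
qed

text \<open>Derivatives of every order from three on obey the same power bound, so membership for
  both weights of the assumption reduces to one lower bound on m.\<close>

lemma nabla3_linear_symbol_in_symbol_class:
  assumes c: "0 < c" and m: "\<And>\<rho>. c * japanese (snd \<rho>) powr (\<alpha>\<^sub>2 - 2 * \<alpha>\<^sub>1) \<le> m \<rho>"
  shows "nabla_pow 3 (linear_symbol X) \<in> symbol_class 3 m aniso"
  unfolding symbol_class_def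
proof (intro CollectI conjI allI impI)
  let ?p = "linear_symbol X"
  have p: "smooth ?p" by (rule smooth_linear_symbol[OF tame_smooth[OF X]])
  show "multilinear 3 (nabla_pow 3 ?p \<rho>)" for \<rho> by (rule multilinear_nabla_pow[OF p])
  show "smooth (\<lambda>\<rho>. nabla_pow 3 ?p \<rho> Xs)" if "length Xs = 3" for Xs
    using smooth_iter_ddir[OF p, of "rev Xs"] unfolding nabla_pow_eq_iter_ddir[of Xs, symmetric, unfolded that]
    by simp
  fix j
  have "Suc (j + 2) = j + 3" by simp
  then have "(nabla ^^ j) (nabla_pow 3 ?p) = nabla_pow (Suc (j + 2)) ?p"
    by (simp only: nabla_pow_def funpow_add o_apply)
  moreover obtain C where C: "0 \<le> C" "\<And>\<rho>. tensor_norm aniso (Suc (j + 2)) (nabla_pow (Suc (j + 2)) ?p) \<rho> \<le>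
      C * japanese (snd \<rho>) powr (\<alpha>\<^sub>2 - 2 * \<alpha>\<^sub>1)"
    using nabla_linear_symbol_bound[of "j + 2"] by auto
  moreover have "tensor_norm aniso (Suc (j + 2)) (nabla_pow (Suc (j + 2)) ?p) \<rho> / m \<rho> \<le> C / c" for \<rho>
  proof -
    let ?j = "japanese (snd \<rho>) powr (\<alpha>\<^sub>2 - 2 * \<alpha>\<^sub>1)"
    have "0 < ?j" using japanese_pos[of "snd \<rho>"] by simp
    then have "0 < m \<rho>" using c m[of \<rho>] mult_pos_pos[of c ?j] by linarith
    have "?j \<le> m \<rho> / c" using c m[of \<rho>] by (simp add: pos_le_divide_eq mult.commute)
    then have "C * ?j \<le> C * (m \<rho> / c)" using C(1) by (intro mult_left_mono)
    then show ?thesis using C(2)[of \<rho>] \<open>0 < m \<rho>\<close> by (simp add: pos_divide_le_eq mult.commute)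
  qed
  ultimately show "bdd_above (range (\<lambda>\<rho>. tensor_norm aniso (j + 3) ((nabla ^^ j) (nabla_pow 3 ?p)) \<rho> / m \<rho>))"
    by (auto simp: bdd_above_def numeral_3_eq_3)
qed

context
  fixes \<Phi> :: "real \<Rightarrow> 'a \<times> 'a \<Rightarrow> 'a \<times> 'a"
  assumes \<Phi>0: "\<And>\<rho>. \<Phi> 0 \<rho> = \<rho>"
    and \<Phi>: "\<And>t \<rho>. ((\<lambda>t. \<Phi> t \<rho>) has_vector_derivative cotangent_field X (\<Phi> t \<rho>)) (at t)"
begin

lemma aniso_flow_growth:
  "\<exists>\<Upsilon>\<ge>0. \<exists>C>0. \<forall>\<rho> t \<zeta>. aniso (\<Phi> t \<rho>) \<zeta> \<zeta> \<le> C\<^sup>2 * exp (2 * \<Upsilon> * \<bar>t\<bar>) * aniso \<rho> \<zeta> \<zeta>"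
proof -
  obtain K where K: "0 \<le> K" "\<And>x \<xi>. norm (cotangent_force X (x, \<xi>)) \<le> K * norm \<xi>"
    using cotangent_force_bound[OF X] by blast
  have "aniso (\<Phi> t \<rho>) \<zeta> \<zeta> \<le> (exp (K * \<bar>t\<bar>))\<^sup>2 * aniso \<rho> \<zeta> \<zeta>" for \<rho> t \<zeta>
    by (intro aniso_le japanese_le_if_norm_le snd_flow_growth[OF X \<Phi>0 \<Phi> K])
      (use K(1) in auto)
  moreover have "(exp (K * \<bar>t\<bar>))\<^sup>2 = exp (2 * K * \<bar>t\<bar>)" for t
    by (simp add: power2_eq_square exp_add[symmetric])
  ultimately show ?thesis using K(1) by (intro exI[of _ K] conjI exI[of _ 1]) auto
qed

text \<open>This is the product rule at time 0. The brackets move with the momentum component of the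
  flow, and the differential V starts at the identity with velocity given by the derivative of the
  field.\<close>

lemma lie_derivative_aniso:
  assumes V: "\<And>t. (\<Phi> t has_derivative V t) (at \<rho>)" "\<And>\<zeta>. V 0 \<zeta> = \<zeta>"
    "\<And>t \<zeta>. ((\<lambda>t. V t \<zeta>) has_vector_derivative ddir (V t \<zeta>) (cotangent_field X) (\<Phi> t \<rho>)) (at t)"
  shows "lie_derivative_metric \<Phi> aniso \<rho> [\<zeta>, \<zeta>'] =
    2 * \<alpha>\<^sub>1 * japanese (snd \<rho>) powr (2 * \<alpha>\<^sub>1 - 2) * (snd \<rho> \<bullet> cotangent_force X \<rho>) * (fst \<zeta> \<bullet> fst \<zeta>') +
    japanese (snd \<rho>) powr (2 * \<alpha>\<^sub>1) *
      (fst (ddir \<zeta> (cotangent_field X) \<rho>) \<bullet> fst \<zeta>' + fst \<zeta> \<bullet> fst (ddir \<zeta>' (cotangent_field X) \<rho>)) +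
    2 * (- \<alpha>\<^sub>2) * japanese (snd \<rho>) powr (- 2 * \<alpha>\<^sub>2 - 2) * (snd \<rho> \<bullet> cotangent_force X \<rho>) * (snd \<zeta> \<bullet> snd \<zeta>') +
    japanese (snd \<rho>) powr (- 2 * \<alpha>\<^sub>2) *
      (snd (ddir \<zeta> (cotangent_field X) \<rho>) \<bullet> snd \<zeta>' + snd \<zeta> \<bullet> snd (ddir \<zeta>' (cotangent_field X) \<rho>))"
    (is "_ = ?D")
proof -
  have fd: "frechet_derivative (\<Phi> t) (at \<rho>) = V t" for t
    using frechet_derivative_at[OF V(1)] by simp
  have f: "((\<lambda>t. fst (V t \<zeta>)) has_vector_derivative fst (ddir \<zeta> (cotangent_field X) \<rho>)) (at 0)"
    and s: "((\<lambda>t. snd (V t \<zeta>)) has_vector_derivative snd (ddir \<zeta> (cotangent_field X) \<rho>)) (at 0)" for \<zeta>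
    using bounded_linear.has_vector_derivative[OF bounded_linear_fst V(3)[of \<zeta> 0]]
      bounded_linear.has_vector_derivative[OF bounded_linear_snd V(3)[of \<zeta> 0]] by (simp_all add: V(2) \<Phi>0)
  have inner: "((\<lambda>t. u t \<bullet> v t) has_real_derivative u' \<bullet> v 0 + u 0 \<bullet> v') (at 0)"
    if "(u has_vector_derivative u') (at 0)" "(v has_vector_derivative v') (at 0)"
    for u v :: "real \<Rightarrow> 'a" and u' v'
    using has_derivative_inner[OF that[unfolded has_vector_derivative_def]]
    unfolding has_field_derivative_def
    by (rule has_derivative_eq_rhs) (auto simp: algebra_simps fun_eq_iff)
  have J: "((\<lambda>t. japanese (snd (\<Phi> t \<rho>)) powr s) has_real_derivative
      s * japanese (snd \<rho>) powr (s - 2) * (snd \<rho> \<bullet> cotangent_force X \<rho>)) (at 0)" for s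
    using japanese_powr_derivative[OF snd_flow[OF X \<Phi>0 \<Phi>, of \<rho> 0], of s] by (simp add: \<Phi>0)
  have "(\<lambda>t. metric_pullback (\<Phi> t) aniso \<rho> \<zeta> \<zeta>') = (\<lambda>t.
      japanese (snd (\<Phi> t \<rho>)) powr (2 * \<alpha>\<^sub>1) * (fst (V t \<zeta>) \<bullet> fst (V t \<zeta>')) +
      japanese (snd (\<Phi> t \<rho>)) powr (- 2 * \<alpha>\<^sub>2) * (snd (V t \<zeta>) \<bullet> snd (V t \<zeta>')))"
    by (auto simp: metric_pullback_def fd anisotropic_metric_def split: prod.splits)
  moreover have "(\<dots> has_real_derivative ?D) (at 0)"
    by (rule DERIV_cong[OF DERIV_add[OF DERIV_mult[OF J inner[OF f f]] DERIV_mult[OF J inner[OF s s]]]])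
      (simp add: V(2) \<Phi>0 algebra_simps)
  ultimately show ?thesis
    by (simp only: lie_derivative_metric_def nth_Cons_0 nth_Cons_Suc One_nat_def DERIV_imp_deriv)
qed

text \<open>When a bracket power is differentiated, its exponent drops by 2 and the factor
  \<open>\<xi> \<bullet> cotangent_force X (x, \<xi>)\<close>, at most K times the squared bracket,
  restores it. When the differential is differentiated, the only growing contribution is |\<xi>|
  times the position extent, which is at most the momentum extent.\<close>

lemma lie_derivative_aniso_bounded:
  "bdd_above (range (tensor_norm aniso 2 (lie_derivative_metric \<Phi> aniso)))"
proof -
  obtain K where K: "0 \<le> K" "\<And>x \<xi>. norm (cotangent_force X (x, \<xi>)) \<le> K * norm \<xi>"
    using cotangent_force_bound[OF X] by blast
  obtain C where C: "0 \<le> C" "\<And>\<zeta>s x \<xi> a b. length \<zeta>s = Suc 0 \<and> 0 < a \<and> 0 \<le> b \<and>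
      (\<forall>\<zeta>\<in>set \<zeta>s. norm (fst \<zeta>) \<le> a \<and> norm (snd \<zeta>) \<le> b) \<longrightarrow>
      norm (fst (iter_ddir \<zeta>s (cotangent_field X) (x, \<xi>))) \<le> C * a ^ Suc 0 \<and>
      norm (snd (iter_ddir \<zeta>s (cotangent_field X) (x, \<xi>))) \<le> C * (norm \<xi> * a ^ Suc 0 + b * a ^ 0)"
    using cotangent_field_bound[OF X, of 0] by blast
  \<comment> \<open>The position block contributes 2 K + 2 C. The momentum block contributes 2 K + 4
    C, since its differentiated vectors are bounded by 2 C times the momentum extent.\<close>
  define M where "M = 2 * K + 2 * C + 2 * K + 4 * C"
  have "tensor_norm aniso 2 (lie_derivative_metric \<Phi> aniso) (x, \<xi>) \<le> M" for x \<xi>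
    unfolding tensor_norm_def
  proof (rule cSup_least[OF unit_ball_aniso_nonempty])
    fix r assume "r \<in> {norm (lie_derivative_metric \<Phi> aniso (x, \<xi>) Xs) |Xs. length Xs = 2 \<and>
        (\<forall>\<zeta>\<in>set Xs. form_norm (aniso (x, \<xi>)) \<zeta> \<le> 1)}"
    then obtain Xs where Xs: "r = norm (lie_derivative_metric \<Phi> aniso (x, \<xi>) Xs)" "length Xs = 2"
      "\<forall>\<zeta>\<in>set Xs. form_norm (aniso (x, \<xi>)) \<zeta> \<le> 1" by blast
    from Xs(2) obtain \<zeta> \<zeta>' where X2: "Xs = [\<zeta>, \<zeta>']"
      by (auto simp: numeral_2_eq_2 length_Suc_conv)
    let ?J = "japanese \<xi>"
    let ?a = "?J powr - \<alpha>\<^sub>1" and ?b = "?J powr \<alpha>\<^sub>2"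
    have J: "0 < ?J powr s" for s using japanese_pos[of \<xi>] by simp
    have u: "norm (fst \<zeta>) \<le> ?a" "norm (snd \<zeta>) \<le> ?b" "norm (fst \<zeta>') \<le> ?a" "norm (snd \<zeta>') \<le> ?b"
      using unit_ball_aniso[of x \<xi> \<zeta>] unit_ball_aniso[of x \<xi> \<zeta>'] Xs(3) by (auto simp: X2)
    have "norm \<xi> * ?a \<le> ?J powr 1 * ?a" using norm_le_japanese[of \<xi>] by (intro mult_right_mono) auto
    also have "\<dots> \<le> ?b" unfolding powr_add[symmetric] using \<alpha> by (intro japanese_powr_mono) auto
    finally have xa: "norm \<xi> * ?a \<le> ?b" .
    have D: "norm (fst (ddir \<zeta> (cotangent_field X) (x, \<xi>))) \<le> C * ?a"
        "norm (snd (ddir \<zeta> (cotangent_field X) (x, \<xi>))) \<le> 2 * C * ?b"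
      if "norm (fst \<zeta>) \<le> ?a" "norm (snd \<zeta>) \<le> ?b" for \<zeta>
    proof -
      have "C * (norm \<xi> * ?a + ?b) \<le> C * (?b + ?b)" using xa C(1) by (intro mult_left_mono) auto
      then show "norm (fst (ddir \<zeta> (cotangent_field X) (x, \<xi>))) \<le> C * ?a"
        "norm (snd (ddir \<zeta> (cotangent_field X) (x, \<xi>))) \<le> 2 * C * ?b"
        using C(2)[of "[\<zeta>]" ?a ?b x \<xi>] that J[of "- \<alpha>\<^sub>1"] by auto
    qed
    have prod: "\<bar>v \<bullet> w\<bar> \<le> A * B" if "norm v \<le> A" "norm w \<le> B" for v w :: 'a and A B
      using Cauchy_Schwarz_ineq2[of v w] mult_mono[OF that] order_trans[OF norm_ge_zero that(1)] by simp
    have aa: "?J powr (2 * \<alpha>\<^sub>1) * (?a * ?a) = 1" "?J powr (- 2 * \<alpha>\<^sub>2) * (?b * ?b) = 1"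
      using japanese_pos[of \<xi>] by (simp_all add: powr_add[symmetric])
    have force: "?J powr (s - 2) * \<bar>\<xi> \<bullet> cotangent_force X (x, \<xi>)\<bar> \<le> K * ?J powr s" for s
    proof -
      have "\<bar>\<xi> \<bullet> cotangent_force X (x, \<xi>)\<bar> \<le> ?J * (K * ?J)"
        using K(2)[of x \<xi>] mult_left_mono[OF norm_le_japanese K(1), of \<xi>] norm_le_japanese[of \<xi>]
        by (intro prod) auto
      then have "?J powr (s - 2) * \<bar>\<xi> \<bullet> cotangent_force X (x, \<xi>)\<bar> \<le> ?J powr (s - 2) * (?J * (K * ?J))"
        by (intro mult_left_mono) auto
      also have "\<dots> = K * (?J powr (s - 2) * ?J powr 2)"
        using japanese_pos[of \<xi>] by (simp add: power2_eq_square)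
      also have "\<dots> = K * ?J powr s" unfolding powr_add[symmetric] by simp
      finally show ?thesis .
    qed
    obtain V where V: "\<And>t. (\<Phi> t has_derivative V t) (at (x, \<xi>))" "\<And>\<zeta>. V 0 \<zeta> = \<zeta>"
      "\<And>t \<zeta>. ((\<lambda>t. V t \<zeta>) has_vector_derivative ddir (V t \<zeta>) (cotangent_field X) (\<Phi> t (x, \<xi>))) (at t)"
      using cotangent_flow_derivative[OF X \<Phi>0 \<Phi>, of "(x, \<xi>)"] by blast
    have 1: "\<bar>(2 * \<alpha>) * ?J powr (s - 2) * (\<xi> \<bullet> cotangent_force X (x, \<xi>)) * (v \<bullet> w)\<bar> \<le> 2 * K"
      if "\<bar>\<alpha>\<bar> \<le> 1" "norm v \<le> A" "norm w \<le> A" "?J powr s * (A * A) = 1" for \<alpha> s A and v w :: 'a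
    proof -
      have "\<bar>(2 * \<alpha>) * ?J powr (s - 2) * (\<xi> \<bullet> cotangent_force X (x, \<xi>)) * (v \<bullet> w)\<bar> =
          (2 * \<bar>\<alpha>\<bar>) * ((?J powr (s - 2) * \<bar>\<xi> \<bullet> cotangent_force X (x, \<xi>)\<bar>) * \<bar>v \<bullet> w\<bar>)"
        by (simp add: abs_mult)
      also have "\<dots> \<le> (2 * 1) * ((K * ?J powr s) * (A * A))"
        using that K(1) by (intro mult_mono force prod) auto
      also have "\<dots> = 2 * K * (?J powr s * (A * A))" by simp
      finally show ?thesis unfolding that(4) by simp
    qed
    have 2: "\<bar>?J powr s * (v' \<bullet> w + v \<bullet> w')\<bar> \<le> 2 * B"
      if "norm v \<le> A" "norm w \<le> A" "norm v' \<le> B * A" "norm w' \<le> B * A" "?J powr s * (A * A) = 1" for s A B and v w v' w' :: 'a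
    proof -
      have "\<bar>v' \<bullet> w + v \<bullet> w'\<bar> \<le> (B * A) * A + A * (B * A)"
        using prod[OF that(3,2)] prod[OF that(1,4)] by linarith
      then have "?J powr s * \<bar>v' \<bullet> w + v \<bullet> w'\<bar> \<le> ?J powr s * ((B * A) * A + A * (B * A))"
        by (intro mult_left_mono) auto
      also have "\<dots> = 2 * B * (?J powr s * (A * A))" by (simp add: algebra_simps)
      finally show ?thesis unfolding that(5) by (simp add: abs_mult)
    qed
    have a2: "\<bar>\<alpha>\<^sub>1\<bar> \<le> 1" "\<bar>- \<alpha>\<^sub>2\<bar> \<le> 1" using \<alpha> by auto
    have four: "\<bar>a + b + c + d\<bar> \<le> A + B + C' + D"
      if "\<bar>a\<bar> \<le> A" "\<bar>b\<bar> \<le> B" "\<bar>c\<bar> \<le> C'" "\<bar>d\<bar> \<le> D" for a b c d A B C' D :: real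
      using that by linarith
    have "\<bar>lie_derivative_metric \<Phi> aniso (x, \<xi>) [\<zeta>, \<zeta>']\<bar> \<le> 2 * K + 2 * C + 2 * K + 2 * (2 * C)"
      unfolding lie_derivative_aniso[OF V] snd_conv
      by (intro four 1[OF a2(1) u(1,3) aa(1)] 2[OF u(1,3) D(1)[OF u(1,2)] D(1)[OF u(3,4)] aa(1)]
        1[OF a2(2) u(2,4) aa(2)] 2[OF u(2,4) D(2)[OF u(1,2)] D(2)[OF u(3,4)] aa(2)])
    then show "r \<le> M" by (simp add: Xs(1) X2 M_def)
  qed
  then show ?thesis by (auto simp: bdd_above_def)
qed

end

text \<open>The supremum of the gain is 1, and \<epsilon> = 1/2 is chosen. The first weight is then
  at least a multiple of the bracket to the power \<open>3 * (\<alpha>\<^sub>2 - \<alpha>\<^sub>1) -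
  \<alpha>\<^sub>2 / 2\<close>, the second is its power
  \<open>\<alpha>\<^sub>2 - \<alpha>\<^sub>1\<close>; both exponents are at least
  \<open>\<alpha>\<^sub>2 - 2 * \<alpha>\<^sub>1\<close>.\<close>

theorem assumption_B_linear_symbol:
  assumes e: "euclidean_form e"
  shows "assumption_B e (linear_symbol X) aniso"
proof -
  obtain \<Phi> where \<Phi>: "hamiltonian_flow (linear_symbol X) \<Phi>"
    using cotangent_flow_exists[OF X] hamiltonian_flow_linear_symbol[OF tame_smooth[OF X]] by blast
  then have \<Phi>0: "\<And>\<rho>. \<Phi> 0 \<rho> = \<rho>"
    and \<Phi>': "\<And>t \<rho>. ((\<lambda>t. \<Phi> t \<rho>) has_vector_derivative cotangent_field X (\<Phi> t \<rho>)) (at t)"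
    using hamiltonian_flow_linear_symbol[OF tame_smooth[OF X]] by blast+
  obtain C where C: "0 < C" "\<And>\<rho>. 0 < theta e aniso \<rho>"
      "\<And>\<rho>. theta e aniso \<rho> \<le> C * japanese (snd \<rho>) powr \<alpha>\<^sub>2"
    using theta_aniso[OF e] by blast
  have "C powr (- (1/2)) * japanese (snd \<rho>) powr (\<alpha>\<^sub>2 - 2 * \<alpha>\<^sub>1) \<le>
      (theta e aniso \<rho> * sqrt (gain_sup aniso)) powr (- (1/2)) * (gain aniso \<rho> / gain_sup aniso) powi (- 3)" for \<rho>
  proof -
    let ?J = "japanese (snd \<rho>)"
    have "gain aniso \<rho> powi (- 3) = gain aniso \<rho> powr (real_of_int (- 3))"
      using japanese_pos[of "snd \<rho>"] by (subst powr_real_of_int') (auto simp: gain_aniso)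
    also have "\<dots> = ?J powr (3 * (\<alpha>\<^sub>2 - \<alpha>\<^sub>1))"
      by (simp add: gain_aniso powr_powr algebra_simps)
    finally have 1: "gain aniso \<rho> powi (- 3) = ?J powr (3 * (\<alpha>\<^sub>2 - \<alpha>\<^sub>1))" .
    have "(C * ?J powr \<alpha>\<^sub>2) powr (- (1/2)) \<le> theta e aniso \<rho> powr (- (1/2))"
      using C by (intro powr_mono2') auto
    also have "(C * ?J powr \<alpha>\<^sub>2) powr (- (1/2)) = C powr (- (1/2)) * ?J powr (- (\<alpha>\<^sub>2 / 2))"
      using C(1) by (simp add: powr_mult powr_powr)
    finally have "C powr (- (1/2)) * ?J powr (- (\<alpha>\<^sub>2 / 2)) * ?J powr (3 * (\<alpha>\<^sub>2 - \<alpha>\<^sub>1)) \<le>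
        theta e aniso \<rho> powr (- (1/2)) * ?J powr (3 * (\<alpha>\<^sub>2 - \<alpha>\<^sub>1))"
      by (intro mult_right_mono) auto
    moreover have "C powr (- (1/2)) * ?J powr (\<alpha>\<^sub>2 - 2 * \<alpha>\<^sub>1) \<le>
        C powr (- (1/2)) * (?J powr (- (\<alpha>\<^sub>2 / 2)) * ?J powr (3 * (\<alpha>\<^sub>2 - \<alpha>\<^sub>1)))"
      unfolding powr_add[symmetric] using \<alpha> by (intro mult_left_mono japanese_powr_mono) auto
    ultimately show ?thesis by (simp add: gain_sup_aniso 1 mult.assoc)
  qed
  then have S1: "nabla_pow 3 (linear_symbol X) \<in> symbol_class 3 (\<lambda>\<rho>.
      (theta e aniso \<rho> * sqrt (gain_sup aniso)) powr (- (1/2)) * (gain aniso \<rho> / gain_sup aniso) powi (- 3)) aniso"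
    using C(1) by (intro nabla3_linear_symbol_in_symbol_class[of "C powr (- (1/2))"]) auto
  have "1 * japanese (snd \<rho>) powr (\<alpha>\<^sub>2 - 2 * \<alpha>\<^sub>1) \<le> (gain aniso \<rho> / gain_sup aniso) powi (- 1)" for \<rho>
  proof -
    have "gain aniso \<rho> powi (- 1) = japanese (snd \<rho>) powr (\<alpha>\<^sub>2 - \<alpha>\<^sub>1)"
      by (simp add: gain_aniso power_int_minus powr_minus[symmetric])
    then show ?thesis using \<alpha> japanese_powr_mono[of "\<alpha>\<^sub>2 - 2 * \<alpha>\<^sub>1" "\<alpha>\<^sub>2 - \<alpha>\<^sub>1" "snd \<rho>"]
      by (simp add: gain_sup_aniso)
  qed
  then have S2: "nabla_pow 3 (linear_symbol X) \<in> symbol_class 3 (\<lambda>\<rho>. (gain aniso \<rho> / gain_sup aniso) powi (- 1)) aniso"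
    by (intro nabla3_linear_symbol_in_symbol_class[of 1]) auto
  show ?thesis
    unfolding assumption_B_def
  proof (intro conjI)
    show "\<exists>\<phi>. hamiltonian_flow (linear_symbol X) \<phi> \<and>
        bdd_above (range (tensor_norm aniso 2 (lie_derivative_metric \<phi> aniso))) \<and>
        (\<exists>\<Upsilon>\<ge>0. \<exists>C>0. \<forall>\<rho> t \<zeta>. aniso (\<phi> t \<rho>) \<zeta> \<zeta> \<le> C\<^sup>2 * exp (2 * \<Upsilon> * \<bar>t\<bar>) * aniso \<rho> \<zeta> \<zeta>)"
      using \<Phi> lie_derivative_aniso_bounded[OF \<Phi>0 \<Phi>'] aniso_flow_growth[OF \<Phi>0 \<Phi>'] by blast
    show "\<exists>\<epsilon>. 0 < \<epsilon> \<and> \<epsilon> \<le> 1/2 \<and> nabla_pow 3 (linear_symbol X) \<in>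
        symbol_class 3 (\<lambda>\<rho>. (theta e aniso \<rho> * sqrt (gain_sup aniso)) powr (- \<epsilon>) *
          (gain aniso \<rho> / gain_sup aniso) powi (- 3)) aniso \<inter>
        symbol_class 3 (\<lambda>\<rho>. (gain aniso \<rho> / gain_sup aniso) powi (- 1)) aniso"
      by (intro exI[of _ "1/2"] conjI IntI S1 S2) auto
  qed (rule admissible_aniso)
qed

end

end

section \<open>Schwartz functions\<close>

definition japanese_weights :: "('a::real_normed_vector \<Rightarrow> real) set" where
  "japanese_weights = range (\<lambda>N x. japanese x ^ N)"

abbreviation rapid :: "('a::real_normed_vector \<Rightarrow> 'b::real_normed_vector) \<Rightarrow> bool" where
  "rapid \<equiv> tame japanese_weights"

abbreviation bounded_smooth :: "('a::real_normed_vector \<Rightarrow> 'b::real_normed_vector) \<Rightarrow> bool" where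
  "bounded_smooth \<equiv> tame {\<lambda>x. 1}"

lemma japanese_weights_nonneg: "w \<in> japanese_weights \<Longrightarrow> 0 \<le> w x"
  using japanese_pos[of x] by (auto simp: japanese_weights_def intro: less_imp_le)

lemma rapid_imp_bounded_smooth: "rapid f \<Longrightarrow> bounded_smooth f"
proof (erule tame_mono)
  have "(\<lambda>x. 1) = (\<lambda>x::'a. japanese x ^ 0)" by simp
  then show "{\<lambda>x::'a. 1} \<subseteq> japanese_weights" unfolding japanese_weights_def by blast
qed

lemma rapid_decay:
  fixes f :: "'a::real_normed_vector \<Rightarrow> 'b::real_normed_vector"
  assumes "rapid f"
  shows "\<exists>C\<ge>0. \<forall>x. norm (f x) * japanese x ^ N \<le> C"
proof -
  from assms obtain C where C: "\<forall>x. norm (f x) * japanese x ^ N \<le> C"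
    using tame_bounded[of japanese_weights f "\<lambda>x. japanese x ^ N"] by (auto simp: japanese_weights_def)
  have "0 \<le> norm (f 0) * japanese (0::'a) ^ N"
    by (simp add: japanese_def)
  also have "\<dots> \<le> C" using C by blast
  finally show ?thesis using C by blast
qed

text \<open>The seminorms take suprema over unit directions, tameness fixes the directions; in
  finite dimension the two conditions agree.\<close>

lemma schwartz_iff_rapid: "u \<in> schwartz \<longleftrightarrow> rapid u"
proof
  assume "u \<in> schwartz"
  then have u: "smooth u" "bdd_above (range (\<lambda>x. japanese x ^ N * tensor_norm (\<lambda>_. inner) k (nabla_pow k u) x))" for N k
    by (auto simp: schwartz_def schwartz_weighted_def[abs_def])
  show "rapid u"
  proof (rule tame_if_tensor_norm[OF u(1)])
    show "bdd_above (range (\<lambda>x. w x * tensor_norm (\<lambda>_. inner) k (nabla_pow k u) x))"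
      if "w \<in> japanese_weights" for k w
      using that u(2) by (auto simp: japanese_weights_def)
  qed (rule japanese_weights_nonneg)
next
  assume u: "rapid u"
  have "bdd_above (range (schwartz_weighted N k u))" for N k
    unfolding schwartz_weighted_def[abs_def]
  proof (rule tensor_norm_le_if_tame[OF u])
    show "(\<lambda>x. japanese x ^ N) \<in> japanese_weights" by (auto simp: japanese_weights_def)
    then show "0 \<le> japanese x ^ N" for x :: 'a by (rule japanese_weights_nonneg)
  qed
  then show "u \<in> schwartz" using tame_smooth[OF u] by (simp add: schwartz_def)
qed

lemma le_schwartz_seminorm:
  assumes "u \<in> schwartz"
  shows "cmod (u x) * japanese x ^ N \<le> schwartz_seminorm N 0 u"
proof -
  have "schwartz_weighted N 0 u x \<le> schwartz_seminorm N 0 u"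
    unfolding schwartz_seminorm_def using assms by (intro cSup_upper) (auto simp: schwartz_def)
  then show ?thesis by (simp add: schwartz_weighted_def tensor_norm_def nabla_pow_def mult.commute)
qed

lemma schwartz_seminorm_nonneg:
  assumes "u \<in> schwartz"
  shows "0 \<le> schwartz_seminorm N k u"
proof -
  have "0 \<le> tensor_norm (\<lambda>_. inner) k (nabla_pow k u) 0"
    using order_trans[OF norm_ge_zero tensor_norm_iter_ddir_le[of u "replicate k 0" k 0]] assms
    by (simp add: schwartz_def)
  then have "0 \<le> schwartz_weighted N k u 0" by (simp add: schwartz_weighted_def japanese_def)
  also have "\<dots> \<le> schwartz_seminorm N k u"
    unfolding schwartz_seminorm_def using assms by (intro cSup_upper) (auto simp: schwartz_def)
  finally show ?thesis .
qed

lemma rapid_add: "rapid f \<Longrightarrow> rapid g \<Longrightarrow> rapid (\<lambda>x. f x + g x)"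
  by (rule tame_add)

lemma rapid_sum: "(\<And>i. i \<in> I \<Longrightarrow> rapid (f i)) \<Longrightarrow> rapid (\<lambda>x. \<Sum>i\<in>I. f i x)"
  by (rule tame_sum)

lemma rapid_linear: "bounded_linear T \<Longrightarrow> rapid f \<Longrightarrow> rapid (\<lambda>x. T (f x))"
  by (rule tame_bounded_linear) (auto intro: japanese_weights_nonneg)

lemma bounded_smooth_linear: "bounded_linear T \<Longrightarrow> bounded_smooth f \<Longrightarrow> bounded_smooth (\<lambda>x. T (f x))"
  by (rule tame_bounded_linear) auto

lemma rapid_mult:
  fixes f g :: "_ \<Rightarrow> 'b::real_normed_algebra"
  shows "rapid f \<Longrightarrow> bounded_smooth g \<Longrightarrow> rapid (\<lambda>x. f x * g x)"
  by (rule tame_bilinear[OF bounded_bilinear_mult])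

lemma rapid_mult_left:
  fixes f g :: "_ \<Rightarrow> complex"
  shows "bounded_smooth f \<Longrightarrow> rapid g \<Longrightarrow> rapid (\<lambda>x. f x * g x)"
  using rapid_mult[of g f] by (simp add: mult.commute)

lemma japanese_scale:
  assumes "c \<noteq> 0"
  shows "\<exists>K>0. \<forall>x. japanese x \<le> K * japanese (c *\<^sub>R x + x0)"
proof -
  define M where "M = max 1 (1 / \<bar>c\<bar>)"
  have "japanese x \<le> M * (2 * (japanese (c *\<^sub>R x + x0) * japanese x0))" for x
  proof -
    have "norm x \<le> M * norm (c *\<^sub>R x)"
    proof -
      have "1 / \<bar>c\<bar> * norm (c *\<^sub>R x) \<le> M * norm (c *\<^sub>R x)" by (intro mult_right_mono) (auto simp: M_def)
      then show ?thesis using assms by simp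
    qed
    then have "japanese x \<le> M * japanese (c *\<^sub>R x)" by (intro japanese_le_if_norm_le) (auto simp: M_def)
    also have "\<dots> \<le> M * (2 * (japanese (c *\<^sub>R x + x0) * japanese x0))"
      using japanese_diff_le[of "c *\<^sub>R x + x0" x0] by (intro mult_left_mono) (auto simp: M_def)
    finally show ?thesis .
  qed
  moreover have "0 < M * (2 * japanese x0)" using japanese_pos[of x0] by (auto simp: M_def)
  ultimately show ?thesis by (intro exI[of _ "M * (2 * japanese x0)"]) (auto simp: mult_ac)
qed

lemma ddir_scale:
  assumes "smooth f"
  shows "ddir v (\<lambda>x. f (c *\<^sub>R x + x0)) = (\<lambda>x. c *\<^sub>R ddir v f (c *\<^sub>R x + x0))"
proof
  fix x
  show "ddir v (\<lambda>x. f (c *\<^sub>R x + x0)) x = c *\<^sub>R ddir v f (c *\<^sub>R x + x0)"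
    using ddir_affine(2)[OF bounded_linear_scaleR_right smooth_differentiable[OF assms], of v c x0 x]
      ddir_vec(2)[OF smooth_differentiable[OF assms]] by simp
qed

lemma rapid_scale:
  assumes f: "rapid f" and c: "c \<noteq> 0"
  shows "rapid (\<lambda>x. f (c *\<^sub>R x + x0))"
proof -
  let ?S = "{\<lambda>x. f (c *\<^sub>R x + x0) |f. rapid f}"
  have "(\<lambda>x. f (c *\<^sub>R x + x0)) \<in> ?S" using f by blast
  then show ?thesis
  proof (rule tame_coinduct)
    fix g :: "'a \<Rightarrow> 'b" and x v and w :: "'a \<Rightarrow> real" assume "g \<in> ?S"
    then obtain f where g: "g = (\<lambda>x. f (c *\<^sub>R x + x0))" and f: "rapid f" by blast
    show "g differentiable (at x)"
      unfolding g using smooth_affine[OF bounded_linear_scaleR_right tame_smooth[OF f]] smooth_differentiable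
      by blast
    have "ddir v g = (\<lambda>x. (\<lambda>y. c *\<^sub>R ddir v f y) (c *\<^sub>R x + x0))"
      unfolding g ddir_scale[OF tame_smooth[OF f]] ..
    moreover have "rapid (\<lambda>y. c *\<^sub>R ddir v f y)"
      by (rule rapid_linear[OF bounded_linear_scaleR_right tame_ddir[OF f]])
    ultimately show "ddir v g \<in> ?S" by (intro CollectI exI[of _ "\<lambda>y. c *\<^sub>R ddir v f y"]) simp
    assume "w \<in> japanese_weights"
    then obtain N where w: "w = (\<lambda>x. japanese x ^ N)" by (auto simp: japanese_weights_def)
    obtain C where C: "\<And>x. norm (f x) * japanese x ^ N \<le> C" using rapid_decay[OF f, of N] by blast
    obtain K where K: "0 < K" "\<And>x. japanese x \<le> K * japanese (c *\<^sub>R x + x0)"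
      using japanese_scale[OF c, of x0] by blast
    have "norm (g x) * w x \<le> K ^ N * C" for x
    proof -
      have "norm (g x) * w x \<le> norm (g x) * (K * japanese (c *\<^sub>R x + x0)) ^ N"
        unfolding w using K japanese_pos[of x] by (intro mult_left_mono power_mono) (auto intro: less_imp_le)
      also have "\<dots> = K ^ N * (norm (f (c *\<^sub>R x + x0)) * japanese (c *\<^sub>R x + x0) ^ N)"
        by (simp add: g power_mult_distrib)
      also have "\<dots> \<le> K ^ N * C" using K by (intro mult_left_mono C) auto
      finally show ?thesis .
    qed
    then show "\<exists>C. \<forall>x. norm (g x) * w x \<le> C" by blast
  qed
qed

section \<open>Integrals of rapidly decaying functions\<close>

lemma integrable_japanese: "integrable lborel (\<lambda>x::'a::euclidean_space. inverse (japanese x ^ (DIM('a) + 2)))"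
proof -
  have "integrable lborel (\<lambda>x::'a. complex_of_real (inverse (japanese x ^ (DIM('a) + 2))))"
  proof (rule integrable_lborel_if_decay)
    show "continuous_on UNIV (\<lambda>x::'a. complex_of_real (inverse (japanese x ^ (DIM('a) + 2))))"
      using japanese_pos unfolding japanese_def
      by (intro continuous_intros) (auto simp: add_nonneg_eq_0_iff)
    show "cmod (complex_of_real (inverse (japanese x ^ (DIM('a) + 2)))) * japanese x ^ (DIM('a) + 2) \<le> 1" for x :: 'a
    proof -
      have "cmod (complex_of_real (inverse a)) * a = 1" if "0 < a" for a
        using that by (simp add: norm_inverse)
      from this[OF zero_less_power[OF japanese_pos[of x]]] show ?thesis by (rule eq_refl)
    qed
  qed
  then show ?thesis using complex_of_real_integrable_eq by blast
qed

text \<open>Comparison with one fixed integrable function bounds the integral linearly in C. This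
  makes the distribution of the symbol continuous and keeps integrated Taylor remainders of second
  order.\<close>

lemma integrable_if_decay:
  fixes f :: "'a::euclidean_space \<Rightarrow> 'b::{banach, second_countable_topology}"
  assumes "f \<in> borel_measurable borel" and C: "\<And>x. norm (f x) * japanese x ^ (DIM('a) + 2) \<le> C"
  shows "integrable lborel f" "norm (LINT x|lborel. f x) \<le> C * (LINT x|lborel. inverse (japanese (x::'a) ^ (DIM('a) + 2)))"
proof -
  have int: "integrable lborel (\<lambda>x::'a. C * inverse (japanese x ^ (DIM('a) + 2)))"
    by (intro integrable_mult_right integrable_japanese)
  have le: "norm (f x) \<le> C * inverse (japanese x ^ (DIM('a) + 2))" for x
    using C[of x] japanese_pos[of x] by (simp add: field_simps)
  show "integrable lborel f"
    by (rule Bochner_Integration.integrable_bound[OF int])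
      (use assms(1) le order_trans[OF le abs_ge_self] in auto)
  have "norm (LINT x|lborel. f x) \<le> (LINT x|lborel. C * inverse (japanese (x::'a) ^ (DIM('a) + 2)))"
    by (rule Bochner_Integration.integral_norm_bound_integral[OF \<open>integrable lborel f\<close> int]) (rule le)
  then show "norm (LINT x|lborel. f x) \<le> C * (LINT x|lborel. inverse (japanese (x::'a) ^ (DIM('a) + 2)))"
    by simp
qed

lemma japanese_integral_nonneg: "0 \<le> (LINT x|lborel. inverse (japanese (x::'a::euclidean_space) ^ (DIM('a) + 2)))"
  by (intro Bochner_Integration.integral_nonneg) (intro inverse_nonnegative_iff_nonnegative[THEN iffD2] zero_le_power less_imp_le japanese_pos)

lemma smooth_borel: "smooth f \<Longrightarrow> f \<in> borel_measurable borel"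
  for f :: "'a::euclidean_space \<Rightarrow> 'b::real_normed_vector"
  by (intro borel_measurable_continuous_onI smooth_continuous)

lemma rapid_integrable:
  fixes f :: "'a::euclidean_space \<Rightarrow> 'b::{banach, second_countable_topology}"
  assumes f: "rapid f"
  shows "integrable lborel f"
proof -
  obtain C where "\<And>x. norm (f x) * japanese x ^ (DIM('a) + 2) \<le> C"
    using rapid_decay[OF f, of "DIM('a) + 2"] by blast
  then show ?thesis by (intro integrable_if_decay(1)[OF smooth_borel[OF tame_smooth[OF f]]])
qed

text \<open>The uniform decay of the second order Taylor remainder allows differentiation under the
  integral sign without any appeal to dominated convergence.\<close>

lemma rapid_taylor:
  fixes f :: "'a::euclidean_space \<Rightarrow> 'b::real_normed_vector"
  assumes f: "rapid f"
  shows "\<exists>C\<ge>0. \<forall>x h. norm h \<le> 1 \<longrightarrow> norm (f (x + h) - f x - ddir h f x) * japanese x ^ N \<le> C * (norm h)\<^sup>2"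
proof -
  have w: "(\<lambda>x::'a. japanese x ^ N) \<in> japanese_weights" by (auto simp: japanese_weights_def)
  obtain A where A: "0 \<le> A" "\<And>vs x r. length vs = 2 \<Longrightarrow> 0 < r \<Longrightarrow> \<forall>v\<in>set vs. norm v \<le> r \<Longrightarrow>
      norm (iter_ddir vs f x) * japanese x ^ N \<le> A * r\<^sup>2"
    using tame_uniform_norm[OF f w japanese_weights_nonneg[OF w], of 2] by blast
  \<comment> \<open>The constant 4 is the 2 of \<open>japanese_diff_le\<close> times the bound 2 for
    the bracket of a vector of norm at most 1: weights at x and on the segment are
    comparable.\<close>
  have "norm (f (x + h) - f x - ddir h f x) * japanese x ^ N \<le> (4 ^ N * A) * (norm h)\<^sup>2" if h: "norm h \<le> 1" for x h
  proof (cases "h = 0")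
    case True
    then show ?thesis using ddir_vec(2)[OF smooth_differentiable[OF tame_smooth[OF f]], of 0 h x] by simp
  next
    case False
    have "norm (f (x + h) - f x - ddir h f x) \<le> 4 ^ N * A * (norm h)\<^sup>2 / japanese x ^ N"
    proof (rule segment_taylor[OF tame_smooth[OF f]])
      fix s :: real assume s: "0 \<le> s" "s \<le> 1"
      let ?y = "x + s *\<^sub>R h"
      have "norm (s *\<^sub>R h) \<le> 1" using s h by (simp add: mult_le_one)
      then have "japanese (s *\<^sub>R h) \<le> sqrt (1 + 1)"
        unfolding japanese_def by (intro real_sqrt_le_mono add_left_mono power_le_one) auto
      also have "\<dots> \<le> 2" using sqrt2_less_2 by simp
      finally have 2: "japanese (s *\<^sub>R h) \<le> 2" .
      have "japanese x \<le> 2 * (japanese ?y * japanese (s *\<^sub>R h))"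
        using japanese_diff_le[of ?y "s *\<^sub>R h"] by simp
      also have "\<dots> \<le> 4 * japanese ?y"
        using mult_left_mono[OF 2, of "japanese ?y"] japanese_pos[of ?y] by simp
      finally have "japanese x ^ N \<le> (4 * japanese ?y) ^ N"
        using japanese_pos[of x] by (intro power_mono) auto
      then have "norm (ddir h (ddir h f) ?y) * japanese x ^ N \<le>
          norm (ddir h (ddir h f) ?y) * (4 * japanese ?y) ^ N"
        by (intro mult_left_mono) auto
      also have "\<dots> = 4 ^ N * (norm (iter_ddir [h, h] f ?y) * japanese ?y ^ N)"
        by (simp add: power_mult_distrib)
      also have "\<dots> \<le> 4 ^ N * (A * (norm h)\<^sup>2)"
        using False by (intro mult_left_mono A(2)) auto
      finally show "norm (ddir h (ddir h f) ?y) \<le> 4 ^ N * A * (norm h)\<^sup>2 / japanese x ^ N"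
        using japanese_pos[of x] by (simp add: pos_le_divide_eq)
    qed
    then show ?thesis using japanese_pos[of x] by (simp add: pos_le_divide_eq)
  qed
  then show ?thesis using A(1) by (intro exI[of _ "4 ^ N * A"]) auto
qed

lemma ddir_borel:
  fixes f :: "'a::euclidean_space \<Rightarrow> 'b::real_normed_vector"
  shows "smooth f \<Longrightarrow> ddir v f \<in> borel_measurable borel"
  by (intro smooth_borel smooth_ddir)

text \<open>By translation invariance the integral of f (x + t a) - f x vanishes, so t times the
  integral of the derivative equals minus the integral of a Taylor remainder of order t^2. A nonzero
  integral is contradicted by small t.\<close>

lemma integral_ddir_eq_0:
  fixes f :: "'a::euclidean_space \<Rightarrow> complex"
  assumes f: "rapid f"
  shows "(LINT x|lborel. ddir a f x) = 0"
proof (rule ccontr)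
  assume nz: "(LINT x|lborel. ddir a f x) \<noteq> 0"
  let ?I = "LINT x|lborel. ddir a f x"
  let ?B = "LINT x|lborel. inverse (japanese (x::'a) ^ (DIM('a) + 2))"
  obtain C where C: "0 \<le> C" "\<And>x h. norm h \<le> 1 \<Longrightarrow>
      norm (f (x + h) - f x - ddir h f x) * japanese x ^ (DIM('a) + 2) \<le> C * (norm h)\<^sup>2"
    using rapid_taylor[OF f, of "DIM('a) + 2"] by blast
  have f_borel: "f \<in> borel_measurable borel" by (rule smooth_borel[OF tame_smooth[OF f]])
  have shift: "integrable lborel (\<lambda>x. f (x + h))" for h
    using rapid_integrable[OF rapid_scale[OF f, of 1 h]] by simp
  have small: "t * norm ?I \<le> C * (norm (t *\<^sub>R a))\<^sup>2 * ?B" if t: "0 < t" "norm (t *\<^sub>R a) \<le> 1" for t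
  proof -
    have "(LINT x|lborel. f (x + t *\<^sub>R a) - f x - t *\<^sub>R ddir a f x) = - (t *\<^sub>R ?I)"
      using shift rapid_integrable[OF f] rapid_integrable[OF tame_ddir[OF f]] integral_lborel_translate[OF f_borel]
      by simp
    moreover have "norm (LINT x|lborel. f (x + t *\<^sub>R a) - f x - t *\<^sub>R ddir a f x) \<le> C * (norm (t *\<^sub>R a))\<^sup>2 * ?B"
    proof (rule integrable_if_decay(2))
      show "(\<lambda>x. f (x + t *\<^sub>R a) - f x - t *\<^sub>R ddir a f x) \<in> borel_measurable borel"
        using f_borel ddir_borel[OF tame_smooth[OF f]] by measurable
      show "norm (f (x + t *\<^sub>R a) - f x - t *\<^sub>R ddir a f x) * japanese x ^ (DIM('a) + 2) \<le> C * (norm (t *\<^sub>R a))\<^sup>2" for x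
        using C(2)[OF t(2), of x] ddir_vec(2)[OF smooth_differentiable[OF tame_smooth[OF f]], of t a x] by simp
    qed
    ultimately show ?thesis using t(1) by simp
  qed
  define D where "D = C * (norm a)\<^sup>2 * ?B + 1"
  have D: "0 < D" unfolding D_def using C(1) japanese_integral_nonneg[where 'a = 'a]
    by (intro add_nonneg_pos mult_nonneg_nonneg) auto
  \<comment> \<open>The first entry keeps t a in the unit ball, where the remainder estimate holds;
    the second leaves at most half of the assumed nonzero modulus.\<close>
  define t where "t = min (1 / (norm a + 1)) (norm ?I / (2 * D))"
  have a1: "0 < norm a + 1" by (simp add: add_nonneg_pos)
  have t: "0 < t" unfolding t_def using nz D a1 by simp
  have "t * norm a \<le> 1 / (norm a + 1) * norm a" by (intro mult_right_mono) (auto simp: t_def)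
  also have "\<dots> \<le> 1" using a1 by (simp add: pos_divide_le_eq)
  finally have "norm (t *\<^sub>R a) \<le> 1" using t by simp
  from small[OF t this] have "t * norm ?I \<le> t * (t * (C * (norm a)\<^sup>2 * ?B))"
    by (simp add: power_mult_distrib power2_eq_square mult_ac)
  then have "norm ?I \<le> t * (C * (norm a)\<^sup>2 * ?B)" using t by simp
  also have "\<dots> \<le> t * D" using t by (intro mult_left_mono) (auto simp: D_def)
  also have "\<dots> \<le> norm ?I / (2 * D) * D" using D by (intro mult_right_mono) (auto simp: t_def)
  also have "\<dots> = norm ?I / 2" using D by simp
  finally show False using nz by simp
qed

lemma ddir_mult:
  fixes f g :: "'a::euclidean_space \<Rightarrow> complex"
  assumes "smooth f" "smooth g"
  shows "ddir v (\<lambda>x. f x * g x) = (\<lambda>x. f x * ddir v g x + ddir v f x * g x)"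
  by (rule ext) (rule ddir_bilinear(2)[OF bounded_bilinear_mult assms[THEN smooth_differentiable]])

lemma integration_by_parts:
  fixes f g :: "'a::euclidean_space \<Rightarrow> complex"
  assumes f: "rapid f" and g: "bounded_smooth g"
  shows "(LINT x|lborel. ddir a f x * g x) = - (LINT x|lborel. f x * ddir a g x)"
proof -
  have "0 = (LINT x|lborel. f x * ddir a g x + ddir a f x * g x)"
    using integral_ddir_eq_0[OF rapid_mult[OF f g], of a] ddir_mult[OF tame_smooth[OF f] tame_smooth[OF g], of a]
    by simp
  also have "\<dots> = (LINT x|lborel. f x * ddir a g x) + (LINT x|lborel. ddir a f x * g x)"
    by (intro Bochner_Integration.integral_add rapid_integrable rapid_mult tame_ddir f g)
  finally show ?thesis by (simp add: eq_neg_iff_add_eq_0 add.commute)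
qed

section \<open>Gaussians\<close>

text \<open>Differentiation multiplies the Gaussian by a coordinate, so its polynomial multiples are
  stable. Decay of all of them reduces to that of the Gaussian itself, as a coordinate costs one
  power of the bracket.\<close>

lemma rapid_exp_square:
  assumes a: "0 < a"
  shows "rapid (\<lambda>x::'a::euclidean_space. exp (- (a * (x \<bullet> x))))"
proof -
  let ?E = "\<lambda>x::'a. exp (- (a * (x \<bullet> x)))"
  have d: "(?E has_derivative (\<lambda>v. (- 2 * a) * ((x \<bullet> v) * ?E x))) (at x)" for x
    by (auto intro!: derivative_eq_intros simp: inner_commute algebra_simps)
  have F: "f differentiable (at x)" "ddir v f \<in> poly_span {?E}" if "f \<in> {?E}" for f x v
  proof -
    show "f differentiable (at x)" using that d differentiableI by blast
    have "ddir v ?E = (\<lambda>x. (- 2 * a) * ((x \<bullet> v) * ?E x))" by (rule ext, rule ddir_eqI[OF d])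
    also have "\<dots> \<in> poly_span {?E}"
      by (intro poly_span.scale poly_span.coord poly_span.base) simp
    finally show "ddir v f \<in> poly_span {?E}" using that by simp
  qed
  have bound: "\<forall>N. \<exists>C. \<forall>x. \<bar>f x\<bar> * japanese x ^ N \<le> C" if "f \<in> poly_span {?E}" for f
    using that
  proof induction
    case (base f)
    show ?case
    proof
      fix N :: nat
      \<comment> \<open>Decay comes from (1 + t / n)^n \<le> exp t with t = a (x \<bullet> x) and n
        = Suc N, which is never 0. M is chosen so that 1 + x \<bullet> x \<le> M (1 + t /
        n).\<close>
      define M where "M = max 1 (real (Suc N) / a)"
      have "\<bar>?E x\<bar> * japanese x ^ N \<le> M ^ Suc N" for x
      proof -
        let ?q = "x \<bullet> x"
        have q: "0 \<le> ?q" by simp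
        have "japanese x ^ N \<le> japanese x ^ (2 * Suc N)"
          by (intro power_increasing japanese_ge_1) simp
        also have "\<dots> = (1 + ?q) ^ Suc N"
          by (simp only: power_mult japanese_sq power2_norm_eq_inner)
        also have "\<dots> \<le> (M * (1 + a * ?q / real (Suc N))) ^ Suc N"
        proof (rule power_mono)
          have "?q = real (Suc N) / a * (a * ?q / real (Suc N))" using a by simp
          also have "\<dots> \<le> M * (a * ?q / real (Suc N))"
            using a q by (intro mult_right_mono) (auto simp: M_def)
          finally show "1 + ?q \<le> M * (1 + a * ?q / real (Suc N))"
            by (simp add: M_def distrib_left)
        qed (use q in auto)
        also have "\<dots> = M ^ Suc N * (1 + a * ?q / real (Suc N)) ^ Suc N" by (rule power_mult_distrib)
        also have "\<dots> \<le> M ^ Suc N * exp (a * ?q)"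
        proof (rule mult_left_mono)
          have "0 \<le> a * ?q" using a q by simp
          then have "- real (Suc N) \<le> a * ?q" by linarith
          from exp_ge_one_plus_x_over_n_power_n[OF this]
          show "(1 + a * ?q / real (Suc N)) ^ Suc N \<le> exp (a * ?q)" by simp
        qed (simp add: M_def)
        finally have "?E x * japanese x ^ N \<le> ?E x * (M ^ Suc N * exp (a * ?q))"
          by (intro mult_left_mono) auto
        also have "\<dots> = M ^ Suc N" by (simp add: exp_minus)
        finally show ?thesis by simp
      qed
      then show "\<exists>C. \<forall>x. \<bar>f x\<bar> * japanese x ^ N \<le> C" using base by auto
    qed
  next
    case (coord f v)
    show ?case
    proof
      fix N
      obtain C where C: "\<And>x. \<bar>f x\<bar> * japanese x ^ Suc N \<le> C" using coord.IH by blast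
      have "\<bar>(x \<bullet> v) * f x\<bar> * japanese x ^ N \<le> norm v * C" for x
      proof -
        have "\<bar>x \<bullet> v\<bar> \<le> japanese x * norm v"
          using Cauchy_Schwarz_ineq2[of x v] mult_right_mono[OF norm_le_japanese[of x] norm_ge_zero[of v]] by linarith
        then have "\<bar>x \<bullet> v\<bar> * (\<bar>f x\<bar> * japanese x ^ N) \<le> (japanese x * norm v) * (\<bar>f x\<bar> * japanese x ^ N)"
          using japanese_pos[of x] by (intro mult_right_mono) auto
        also have "\<dots> = norm v * (\<bar>f x\<bar> * japanese x ^ Suc N)" by simp
        also have "\<dots> \<le> norm v * C" by (intro mult_left_mono C) simp
        finally show ?thesis by (simp add: abs_mult mult.assoc)
      qed
      then show "\<exists>C. \<forall>x. \<bar>(x \<bullet> v) * f x\<bar> * japanese x ^ N \<le> C" by blast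
    qed
  next
    case (scale f c)
    show ?case
    proof
      fix N
      obtain C where C: "\<And>x. \<bar>f x\<bar> * japanese x ^ N \<le> C" using scale.IH by blast
      have "\<bar>c * f x\<bar> * japanese x ^ N \<le> \<bar>c\<bar> * C" for x
        using mult_left_mono[OF C[of x] abs_ge_zero[of c]] by (simp add: abs_mult mult.assoc)
      then show "\<exists>C. \<forall>x. \<bar>c * f x\<bar> * japanese x ^ N \<le> C" by blast
    qed
  next
    case (add f g)
    show ?case
    proof
      fix N
      obtain C where C: "\<And>x. \<bar>f x\<bar> * japanese x ^ N \<le> C" using add.IH(1) by blast
      obtain D where D: "\<And>x. \<bar>g x\<bar> * japanese x ^ N \<le> D" using add.IH(2) by blast
      have "\<bar>f x + g x\<bar> * japanese x ^ N \<le> C + D" for x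
      proof -
        have "\<bar>f x + g x\<bar> * japanese x ^ N \<le> (\<bar>f x\<bar> + \<bar>g x\<bar>) * japanese x ^ N"
          using japanese_pos[of x] by (intro mult_right_mono abs_triangle_ineq) auto
        then show ?thesis using C[of x] D[of x] by (simp add: distrib_right)
      qed
      then show "\<exists>C. \<forall>x. \<bar>f x + g x\<bar> * japanese x ^ N \<le> C" by blast
    qed
  qed
  have "?E \<in> poly_span {?E}" by (intro poly_span.base) simp
  then show ?thesis
    by (rule tame_coinduct)
      (use poly_span_ddir[OF F] bound in \<open>auto simp: japanese_weights_def\<close>)
qed

definition gaussian :: "'a::euclidean_space \<Rightarrow> real" where
  "gaussian x = (1 / sqrt (2 * pi)) ^ DIM('a) * exp (- (x \<bullet> x) / 2)"

lemma gaussian_pos: "0 < gaussian x"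
  by (simp add: gaussian_def)

lemma gaussian_rapid: "rapid (gaussian :: 'a::euclidean_space \<Rightarrow> real)"
  using rapid_linear[OF bounded_linear_mult_right[of "(1 / sqrt (2 * pi)) ^ DIM('a)"] rapid_exp_square[of "1/2"]]
  by (simp add: gaussian_def[abs_def])

lemma integral_scale:
  fixes f :: "'a::euclidean_space \<Rightarrow> 'b::{banach, second_countable_topology}"
  assumes [measurable]: "f \<in> borel_measurable borel" and c: "0 < c"
  shows "(LINT x|lborel. f (c *\<^sub>R x)) = (1 / c ^ DIM('a)) *\<^sub>R (LINT x|lborel. f x)"
proof -
  have "(LINT x|lborel. f x) = (LINT x|density (distr lborel borel (\<lambda>x. 0 + c *\<^sub>R x)) (\<lambda>_. ennreal (\<bar>c\<bar> ^ DIM('a))). f x)"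
    using lborel_affine[of c "0::'a"] c by simp
  also have "\<dots> = (LINT x|distr lborel borel (\<lambda>x. 0 + c *\<^sub>R x). (c ^ DIM('a)) *\<^sub>R f x)"
    using c by (subst integral_density) auto
  also have "\<dots> = (LINT x|lborel. (c ^ DIM('a)) *\<^sub>R f (0 + c *\<^sub>R x))"
    by (subst integral_distr) simp_all
  also have "\<dots> = (c ^ DIM('a)) *\<^sub>R (LINT x|lborel. f (c *\<^sub>R x))"
    by simp
  finally show ?thesis using c by simp
qed

text \<open>The integrand factors over the coordinates, and each factor is the characteristic
  function of the standard normal distribution.\<close>

lemma gaussian_fourier:
  fixes \<xi> :: "'a::euclidean_space"
  shows "(LINT z|lborel. exp (\<i> * of_real (\<xi> \<bullet> z)) * of_real (gaussian z)) = of_real (exp (- (\<xi> \<bullet> \<xi>) / 2))"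
proof -
  let ?h = "\<lambda>b t. exp (\<i> * of_real ((\<xi> \<bullet> b) * t)) * complex_of_real (std_normal_density t)"
  interpret product_sigma_finite "\<lambda>_::'a. lborel :: real measure" ..
  have prod: "exp (\<i> * of_real (\<xi> \<bullet> z)) * of_real (gaussian z) = (\<Prod>b\<in>Basis. ?h b (z \<bullet> b))" for z
  proof -
    have "(\<Prod>b\<in>Basis. exp (\<i> * of_real ((\<xi> \<bullet> b) * (z \<bullet> b)))) = exp (\<i> * of_real (\<xi> \<bullet> z))"
      by (simp add: exp_sum[symmetric] sum_distrib_left[symmetric] euclidean_inner[of \<xi> z])
    moreover have "(\<Prod>b\<in>Basis. std_normal_density (z \<bullet> b)) = gaussian z"
      by (simp add: std_normal_density_def prod_dividef gaussian_def exp_sum power_divide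
          euclidean_inner[of z z] power2_eq_square sum_negf[symmetric] sum_divide_distrib)
    ultimately show ?thesis by (simp add: prod.distrib of_real_prod[symmetric])
  qed
  have meas: "(\<lambda>z::'a. \<Prod>b\<in>Basis. ?h b (z \<bullet> b)) \<in> borel_measurable borel"
    by measurable
  have one: "integrable lborel (?h b)" "(LINT t|lborel. ?h b t) = of_real (exp (- ((\<xi> \<bullet> b)\<^sup>2) / 2))" for b
  proof -
    have int: "integrable lborel (\<lambda>t. std_normal_density t)" by simp
    show "integrable lborel (?h b)"
      by (rule Bochner_Integration.integrable_bound[OF int]) (auto simp: norm_mult)
    have "(LINT t|lborel. ?h b t) = char std_normal_distribution (\<xi> \<bullet> b)"
      unfolding char_def by (subst integral_density) (auto simp: scaleR_conv_of_real mult.commute)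
    then show "(LINT t|lborel. ?h b t) = of_real (exp (- ((\<xi> \<bullet> b)\<^sup>2) / 2))"
      by (simp only: char_std_normal_distribution)
  qed
  have "(LINT z|lborel. (\<Prod>b\<in>Basis. ?h b (z \<bullet> b))) =
      (LINT f|(\<Pi>\<^sub>M b\<in>Basis. lborel). (\<Prod>b\<in>Basis. ?h b ((\<Sum>b\<in>Basis. f b *\<^sub>R b) \<bullet> b)))"
    by (subst lborel_eq, subst integral_distr) (use meas in auto)
  also have "\<dots> = (LINT f|(\<Pi>\<^sub>M b\<in>Basis. lborel). (\<Prod>b\<in>Basis. ?h b (f b)))"
    by (simp cong: prod.cong)
  also have "\<dots> = (\<Prod>b\<in>Basis. (LINT t|lborel. ?h b t))"
    by (rule product_integral_prod) (use one in auto)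
  also have "\<dots> = of_real (\<Prod>b\<in>Basis. exp (- ((\<xi> \<bullet> b)\<^sup>2) / 2))"
    by (simp only: one(2) of_real_prod)
  also have "(\<Prod>b\<in>Basis. exp (- ((\<xi> \<bullet> b)\<^sup>2) / 2)) = exp (- (\<xi> \<bullet> \<xi>) / 2)"
    by (simp add: exp_sum[symmetric] euclidean_inner[of \<xi> \<xi>] power2_eq_square sum_negf[symmetric] sum_divide_distrib)
  finally show ?thesis unfolding prod .
qed

lemma gaussian_integral: "(LINT z|lborel. gaussian (z::'a::euclidean_space)) = 1"
proof -
  have "(LINT z|lborel. complex_of_real (gaussian (z::'a))) = 1"
    using gaussian_fourier[of "0::'a"] by simp
  then show ?thesis by (simp add: of_real_eq_1_iff)
qed

section \<open>Transport operators\<close>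

text \<open>This form of the divergence makes sense in every Euclidean space; for real coordinate
  space \<open>divergence_eq_vdiv\<close> identifies it with the trace of the Jacobian.\<close>

definition vdiv :: "('a::euclidean_space \<Rightarrow> 'a) \<Rightarrow> 'a \<Rightarrow> real" where
  "vdiv X x = (\<Sum>b\<in>Basis. ddir b X x \<bullet> b)"

definition transport :: "('a::euclidean_space \<Rightarrow> 'a) \<Rightarrow> ('a \<Rightarrow> complex) \<Rightarrow> 'a \<Rightarrow> complex" where
  "transport X u x = (1 / \<i>) * ddir (X x) u x + (1 / (2 * \<i>)) * of_real (vdiv X x) * u x"

lemma borel_rapid: "rapid f \<Longrightarrow> f \<in> borel_measurable borel"
  for f :: "'a::euclidean_space \<Rightarrow> 'b::real_normed_vector"
  by (intro smooth_borel tame_smooth)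

context
  fixes X :: "'a::euclidean_space \<Rightarrow> 'a"
  assumes X: "bounded_smooth X"
begin

lemma bounded_smooth_component: "bounded_smooth (\<lambda>x. complex_of_real (X x \<bullet> b))"
  by (intro bounded_smooth_linear[OF bounded_linear_of_real] bounded_smooth_linear[OF bounded_linear_inner_left] X)

lemma bounded_smooth_vdiv: "bounded_smooth (\<lambda>x. complex_of_real (vdiv X x))"
  unfolding vdiv_def
  by (intro bounded_smooth_linear[OF bounded_linear_of_real] tame_sum
      bounded_smooth_linear[OF bounded_linear_inner_left] tame_ddir X)

lemma ddir_along:
  assumes "rapid u"
  shows "ddir (X x) u x = (\<Sum>b\<in>Basis. complex_of_real (X x \<bullet> b) * ddir b u x)"
  by (simp add: ddir_expand[OF smooth_differentiable[OF tame_smooth[OF assms]], of "X x"] scaleR_conv_of_real)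

lemma rapid_ddir_along:
  assumes u: "rapid u"
  shows "rapid (\<lambda>x. ddir (X x) u x :: complex)"
  unfolding ddir_along[OF u]
  by (intro rapid_sum rapid_mult_left bounded_smooth_component tame_ddir u)

lemma rapid_vdiv_mult:
  "rapid u \<Longrightarrow> rapid (\<lambda>x. of_real (vdiv X x) * u x :: complex)"
  by (intro rapid_mult_left bounded_smooth_vdiv)

lemma rapid_transport:
  assumes u: "rapid u"
  shows "rapid (transport X u)"
  unfolding transport_def[abs_def] mult.assoc
  by (intro rapid_add rapid_linear[OF bounded_linear_mult_right] rapid_ddir_along rapid_vdiv_mult u)

lemma ddir_along_by_parts:
  fixes u v :: "'a \<Rightarrow> complex"
  assumes u: "rapid u" and v: "rapid v"
  shows "(LINT x|lborel. ddir (X x) u x * v x) =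
    - (LINT x|lborel. u x * (of_real (vdiv X x) * v x + ddir (X x) v x))"
proof -
  let ?Xv = "\<lambda>b x. complex_of_real (X x \<bullet> b) * v x"
  have Xv: "rapid (?Xv b)" for b
    by (intro rapid_mult_left bounded_smooth_component v)
  have dX: "ddir b (\<lambda>x. complex_of_real (X x \<bullet> b')) x = of_real (ddir b X x \<bullet> b')" for b b' x
    using ddir_bounded_linear(2)[OF bounded_linear_compose[OF bounded_linear_of_real bounded_linear_inner_left]
      smooth_differentiable[OF tame_smooth[OF X]], of b b' x] by simp
  have dXv: "ddir b (?Xv b) = (\<lambda>x. of_real (X x \<bullet> b) * ddir b v x + of_real (ddir b X x \<bullet> b) * v x)" for b
    using ddir_mult[OF tame_smooth[OF bounded_smooth_component] tame_smooth[OF v], of b b] by (simp add: dX)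
  have "(LINT x|lborel. ddir (X x) u x * v x) = (LINT x|lborel. (\<Sum>b\<in>Basis. ddir b u x * ?Xv b x))"
    by (simp add: ddir_along[OF u] sum_distrib_left sum_distrib_right mult_ac)
  also have "\<dots> = (\<Sum>b\<in>Basis. (LINT x|lborel. ddir b u x * ?Xv b x))"
    by (intro Bochner_Integration.integral_sum rapid_integrable rapid_mult tame_ddir u rapid_imp_bounded_smooth Xv)
  also have "\<dots> = (\<Sum>b\<in>Basis. - (LINT x|lborel. u x * ddir b (?Xv b) x))"
    by (intro sum.cong refl integration_by_parts u rapid_imp_bounded_smooth Xv)
  also have "\<dots> = - (LINT x|lborel. (\<Sum>b\<in>Basis. u x * ddir b (?Xv b) x))"
    unfolding sum_negf
    by (subst Bochner_Integration.integral_sum)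
      (intro rapid_integrable rapid_mult u rapid_imp_bounded_smooth tame_ddir Xv, rule refl)
  also have "(\<lambda>x. (\<Sum>b\<in>Basis. u x * ddir b (?Xv b) x)) =
      (\<lambda>x. u x * (of_real (vdiv X x) * v x + ddir (X x) v x))"
    unfolding dXv vdiv_def ddir_along[OF v]
    by (simp add: sum_distrib_left sum_distrib_right sum.distrib distrib_left add.commute)
  finally show ?thesis .
qed

text \<open>Integration by parts moves the derivative to v and produces a divergence, which is
  shared equally by the halves in the two operators. For the bilinear pairing a sign remains;
  conjugating 1 / \<i> turns it into symmetry of the sesquilinear one.\<close>

lemma transport_antisymmetric:
  assumes u: "rapid u" and v: "rapid v"
  shows "(LINT x|lborel. transport X u x * v x) = - (LINT x|lborel. u x * transport X v x)"
proof -
  have i1: "integrable lborel (\<lambda>x. ddir (X x) u x * v x)" "integrable lborel (\<lambda>x. u x * ddir (X x) v x)"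
    by (intro rapid_integrable rapid_mult rapid_ddir_along rapid_imp_bounded_smooth u v)+
  have i2: "integrable lborel (\<lambda>x. u x * (of_real (vdiv X x) * v x))"
    by (intro rapid_integrable rapid_mult rapid_vdiv_mult rapid_imp_bounded_smooth u v)
  let ?A = "LINT x|lborel. ddir (X x) u x * v x" and ?B = "LINT x|lborel. u x * ddir (X x) v x"
  let ?D = "LINT x|lborel. u x * (of_real (vdiv X x) * v x)"
  have A: "?A = - (?D + ?B)"
    using ddir_along_by_parts[OF u v] i1 i2 by (simp add: distrib_left)
  have "(LINT x|lborel. transport X u x * v x) = (LINT x|lborel. (1 / \<i>) * (ddir (X x) u x * v x) +
      (1 / (2 * \<i>)) * (u x * (of_real (vdiv X x) * v x)))"
    by (simp add: transport_def algebra_simps)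
  then have T: "(LINT x|lborel. transport X u x * v x) = (1 / \<i>) * ?A + (1 / (2 * \<i>)) * ?D"
    using i1 i2 by simp
  have "(LINT x|lborel. u x * transport X v x) = (LINT x|lborel. (1 / \<i>) * (u x * ddir (X x) v x) +
      (1 / (2 * \<i>)) * (u x * (of_real (vdiv X x) * v x)))"
    by (simp add: transport_def algebra_simps)
  then have T': "(LINT x|lborel. u x * transport X v x) = (1 / \<i>) * ?B + (1 / (2 * \<i>)) * ?D"
    using i1 i2 by simp
  show ?thesis unfolding T T' A by (simp add: field_simps)
qed

text \<open>Averaging with the antisymmetric counterpart cancels the divergence. The result has the
  shape in which the marginals of Wigner functions of derivatives appear.\<close>

lemma transport_pairing:
  assumes u: "rapid u" and v: "rapid v"
  shows "(LINT x|lborel. transport X u x * v x) =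
    (\<i> / 2) * (LINT x|lborel. u x * ddir (X x) v x - ddir (X x) u x * v x)"
proof -
  have i: "integrable lborel (\<lambda>x. transport X u x * v x)" "integrable lborel (\<lambda>x. u x * transport X v x)"
    by (intro rapid_integrable rapid_mult rapid_transport rapid_imp_bounded_smooth u v)+
  have "2 * (LINT x|lborel. transport X u x * v x) = (LINT x|lborel. transport X u x * v x - u x * transport X v x)"
    using transport_antisymmetric[OF u v] i by simp
  also have "\<dots> = (LINT x|lborel. \<i> * (u x * ddir (X x) v x - ddir (X x) u x * v x))"
    by (intro arg_cong[of _ _ "lebesgue_integral lborel"] ext) (simp add: transport_def algebra_simps)
  also have "\<dots> = \<i> * (LINT x|lborel. u x * ddir (X x) v x - ddir (X x) u x * v x)"
    by (rule integral_mult_right_zero)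
  finally show ?thesis by (simp add: eq_divide_eq mult.commute[of _ 2])
qed

end

section \<open>The Wigner function\<close>

lemma half_sum_diff:
  fixes x z :: "'a::real_vector"
  shows "(x + (1/2) *\<^sub>R z) - (x - (1/2) *\<^sub>R z) = z" "(x + (1/2) *\<^sub>R z) + (x - (1/2) *\<^sub>R z) = 2 *\<^sub>R x"
  by (simp_all add: scaleR_add_left[symmetric] scaleR_2)

text \<open>The arguments x + z/2 and x - z/2 have difference z and sum 2 x, so the brackets of x
  and of z are both controlled by the product of the two brackets. Each of u and v thus pays 2 N
  powers.\<close>

lemma wigner_integrand_decay:
  fixes u v :: "'a::euclidean_space \<Rightarrow> complex"
  assumes u: "rapid u" and v: "rapid v"
  shows "\<exists>C\<ge>0. \<forall>x z. cmod (u (x - (1/2) *\<^sub>R z) * v (x + (1/2) *\<^sub>R z)) * (japanese x ^ N * japanese z ^ N) \<le> C"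
proof -
  obtain A where A: "0 \<le> A" "\<And>x. cmod (u x) * japanese x ^ (2 * N) \<le> A" using rapid_decay[OF u] by blast
  obtain B where B: "0 \<le> B" "\<And>x. cmod (v x) * japanese x ^ (2 * N) \<le> B" using rapid_decay[OF v] by blast
  have j0: "0 \<le> japanese (x::'a)" for x using japanese_pos[of x] by simp
  have "cmod (u (x - (1/2) *\<^sub>R z) * v (x + (1/2) *\<^sub>R z)) * (japanese x ^ N * japanese z ^ N) \<le> 4 ^ N * (A * B)" for x z
  proof -
    let ?p = "x + (1/2) *\<^sub>R z" and ?m = "x - (1/2) *\<^sub>R z"
    let ?P = "japanese ?p * japanese ?m"
    have z: "japanese z \<le> 2 * ?P" using japanese_diff_le[of ?p ?m] by (simp only: half_sum_diff)
    have "japanese x \<le> japanese (2 *\<^sub>R x)"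
      unfolding japanese_def by (intro real_sqrt_le_mono add_left_mono power_mono) auto
    also have "\<dots> \<le> 2 * (japanese ?p * japanese (- ?m))"
      using japanese_diff_le[of ?p "- ?m"] unfolding diff_minus_eq_add half_sum_diff(2) .
    also have "japanese (- ?m) = japanese ?m" unfolding japanese_def norm_minus_cancel ..
    finally have x: "japanese x \<le> 2 * ?P" .
    have "japanese x ^ N * japanese z ^ N \<le> (2 * ?P) ^ N * (2 * ?P) ^ N"
      by (intro mult_mono power_mono x z j0 zero_le_power) (auto intro: mult_nonneg_nonneg j0)
    also have "\<dots> = (2 ^ N * 2 ^ N) * (japanese ?p ^ (2 * N) * japanese ?m ^ (2 * N))"
      by (simp add: power_mult_distrib power_even_eq power2_eq_square)
    also have "(2 ^ N * 2 ^ N :: real) = 4 ^ N" by (simp add: power_mult_distrib[symmetric])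
    finally have "cmod (u ?m * v ?p) * (japanese x ^ N * japanese z ^ N) \<le>
        cmod (u ?m * v ?p) * (4 ^ N * (japanese ?p ^ (2 * N) * japanese ?m ^ (2 * N)))"
      by (intro mult_left_mono) auto
    also have "\<dots> = 4 ^ N * ((cmod (u ?m) * japanese ?m ^ (2 * N)) * (cmod (v ?p) * japanese ?p ^ (2 * N)))"
      by (simp add: norm_mult mult_ac)
    also have "\<dots> \<le> 4 ^ N * (A * B)"
      by (intro mult_left_mono mult_mono A B) (auto intro!: mult_nonneg_nonneg zero_le_power j0)
    finally show ?thesis .
  qed
  then show ?thesis using A(1) B(1) by (intro exI[of _ "4 ^ N * (A * B)"]) auto
qed

definition wigner_integrand :: "('a::euclidean_space \<Rightarrow> complex) \<Rightarrow> ('a \<Rightarrow> complex) \<Rightarrow> 'a \<times> 'a \<Rightarrow> 'a \<Rightarrow> complex" where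
  "wigner_integrand u v \<rho> z =
    exp (\<i> * of_real (snd \<rho> \<bullet> z)) * u (fst \<rho> - (1/2) *\<^sub>R z) * v (fst \<rho> + (1/2) *\<^sub>R z)"

lemma wigner_eq:
  "wigner u v \<rho> = of_real (1 / (2 * pi) ^ DIM('a)) * (LINT z|lborel. wigner_integrand u v \<rho> z)"
  for u v :: "'a::euclidean_space \<Rightarrow> complex"
  by (simp add: wigner_def wigner_integrand_def split: prod.split)

lemma continuous_wigner_integrand:
  assumes u: "rapid u" and v: "rapid v"
  shows "continuous_on UNIV (\<lambda>(\<rho>, z). wigner_integrand u v \<rho> z)"
  unfolding wigner_integrand_def case_prod_unfold
  by (intro continuous_intros continuous_on_compose2[OF smooth_continuous[OF tame_smooth[OF u]]]
      continuous_on_compose2[OF smooth_continuous[OF tame_smooth[OF v]]]) auto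

lemma borel_wigner_integrand:
  assumes "rapid u" "rapid v"
  shows "wigner_integrand u v \<rho> \<in> borel_measurable borel"
proof -
  have "continuous_on UNIV (\<lambda>z. (\<lambda>(\<rho>, z). wigner_integrand u v \<rho> z) (\<rho>, z))"
    by (rule continuous_on_compose2[OF continuous_wigner_integrand[OF assms]])
      (auto intro!: continuous_intros)
  then show ?thesis by (intro borel_measurable_continuous_onI) simp
qed

lemma borel_wigner:
  fixes u v :: "'a::euclidean_space \<Rightarrow> complex"
  assumes "rapid u" "rapid v"
  shows "wigner u v \<in> borel_measurable borel"
proof -
  have "(\<lambda>(\<rho>, z). wigner_integrand u v \<rho> z) \<in> borel_measurable (lborel \<Otimes>\<^sub>M lborel)"
    unfolding lborel_prod using borel_measurable_continuous_onI[OF continuous_wigner_integrand[OF assms]] by simp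
  from lborel.borel_measurable_lebesgue_integral[OF this]
  have "(\<lambda>\<rho>. LINT z|lborel. wigner_integrand u v \<rho> z) \<in> borel_measurable borel" by simp
  then show ?thesis unfolding wigner_eq[abs_def] by measurable
qed

lemma wigner_integrand_bound:
  fixes u v :: "'a::euclidean_space \<Rightarrow> complex"
  assumes u: "rapid u" and v: "rapid v"
  shows "\<exists>C\<ge>0. \<forall>\<rho>. integrable lborel (wigner_integrand u v \<rho>) \<and> cmod (wigner u v \<rho>) * japanese (fst \<rho>) ^ N \<le> C"
proof -
  \<comment> \<open>N powers are spent on decay in position and DIM + 2 on integrability in z; one
    exponent covers both.\<close>
  define M where "M = N + (DIM('a) + 2)"
  let ?I = "LINT x|lborel. inverse (japanese (x::'a) ^ (DIM('a) + 2))"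
  obtain C where C: "0 \<le> C" "\<And>x z. cmod (u (x - (1/2) *\<^sub>R z) * v (x + (1/2) *\<^sub>R z)) * (japanese x ^ M * japanese z ^ M) \<le> C"
    using wigner_integrand_decay[OF u v] by blast
  have dec: "cmod (wigner_integrand u v \<rho> z) * japanese z ^ (DIM('a) + 2) \<le> C / japanese (fst \<rho>) ^ N" for \<rho> z
  proof -
    have "japanese (fst \<rho>) ^ N * japanese z ^ (DIM('a) + 2) \<le> japanese (fst \<rho>) ^ M * japanese z ^ M"
      unfolding M_def using japanese_pos
      by (intro mult_mono power_increasing japanese_ge_1 zero_le_power) (auto intro: less_imp_le)
    then have "cmod (wigner_integrand u v \<rho> z) * (japanese (fst \<rho>) ^ N * japanese z ^ (DIM('a) + 2)) \<le>
        cmod (wigner_integrand u v \<rho> z) * (japanese (fst \<rho>) ^ M * japanese z ^ M)"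
      by (intro mult_left_mono) auto
    also have "cmod (wigner_integrand u v \<rho> z) = cmod (u (fst \<rho> - (1/2) *\<^sub>R z) * v (fst \<rho> + (1/2) *\<^sub>R z))"
      by (simp add: wigner_integrand_def norm_mult norm_exp_i_times)
    also have "\<dots> * (japanese (fst \<rho>) ^ M * japanese z ^ M) \<le> C" by (rule C)
    finally show ?thesis
      using japanese_pos[of "fst \<rho>"]
      by (simp add: pos_le_divide_eq wigner_integrand_def norm_mult norm_exp_i_times mult_ac)
  qed
  note int = integrable_if_decay[OF borel_wigner_integrand[OF u v] dec]
  have "cmod (wigner u v \<rho>) * japanese (fst \<rho>) ^ N \<le> (1 / (2 * pi) ^ DIM('a)) * (C * ?I)" for \<rho>
  proof -
    have "cmod (wigner u v \<rho>) = (1 / (2 * pi) ^ DIM('a)) * cmod (LINT z|lborel. wigner_integrand u v \<rho> z)"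
      by (simp add: wigner_eq norm_mult norm_divide norm_power)
    also have "\<dots> \<le> (1 / (2 * pi) ^ DIM('a)) * (C / japanese (fst \<rho>) ^ N * ?I)"
      by (intro mult_left_mono int(2)) auto
    finally have "cmod (wigner u v \<rho>) * japanese (fst \<rho>) ^ N \<le>
        (1 / (2 * pi) ^ DIM('a)) * (C / japanese (fst \<rho>) ^ N * ?I) * japanese (fst \<rho>) ^ N"
      using japanese_pos[of "fst \<rho>"] by (intro mult_right_mono) auto
    then show ?thesis using japanese_pos[of "fst \<rho>"] by simp
  qed
  moreover have "0 \<le> (1 / (2 * pi) ^ DIM('a)) * (C * ?I)"
    using C(1) japanese_integral_nonneg[where 'a = 'a] by (intro mult_nonneg_nonneg) auto
  ultimately show ?thesis using int(1) by blast
qed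

lemma bounded_smooth_exp_i: "bounded_smooth (\<lambda>z::'a::euclidean_space. exp (\<i> * of_real (\<xi> \<bullet> z)))"
  and ddir_exp_i: "ddir a (\<lambda>z::'a. exp (\<i> * of_real (\<xi> \<bullet> z))) = (\<lambda>z. \<i> * of_real (\<xi> \<bullet> a) * exp (\<i> * of_real (\<xi> \<bullet> z)))"
proof -
  let ?e = "\<lambda>z::'a. exp (\<i> * of_real (\<xi> \<bullet> z))"
  let ?S = "range (\<lambda>c z. c * ?e z)"
  have d: "((\<lambda>z. c * ?e z) has_derivative (\<lambda>v. (c * (\<i> * of_real (\<xi> \<bullet> v))) * ?e z)) (at z)" for c z
  proof -
    have "((\<lambda>z. \<i> * complex_of_real (\<xi> \<bullet> z)) has_derivative (\<lambda>v. \<i> * of_real (\<xi> \<bullet> v))) (at z)"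
      by (intro bounded_linear_imp_has_derivative bounded_linear_compose[OF bounded_linear_mult_right]
          bounded_linear_compose[OF bounded_linear_of_real] bounded_linear_inner_right)
    moreover have "(exp has_derivative (\<lambda>h. h * ?e z)) (at (\<i> * complex_of_real (\<xi> \<bullet> z)))"
      using DERIV_exp[of "\<i> * complex_of_real (\<xi> \<bullet> z)"] unfolding has_field_derivative_def
      by (rule has_derivative_eq_rhs) (simp add: fun_eq_iff mult.commute)
    ultimately have "(?e has_derivative (\<lambda>v. \<i> * of_real (\<xi> \<bullet> v) * ?e z)) (at z)"
      by (rule has_derivative_compose)
    from has_derivative_mult_right[OF this, of c] show ?thesis by (simp add: mult.assoc)
  qed
  have "?e = (\<lambda>z. 1 * ?e z)" by simp
  then have "?e \<in> ?S" by blast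
  then show "bounded_smooth ?e"
  proof (rule tame_coinduct)
    show "f differentiable (at x)" if "f \<in> ?S" for f x using that d differentiableI by blast
    show "\<exists>C. \<forall>x. norm (f x) * w x \<le> C" if "f \<in> ?S" "w \<in> {\<lambda>x. 1}" for f and w :: "'a \<Rightarrow> real"
      using that by (auto simp: norm_mult norm_exp_i_times)
    show "ddir v f \<in> ?S" if f: "f \<in> ?S" for f v
    proof -
      from f obtain c where "f = (\<lambda>z. c * ?e z)" by blast
      then have "ddir v f = (\<lambda>z. (c * (\<i> * of_real (\<xi> \<bullet> v))) * ?e z)" by (auto intro!: ddir_eqI d)
      then show ?thesis by blast
    qed
  qed
  show "ddir a ?e = (\<lambda>z. \<i> * of_real (\<xi> \<bullet> a) * ?e z)"
    using d[of 1] by (intro ext ddir_eqI) simp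
qed

text \<open>Integration by parts in z: the exponential yields \<i> (\<xi> \<bullet> a), and the
  arguments shifted by half of z yield derivatives of u and v with factors -1/2 and 1/2. Iterating
  it gives decay in \<xi>, and taking a = X x quantizes the symbol.\<close>

lemma wigner_mult_coord:
  fixes u v :: "'a::euclidean_space \<Rightarrow> complex"
  assumes u: "rapid u" and v: "rapid v"
  shows "of_real (snd \<rho> \<bullet> a) * wigner u v \<rho> = (\<i> / 2) * (wigner u (ddir a v) \<rho> - wigner (ddir a u) v \<rho>)"
proof -
  obtain x \<xi> where \<rho>: "\<rho> = (x, \<xi>)" by (cases \<rho>)
  let ?e = "\<lambda>z. exp (\<i> * of_real (\<xi> \<bullet> z))"
  let ?U = "\<lambda>u z. u (x - (1/2) *\<^sub>R z)" and ?V = "\<lambda>v z. v (x + (1/2) *\<^sub>R z)"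
  have U: "rapid (?U f)" and V: "rapid (?V f)" if "rapid f" for f :: "'a \<Rightarrow> complex"
    using rapid_scale[OF that, of "-1/2" x] rapid_scale[OF that, of "1/2" x] by (simp_all add: add.commute)
  have dU: "ddir a (?U f) = (\<lambda>z. (-1/2) *\<^sub>R ?U (ddir a f) z)" and dV: "ddir a (?V f) = (\<lambda>z. (1/2) *\<^sub>R ?V (ddir a f) z)"
    if "rapid f" for f :: "'a \<Rightarrow> complex"
    using ddir_scale[OF tame_smooth[OF that], of a "-1/2" x] ddir_scale[OF tame_smooth[OF that], of a "1/2" x]
    by (simp_all add: add.commute)
  have UV: "rapid (\<lambda>z. ?U u z * ?V v z)" by (intro rapid_mult U V u v rapid_imp_bounded_smooth)
  have h: "rapid (\<lambda>z. ?e z * (?U u z * ?V v z))" by (intro rapid_mult_left bounded_smooth_exp_i UV)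
  have "ddir a (\<lambda>z. ?e z * (?U u z * ?V v z)) = (\<lambda>z. (1/2) * wigner_integrand u (ddir a v) \<rho> z -
      (1/2) * wigner_integrand (ddir a u) v \<rho> z + \<i> * of_real (\<xi> \<bullet> a) * wigner_integrand u v \<rho> z)"
    unfolding ddir_mult[OF tame_smooth[OF bounded_smooth_exp_i] tame_smooth[OF UV]] ddir_exp_i
      ddir_mult[OF tame_smooth[OF U[OF u]] tame_smooth[OF V[OF v]]] dU[OF u] dV[OF v]
    by (rule ext) (simp add: wigner_integrand_def \<rho> scaleR_conv_of_real algebra_simps)
  with integral_ddir_eq_0[OF h, of a]
  have "0 = (LINT z|lborel. (1/2) * wigner_integrand u (ddir a v) \<rho> z -
      (1/2) * wigner_integrand (ddir a u) v \<rho> z + \<i> * of_real (\<xi> \<bullet> a) * wigner_integrand u v \<rho> z)" by simp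
  also have "\<dots> = (1/2) * (LINT z|lborel. wigner_integrand u (ddir a v) \<rho> z) -
      (1/2) * (LINT z|lborel. wigner_integrand (ddir a u) v \<rho> z) + \<i> * of_real (\<xi> \<bullet> a) * (LINT z|lborel. wigner_integrand u v \<rho> z)"
  proof -
    have "integrable lborel (wigner_integrand u (ddir a v) \<rho>)" "integrable lborel (wigner_integrand (ddir a u) v \<rho>)"
      "integrable lborel (wigner_integrand u v \<rho>)"
      using wigner_integrand_bound[OF u tame_ddir[OF v]] wigner_integrand_bound[OF tame_ddir[OF u] v]
        wigner_integrand_bound[OF u v] by blast+
    then show ?thesis by simp
  qed
  finally have eq: "\<i> * (of_real (\<xi> \<bullet> a) * (LINT z|lborel. wigner_integrand u v \<rho> z)) =
      (1/2) * ((LINT z|lborel. wigner_integrand (ddir a u) v \<rho> z) - (LINT z|lborel. wigner_integrand u (ddir a v) \<rho> z))"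
    by (simp add: algebra_simps)
  have "of_real (\<xi> \<bullet> a) * (LINT z|lborel. wigner_integrand u v \<rho> z) =
      (- \<i>) * (\<i> * (of_real (\<xi> \<bullet> a) * (LINT z|lborel. wigner_integrand u v \<rho> z)))" by simp
  also have "\<dots> = (\<i> / 2) * ((LINT z|lborel. wigner_integrand u (ddir a v) \<rho> z) - (LINT z|lborel. wigner_integrand (ddir a u) v \<rho> z))"
    unfolding eq by (simp add: algebra_simps)
  finally have eq2: "of_real (\<xi> \<bullet> a) * (LINT z|lborel. wigner_integrand u v \<rho> z) =
      (\<i> / 2) * ((LINT z|lborel. wigner_integrand u (ddir a v) \<rho> z) - (LINT z|lborel. wigner_integrand (ddir a u) v \<rho> z))" .
  show ?thesis
    unfolding wigner_eq right_diff_distrib[symmetric] mult.left_commute[of _ "of_real (1 / (2 * pi) ^ DIM('a))"]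
    using eq2 by (simp only: \<rho> snd_conv)
qed

text \<open>Multiplying a Wigner function by a momentum coordinate gives a combination of Wigner
  functions of derivatives. In this span, momentum weights can be absorbed while decay in position
  persists.\<close>

inductive_set wigner_span :: "('a::euclidean_space \<times> 'a \<Rightarrow> complex) set" where
  base: "rapid u \<Longrightarrow> rapid v \<Longrightarrow> wigner u v \<in> wigner_span"
| scale: "f \<in> wigner_span \<Longrightarrow> (\<lambda>\<rho>. c * f \<rho>) \<in> wigner_span"
| add: "f \<in> wigner_span \<Longrightarrow> g \<in> wigner_span \<Longrightarrow> (\<lambda>\<rho>. f \<rho> + g \<rho>) \<in> wigner_span"

lemma wigner_span_coord: "f \<in> wigner_span \<Longrightarrow> (\<lambda>\<rho>. of_real (snd \<rho> \<bullet> a) * f \<rho>) \<in> wigner_span"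
proof (induction rule: wigner_span.induct)
  case (base u v)
  have "of_real (snd \<rho> \<bullet> a) * wigner u v \<rho> =
      (\<i> / 2) * wigner u (ddir a v) \<rho> + (- \<i> / 2) * wigner (ddir a u) v \<rho>" for \<rho>
    unfolding wigner_mult_coord[OF base] by (simp add: right_diff_distrib)
  then have "(\<lambda>\<rho>. of_real (snd \<rho> \<bullet> a) * wigner u v \<rho>) =
      (\<lambda>\<rho>. (\<i> / 2) * wigner u (ddir a v) \<rho> + (- \<i> / 2) * wigner (ddir a u) v \<rho>)"
    by (rule ext)
  also have "\<dots> \<in> wigner_span"
    by (intro wigner_span.add wigner_span.scale wigner_span.base tame_ddir base)
  finally show ?case .
next
  case (scale f c)
  from wigner_span.scale[OF scale.IH, of c] show ?case by (simp add: mult.left_commute)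
next
  case (add f g)
  from wigner_span.add[OF add.IH] show ?case by (simp add: distrib_left)
qed

lemma wigner_span_sum:
  assumes "f0 \<in> wigner_span" "\<And>i. i \<in> I \<Longrightarrow> f i \<in> wigner_span"
  shows "(\<lambda>\<rho>. f0 \<rho> + (\<Sum>i\<in>I. f i \<rho>)) \<in> wigner_span"
  using assms(2)
proof (induction I rule: infinite_finite_induct)
  case (insert i I)
  from wigner_span.add[OF insert.IH insert.prems[of i]] insert show ?case by (simp add: add_ac)
qed (use assms(1) in simp_all)

lemma wigner_span_japanese:
  assumes f: "f \<in> wigner_span"
  shows "(\<lambda>\<rho>. of_real ((japanese (snd \<rho>))\<^sup>2) * f \<rho>) \<in> wigner_span"
proof -
  have "(\<lambda>\<rho>. f \<rho> + (\<Sum>b\<in>Basis. of_real (snd \<rho> \<bullet> b) * (of_real (snd \<rho> \<bullet> b) * f \<rho>))) \<in> wigner_span"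
    by (intro wigner_span_sum f wigner_span_coord)
  moreover have "of_real ((japanese (snd \<rho>))\<^sup>2) * f \<rho> =
      f \<rho> + (\<Sum>b\<in>Basis. of_real (snd \<rho> \<bullet> b) * (of_real (snd \<rho> \<bullet> b) * f \<rho>))" for \<rho>
    unfolding japanese_sq power2_norm_eq_inner euclidean_inner[of "snd \<rho>" "snd \<rho>"]
    by (simp add: distrib_right sum_distrib_right mult.assoc)
  ultimately show ?thesis by simp
qed

lemma wigner_span_decay:
  assumes "f \<in> wigner_span"
  shows "f \<in> borel_measurable borel" "\<exists>C\<ge>0. \<forall>\<rho>. cmod (f \<rho>) * japanese (fst \<rho>) ^ N \<le> C"
proof -
  show "f \<in> borel_measurable borel"
    using assms by induction (auto intro: borel_wigner)
  show "\<exists>C\<ge>0. \<forall>\<rho>. cmod (f \<rho>) * japanese (fst \<rho>) ^ N \<le> C"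
    using assms
  proof induction
    case (base u v)
    from wigner_integrand_bound[OF this, of N] show ?case by blast
  next
    case (scale f c)
    then obtain C where C: "0 \<le> C" "\<And>\<rho>. cmod (f \<rho>) * japanese (fst \<rho>) ^ N \<le> C" by blast
    have "cmod (c * f \<rho>) * japanese (fst \<rho>) ^ N \<le> cmod c * C" for \<rho>
      using mult_left_mono[OF C(2)[of \<rho>] norm_ge_zero[of c]] by (simp add: norm_mult mult.assoc)
    then show ?case using C(1) by (intro exI[of _ "cmod c * C"]) auto
  next
    case (add f g)
    from add.IH(1) obtain C where C: "0 \<le> C" "\<And>\<rho>. cmod (f \<rho>) * japanese (fst \<rho>) ^ N \<le> C" by blast
    from add.IH(2) obtain D where D: "0 \<le> D" "\<And>\<rho>. cmod (g \<rho>) * japanese (fst \<rho>) ^ N \<le> D" by blast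
    have "cmod (f \<rho> + g \<rho>) * japanese (fst \<rho>) ^ N \<le> C + D" for \<rho>
    proof -
      have "cmod (f \<rho> + g \<rho>) * japanese (fst \<rho>) ^ N \<le> (cmod (f \<rho>) + cmod (g \<rho>)) * japanese (fst \<rho>) ^ N"
        using japanese_pos[of "fst \<rho>"] by (intro mult_right_mono norm_triangle_ineq) auto
      then show ?thesis using C(2)[of \<rho>] D(2)[of \<rho>] by (simp add: distrib_right)
    qed
    then show ?case using C(1) D(1) by (intro exI[of _ "C + D"]) auto
  qed
qed

text \<open>Each factor of the squared momentum bracket keeps the function in the span, where decay
  in position is uniform in the momentum. Decay in both variables together follows by induction on
  the number of factors.\<close>

lemma wigner_span_rapid_decay:
  assumes "f \<in> wigner_span"
  shows "\<exists>C\<ge>0. \<forall>\<rho>. cmod (f \<rho>) * japanese \<rho> ^ N \<le> C"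
proof -
  have dec: "\<exists>C\<ge>0. \<forall>\<rho>. cmod (f \<rho>) * (japanese (fst \<rho>) ^ N * japanese (snd \<rho>) ^ (2 * M)) \<le> C" for M
    using assms
  proof (induction M arbitrary: f)
    case 0
    then show ?case using wigner_span_decay(2) by simp
  next
    case (Suc M)
    from Suc.IH[OF wigner_span_japanese[OF Suc.prems]] show ?case
      by (simp add: norm_mult norm_power power2_eq_square mult_ac)
  qed
  obtain C where C: "0 \<le> C" "\<And>\<rho>. cmod (f \<rho>) * (japanese (fst \<rho>) ^ N * japanese (snd \<rho>) ^ (2 * N)) \<le> C"
    using dec[of N] by blast
  have "cmod (f \<rho>) * japanese \<rho> ^ N \<le> C" for \<rho>
  proof -
    have "japanese \<rho> ^ N \<le> (japanese (fst \<rho>) * japanese (snd \<rho>)) ^ N"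
      using japanese_Pair_le[of "fst \<rho>" "snd \<rho>"] japanese_pos[of \<rho>] by (intro power_mono) auto
    also have "\<dots> \<le> japanese (fst \<rho>) ^ N * japanese (snd \<rho>) ^ (2 * N)"
      unfolding power_mult_distrib using japanese_pos[of "fst \<rho>"]
      by (intro mult_left_mono power_increasing japanese_ge_1) auto
    finally have "cmod (f \<rho>) * japanese \<rho> ^ N \<le> cmod (f \<rho>) * (japanese (fst \<rho>) ^ N * japanese (snd \<rho>) ^ (2 * N))"
      by (intro mult_left_mono) auto
    then show ?thesis using C(2)[of \<rho>] by linarith
  qed
  then show ?thesis using C(1) by blast
qed

lemma wigner_slice_integrable:
  fixes u v :: "'a::euclidean_space \<Rightarrow> complex"
  assumes "rapid u" "rapid v"
  shows "integrable lborel (\<lambda>\<xi>. wigner u v (x, \<xi>))"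
proof -
  obtain C where C: "\<And>\<rho>. cmod (wigner u v \<rho>) * japanese \<rho> ^ (DIM('a) + 2) \<le> C"
    using wigner_span_rapid_decay[OF wigner_span.base[OF assms]] by blast
  show ?thesis
  proof (rule integrable_if_decay(1))
    show "(\<lambda>\<xi>. wigner u v (x, \<xi>)) \<in> borel_measurable borel"
      using borel_wigner[OF assms] by measurable
    show "cmod (wigner u v (x, \<xi>)) * japanese \<xi> ^ (DIM('a) + 2) \<le> C" for \<xi>
    proof -
      have "japanese \<xi> ^ (DIM('a) + 2) \<le> japanese (x, \<xi>) ^ (DIM('a) + 2)"
        using japanese_pos[of \<xi>] by (intro power_mono japanese_snd_le) auto
      then have "cmod (wigner u v (x, \<xi>)) * japanese \<xi> ^ (DIM('a) + 2) \<le>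
          cmod (wigner u v (x, \<xi>)) * japanese (x, \<xi>) ^ (DIM('a) + 2)" by (intro mult_left_mono) auto
      then show ?thesis using C[of "(x, \<xi>)"] by linarith
    qed
  qed
qed

section \<open>Fourier inversion and the Weyl symbol\<close>

text \<open>A Gaussian at scale e n in \<xi> justifies Fubini. Its explicit transform turns the
  inner integral into a Gaussian average of F at scale e n around 0, and dominated convergence
  applies on both sides. Inversion at the origin suffices because the position enters the Wigner
  function as a parameter of F.\<close>

lemma fourier_inversion_at_0:
  fixes F :: "'a::euclidean_space \<Rightarrow> complex"
  assumes cont: "continuous_on UNIV F" and int: "integrable lborel F" and bound: "\<And>z. cmod (F z) \<le> B"
    and int': "integrable lborel (\<lambda>\<xi>. LINT z|lborel. exp (\<i> * of_real (\<xi> \<bullet> z)) * F z)"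
  shows "(LINT \<xi>|lborel. (LINT z|lborel. exp (\<i> * of_real (\<xi> \<bullet> z)) * F z)) = of_real ((2 * pi) ^ DIM('a)) * F 0"
proof -
  define Fh where "Fh \<xi> = (LINT z|lborel. exp (\<i> * of_real (\<xi> \<bullet> z)) * F z)" for \<xi>
  define e where "e n = 1 / real (Suc n)" for n
  \<comment> \<open>The value of the Gaussian at 0 is 1 / s, and s appears once more when its
    transform is written as a multiple of the Gaussian; together they give s * s, the inversion
    constant.\<close>
  define s where "s = sqrt (2 * pi) ^ DIM('a)"
  have s: "0 < s" by (simp add: s_def)
  have e: "0 < e n" for n by (simp add: e_def)
  have e0: "e \<longlonglongrightarrow> 0" unfolding e_def by (rule LIMSEQ_Suc[OF lim_const_over_n])
  have g_cont: "continuous_on S (gaussian :: 'a \<Rightarrow> real)" for S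
    by (rule smooth_continuous[OF tame_smooth[OF gaussian_rapid]])
  have g_int: "integrable lborel (\<lambda>\<xi>::'a. gaussian (c *\<^sub>R \<xi>))" if "c \<noteq> 0" for c
    using rapid_integrable[OF rapid_scale[OF gaussian_rapid that, of 0]] by simp
  have [measurable]: "F \<in> borel_measurable borel" "(gaussian :: 'a \<Rightarrow> real) \<in> borel_measurable borel"
    using borel_measurable_continuous_onI cont g_cont by blast+
  have step: "(LINT \<xi>|lborel. Fh \<xi> * of_real (gaussian (e n *\<^sub>R \<xi>))) =
      of_real s * (LINT y|lborel. F (e n *\<^sub>R y) * of_real (gaussian y))" for n
  proof -
    define c where "c = e n"
    have c: "0 < c" using e by (simp add: c_def)
    let ?f = "\<lambda>\<xi> z. exp (\<i> * of_real (\<xi> \<bullet> z)) * F z * complex_of_real (gaussian (c *\<^sub>R \<xi>))"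
    have "integrable (lborel \<Otimes>\<^sub>M lborel) (case_prod ?f)"
    proof (rule lborel_pair.Fubini_integrable)
      have "continuous_on UNIV (\<lambda>(\<xi>, z). ?f \<xi> z)"
        unfolding case_prod_unfold
        by (intro continuous_intros continuous_on_compose2[OF cont] continuous_on_compose2[OF g_cont]) auto
      then show "case_prod ?f \<in> borel_measurable (lborel \<Otimes>\<^sub>M lborel)"
        unfolding lborel_prod using borel_measurable_continuous_onI by simp
      have "(LINT z|lborel. norm (case_prod ?f (\<xi>, z))) = gaussian (c *\<^sub>R \<xi>) * (LINT z|lborel. cmod (F z))" for \<xi>
        using gaussian_pos[of "c *\<^sub>R \<xi>"]
        by (simp add: norm_mult norm_exp_i_times mult.commute)
      then show "integrable lborel (\<lambda>\<xi>. LINT z|lborel. norm (case_prod ?f (\<xi>, z)))"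
        using g_int[of c] c by simp
      show "AE \<xi> in lborel. integrable lborel (\<lambda>z. case_prod ?f (\<xi>, z))"
      proof (rule AE_I2)
        fix \<xi> :: 'a
        have "integrable lborel (\<lambda>z. exp (\<i> * of_real (\<xi> \<bullet> z)) * F z)"
          by (rule Bochner_Integration.integrable_bound[OF int]) (auto simp: norm_mult norm_exp_i_times)
        then show "integrable lborel (\<lambda>z. case_prod ?f (\<xi>, z))" by simp
      qed
    qed
    from lborel_pair.Fubini_integral[OF this]
    have swap: "(LINT \<xi>|lborel. (LINT z|lborel. ?f \<xi> z)) = (LINT z|lborel. (LINT \<xi>|lborel. ?f \<xi> z))" ..
    have inner: "(LINT \<xi>|lborel. ?f \<xi> z) = F z * of_real ((1 / c ^ DIM('a)) * exp (- (((1/c) *\<^sub>R z) \<bullet> ((1/c) *\<^sub>R z)) / 2))" for z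
    proof -
      let ?h = "\<lambda>\<eta>::'a. exp (\<i> * of_real (((1/c) *\<^sub>R z) \<bullet> \<eta>)) * complex_of_real (gaussian \<eta>)"
      have [measurable]: "?h \<in> borel_measurable borel" by measurable
      have "(LINT \<xi>|lborel. ?f \<xi> z) = (LINT \<xi>|lborel. F z * ?h (c *\<^sub>R \<xi>))"
        using c by (intro arg_cong[of _ _ "lebesgue_integral lborel"] ext) (simp add: inner_commute mult_ac)
      also have "\<dots> = F z * ((1 / c ^ DIM('a)) *\<^sub>R (LINT \<eta>|lborel. ?h \<eta>))"
        unfolding integral_mult_right_zero by (subst integral_scale[OF _ c]) auto
      finally show ?thesis unfolding gaussian_fourier by (simp add: scaleR_conv_of_real)
    qed
    let ?k = "\<lambda>y. F y * of_real (exp (- (((1/c) *\<^sub>R y) \<bullet> ((1/c) *\<^sub>R y)) / 2))"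
    have "(LINT \<xi>|lborel. Fh \<xi> * of_real (gaussian (c *\<^sub>R \<xi>))) = (LINT \<xi>|lborel. (LINT z|lborel. ?f \<xi> z))"
      by (simp add: Fh_def)
    also have "\<dots> = (LINT z|lborel. (1 / c ^ DIM('a)) *\<^sub>R ?k z)"
      unfolding swap inner by (intro arg_cong[of _ _ "lebesgue_integral lborel"] ext) (simp add: scaleR_conv_of_real)
    also have "\<dots> = (LINT y|lborel. ?k (c *\<^sub>R y))"
      unfolding integral_scaleR_right by (subst integral_scale[OF _ c]) auto
    also have "\<dots> = (LINT y|lborel. of_real s * (F (c *\<^sub>R y) * of_real (gaussian y)))"
      using c by (intro arg_cong[of _ _ "lebesgue_integral lborel"] ext) (simp add: gaussian_def s_def power_divide)
    finally show ?thesis by (simp add: c_def)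
  qed
  have g0: "gaussian (\<xi>::'a) \<le> 1 / s" "gaussian (0::'a) = 1 / s" for \<xi>
    by (simp_all add: gaussian_def s_def power_divide divide_right_mono)
  have conv0: "(\<lambda>n. e n *\<^sub>R y) \<longlonglongrightarrow> 0" for y :: 'a
    using tendsto_scaleR[OF e0 tendsto_const[of y]] by simp
  have L: "(\<lambda>n. LINT \<xi>|lborel. Fh \<xi> * of_real (gaussian (e n *\<^sub>R \<xi>))) \<longlonglongrightarrow> (LINT \<xi>|lborel. Fh \<xi> * of_real (gaussian (0::'a)))"
  proof (rule integral_dominated_convergence)
    show "integrable lborel (\<lambda>\<xi>. cmod (Fh \<xi>) * (1 / s))"
      using int' by (intro integrable_mult_left integrable_norm) (simp add: Fh_def)
    have [measurable]: "Fh \<in> borel_measurable borel"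
      using borel_measurable_integrable[OF int'] by (simp add: Fh_def[abs_def])
    show "(\<lambda>\<xi>. Fh \<xi> * of_real (gaussian (0::'a))) \<in> borel_measurable lborel"
      "(\<lambda>\<xi>. Fh \<xi> * of_real (gaussian (e n *\<^sub>R \<xi>))) \<in> borel_measurable lborel" for n
      by measurable
    show "AE \<xi> in lborel. (\<lambda>n. Fh \<xi> * of_real (gaussian (e n *\<^sub>R \<xi>))) \<longlonglongrightarrow> Fh \<xi> * of_real (gaussian (0::'a))"
      by (intro AE_I2 tendsto_intros continuous_on_tendsto_compose[OF g_cont[of UNIV] conv0]) auto
    show "AE \<xi> in lborel. norm (Fh \<xi> * of_real (gaussian (e n *\<^sub>R \<xi>))) \<le> cmod (Fh \<xi>) * (1 / s)" for n
      unfolding norm_mult norm_of_real abs_of_pos[OF gaussian_pos] by (intro AE_I2 mult_left_mono g0) simp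
  qed
  have R: "(\<lambda>n. LINT y|lborel. F (e n *\<^sub>R y) * of_real (gaussian y)) \<longlonglongrightarrow> (LINT y|lborel. F 0 * of_real (gaussian (y::'a)))"
  proof (rule integral_dominated_convergence)
    show "integrable lborel (\<lambda>y::'a. B * gaussian y)" using g_int[of 1] by simp
    show "(\<lambda>y. F 0 * of_real (gaussian (y::'a))) \<in> borel_measurable lborel"
      "(\<lambda>y. F (e n *\<^sub>R y) * of_real (gaussian y)) \<in> borel_measurable lborel" for n
      by measurable
    show "AE y in lborel. (\<lambda>n. F (e n *\<^sub>R y) * of_real (gaussian y)) \<longlonglongrightarrow> F 0 * of_real (gaussian y)"
      by (intro AE_I2 tendsto_intros continuous_on_tendsto_compose[OF cont conv0]) auto
    show "AE y in lborel. norm (F (e n *\<^sub>R y) * of_real (gaussian y)) \<le> B * gaussian y" for n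
      unfolding norm_mult norm_of_real abs_of_pos[OF gaussian_pos]
      by (intro AE_I2 mult_right_mono bound less_imp_le[OF gaussian_pos])
  qed
  have "(LINT \<xi>|lborel. Fh \<xi> * of_real (gaussian (0::'a))) = of_real s * (LINT y|lborel. F 0 * of_real (gaussian (y::'a)))"
    using LIMSEQ_unique[OF L] tendsto_mult[OF tendsto_const R, of "of_real s"] unfolding step by blast
  then have "(LINT \<xi>|lborel. Fh \<xi>) * of_real (1 / s) = of_real s * F 0"
    by (simp add: g0 gaussian_integral)
  then have "(LINT \<xi>|lborel. Fh \<xi>) * of_real (1 / s) * of_real s = of_real s * F 0 * of_real s"
    by (rule arg_cong)
  moreover have "complex_of_real (1 / s) * of_real s = 1"
    using s by (simp flip: of_real_mult)
  ultimately have "(LINT \<xi>|lborel. Fh \<xi>) = of_real (s * s) * F 0"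
    by (simp only: mult.assoc mult_1_right of_real_mult mult.left_commute mult.commute[of "F 0"])
  moreover have "s * s = (2 * pi) ^ DIM('a)" 
    unfolding s_def power_mult_distrib[symmetric] by simp
  ultimately show ?thesis by (simp add: Fh_def)
qed

text \<open>For fixed x the Wigner function is a normalized Fourier transform of u (x - z/2) v (x +
  z/2) in z, so inversion at z = 0 applies.\<close>

lemma wigner_marginal:
  fixes u v :: "'a::euclidean_space \<Rightarrow> complex"
  assumes u: "rapid u" and v: "rapid v"
  shows "(LINT \<xi>|lborel. wigner u v (x, \<xi>)) = u x * v x"
proof -
  let ?F = "\<lambda>z. u (x - (1/2) *\<^sub>R z) * v (x + (1/2) *\<^sub>R z)"
  have F: "rapid ?F"
    using rapid_scale[OF u, of "-1/2" x] rapid_scale[OF v, of "1/2" x]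
    by (intro rapid_mult rapid_imp_bounded_smooth) (simp_all add: add.commute)
  obtain B where B: "\<And>z. cmod (?F z) * japanese z ^ 0 \<le> B" using rapid_decay[OF F, of 0] by blast
  let ?c = "complex_of_real (1 / (2 * pi) ^ DIM('a))"
  have c: "?c \<noteq> 0" by simp
  have eq: "wigner u v (x, \<xi>) = ?c * (LINT z|lborel. exp (\<i> * of_real (\<xi> \<bullet> z)) * ?F z)" for \<xi>
    by (simp add: wigner_def mult.assoc)
  have "integrable lborel (\<lambda>\<xi>. ?c * (LINT z|lborel. exp (\<i> * of_real (\<xi> \<bullet> z)) * ?F z))"
    using wigner_slice_integrable[OF u v, of x] unfolding eq .
  then have "integrable lborel (\<lambda>\<xi>. LINT z|lborel. exp (\<i> * of_real (\<xi> \<bullet> z)) * ?F z)"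
  proof -
    let ?G = "\<lambda>\<xi>. LINT z|lborel. exp (\<i> * of_real (\<xi> \<bullet> z)) * ?F z"
    assume "integrable lborel (\<lambda>\<xi>. ?c * ?G \<xi>)"
    then have "integrable lborel (\<lambda>\<xi>. inverse ?c * (?c * ?G \<xi>))" by (rule integrable_mult_right)
    moreover have "inverse ?c * (?c * y) = y" for y
      using left_inverse[OF c] by (simp only: mult.assoc[symmetric] mult_1_left)
    ultimately show "integrable lborel ?G" by simp
  qed
  from fourier_inversion_at_0[OF smooth_continuous[OF tame_smooth[OF F]] rapid_integrable[OF F] _ this, of B] B
  show ?thesis unfolding eq by simp
qed

section \<open>The distribution and the Weyl quantization of a linear symbol\<close>

lemma linear_symbol_growth:
  fixes X :: "'a::euclidean_space \<Rightarrow> 'a"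
  assumes X: "bounded_smooth X"
  shows "\<exists>B\<ge>0. \<forall>\<rho>. \<bar>linear_symbol X \<rho>\<bar> \<le> B * japanese \<rho>"
proof -
  obtain B where B: "\<And>x. norm (X x) \<le> B" using tame_bounded[OF X, of "\<lambda>x. 1"] by auto
  have "\<bar>linear_symbol X \<rho>\<bar> \<le> B * japanese \<rho>" for \<rho>
  proof -
    have "\<bar>linear_symbol X \<rho>\<bar> \<le> norm (snd \<rho>) * norm (X (fst \<rho>))"
      unfolding linear_symbol_def by (rule Cauchy_Schwarz_ineq2)
    also have "\<dots> \<le> japanese \<rho> * B"
      using norm_le_japanese[of "snd \<rho>"] japanese_snd_le[of "snd \<rho>" "fst \<rho>"] japanese_pos[of \<rho>]
      by (intro mult_mono B) auto
    finally show ?thesis by (simp add: mult.commute)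
  qed
  moreover have "0 \<le> B" using B[of 0] norm_ge_zero order_trans by blast
  ultimately show ?thesis by blast
qed

text \<open>The symbol grows at most linearly, hence the exponent DIM + 3, one above what
  integrability needs. The constant K is independent of f, which gives temperedness.\<close>

lemma integrable_linear_symbol_mult:
  fixes X :: "'a::euclidean_space \<Rightarrow> 'a"
  assumes X: "bounded_smooth X"
  shows "\<exists>K\<ge>0. \<forall>f C. f \<in> borel_measurable borel \<longrightarrow> (\<forall>\<rho>. cmod (f \<rho>) * japanese \<rho> ^ (DIM('a \<times> 'a) + 3) \<le> C) \<longrightarrow>
    integrable lborel (\<lambda>\<rho>. of_real (linear_symbol X \<rho>) * f \<rho>) \<and>
    cmod (LINT \<rho>|lborel. of_real (linear_symbol X \<rho>) * f \<rho>) \<le> K * C"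
proof -
  let ?D = "DIM('a \<times> 'a)"
  let ?I = "LINT \<rho>|lborel. inverse (japanese (\<rho>::'a \<times> 'a) ^ (?D + 2))"
  obtain B where B: "0 \<le> B" "\<And>\<rho>. \<bar>linear_symbol X \<rho>\<bar> \<le> B * japanese \<rho>" using linear_symbol_growth[OF X] by blast
  have main: "integrable lborel (\<lambda>\<rho>. of_real (linear_symbol X \<rho>) * f \<rho>) \<and>
      cmod (LINT \<rho>|lborel. of_real (linear_symbol X \<rho>) * f \<rho>) \<le> B * C * ?I"
    if [measurable]: "f \<in> borel_measurable borel" and C: "\<And>\<rho>. cmod (f \<rho>) * japanese \<rho> ^ (?D + 3) \<le> C" for f C
  proof -
    have [measurable]: "linear_symbol X \<in> borel_measurable borel"
      by (intro smooth_borel smooth_linear_symbol tame_smooth[OF X])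
    have m: "(\<lambda>\<rho>. complex_of_real (linear_symbol X \<rho>) * f \<rho>) \<in> borel_measurable borel" by measurable
    have d: "cmod (complex_of_real (linear_symbol X \<rho>) * f \<rho>) * japanese \<rho> ^ (?D + 2) \<le> B * C" for \<rho>
    proof -
      have "cmod (complex_of_real (linear_symbol X \<rho>) * f \<rho>) * japanese \<rho> ^ (?D + 2) =
          \<bar>linear_symbol X \<rho>\<bar> * (cmod (f \<rho>) * japanese \<rho> ^ (?D + 2))" by (simp add: norm_mult)
      also have "\<dots> \<le> (B * japanese \<rho>) * (cmod (f \<rho>) * japanese \<rho> ^ (?D + 2))"
        using japanese_pos[of \<rho>] by (intro mult_right_mono B mult_nonneg_nonneg zero_le_power) auto
      also have "\<dots> = B * (cmod (f \<rho>) * japanese \<rho> ^ (?D + 3))"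
        by (simp only: power_add power3_eq_cube power2_eq_square mult_ac)
      also have "\<dots> \<le> B * C" by (intro mult_left_mono C B)
      finally show ?thesis .
    qed
    show ?thesis using integrable_if_decay[OF m d] by blast
  qed
  have "0 \<le> B * ?I" using B(1) japanese_integral_nonneg[where 'a = "'a \<times> 'a"] by (intro mult_nonneg_nonneg)
  moreover have "B * C * ?I = (B * ?I) * C" for C by simp
  ultimately show ?thesis using main by (intro exI[of _ "B * ?I"]) (simp only:, blast)
qed

definition linear_distribution :: "('a::euclidean_space \<Rightarrow> 'a) \<Rightarrow> ('a \<times> 'a \<Rightarrow> complex) \<Rightarrow> complex" where
  "linear_distribution X f = (LINT \<rho>|lborel. of_real (linear_symbol X \<rho>) * f \<rho>)"

lemma linear_distribution_tempered:
  fixes X :: "'a::euclidean_space \<Rightarrow> 'a"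
  assumes X: "bounded_smooth X"
  shows "is_distribution_of (linear_distribution X) (\<lambda>\<rho>. complex_of_real (linear_symbol X \<rho>))"
proof -
  let ?N = "DIM('a \<times> 'a) + 3"
  obtain K where K: "0 \<le> K" "\<And>f C. f \<in> borel_measurable borel \<Longrightarrow> \<forall>\<rho>. cmod (f \<rho>) * japanese \<rho> ^ ?N \<le> C \<Longrightarrow>
    integrable lborel (\<lambda>\<rho>. of_real (linear_symbol X \<rho>) * f \<rho>) \<and>
    cmod (LINT \<rho>|lborel. of_real (linear_symbol X \<rho>) * f \<rho>) \<le> K * C"
    using integrable_linear_symbol_mult[OF X] by blast
  have main: "integrable lborel (\<lambda>\<rho>. of_real (linear_symbol X \<rho>) * f \<rho>)"
    "cmod (linear_distribution X f) \<le> K * schwartz_seminorm ?N 0 f" if "f \<in> schwartz" for f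
    using K(2)[of f "schwartz_seminorm ?N 0 f"] le_schwartz_seminorm[OF that] that
    by (auto simp: schwartz_iff_rapid borel_rapid linear_distribution_def)
  have "cmod (linear_distribution X f) \<le> K * (\<Sum>k\<le>?N. schwartz_seminorm ?N k f)" if "f \<in> schwartz" for f
  proof -
    have "schwartz_seminorm ?N 0 f \<le> (\<Sum>k\<le>?N. schwartz_seminorm ?N k f)"
      by (rule member_le_sum) (use schwartz_seminorm_nonneg[OF that] in auto)
    then show ?thesis using main(2)[OF that] mult_left_mono[OF _ K(1)] order_trans by blast
  qed
  moreover have "linear_distribution X (\<lambda>\<rho>. f \<rho> + g \<rho>) = linear_distribution X f + linear_distribution X g"
    if "f \<in> schwartz" "g \<in> schwartz" for f g
    using main(1)[OF that(1)] main(1)[OF that(2)] by (simp add: linear_distribution_def distrib_left)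
  moreover have "linear_distribution X (\<lambda>\<rho>. c * f \<rho>) = c * linear_distribution X f" for c f
    by (simp add: linear_distribution_def mult.left_commute)
  ultimately show ?thesis
    unfolding is_distribution_of_def tempered_distribution_def by (auto simp: linear_distribution_def)
qed

text \<open>After integrating over \<xi> first, x is fixed and the symbol is a momentum coordinate
  in the fixed direction X x. \<open>wigner_mult_coord\<close> removes it and the marginals evaluate
  the \<xi>-integral, leaving the antisymmetric form of \<open>transport_pairing\<close>.\<close>

theorem weyl_op_linear_distribution:
  fixes X :: "'a::euclidean_space \<Rightarrow> 'a"
  assumes X: "bounded_smooth X" and u: "rapid u" and v: "rapid v"
  shows "weyl_op (linear_distribution X) u v = (LINT x|lborel. transport X u x * v x)"
proof -
  let ?f = "\<lambda>\<rho>. of_real (linear_symbol X \<rho>) * wigner u v \<rho>"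
  obtain C where "\<forall>\<rho>. cmod (wigner u v \<rho>) * japanese \<rho> ^ (DIM('a \<times> 'a) + 3) \<le> C"
    using wigner_span_rapid_decay[OF wigner_span.base[OF u v]] by blast
  then have "integrable lborel ?f"
    using integrable_linear_symbol_mult[OF X] borel_wigner[OF u v] by blast
  then have "(LINT \<rho>|lborel. ?f \<rho>) = (LINT x|lborel. (LINT \<xi>|lborel. ?f (x, \<xi>)))"
    using lborel_pair.integral_fst'[of ?f] by (simp add: lborel_prod)
  also have "\<dots> = (LINT x|lborel. (\<i> / 2) * (u x * ddir (X x) v x - ddir (X x) u x * v x))"
  proof (intro arg_cong[of _ _ "lebesgue_integral lborel"] ext)
    fix x
    have eq: "?f (x, \<xi>) = (\<i> / 2) * (wigner u (ddir (X x) v) (x, \<xi>) - wigner (ddir (X x) u) v (x, \<xi>))" for \<xi>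
      using wigner_mult_coord[OF u v, of "(x, \<xi>)" "X x"] by (simp add: linear_symbol_def)
    have "(LINT \<xi>|lborel. ?f (x, \<xi>)) = (\<i> / 2) * ((LINT \<xi>|lborel. wigner u (ddir (X x) v) (x, \<xi>)) -
        (LINT \<xi>|lborel. wigner (ddir (X x) u) v (x, \<xi>)))"
      unfolding eq using wigner_slice_integrable[OF u tame_ddir[OF v]] wigner_slice_integrable[OF tame_ddir[OF u] v]
      by simp
    then show "(LINT \<xi>|lborel. ?f (x, \<xi>)) = (\<i> / 2) * (u x * ddir (X x) v x - ddir (X x) u x * v x)"
      by (simp only: wigner_marginal[OF u tame_ddir[OF v]] wigner_marginal[OF tame_ddir[OF u] v])
  qed
  finally show ?thesis
    by (simp add: weyl_op_def linear_distribution_def transport_pairing[OF X u v])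
qed

section \<open>Square-integrable functions\<close>

definition l2norm :: "('a::euclidean_space \<Rightarrow> complex) \<Rightarrow> real" where
  "l2norm f = sqrt (LINT x|lborel. (cmod (f x))\<^sup>2)"

lemma L2_dist_eq: "L2_dist f g = l2norm (\<lambda>x. f x - g x)"
  by (simp add: L2_dist_def l2norm_def)

lemma L2_iff: "f \<in> L2 \<longleftrightarrow> f \<in> borel_measurable borel \<and> integrable lborel (\<lambda>x. (cmod (f x))\<^sup>2)"
  by (simp add: L2_def)

lemma L2_borel: "f \<in> L2 \<Longrightarrow> f \<in> borel_measurable borel"
  by (simp add: L2_iff)

lemma l2norm_nonneg: "0 \<le> l2norm f"
  by (simp add: l2norm_def)

lemma l2norm_sq: "(l2norm f)\<^sup>2 = (LINT x|lborel. (cmod (f x))\<^sup>2)"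
  by (simp add: l2norm_def)

lemma L2_dominated:
  assumes "f \<in> borel_measurable borel" "g \<in> L2" "0 \<le> C" and le: "\<And>x. cmod (f x) \<le> C * cmod (g x)"
  shows "f \<in> L2" "l2norm f \<le> C * l2norm g"
proof -
  have g: "integrable lborel (\<lambda>x. C\<^sup>2 * (cmod (g x))\<^sup>2)" using assms(2) by (simp add: L2_iff)
  have sq: "(cmod (f x))\<^sup>2 \<le> C\<^sup>2 * (cmod (g x))\<^sup>2" for x
    using power_mono[OF le[of x] norm_ge_zero, of 2] by (simp add: power_mult_distrib)
  have f: "integrable lborel (\<lambda>x. (cmod (f x))\<^sup>2)"
    by (rule Bochner_Integration.integrable_bound[OF g]) (use assms(1) sq in auto)
  then show "f \<in> L2" using assms(1) by (simp add: L2_iff)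
  have "(LINT x|lborel. (cmod (f x))\<^sup>2) \<le> (LINT x|lborel. C\<^sup>2 * (cmod (g x))\<^sup>2)"
    by (rule integral_mono[OF f g sq])
  then have "l2norm f \<le> sqrt (C\<^sup>2 * (LINT x|lborel. (cmod (g x))\<^sup>2))"
    unfolding l2norm_def by simp
  then show "l2norm f \<le> C * l2norm g" using assms(3) by (simp add: real_sqrt_mult l2norm_def)
qed

lemma L2_cnj: "f \<in> L2 \<Longrightarrow> (\<lambda>x. cnj (f x)) \<in> L2"
proof -
  assume f: "f \<in> L2"
  have "(\<lambda>x. cnj (f x)) \<in> borel_measurable borel"
    using L2_borel[OF f] by (intro borel_measurable_continuous_on[OF _ L2_borel[OF f]] continuous_intros)
  then show ?thesis using f by (simp add: L2_iff)
qed

lemma l2norm_cnj: "l2norm (\<lambda>x. cnj (f x)) = l2norm f"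
  by (simp add: l2norm_def)

lemma L2_mult_integrable:
  assumes f: "f \<in> L2" and g: "g \<in> L2"
  shows "integrable lborel (\<lambda>x. cmod (f x) * cmod (g x))" "integrable lborel (\<lambda>x. f x * g x)"
proof -
  have [measurable]: "f \<in> borel_measurable borel" "g \<in> borel_measurable borel"
    using f g by (auto simp: L2_iff)
  have i: "integrable lborel (\<lambda>x. (cmod (f x))\<^sup>2 + (cmod (g x))\<^sup>2)"
    using f g by (simp add: L2_iff)
  have le: "cmod (f x) * cmod (g x) \<le> (cmod (f x))\<^sup>2 + (cmod (g x))\<^sup>2" for x
    using sum_squares_bound[of "cmod (f x)" "cmod (g x)"]
      mult_nonneg_nonneg[OF norm_ge_zero[of "f x"] norm_ge_zero[of "g x"]] by linarith
  show "integrable lborel (\<lambda>x. cmod (f x) * cmod (g x))"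
    by (rule Bochner_Integration.integrable_bound[OF i]) (auto simp: le)
  show "integrable lborel (\<lambda>x. f x * g x)"
    by (rule Bochner_Integration.integrable_bound[OF i]) (auto simp: norm_mult le)
qed

text \<open>Young's inequality 2ab \<le> ta^2 + b^2/t with t the ratio of the norms; the small
  positive constant added to both norms avoids division by zero.\<close>

lemma L2_cauchy_schwarz:
  assumes f: "f \<in> L2" and g: "g \<in> L2"
  shows "(LINT x|lborel. cmod (f x) * cmod (g x)) \<le> l2norm f * l2norm g"
    "cmod (LINT x|lborel. f x * g x) \<le> l2norm f * l2norm g"
proof -
  let ?I = "LINT x|lborel. cmod (f x) * cmod (g x)"
  have i: "integrable lborel (\<lambda>x. (cmod (f x))\<^sup>2)" "integrable lborel (\<lambda>x. (cmod (g x))\<^sup>2)"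
    using f g by (auto simp: L2_iff)
  have step: "?I \<le> (l2norm f + d) * (l2norm g + d)" if d: "0 < d" for d
  proof -
    define A where "A = l2norm f + d"
    define B where "B = l2norm g + d"
    have A: "0 < A" and B: "0 < B" unfolding A_def B_def by (intro add_nonneg_pos l2norm_nonneg d)+
    have "2 * (cmod (f x) * cmod (g x)) \<le> (B / A) * (cmod (f x))\<^sup>2 + (A / B) * (cmod (g x))\<^sup>2" for x
    proof -
      have "0 \<le> (B * cmod (f x) - A * cmod (g x))\<^sup>2 / (A * B)" using A B by simp
      also have "\<dots> = (B / A) * (cmod (f x))\<^sup>2 + (A / B) * (cmod (g x))\<^sup>2 - 2 * (cmod (f x) * cmod (g x))"
        using A B by (simp add: field_simps power2_eq_square)
      finally show ?thesis by simp
    qed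
    then have "(LINT x|lborel. 2 * (cmod (f x) * cmod (g x))) \<le>
        (LINT x|lborel. (B / A) * (cmod (f x))\<^sup>2 + (A / B) * (cmod (g x))\<^sup>2)"
      using i L2_mult_integrable(1)[OF f g] by (intro integral_mono) auto
    then have "2 * ?I \<le> (B / A) * (l2norm f)\<^sup>2 + (A / B) * (l2norm g)\<^sup>2"
      using i by (simp add: l2norm_sq)
    also have "\<dots> \<le> (B / A) * A\<^sup>2 + (A / B) * B\<^sup>2"
      using A B d l2norm_nonneg by (intro add_mono mult_left_mono power_mono) (auto simp: A_def B_def)
    also have "\<dots> = 2 * (A * B)" using A B by (simp add: power2_eq_square)
    finally show ?thesis by (simp add: A_def B_def)
  qed
  show 1: "?I \<le> l2norm f * l2norm g"
  proof (rule LIMSEQ_le_const)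
    show "(\<lambda>n. (l2norm f + 1 / real (Suc n)) * (l2norm g + 1 / real (Suc n))) \<longlonglongrightarrow> l2norm f * l2norm g"
      using tendsto_mult[OF tendsto_add[OF tendsto_const LIMSEQ_Suc[OF lim_const_over_n[of 1]]]
          tendsto_add[OF tendsto_const LIMSEQ_Suc[OF lim_const_over_n[of 1]]], of "l2norm f" "l2norm g"] by simp
    show "\<exists>N. \<forall>n\<ge>N. ?I \<le> (l2norm f + 1 / real (Suc n)) * (l2norm g + 1 / real (Suc n))"
      using step by (intro exI[of _ 0]) simp
  qed
  have "cmod (LINT x|lborel. f x * g x) \<le> (LINT x|lborel. cmod (f x * g x))"
    by (rule integral_norm_bound)
  then show "cmod (LINT x|lborel. f x * g x) \<le> l2norm f * l2norm g"
    using 1 by (simp add: norm_mult)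
qed

lemma L2_add:
  assumes f: "f \<in> L2" and g: "g \<in> L2"
  shows "(\<lambda>x. f x + g x) \<in> L2" "l2norm (\<lambda>x. f x + g x) \<le> l2norm f + l2norm g"
proof -
  have i: "integrable lborel (\<lambda>x. (cmod (f x))\<^sup>2)" "integrable lborel (\<lambda>x. (cmod (g x))\<^sup>2)"
    using f g by (auto simp: L2_iff)
  let ?h = "\<lambda>x. ((cmod (f x))\<^sup>2 + (cmod (g x))\<^sup>2) + 2 * (cmod (f x) * cmod (g x))"
  have h: "integrable lborel ?h" using i L2_mult_integrable(1)[OF f g] by simp
  have le: "(cmod (f x + g x))\<^sup>2 \<le> ?h x" for x
    using power_mono[OF norm_triangle_ineq[of "f x" "g x"] norm_ge_zero, of 2] by (simp add: power2_sum algebra_simps)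
  have [measurable]: "f \<in> borel_measurable borel" "g \<in> borel_measurable borel"
    using f g by (auto simp: L2_iff)
  have fg: "integrable lborel (\<lambda>x. (cmod (f x + g x))\<^sup>2)"
  proof (rule Bochner_Integration.integrable_bound[OF h])
    show "AE x in lborel. norm ((cmod (f x + g x))\<^sup>2) \<le> norm (?h x)"
      unfolding real_norm_def abs_power2 by (intro AE_I2 order_trans[OF le abs_ge_self])
  qed measurable
  then show "(\<lambda>x. f x + g x) \<in> L2" by (simp add: L2_iff)
  have "(l2norm (\<lambda>x. f x + g x))\<^sup>2 \<le> (LINT x|lborel. ?h x)"
    unfolding l2norm_sq by (rule integral_mono[OF fg h]) (rule le)
  also have "\<dots> = (l2norm f)\<^sup>2 + (l2norm g)\<^sup>2 + 2 * (LINT x|lborel. cmod (f x) * cmod (g x))"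
    unfolding l2norm_sq Bochner_Integration.integral_add[OF Bochner_Integration.integrable_add[OF i]
        integrable_mult_right[OF L2_mult_integrable(1)[OF f g]]] Bochner_Integration.integral_add[OF i]
      integral_mult_right_zero ..
  also have "\<dots> \<le> (l2norm f + l2norm g)\<^sup>2"
    unfolding power2_sum mult.assoc
    by (intro add_left_mono mult_left_mono L2_cauchy_schwarz(1) f g) simp
  finally show "l2norm (\<lambda>x. f x + g x) \<le> l2norm f + l2norm g"
    by (rule power2_le_imp_le) (intro add_nonneg_nonneg l2norm_nonneg)
qed

lemma L2_diff:
  assumes f: "f \<in> L2" and g: "g \<in> L2"
  shows "(\<lambda>x. f x - g x) \<in> L2" "l2norm (\<lambda>x. f x - g x) \<le> l2norm f + l2norm g"
proof -
  have "(\<lambda>x. - g x) \<in> L2" using g by (simp add: L2_iff)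
  moreover have "l2norm (\<lambda>x. - g x) = l2norm g" by (simp add: l2norm_def)
  ultimately show "(\<lambda>x. f x - g x) \<in> L2" "l2norm (\<lambda>x. f x - g x) \<le> l2norm f + l2norm g"
    using L2_add[OF f, of "\<lambda>x. - g x"] by simp_all
qed

lemma l2norm_diff_triangle:
  assumes "f \<in> L2" "g \<in> L2" "h \<in> L2"
  shows "l2norm (\<lambda>x. f x - h x) \<le> l2norm (\<lambda>x. f x - g x) + l2norm (\<lambda>x. g x - h x)"
  using L2_add(2)[OF L2_diff(1)[OF assms(1,2)] L2_diff(1)[OF assms(2,3)]] by simp

lemma L2_sum:
  assumes "\<And>i. i \<in> I \<Longrightarrow> f i \<in> L2" "finite I"
  shows "(\<lambda>x. \<Sum>i\<in>I. f i x) \<in> L2" "l2norm (\<lambda>x. \<Sum>i\<in>I. f i x) \<le> (\<Sum>i\<in>I. l2norm (f i))"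
proof -
  have "(\<lambda>x. \<Sum>i\<in>I. f i x) \<in> L2 \<and> l2norm (\<lambda>x. \<Sum>i\<in>I. f i x) \<le> (\<Sum>i\<in>I. l2norm (f i))"
    using assms(2,1)
  proof (induction I rule: finite_induct)
    case empty
    then show ?case by (simp add: L2_iff l2norm_def)
  next
    case (insert i I)
    then have "f i \<in> L2" and I: "(\<lambda>x. \<Sum>i\<in>I. f i x) \<in> L2" "l2norm (\<lambda>x. \<Sum>i\<in>I. f i x) \<le> (\<Sum>i\<in>I. l2norm (f i))"
      by auto
    from L2_add[OF this(1) I(1)] I(2) insert.hyps show ?case by simp
  qed
  then show "(\<lambda>x. \<Sum>i\<in>I. f i x) \<in> L2" "l2norm (\<lambda>x. \<Sum>i\<in>I. f i x) \<le> (\<Sum>i\<in>I. l2norm (f i))" by auto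
qed

lemma rapid_cnj: "rapid f \<Longrightarrow> rapid (\<lambda>x. cnj (f x))"
  by (rule rapid_linear[OF bounded_linear_cnj])

lemma rapid_L2:
  assumes f: "rapid f"
  shows "f \<in> L2"
proof -
  have "integrable lborel (\<lambda>x. Re (f x * cnj (f x)))"
    by (intro integrable_Re rapid_integrable rapid_mult f rapid_imp_bounded_smooth rapid_cnj)
  moreover have "Re (f x * cnj (f x)) = (cmod (f x))\<^sup>2" for x
    unfolding complex_norm_square[symmetric] by simp
  ultimately show ?thesis using borel_rapid[OF f] by (simp add: L2_iff)
qed

section \<open>Convolution\<close>

lemma lborel_isometry:
  fixes t :: "'a::euclidean_space"
  assumes "\<bar>c\<bar> = 1"
  shows "distr lborel borel (\<lambda>x. t + c *\<^sub>R x) = lborel"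
  using lborel_affine[of c t] assms by (auto simp: density_1)

lemma integrable_isometry:
  fixes f :: "'a::euclidean_space \<Rightarrow> 'b::{banach, second_countable_topology}"
  assumes [measurable]: "f \<in> borel_measurable borel"
  shows "integrable lborel (\<lambda>y. f (x - y)) \<longleftrightarrow> integrable lborel f" "(LINT y|lborel. f (x - y)) = (LINT y|lborel. f y)"
    "integrable lborel (\<lambda>y. f (y - x)) \<longleftrightarrow> integrable lborel f" "(LINT y|lborel. f (y - x)) = (LINT y|lborel. f y)"
proof -
  have 1: "distr lborel borel (\<lambda>y. x - y) = lborel" "distr lborel borel (\<lambda>y. y - x) = lborel"
    using lborel_isometry[of "-1" x] lborel_isometry[of 1 "- x"] by simp_all
  show "integrable lborel (\<lambda>y. f (x - y)) \<longleftrightarrow> integrable lborel f"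
    using integrable_distr_eq[of "\<lambda>y. x - y" lborel borel f] by (simp add: 1)
  show "(LINT y|lborel. f (x - y)) = (LINT y|lborel. f y)"
    using integral_distr[of "\<lambda>y. x - y" lborel borel f] by (simp add: 1)
  show "integrable lborel (\<lambda>y. f (y - x)) \<longleftrightarrow> integrable lborel f"
    using integrable_distr_eq[of "\<lambda>y. y - x" lborel borel f] by (simp add: 1)
  show "(LINT y|lborel. f (y - x)) = (LINT y|lborel. f y)"
    using integral_distr[of "\<lambda>y. y - x" lborel borel f] by (simp add: 1)
qed

text \<open>Splitting k into sqrt k times sqrt k, Cauchy-Schwarz bounds the square at x by the mass
  of k times the average of |v|^2 against k (x - y), which Fubini integrates. The bound B makes the
  integrals converge at every x, not just at almost every x.\<close>

lemma schur_bound: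
  fixes k :: "'a::euclidean_space \<Rightarrow> real" and K :: "'a \<Rightarrow> 'a \<Rightarrow> complex"
  assumes k[measurable]: "k \<in> borel_measurable borel" and k0: "\<And>z. 0 \<le> k z" and kB: "\<And>z. k z \<le> B"
    and k_int: "integrable lborel k"
    and K: "(\<lambda>(x, y). K x y) \<in> borel_measurable borel" and Kk: "\<And>x y. cmod (K x y) \<le> k (x - y)"
    and v: "v \<in> L2"
  shows "integrable lborel (\<lambda>y. K x y * v y)"
    "(\<lambda>x. LINT y|lborel. K x y * v y) \<in> L2"
    "l2norm (\<lambda>x. LINT y|lborel. K x y * v y) \<le> (LINT z|lborel. k z) * l2norm v"
proof -
  have [measurable]: "v \<in> borel_measurable borel" by (rule L2_borel[OF v])
  have v2: "integrable lborel (\<lambda>y. (cmod (v y))\<^sup>2)" using v by (simp add: L2_iff)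
  have Kx[measurable]: "K x \<in> borel_measurable borel" for x
  proof -
    have "(\<lambda>y. (x, y)) \<in> borel \<rightarrow>\<^sub>M borel" by (intro borel_measurable_continuous_onI continuous_intros)
    from measurable_compose[OF this K] show ?thesis by simp
  qed
  let ?f1 = "\<lambda>x y. complex_of_real (sqrt (k (x - y)))"
  let ?f2 = "\<lambda>x y. complex_of_real (sqrt (k (x - y))) * v y"
  let ?H = "\<lambda>x. LINT y|lborel. k (x - y) * (cmod (v y))\<^sup>2"
  have f1_sq: "(cmod (?f1 x y))\<^sup>2 = k (x - y)" for x y using k0 by simp
  have f2_sq: "(cmod (?f2 x y))\<^sup>2 = k (x - y) * (cmod (v y))\<^sup>2" for x y
    using k0 by (simp add: norm_mult power_mult_distrib)
  have f1: "?f1 x \<in> L2" for x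
    unfolding L2_iff f1_sq using integrable_isometry(1)[OF k] k_int by auto
  have kv_int: "integrable lborel (\<lambda>y. k (x - y) * (cmod (v y))\<^sup>2)" for x
  proof (rule Bochner_Integration.integrable_bound[of _ "\<lambda>y. B * (cmod (v y))\<^sup>2"])
    show "AE y in lborel. norm (k (x - y) * (cmod (v y))\<^sup>2) \<le> norm (B * (cmod (v y))\<^sup>2)"
    proof (rule AE_I2)
      fix y
      have "k (x - y) * (cmod (v y))\<^sup>2 \<le> B * (cmod (v y))\<^sup>2" by (intro mult_right_mono kB) simp
      then show "norm (k (x - y) * (cmod (v y))\<^sup>2) \<le> norm (B * (cmod (v y))\<^sup>2)"
        using k0[of "x - y"] order_trans[OF k0 kB] by (simp add: abs_mult mult_right_mono)
    qed
  qed (use v2 in auto)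
  have f2: "?f2 x \<in> L2" for x unfolding L2_iff f2_sq using kv_int by auto
  have prod: "cmod (?f1 x y) * cmod (?f2 x y) = k (x - y) * cmod (v y)" for x y
    using k0[of "x - y"] by (simp add: norm_mult mult.assoc[symmetric])
  have kv1: "integrable lborel (\<lambda>y. k (x - y) * cmod (v y))" for x
    using L2_mult_integrable(1)[OF f1 f2, of x x] unfolding prod .
  have le: "cmod (K x y * v y) \<le> k (x - y) * cmod (v y)" for x y
    unfolding norm_mult by (intro mult_right_mono Kk) simp
  show Kv: "integrable lborel (\<lambda>y. K x y * v y)" for x
    by (rule Bochner_Integration.integrable_bound[OF kv1])
      (auto intro: order_trans[OF le abs_ge_self])
  have pt: "(cmod (LINT y|lborel. K x y * v y))\<^sup>2 \<le> (LINT z|lborel. k z) * ?H x" for x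
  proof -
    have "cmod (LINT y|lborel. K x y * v y) \<le> (LINT y|lborel. k (x - y) * cmod (v y))"
      by (rule Bochner_Integration.integral_norm_bound_integral[OF Kv kv1]) (rule le)
    also have "\<dots> \<le> l2norm (?f1 x) * l2norm (?f2 x)"
      using L2_cauchy_schwarz(1)[OF f1 f2, of x x] unfolding prod .
    finally have "(cmod (LINT y|lborel. K x y * v y))\<^sup>2 \<le> (l2norm (?f1 x) * l2norm (?f2 x))\<^sup>2"
      by (rule power_mono) simp
    then show ?thesis
      unfolding power_mult_distrib l2norm_sq f1_sq f2_sq integrable_isometry(2)[OF k] .
  qed
  have pair: "integrable (lborel \<Otimes>\<^sub>M lborel) (\<lambda>(y, x). k (x - y) * (cmod (v y))\<^sup>2)"
  proof (rule lborel_pair.Fubini_integrable)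
    show "(\<lambda>(y, x). k (x - y) * (cmod (v y))\<^sup>2) \<in> borel_measurable (lborel \<Otimes>\<^sub>M lborel)"
      by measurable
    have "(LINT x|lborel. norm (k (x - y) * (cmod (v y))\<^sup>2)) = (LINT z|lborel. k z) * (cmod (v y))\<^sup>2" for y
      using k0 integrable_isometry(4)[OF k, of y] by (simp add: abs_mult)
    then show "integrable lborel (\<lambda>y. LINT x|lborel. norm (case (y, x) of (y, x) \<Rightarrow> k (x - y) * (cmod (v y))\<^sup>2))"
      using v2 by simp
    show "AE y in lborel. integrable lborel (\<lambda>x. case (y, x) of (y, x) \<Rightarrow> k (x - y) * (cmod (v y))\<^sup>2)"
      using integrable_isometry(3)[OF k] k_int by simp
  qed
  have H_int: "integrable lborel ?H"
    using lborel_pair.integrable_snd[of "\<lambda>y x. k (x - y) * (cmod (v y))\<^sup>2"] pair by simp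
  have "(LINT x|lborel. ?H x) = (LINT y|lborel. LINT x|lborel. k (x - y) * (cmod (v y))\<^sup>2)"
    using lborel_pair.Fubini_integral[of "\<lambda>y x. k (x - y) * (cmod (v y))\<^sup>2"] pair by simp
  also have "\<dots> = (LINT z|lborel. k z) * (l2norm v)\<^sup>2"
    by (simp add: integrable_isometry(4)[OF k] l2norm_sq)
  finally have H: "(LINT x|lborel. ?H x) = (LINT z|lborel. k z) * (l2norm v)\<^sup>2" .
  have bnd: "integrable lborel (\<lambda>x. (LINT z|lborel. k z) * ?H x)" using H_int by simp
  have meas: "(\<lambda>x. LINT y|lborel. K x y * v y) \<in> borel_measurable borel"
  proof -
    have [measurable]: "(\<lambda>(x, y). K x y) \<in> borel_measurable (lborel \<Otimes>\<^sub>M lborel)"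
      unfolding lborel_prod using K by simp
    have "(\<lambda>(x, y). K x y * v y) \<in> borel_measurable (lborel \<Otimes>\<^sub>M lborel)" by measurable
    from lborel.borel_measurable_lebesgue_integral[OF this] show ?thesis by simp
  qed
  have Kv2: "integrable lborel (\<lambda>x. (cmod (LINT y|lborel. K x y * v y))\<^sup>2)"
    by (rule Bochner_Integration.integrable_bound[OF bnd])
      (use meas in \<open>auto intro: order_trans[OF pt abs_ge_self]\<close>)
  then show "(\<lambda>x. LINT y|lborel. K x y * v y) \<in> L2" using meas by (simp add: L2_iff)
  have "(l2norm (\<lambda>x. LINT y|lborel. K x y * v y))\<^sup>2 \<le> (LINT x|lborel. (LINT z|lborel. k z) * ?H x)"
    unfolding l2norm_sq by (rule integral_mono[OF Kv2 bnd]) (rule pt)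
  also have "\<dots> = ((LINT z|lborel. k z) * l2norm v)\<^sup>2"
    unfolding integral_mult_right_zero H by (simp add: power_mult_distrib power2_eq_square)
  finally show "l2norm (\<lambda>x. LINT y|lborel. K x y * v y) \<le> (LINT z|lborel. k z) * l2norm v"
    by (rule power2_le_imp_le) (intro mult_nonneg_nonneg l2norm_nonneg Bochner_Integration.integral_nonneg k0)
qed

definition convolution :: "('a::euclidean_space \<Rightarrow> complex) \<Rightarrow> ('a \<Rightarrow> complex) \<Rightarrow> 'a \<Rightarrow> complex" where
  "convolution s v x = (LINT y|lborel. s (x - y) * v y)"

lemma rapid_reflect: "rapid s \<Longrightarrow> rapid (\<lambda>y. s (x - y))"
  using rapid_scale[of s "-1" x] by simp

lemma l2norm_reflect: "s \<in> borel_measurable borel \<Longrightarrow> l2norm (\<lambda>y. s (x - y)) = l2norm s"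
  unfolding l2norm_def by (subst integrable_isometry(2)[of "\<lambda>y. (cmod (s y))\<^sup>2"]) auto

lemma convolution_integrable:
  assumes "rapid s" "v \<in> L2"
  shows "integrable lborel (\<lambda>y. s (x - y) * v y)" "cmod (convolution s v x) \<le> l2norm s * l2norm v"
  using L2_mult_integrable(2)[OF rapid_L2[OF rapid_reflect[OF assms(1)]] assms(2)]
    L2_cauchy_schwarz(2)[OF rapid_L2[OF rapid_reflect[OF assms(1)]] assms(2), of x]
  by (simp_all add: convolution_def l2norm_reflect[OF borel_rapid[OF assms(1)]])

text \<open>Here v is only square-integrable, so the Taylor remainder of s is dominated by C |h|^2
  times a fixed square-integrable function and Cauchy-Schwarz makes the error quadratic in
  h.\<close>

lemma convolution_has_derivative:
  fixes s v :: "'a::euclidean_space \<Rightarrow> complex"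
  assumes s: "rapid s" and v: "v \<in> L2"
  shows "(convolution s v has_derivative (\<lambda>h. convolution (ddir h s) v x)) (at x)"
proof -
  let ?N = "DIM('a) + 2"
  obtain C where C: "0 \<le> C" "\<And>z h. norm h \<le> 1 \<Longrightarrow> cmod (s (z + h) - s z - ddir h s z) * japanese z ^ ?N \<le> C * (norm h)\<^sup>2"
    using rapid_taylor[OF s, of ?N] by blast
  let ?\<psi> = "\<lambda>z::'a. complex_of_real (inverse (japanese z ^ ?N))"
  have [measurable]: "(japanese :: 'a \<Rightarrow> real) \<in> borel_measurable borel" unfolding japanese_def by measurable
  have \<psi>: "?\<psi> \<in> L2"
    unfolding L2_iff
  proof
    show "integrable lborel (\<lambda>z. (cmod (?\<psi> z))\<^sup>2)"
    proof (rule Bochner_Integration.integrable_bound[OF integrable_japanese])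
      have "(cmod (?\<psi> z))\<^sup>2 \<le> inverse (japanese z ^ ?N)" for z
      proof -
        let ?i = "inverse (japanese z ^ ?N)"
        have "1 \<le> japanese z ^ ?N" by (intro one_le_power japanese_ge_1)
        then have i: "0 \<le> ?i" "?i \<le> 1" by (auto simp: inverse_le_1_iff simp del: power_Suc)
        have "(cmod (?\<psi> z))\<^sup>2 = ?i * ?i" unfolding norm_of_real using i(1) by (simp add: power2_eq_square)
        also have "\<dots> \<le> 1 * ?i" by (rule mult_right_mono[OF i(2,1)])
        finally show ?thesis by simp
      qed
      then show "AE z in lborel. norm ((cmod (?\<psi> z))\<^sup>2) \<le> norm (inverse (japanese z ^ ?N))"
        by (intro AE_I2) (smt (verit) norm_of_real real_norm_def zero_le_power2)
    qed measurable
  qed measurable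
  have lin: "linear (\<lambda>h. convolution (ddir h s) v x)"
    unfolding convolution_def
    by (intro linearI) (use convolution_integrable(1)[OF tame_ddir[OF s] v] in
      \<open>simp_all add: ddir_vec[OF smooth_differentiable[OF tame_smooth[OF s]]] distrib_right\<close>)
  have error: "cmod (convolution s v y - convolution s v x - convolution (ddir (y - x) s) v x) \<le>
      (C * (norm (y - x))\<^sup>2) * (l2norm ?\<psi> * l2norm v)" if "norm (y - x) \<le> 1" for y
  proof -
    define h where "h = y - x"
    have y: "y = x + h" and h: "norm h \<le> 1" using that by (auto simp: h_def)
    let ?R = "\<lambda>z. s (z + h) - s z - ddir h s z"
    have R: "cmod (?R z) \<le> C * (norm h)\<^sup>2 * cmod (?\<psi> z)" for z
      using C(2)[OF h, of z] japanese_pos[of z] unfolding norm_of_real by (simp add: field_simps)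
    have "convolution s v y - convolution s v x - convolution (ddir h s) v x =
        (LINT t|lborel. s (y - t) * v t - s (x - t) * v t - ddir h s (x - t) * v t)"
      using convolution_integrable(1)[OF s v] convolution_integrable(1)[OF tame_ddir[OF s] v]
      by (simp add: convolution_def)
    also have "\<dots> = (LINT t|lborel. ?R (x - t) * v t)"
      by (simp add: y algebra_simps)
    finally have eq: "convolution s v y - convolution s v x - convolution (ddir h s) v x =
        (LINT t|lborel. ?R (x - t) * v t)" .
    have bor: "?R \<in> borel_measurable borel"
      using borel_rapid[OF s] borel_rapid[OF tame_ddir[OF s], of h] by measurable
    have RL: "?R \<in> L2" "l2norm ?R \<le> C * (norm h)\<^sup>2 * l2norm ?\<psi>"
      using L2_dominated[OF bor \<psi> _ R] C(1) by auto
    have bor': "(\<lambda>t. ?R (x - t)) \<in> borel_measurable borel" using bor by measurable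
    have "(\<lambda>t. ?R (x - t)) \<in> L2"
      using RL(1) integrable_isometry(1)[of "\<lambda>z. (cmod (?R z))\<^sup>2" x] bor bor' by (auto simp: L2_iff)
    from L2_cauchy_schwarz(2)[OF this v]
    have "cmod (LINT t|lborel. ?R (x - t) * v t) \<le> l2norm ?R * l2norm v"
      by (simp only: l2norm_reflect[OF bor])
    also have "\<dots> \<le> (C * (norm h)\<^sup>2 * l2norm ?\<psi>) * l2norm v"
      by (intro mult_right_mono RL(2) l2norm_nonneg)
    finally show ?thesis by (simp add: eq h_def[symmetric] mult.assoc)
  qed
  show ?thesis
  proof (rule has_derivativeI_sandwich[of 1])
    show "bounded_linear (\<lambda>h. convolution (ddir h s) v x)" using lin by (simp add: linear_conv_bounded_linear)
    show "((\<lambda>y. (C * norm (y - x)) * (l2norm ?\<psi> * l2norm v)) \<longlongrightarrow> 0) (at x)"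
      by (auto intro!: tendsto_eq_intros)
    fix y assume "y \<noteq> x" "dist y x < 1"
    then show "norm (convolution s v y - convolution s v x - convolution (ddir (y - x) s) v x) / norm (y - x) \<le>
        (C * norm (y - x)) * (l2norm ?\<psi> * l2norm v)"
      using error[of y] by (simp add: dist_norm pos_divide_le_eq power2_eq_square mult_ac)
  qed simp
qed

lemma ddir_convolution:
  assumes "rapid s" "v \<in> L2"
  shows "ddir a (convolution s v) = convolution (ddir a s) v"
  by (rule ext) (rule ddir_eqI[OF convolution_has_derivative[OF assms]])

text \<open>Derivatives fall on s, so convolutions of rapid functions with the fixed v are a stable
  family, and Cauchy-Schwarz bounds each of them.\<close>

lemma bounded_smooth_convolution:
  fixes s v :: "'a::euclidean_space \<Rightarrow> complex"
  assumes s: "rapid s" and v: "v \<in> L2"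
  shows "bounded_smooth (convolution s v)"
proof -
  let ?S = "{convolution s v |s. rapid s}"
  have "convolution s v \<in> ?S" using s by blast
  then show ?thesis
  proof (rule tame_coinduct)
    show "f differentiable (at x)" if "f \<in> ?S" for f x
      using that convolution_has_derivative[OF _ v] differentiableI by blast
    show "ddir a f \<in> ?S" if "f \<in> ?S" for f a
      using that ddir_convolution[OF _ v] tame_ddir by blast
    show "\<exists>C. \<forall>x. norm (f x) * w x \<le> C" if f: "f \<in> ?S" and w: "w \<in> {\<lambda>x. 1}" for f and w :: "'a \<Rightarrow> real"
    proof -
      from f obtain s where "f = convolution s v" "rapid s" by blast
      then show ?thesis using convolution_integrable(2)[OF _ v] w by auto
    qed
  qed
qed

lemma convolution_ddir_swap:
  assumes s: "rapid s" and f: "rapid f"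
  shows "convolution (ddir a s) f = convolution s (ddir a f)"
proof
  fix x
  have "ddir a (\<lambda>y. s (x - y)) = (\<lambda>y. - ddir a s (x - y))"
    using ddir_scale[OF tame_smooth[OF s], of a "-1" x] by simp
  with integration_by_parts[OF rapid_reflect[OF s] rapid_imp_bounded_smooth[OF f], of a x]
  show "convolution (ddir a s) f x = convolution s (ddir a f) x"
    by (simp add: convolution_def)
qed

section \<open>Gaussian mollifiers\<close>

definition mollifier :: "nat \<Rightarrow> 'a::euclidean_space \<Rightarrow> real" where
  "mollifier n z = real (Suc n) ^ DIM('a) * gaussian (real (Suc n) *\<^sub>R z)"

lemma gaussian_borel [measurable]: "(gaussian :: 'a::euclidean_space \<Rightarrow> real) \<in> borel_measurable borel"
  by (rule borel_rapid[OF gaussian_rapid])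

lemma mollifier_borel [measurable]: "(mollifier n :: 'a::euclidean_space \<Rightarrow> real) \<in> borel_measurable borel"
  unfolding mollifier_def by measurable

lemma mollifier_pos: "0 < mollifier n z"
  unfolding mollifier_def by (intro mult_pos_pos zero_less_power gaussian_pos) simp

lemma mollifier_rapid: "rapid (mollifier n :: 'a::euclidean_space \<Rightarrow> real)"
  unfolding mollifier_def[abs_def]
  using rapid_linear[OF bounded_linear_mult_right rapid_scale[OF gaussian_rapid, of "real (Suc n)" 0]] by simp

lemma complex_mollifier_rapid: "rapid (\<lambda>z::'a::euclidean_space. complex_of_real (mollifier n z))"
  by (rule rapid_linear[OF bounded_linear_of_real mollifier_rapid])

lemma mollifier_integral: "(LINT z|lborel. mollifier n (z::'a::euclidean_space)) = 1"
  using integral_scale[OF gaussian_borel, of "real (Suc n)", where 'a = 'a]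
  by (simp add: mollifier_def gaussian_integral del: of_nat_Suc)

definition mollify :: "nat \<Rightarrow> ('a::euclidean_space \<Rightarrow> complex) \<Rightarrow> 'a \<Rightarrow> complex" where
  "mollify n = convolution (\<lambda>z. of_real (mollifier n z))"

lemma mollifier_bounded: "\<exists>B. \<forall>z. mollifier n (z::'a::euclidean_space) \<le> B"
  using rapid_decay[OF mollifier_rapid[of n, where 'a = 'a], of 0] by (auto simp: abs_le_iff)

lemma mollify_L2:
  fixes v :: "'a::euclidean_space \<Rightarrow> complex"
  assumes v: "v \<in> L2"
  shows "mollify n v \<in> L2" "l2norm (mollify n v) \<le> l2norm v"
proof -
  obtain B where B: "\<And>z::'a. mollifier n z \<le> B" using mollifier_bounded by blast
  have cont: "continuous_on UNIV (mollifier n :: 'a \<Rightarrow> real)"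
    by (rule smooth_continuous[OF tame_smooth[OF mollifier_rapid]])
  have m: "(\<lambda>(x, y). complex_of_real (mollifier n (x - y :: 'a))) \<in> borel_measurable borel"
    unfolding case_prod_unfold
    by (intro borel_measurable_continuous_onI continuous_intros continuous_on_compose2[OF cont]) auto
  have le: "cmod (complex_of_real (mollifier n (x - y))) \<le> mollifier n (x - y)" for x y :: 'a
    using mollifier_pos[of n "x - y"] by simp
  note schur = schur_bound[OF borel_rapid[OF mollifier_rapid] less_imp_le[OF mollifier_pos] B
      rapid_integrable[OF mollifier_rapid] m le v]
  show "mollify n v \<in> L2" "l2norm (mollify n v) \<le> l2norm v"
    using schur(2,3) by (simp_all add: mollify_def convolution_def[abs_def] mollifier_integral)
qed

text \<open>Rescaling the integration variable turns mollification into the average of h (x - w / (n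
  + 1)) against a fixed Gaussian of mass 1, which gives both the bound and the dominated
  limit.\<close>

lemma mollify_pointwise:
  fixes h :: "'a::euclidean_space \<Rightarrow> complex"
  assumes cont: "continuous_on UNIV h" and B: "\<And>x. cmod (h x) \<le> B"
  shows "cmod (mollify n h x) \<le> B" "(\<lambda>n. mollify n h x) \<longlonglongrightarrow> h x"
proof -
  have [measurable]: "h \<in> borel_measurable borel"
    by (rule borel_measurable_continuous_onI[OF cont])
  let ?c = "\<lambda>n. real (Suc n)"
  let ?k = "\<lambda>n w. complex_of_real (gaussian w) * h (x - (1 / ?c n) *\<^sub>R w)"
  have eq: "mollify n h x = (LINT w|lborel. ?k n w)" for n
  proof -
    have "mollify n h x = (LINT z|lborel. of_real (mollifier n (x - (x - z))) * h (x - z))"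
      unfolding mollify_def convolution_def
      by (rule integrable_isometry(2)[of "\<lambda>y. of_real (mollifier n (x - y)) * h y" x, symmetric]) measurable
    also have "\<dots> = (LINT z|lborel. ?c n ^ DIM('a) *\<^sub>R ?k n (?c n *\<^sub>R z))"
      by (intro arg_cong[of _ _ "lebesgue_integral lborel"] ext)
        (simp add: mollifier_def scaleR_conv_of_real mult.assoc del: of_nat_Suc)
    also have "\<dots> = (LINT w|lborel. ?k n w)"
      unfolding integral_scaleR_right by (subst integral_scale) (auto simp del: of_nat_Suc)
    finally show ?thesis .
  qed
  have g_int: "integrable lborel (\<lambda>w::'a. B * gaussian w)"
    using rapid_integrable[OF gaussian_rapid[where 'a = 'a]] by simp
  have k_le: "cmod (?k n w) \<le> B * gaussian w" for n w
  proof -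
    have "gaussian w * cmod (h (x - (1 / ?c n) *\<^sub>R w)) \<le> gaussian w * B"
      by (intro mult_left_mono B less_imp_le[OF gaussian_pos])
    then show ?thesis using gaussian_pos[of w] by (simp add: norm_mult mult.commute)
  qed
  have k_int: "integrable lborel (?k n)" for n
    by (rule Bochner_Integration.integrable_bound[OF g_int])
      (auto intro: order_trans[OF k_le abs_ge_self] simp del: of_nat_Suc)
  have "cmod (LINT w|lborel. ?k n w) \<le> (LINT w|lborel. B * gaussian (w::'a))" for n
    by (rule Bochner_Integration.integral_norm_bound_integral[OF k_int g_int]) (rule k_le)
  then show "cmod (mollify n h x) \<le> B" by (simp add: eq gaussian_integral)
  have "(\<lambda>n. LINT w|lborel. ?k n w) \<longlonglongrightarrow> (LINT w|lborel. complex_of_real (gaussian (w::'a)) * h x)"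
  proof (rule integral_dominated_convergence)
    show "integrable lborel (\<lambda>w::'a. B * gaussian w)" by (rule g_int)
    have "(\<lambda>n. 1 / ?c n) \<longlonglongrightarrow> 0" by (rule LIMSEQ_Suc[OF lim_const_over_n])
    then have "(\<lambda>n. x - (1 / ?c n) *\<^sub>R w) \<longlonglongrightarrow> x - 0 *\<^sub>R w" for w by (intro tendsto_intros)
    then have "(\<lambda>n. h (x - (1 / ?c n) *\<^sub>R w)) \<longlonglongrightarrow> h x" for w
      by (intro continuous_on_tendsto_compose[OF cont]) auto
    then show "AE w in lborel. (\<lambda>n. ?k n w) \<longlonglongrightarrow> complex_of_real (gaussian w) * h x"
      by (intro AE_I2 tendsto_mult tendsto_const)
    show "AE w in lborel. norm (?k n w) \<le> B * gaussian w" for n using k_le by (intro AE_I2)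
  qed measurable
  then show "(\<lambda>n. mollify n h x) \<longlonglongrightarrow> h x"
    unfolding eq using gaussian_integral[where 'a = 'a] by simp
qed

section \<open>Strong convergence of mollification on square-integrable functions\<close>

lemma l2norm_tendsto_zero:
  assumes lim: "e \<longlonglongrightarrow> 0" and le: "\<And>n. (l2norm (f n))\<^sup>2 \<le> e n"
  shows "(\<lambda>n. l2norm (f n)) \<longlonglongrightarrow> 0"
proof -
  have "(\<lambda>n. (l2norm (f n))\<^sup>2) \<longlonglongrightarrow> 0"
    by (rule tendsto_sandwich[OF _ _ tendsto_const lim]) (use le in auto)
  from tendsto_real_sqrt[OF this] show ?thesis by (simp add: l2norm_nonneg)
qed

lemma l2norm_dominated:
  assumes meas: "\<And>n. f n \<in> borel_measurable borel" and g: "integrable lborel g"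
    and le: "\<And>n x. (cmod (f n x))\<^sup>2 \<le> g x" and lim: "AE x in lborel. (\<lambda>n. f n x) \<longlonglongrightarrow> 0"
  shows "(\<lambda>n. l2norm (f n)) \<longlonglongrightarrow> 0"
proof (rule l2norm_tendsto_zero)
  have [measurable]: "f n \<in> borel_measurable borel" for n by (rule meas)
  have "(\<lambda>n. LINT x|lborel. (cmod (f n x))\<^sup>2) \<longlonglongrightarrow> (LINT x|(lborel::'a measure). 0)"
  proof (rule integral_dominated_convergence)
    show "integrable lborel g" by (rule g)
    show "AE x in lborel. (\<lambda>n. (cmod (f n x))\<^sup>2) \<longlonglongrightarrow> 0"
      using lim by eventually_elim (auto intro!: tendsto_eq_intros)
    show "AE x in lborel. norm ((cmod (f n x))\<^sup>2) \<le> g x" for n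
      using le by (intro AE_I2) simp
  qed measurable
  then show "(\<lambda>n. LINT x|lborel. (cmod (f n x))\<^sup>2) \<longlonglongrightarrow> 0" by simp
qed (simp add: l2norm_sq)

lemma cmod_diff_sq: "(cmod (a - b))\<^sup>2 = (cmod a)\<^sup>2 + (cmod b)\<^sup>2 - 2 * Re (a * cnj b)"
  unfolding cmod_power2 by (simp add: power2_eq_square algebra_simps)

text \<open>Since mollification is a contraction, strong convergence follows from the convergence of
  the inner products with h, which is dominated.\<close>

lemma mollify_tendsto_continuous:
  fixes h :: "'a::euclidean_space \<Rightarrow> complex"
  assumes cont: "continuous_on UNIV h" and B: "\<And>x. cmod (h x) \<le> B" and int: "integrable lborel h"
  shows "h \<in> L2" "(\<lambda>n. l2norm (\<lambda>x. mollify n h x - h x)) \<longlonglongrightarrow> 0"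
proof -
  have meas[measurable]: "h \<in> borel_measurable borel" by (rule borel_measurable_continuous_onI[OF cont])
  have B0: "0 \<le> B" using order_trans[OF norm_ge_zero B] .
  have int_B: "integrable lborel (\<lambda>x. B * cmod (h x))" using int by simp
  have "integrable lborel (\<lambda>x. (cmod (h x))\<^sup>2)"
    by (rule Bochner_Integration.integrable_bound[OF int_B])
      (use B B0 in \<open>auto simp: power2_eq_square abs_mult intro!: mult_right_mono\<close>)
  then show h: "h \<in> L2" by (simp add: L2_iff)
  note J = mollify_L2[OF h]
  have hh: "(LINT x|lborel. h x * cnj (h x)) = of_real ((l2norm h)\<^sup>2)"
    unfolding complex_norm_square[symmetric] l2norm_sq by (rule integral_complex_of_real)
  let ?e = "\<lambda>n. 2 * (l2norm h)\<^sup>2 - 2 * Re (LINT x|lborel. mollify n h x * cnj (h x))"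
  show "(\<lambda>n. l2norm (\<lambda>x. mollify n h x - h x)) \<longlonglongrightarrow> 0"
  proof (rule l2norm_tendsto_zero)
    have "(\<lambda>n. LINT x|lborel. mollify n h x * cnj (h x)) \<longlonglongrightarrow> (LINT x|lborel. h x * cnj (h x))"
    proof (rule integral_dominated_convergence)
      show "integrable lborel (\<lambda>x. B * cmod (h x))" by (rule int_B)
      have [measurable]: "mollify n h \<in> borel_measurable borel" "(\<lambda>x. cnj (h x)) \<in> borel_measurable borel" for n
        using L2_borel[OF J(1)] L2_borel[OF L2_cnj[OF h]] by auto
      show "(\<lambda>x. h x * cnj (h x)) \<in> borel_measurable lborel"
        "(\<lambda>x. mollify n h x * cnj (h x)) \<in> borel_measurable lborel" for n by measurable
      show "AE x in lborel. (\<lambda>n. mollify n h x * cnj (h x)) \<longlonglongrightarrow> h x * cnj (h x)"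
        by (intro AE_I2 tendsto_intros mollify_pointwise(2)[OF cont B])
      show "AE x in lborel. norm (mollify n h x * cnj (h x)) \<le> B * cmod (h x)" for n
        unfolding norm_mult complex_mod_cnj
        by (intro AE_I2 mult_right_mono mollify_pointwise(1)[OF cont B]) simp
    qed
    from tendsto_diff[OF tendsto_const tendsto_mult[OF tendsto_const tendsto_Re[OF this]], of "2 * (l2norm h)\<^sup>2" 2]
    show "?e \<longlonglongrightarrow> 0" unfolding hh by simp
  next
    fix n
    have i: "integrable lborel (\<lambda>x. (cmod (mollify n h x))\<^sup>2)" "integrable lborel (\<lambda>x. (cmod (h x))\<^sup>2)"
      using J(1) h by (auto simp: L2_iff)
    have i2: "integrable lborel (\<lambda>x. mollify n h x * cnj (h x))"
      by (rule L2_mult_integrable(2)[OF J(1) L2_cnj[OF h]])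
    have "(l2norm (\<lambda>x. mollify n h x - h x))\<^sup>2 = (LINT x|lborel.
        (cmod (mollify n h x))\<^sup>2 + (cmod (h x))\<^sup>2 - 2 * Re (mollify n h x * cnj (h x)))"
      unfolding l2norm_sq cmod_diff_sq ..
    also have "\<dots> = (l2norm (mollify n h))\<^sup>2 + (l2norm h)\<^sup>2 - 2 * Re (LINT x|lborel. mollify n h x * cnj (h x))"
      unfolding l2norm_sq Bochner_Integration.integral_diff[OF Bochner_Integration.integrable_add[OF i]
          integrable_mult_right[OF integrable_Re[OF i2]]] Bochner_Integration.integral_add[OF i]
        integral_mult_right_zero integral_Re[OF i2] ..
    also have "\<dots> \<le> ?e n"
      using power_mono[OF J(2) l2norm_nonneg, of n 2] by simp
    finally show "(l2norm (\<lambda>x. mollify n h x - h x))\<^sup>2 \<le> ?e n" .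
  qed
qed

lemma L2_truncate:
  fixes v :: "'a::euclidean_space \<Rightarrow> complex"
  assumes v: "v \<in> L2"
  shows "(\<lambda>n. l2norm (\<lambda>x. v x - (if norm x \<le> real n \<and> cmod (v x) \<le> real n then v x else 0))) \<longlonglongrightarrow> 0"
proof (rule l2norm_dominated)
  have [measurable]: "v \<in> borel_measurable borel" by (rule L2_borel[OF v])
  show "(\<lambda>x. v x - (if norm x \<le> real n \<and> cmod (v x) \<le> real n then v x else 0)) \<in> borel_measurable borel" for n
    by measurable
  show "integrable lborel (\<lambda>x. (cmod (v x))\<^sup>2)" using v by (simp add: L2_iff)
  show "AE x in lborel. (\<lambda>n. v x - (if norm x \<le> real n \<and> cmod (v x) \<le> real n then v x else 0)) \<longlonglongrightarrow> 0"
  proof (rule AE_I2)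
    fix x
    obtain N where N: "max (norm x) (cmod (v x)) \<le> real N" using real_arch_simple by blast
    have "eventually (\<lambda>n. v x - (if norm x \<le> real n \<and> cmod (v x) \<le> real n then v x else 0) = 0) sequentially"
      unfolding eventually_sequentially
    proof (intro exI[of _ N] allI impI)
      fix n assume "N \<le> n"
      then have "real N \<le> real n" by simp
      then show "v x - (if norm x \<le> real n \<and> cmod (v x) \<le> real n then v x else 0) = 0" using N by auto
    qed
    then show "(\<lambda>n. v x - (if norm x \<le> real n \<and> cmod (v x) \<le> real n then v x else 0)) \<longlonglongrightarrow> 0"
      by (rule tendsto_eventually)
  qed
qed auto

text \<open>A measurable function is an almost everywhere limit of continuous ones. Applying
  \<open>clip\<close>, which fixes values of modulus at most r, and multiplying by \<theta>, which
  is 1 on the ball of radius r and 0 outside radius r + 1, makes the limit dominated without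
  changing it.\<close>

lemma continuous_approximation_bounded:
  fixes v :: "'a::euclidean_space \<Rightarrow> complex"
  assumes meas: "v \<in> borel_measurable borel" and r: "0 < r"
    and v: "\<And>x. cmod (v x) \<le> r" "\<And>x. r < norm x \<Longrightarrow> v x = 0"
  shows "\<exists>h. (\<forall>n::nat. continuous_on UNIV (h n) \<and> (\<forall>x. cmod (h n x) \<le> r) \<and> integrable lborel (h n)) \<and>
    (\<lambda>n. l2norm (\<lambda>x. v x - h n x)) \<longlonglongrightarrow> 0"
proof -
  have "v \<in> borel_measurable lebesgue" using meas by (intro measurable_completion) simp
  then have "v measurable_on UNIV" by (rule lebesgue_measurable_imp_measurable_on) simp
  then obtain N g where N: "negligible N" and g: "\<And>n. continuous_on UNIV (g n)"
      "\<And>x. x \<notin> N \<Longrightarrow> (\<lambda>n. g n x) \<longlonglongrightarrow> v x"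
    unfolding measurable_on_def by auto
  define clip where "clip z = of_real (1 / max 1 (cmod z / r)) * z" for z :: complex
  define \<theta> where "\<theta> x = max 0 (min 1 (r + 1 - norm x))" for x :: 'a
  define h where "h n x = of_real (\<theta> x) * clip (g n x)" for n x
  have clip_cont: "continuous_on S clip" for S
    unfolding clip_def by (intro continuous_intros) (use r in \<open>auto simp: max_def\<close>)
  have clip_le: "cmod (clip z) \<le> r" for z
  proof -
    have "cmod z / r * r \<le> max 1 (cmod z / r) * r" using r by (intro mult_right_mono) auto
    then have "cmod z \<le> max 1 (cmod z / r) * r" using r by (simp del: mult_le_cancel_right)
    moreover have "cmod (clip z) = cmod z / max 1 (cmod z / r)" by (simp add: clip_def norm_mult norm_divide)
    moreover have "0 < max 1 (cmod z / r)" by simp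
    ultimately show ?thesis by (simp add: pos_divide_le_eq mult.commute del: less_max_iff_disj)
  qed
  have clip_id: "clip z = z" if "cmod z \<le> r" for z using that r by (simp add: clip_def max_def)
  have \<theta>_cont: "continuous_on S \<theta>" for S unfolding \<theta>_def by (intro continuous_intros)
  have \<theta>: "0 \<le> \<theta> x" "\<theta> x \<le> 1" "norm x \<le> r \<Longrightarrow> \<theta> x = 1" "r + 1 < norm x \<Longrightarrow> \<theta> x = 0" for x
    by (auto simp: \<theta>_def)
  have h_cont: "continuous_on UNIV (h n)" for n
    unfolding h_def by (intro continuous_intros \<theta>_cont continuous_on_compose2[OF clip_cont[of UNIV] g(1)]) auto
  have h_le: "cmod (h n x) \<le> r" for n x
    using mult_mono[OF \<theta>(2)[of x] clip_le[of "g n x"]] \<theta>(1)[of x] by (simp add: h_def norm_mult)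
  have h_0: "h n x = 0" if "r + 1 < norm x" for n x using \<theta>(4)[OF that] by (simp add: h_def)
  have [measurable]: "h n \<in> borel_measurable borel" for n by (rule borel_measurable_continuous_onI[OF h_cont])
  have ball_int: "integrable lborel (\<lambda>x::'a. C * indicator (cball 0 (r + 1)) x :: real)" for C
    using emeasure_bounded_finite[of "cball (0::'a) (r + 1)"] by simp
  have h_int: "integrable lborel (h n)" for n
    by (rule Bochner_Integration.integrable_bound[OF ball_int[of r]])
      (use h_le h_0 r in \<open>auto simp: indicator_def intro!: AE_I2\<close>)
  have "(\<lambda>n. l2norm (\<lambda>x. v x - h n x)) \<longlonglongrightarrow> 0"
  proof (rule l2norm_dominated)
    show "(\<lambda>x. v x - h n x) \<in> borel_measurable borel" for n using meas by measurable
    show "integrable lborel (\<lambda>x::'a. (2 * r)\<^sup>2 * indicator (cball 0 (r + 1)) x)" by (rule ball_int)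
    show "(cmod (v x - h n x))\<^sup>2 \<le> (2 * r)\<^sup>2 * indicator (cball 0 (r + 1)) x" for n x
    proof (cases "norm x \<le> r + 1")
      case True
      have "cmod (v x - h n x) \<le> 2 * r"
        using norm_triangle_ineq4[of "v x" "h n x"] v(1)[of x] h_le[of n x] by simp
      then have "(cmod (v x - h n x))\<^sup>2 \<le> (2 * r)\<^sup>2" by (rule power_mono) simp
      then show ?thesis using True by simp
    next
      case False
      then show ?thesis using v(2)[of x] h_0[of x n] by simp
    qed
    have "AE x in lebesgue. x \<notin> N" using N by (intro AE_not_in) (simp add: negligible_iff_null_sets)
    then have "AE x in lborel. x \<notin> N" by (simp add: AE_completion_iff)
    then show "AE x in lborel. (\<lambda>n. v x - h n x) \<longlonglongrightarrow> 0"
    proof eventually_elim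
      case (elim x)
      have "(\<lambda>n. clip (g n x)) \<longlonglongrightarrow> clip (v x)"
        by (rule continuous_on_tendsto_compose[OF clip_cont[of UNIV] g(2)[OF elim]]) auto
      then have "(\<lambda>n. v x - h n x) \<longlonglongrightarrow> v x - of_real (\<theta> x) * clip (v x)"
        unfolding h_def by (intro tendsto_intros)
      moreover have "of_real (\<theta> x) * clip (v x) = v x"
        unfolding clip_id[OF v(1)[of x]] using \<theta>(3)[of x] v(2)[of x] by (cases "norm x \<le> r") auto
      ultimately show ?case by simp
    qed
  qed
  then show ?thesis using h_cont h_le h_int by (intro exI[of _ h]) auto
qed

lemma L2_continuous_approximation:
  fixes v :: "'a::euclidean_space \<Rightarrow> complex"
  assumes v: "v \<in> L2" and e: "0 < e"
  shows "\<exists>h B. continuous_on UNIV h \<and> (\<forall>x. cmod (h x) \<le> B) \<and> integrable lborel h \<and> l2norm (\<lambda>x. v x - h x) < e"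
proof -
  have [measurable]: "v \<in> borel_measurable borel" by (rule L2_borel[OF v])
  have "\<forall>\<^sub>F n in sequentially. l2norm (\<lambda>x. v x - (if norm x \<le> real n \<and> cmod (v x) \<le> real n then v x else 0)) < e / 2"
    using L2_truncate[OF v] e by (intro order_tendstoD(2)) auto
  then have "\<forall>\<^sub>F n in sequentially. 0 < n \<and>
      l2norm (\<lambda>x. v x - (if norm x \<le> real n \<and> cmod (v x) \<le> real n then v x else 0)) < e / 2"
    using eventually_gt_at_top[of "0::nat"] by eventually_elim auto
  then obtain n where n: "0 < n" and
    "l2norm (\<lambda>x. v x - (if norm x \<le> real n \<and> cmod (v x) \<le> real n then v x else 0)) < e / 2"
    using eventually_happens' sequentially_bot by blast
  moreover define w where "w x = (if norm x \<le> real n \<and> cmod (v x) \<le> real n then v x else 0)" for x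
  ultimately have vw: "l2norm (\<lambda>x. v x - w x) < e / 2" by simp
  have w_meas: "w \<in> borel_measurable borel" unfolding w_def by measurable
  have w_L2: "w \<in> L2" by (rule L2_dominated(1)[OF w_meas v, of 1]) (auto simp: w_def)
  obtain h where h: "\<And>m. continuous_on UNIV (h m)" "\<And>m x. cmod (h m x) \<le> real n" "\<And>m. integrable lborel (h m)"
    and lim: "(\<lambda>m::nat. l2norm (\<lambda>x. w x - h m x)) \<longlonglongrightarrow> 0"
    using continuous_approximation_bounded[OF w_meas, of "real n"] n by (fastforce simp: w_def)
  have "\<forall>\<^sub>F m in sequentially. l2norm (\<lambda>x. w x - h m x) < e / 2"
    using lim e by (intro order_tendstoD(2)) auto
  then obtain m where m: "l2norm (\<lambda>x. w x - h m x) < e / 2"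
    using eventually_happens' sequentially_bot by blast
  have "l2norm (\<lambda>x. v x - h m x) < e"
    using l2norm_diff_triangle[OF v w_L2 mollify_tendsto_continuous(1)[OF h(1) h(2) h(3)], of m] vw m by simp
  then show ?thesis using h by blast
qed

lemma mollify_diff:
  assumes "v \<in> L2" "h \<in> L2"
  shows "mollify n (\<lambda>x. v x - h x) = (\<lambda>x. mollify n v x - mollify n h x)"
  unfolding mollify_def convolution_def
  by (simp add: right_diff_distrib convolution_integrable(1)[OF complex_mollifier_rapid assms(1)]
      convolution_integrable(1)[OF complex_mollifier_rapid assms(2)])

text \<open>Mollification is a contraction, so an approximant h within r / 3 of v stays within r / 3
  of it after mollification, uniformly in n.\<close>

lemma mollify_tendsto:
  assumes v: "v \<in> L2"
  shows "(\<lambda>n. l2norm (\<lambda>x. mollify n v x - v x)) \<longlonglongrightarrow> 0"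
proof (rule LIMSEQ_I)
  fix r :: real assume r: "0 < r"
  obtain h B where h: "continuous_on UNIV h" "\<And>x. cmod (h x) \<le> B" "integrable lborel h" and vh: "l2norm (\<lambda>x. v x - h x) < r / 3"
    using L2_continuous_approximation[OF v, of "r / 3"] r by auto
  have hL: "h \<in> L2" by (rule mollify_tendsto_continuous(1)[OF h])
  have "\<forall>\<^sub>F n in sequentially. l2norm (\<lambda>x. mollify n h x - h x) < r / 3"
    using mollify_tendsto_continuous(2)[OF h] r by (intro order_tendstoD(2)) auto
  then obtain N where N: "\<And>n. N \<le> n \<Longrightarrow> l2norm (\<lambda>x. mollify n h x - h x) < r / 3"
    by (auto simp: eventually_sequentially)
  have "norm (l2norm (\<lambda>x. mollify n v x - v x) - 0) < r" if "N \<le> n" for n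
  proof -
    have "l2norm (\<lambda>x. mollify n v x - mollify n h x) \<le> l2norm (\<lambda>x. v x - h x)"
      using mollify_L2(2)[OF L2_diff(1)[OF v hL], of n] by (simp add: mollify_diff[OF v hL])
    moreover have "l2norm (\<lambda>x. h x - v x) = l2norm (\<lambda>x. v x - h x)"
      by (simp add: l2norm_def norm_minus_commute)
    ultimately have "l2norm (\<lambda>x. mollify n v x - v x) < r"
      using l2norm_diff_triangle[OF mollify_L2(1)[OF v] mollify_L2(1)[OF hL] v, of n n]
        l2norm_diff_triangle[OF mollify_L2(1)[OF hL] hL v, of n] N[OF that] vh by linarith
    then show ?thesis by (simp add: l2norm_nonneg)
  qed
  then show "\<exists>N. \<forall>n\<ge>N. norm (l2norm (\<lambda>x. mollify n v x - v x) - 0) < r" by blast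
qed

section \<open>Gaussian cutoffs\<close>

definition cutoff :: "nat \<Rightarrow> 'a::euclidean_space \<Rightarrow> complex" where
  "cutoff n x = of_real (exp (- ((1 / real (Suc n))\<^sup>2 * (x \<bullet> x))))"

lemma cutoff_rapid: "rapid (cutoff n)"
  unfolding cutoff_def[abs_def]
  by (intro rapid_linear[OF bounded_linear_of_real] rapid_exp_square) (simp del: of_nat_Suc)

lemma cutoff_le_1: "cmod (cutoff n x) \<le> 1"
  by (simp add: cutoff_def del: of_nat_Suc)

lemma cutoff_tendsto_1: "(\<lambda>n. cutoff n x) \<longlonglongrightarrow> 1"
proof -
  have "(\<lambda>n. 1 / real (Suc n)) \<longlonglongrightarrow> 0" by (rule LIMSEQ_Suc[OF lim_const_over_n])
  then have "(\<lambda>n. cutoff n x) \<longlonglongrightarrow> of_real (exp (- (0\<^sup>2 * (x \<bullet> x))))"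
    unfolding cutoff_def by (intro tendsto_intros)
  then show ?thesis by simp
qed

lemma cutoff_mult_L2:
  assumes f: "f \<in> L2"
  shows "(\<lambda>x. cutoff n x * f x) \<in> L2" "l2norm (\<lambda>x. cutoff n x * f x) \<le> l2norm f"
proof -
  have m: "(\<lambda>x. cutoff n x * f x) \<in> borel_measurable borel"
    using borel_rapid[OF cutoff_rapid] L2_borel[OF f] by measurable
  have le: "cmod (cutoff n x * f x) \<le> 1 * cmod (f x)" for x
    unfolding norm_mult by (intro mult_right_mono cutoff_le_1) simp
  show "(\<lambda>x. cutoff n x * f x) \<in> L2" by (rule L2_dominated(1)[OF m f _ le]) simp
  show "l2norm (\<lambda>x. cutoff n x * f x) \<le> l2norm f" using L2_dominated(2)[OF m f _ le] by simp
qed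

lemma cutoff_mult_tendsto:
  assumes v: "v \<in> L2"
  shows "(\<lambda>n. l2norm (\<lambda>x. cutoff n x * v x - v x)) \<longlonglongrightarrow> 0"
proof (rule l2norm_dominated)
  show "(\<lambda>x. cutoff n x * v x - v x) \<in> borel_measurable borel" for n
    using borel_rapid[OF cutoff_rapid] L2_borel[OF v] by measurable
  show "integrable lborel (\<lambda>x. 4 * (cmod (v x))\<^sup>2)" using v by (simp add: L2_iff)
  show "(cmod (cutoff n x * v x - v x))\<^sup>2 \<le> 4 * (cmod (v x))\<^sup>2" for n x
  proof -
    have "cmod (cutoff n x * v x - v x) \<le> cmod (cutoff n x * v x) + cmod (v x)" by (rule norm_triangle_ineq4)
    also have "\<dots> \<le> 2 * cmod (v x)"
      using mult_right_mono[OF cutoff_le_1[of n x] norm_ge_zero[of "v x"]] by (simp add: norm_mult)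
    finally show ?thesis using power_mono[of _ "2 * cmod (v x)" 2] by (simp add: power_mult_distrib)
  qed
  show "AE x in lborel. (\<lambda>n. cutoff n x * v x - v x) \<longlonglongrightarrow> 0"
  proof (rule AE_I2)
    fix x
    have "(\<lambda>n. cutoff n x * v x - v x) \<longlonglongrightarrow> 1 * v x - v x" by (intro tendsto_intros cutoff_tendsto_1)
    then show "(\<lambda>n. cutoff n x * v x - v x) \<longlonglongrightarrow> 0" by simp
  qed
qed

text \<open>The mollified function has bounded derivatives but need not decay rapidly, so the
  Gaussian cutoff is multiplied outside. One parameter drives both limits.\<close>

definition regularize :: "nat \<Rightarrow> ('a::euclidean_space \<Rightarrow> complex) \<Rightarrow> 'a \<Rightarrow> complex" where
  "regularize n v x = cutoff n x * mollify n v x"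

lemma bounded_smooth_mollify: "v \<in> L2 \<Longrightarrow> bounded_smooth (mollify n v)"
  unfolding mollify_def by (rule bounded_smooth_convolution[OF complex_mollifier_rapid])

lemma regularize_rapid: "v \<in> L2 \<Longrightarrow> rapid (regularize n v)"
  unfolding regularize_def[abs_def] by (intro rapid_mult cutoff_rapid bounded_smooth_mollify)

lemma cutoff_diff_tendsto:
  assumes f: "\<And>n. f n \<in> L2" and g: "g \<in> L2" and lim: "(\<lambda>n. l2norm (\<lambda>x. f n x - g x)) \<longlonglongrightarrow> 0"
  shows "(\<lambda>n. l2norm (\<lambda>x. cutoff n x * f n x - g x)) \<longlonglongrightarrow> 0"
proof (rule tendsto_sandwich[OF _ _ tendsto_const])
  show "(\<lambda>n. l2norm (\<lambda>x. f n x - g x) + l2norm (\<lambda>x. cutoff n x * g x - g x)) \<longlonglongrightarrow> 0"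
    using tendsto_add[OF lim cutoff_mult_tendsto[OF g]] by simp
  show "\<forall>\<^sub>F n in sequentially. l2norm (\<lambda>x. cutoff n x * f n x - g x) \<le>
      l2norm (\<lambda>x. f n x - g x) + l2norm (\<lambda>x. cutoff n x * g x - g x)"
  proof (rule always_eventually, rule allI)
    fix n
    have "l2norm (\<lambda>x. cutoff n x * f n x - cutoff n x * g x) \<le> l2norm (\<lambda>x. f n x - g x)"
      using cutoff_mult_L2(2)[OF L2_diff(1)[OF f[of n] g], of n] by (simp add: right_diff_distrib)
    then show "l2norm (\<lambda>x. cutoff n x * f n x - g x) \<le>
        l2norm (\<lambda>x. f n x - g x) + l2norm (\<lambda>x. cutoff n x * g x - g x)"
      using l2norm_diff_triangle[OF cutoff_mult_L2(1)[OF f[of n]] cutoff_mult_L2(1)[OF g] g, of n n] by linarith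
  qed
  show "\<forall>\<^sub>F n in sequentially. 0 \<le> l2norm (\<lambda>x. cutoff n x * f n x - g x)"
    by (simp add: l2norm_nonneg)
qed

lemma regularize_tendsto:
  assumes v: "v \<in> L2"
  shows "(\<lambda>n. l2norm (\<lambda>x. regularize n v x - v x)) \<longlonglongrightarrow> 0"
  unfolding regularize_def by (rule cutoff_diff_tendsto[OF mollify_L2(1)[OF v] v mollify_tendsto[OF v]])

lemma schwartz_L2_dense: "L2_dense (schwartz :: ('a::euclidean_space \<Rightarrow> complex) set)"
  unfolding L2_dense_def
proof
  show "(schwartz :: ('a \<Rightarrow> complex) set) \<subseteq> L2"
    using rapid_L2 by (auto simp: schwartz_iff_rapid)
  show "\<forall>u\<in>L2. \<exists>us. (\<forall>n. us n \<in> schwartz) \<and> (\<lambda>n. L2_dist (us n) (u :: 'a \<Rightarrow> complex)) \<longlonglongrightarrow> 0"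
  proof
    fix u :: "'a \<Rightarrow> complex" assume "u \<in> L2"
    then show "\<exists>us. (\<forall>n. us n \<in> schwartz) \<and> (\<lambda>n. L2_dist (us n) u) \<longlonglongrightarrow> 0"
      using regularize_rapid regularize_tendsto
      by (intro exI[of _ "\<lambda>n. regularize n u"]) (auto simp: schwartz_iff_rapid L2_dist_eq)
  qed
qed

section \<open>Essential self-adjointness of transport operators\<close>

lemma transport_cnj:
  assumes u: "rapid u"
  shows "transport X (\<lambda>x. cnj (u x)) x = - cnj (transport X u x)"
proof -
  have "ddir (X x) (\<lambda>x. cnj (u x)) x = cnj (ddir (X x) u x)"
    by (rule ddir_bounded_linear(2)[OF bounded_linear_cnj smooth_differentiable[OF tame_smooth[OF u]]])
  then show ?thesis by (simp add: transport_def)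
qed

lemma mollifier_derivative:
  "((mollifier n :: 'a::euclidean_space \<Rightarrow> real) has_derivative
    (\<lambda>v. - ((real (Suc n))\<^sup>2 * (z \<bullet> v)) * mollifier n z)) (at z)"
  unfolding mollifier_def gaussian_def
  by (auto intro!: derivative_eq_intros simp: inner_commute power2_eq_square algebra_simps simp del: of_nat_Suc)

lemma ddir_complex_mollifier:
  "ddir v (\<lambda>z::'a::euclidean_space. complex_of_real (mollifier n z)) z =
    of_real (- ((real (Suc n))\<^sup>2 * (z \<bullet> v)) * mollifier n z)"
  by (rule ddir_eqI[OF bounded_linear.has_derivative[OF bounded_linear_of_real mollifier_derivative]])

text \<open>The dilation gains 1 / (n + 1). What remains is t exp (- t^2) with t = |x| / (n + 1), at
  most 1 because t \<le> 1 + t^2 \<le> exp (t^2).\<close>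

lemma cutoff_derivative_bound:
  "cmod (ddir v (cutoff n) x) \<le> 2 * norm v / real (Suc n)"
proof -
  define a where "a = 1 / real (Suc n)"
  have a: "0 < a" by (simp add: a_def)
  let ?E = "exp (- (a\<^sup>2 * (x \<bullet> x)))"
  have "((\<lambda>x. exp (- (a\<^sup>2 * (x \<bullet> x)))) has_derivative (\<lambda>v. - 2 * a\<^sup>2 * (x \<bullet> v) * ?E)) (at x)"
    by (auto intro!: derivative_eq_intros simp: inner_commute algebra_simps)
  from bounded_linear.has_derivative[OF bounded_linear_of_real this]
  have "ddir v (cutoff n) x = of_real (- 2 * a\<^sup>2 * (x \<bullet> v) * ?E)"
    unfolding cutoff_def[abs_def] a_def by (rule ddir_eqI)
  then have "cmod (ddir v (cutoff n) x) = \<bar>- 2 * a\<^sup>2 * (x \<bullet> v) * ?E\<bar>"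
    by (simp only: norm_of_real)
  also have "\<dots> = 2 * a\<^sup>2 * \<bar>x \<bullet> v\<bar> * ?E"
    by (simp add: abs_mult)
  also have "\<dots> \<le> 2 * a\<^sup>2 * (norm x * norm v) * ?E"
    by (intro mult_right_mono mult_left_mono Cauchy_Schwarz_ineq2) auto
  also have "\<dots> = (2 * norm v * a) * ((a * norm x) * ?E)" by (simp add: power2_eq_square)
  also have "\<dots> \<le> (2 * norm v * a) * 1"
  proof (rule mult_left_mono)
    let ?t = "a * norm x"
    have "0 \<le> ?t" using a by simp
    then have "?t \<le> 1 + ?t\<^sup>2" using sum_squares_bound[of 1 ?t] unfolding power_one mult_1_right by linarith
    also have "\<dots> \<le> exp (?t\<^sup>2)" by (rule exp_ge_add_one_self)
    also have "?t\<^sup>2 = a\<^sup>2 * (x \<bullet> x)" by (simp add: power_mult_distrib power2_norm_eq_inner)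
    finally have "?t * ?E \<le> exp (a\<^sup>2 * (x \<bullet> x)) * ?E" by (intro mult_right_mono) auto
    then show "?t * ?E \<le> 1" by (simp add: exp_minus)
  qed (use a in auto)
  finally show ?thesis by (simp add: a_def)
qed

section \<open>The commutator with mollification\<close>

context
  fixes X :: "'a::euclidean_space \<Rightarrow> 'a"
  assumes X: "bounded_smooth X"
begin

lemma transport_symmetric:
  assumes u: "rapid u" and v: "rapid v"
  shows "L2_inner (transport X u) v = L2_inner u (transport X v)"
  using transport_antisymmetric[OF X u rapid_cnj[OF v]]
  by (simp add: L2_inner_def transport_cnj[OF v])

text \<open>This is the kernel of transport after mollification minus mollification after transport,
  with the derivative of v integrated by parts onto the mollifier. The gradient of the Gaussian is a
  multiple of \<open>x - y\<close> times the Gaussian itself and is paired with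
  \<open>X x - X y\<close>.\<close>

definition commutator_kernel :: "nat \<Rightarrow> 'a \<Rightarrow> 'a \<Rightarrow> complex" where
  "commutator_kernel n x y =
    (1 / \<i>) * of_real (- ((real (Suc n))\<^sup>2 * ((x - y) \<bullet> (X x - X y))) * mollifier n (x - y)) +
    (1 / (2 * \<i>)) * of_real ((vdiv X x + vdiv X y) * mollifier n (x - y))"

definition commutator :: "nat \<Rightarrow> ('a \<Rightarrow> complex) \<Rightarrow> 'a \<Rightarrow> complex" where
  "commutator n v x = (LINT y|lborel. commutator_kernel n x y * v y)"

lemma vdiv_bounded: "\<exists>M\<ge>0. \<forall>x. \<bar>vdiv X x\<bar> \<le> M"
proof -
  obtain M where M: "\<forall>x. cmod (complex_of_real (vdiv X x)) * 1 \<le> M"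
    using tame_bounded[OF bounded_smooth_vdiv[OF X], of "\<lambda>x. 1"] by auto
  have "0 \<le> cmod (complex_of_real (vdiv X 0)) * 1" by simp
  also have "\<dots> \<le> M" using M by blast
  finally have "0 \<le> M" .
  with M show ?thesis by auto
qed

lemma X_bounded: "\<exists>B\<ge>0. \<forall>x. norm (X x) \<le> B"
proof -
  obtain B where B: "\<forall>x. norm (X x) * 1 \<le> B" using tame_bounded[OF X, of "\<lambda>x. 1"] by auto
  have "0 \<le> norm (X 0) * 1" by simp
  also have "\<dots> \<le> B" using B by blast
  finally have "0 \<le> B" .
  with B show ?thesis by auto
qed

text \<open>The gradient of the mollifier brings (n + 1)^2 |z|, and the Lipschitz bound on X a
  further |z|; together they are the square of the rescaled variable. The kernel is thus dominated
  by a dilation of the fixed profile k with the same integral for every n, and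
  \<open>schur_bound\<close> gives a constant independent of n.\<close>

lemma commutator_bound:
  "\<exists>\<kappa>. \<forall>n v. v \<in> L2 \<longrightarrow> (\<forall>x. integrable lborel (\<lambda>y. commutator_kernel n x y * v y)) \<and>
    commutator n v \<in> L2 \<and> l2norm (commutator n v) \<le> \<kappa> * l2norm v"
proof -
  obtain L' where L': "\<And>x y. norm (X x - X y) \<le> L' * norm (x - y)" using X_lipschitz[OF X] by blast
  define L where "L = \<bar>L'\<bar>"
  have L: "norm (X x - X y) \<le> L * norm (x - y)" for x y
    using L'[of x y] mult_right_mono[OF abs_ge_self[of L'] norm_ge_zero[of "x - y"]] by (simp add: L_def)
  obtain M where M: "0 \<le> M" "\<And>x. \<bar>vdiv X x\<bar> \<le> M" using vdiv_bounded by blast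
  \<comment> \<open>The quadratic term dominates the contribution of the derivatives, and M the half
    sum of two divergences.\<close>
  define k where "k w = (L * (norm w)\<^sup>2 + M) * gaussian w" for w :: 'a
  have k_meas[measurable]: "k \<in> borel_measurable borel" unfolding k_def by measurable
  have k0: "0 \<le> k w" for w
    unfolding k_def using M(1) less_imp_le[OF gaussian_pos] by (intro mult_nonneg_nonneg add_nonneg_nonneg) (auto simp: L_def)
  \<comment> \<open>Two of the DIM + 4 powers are spent on the quadratic factor of k, and DIM + 2
    remain for integrability.\<close>
  obtain C where C: "\<And>w::'a. norm (gaussian w) * japanese w ^ (DIM('a) + 4) \<le> C"
    using rapid_decay[OF gaussian_rapid, of "DIM('a) + 4"] by blast
  have k_dec: "norm (k w) * japanese w ^ (DIM('a) + 2) \<le> (L + M) * C" for w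
  proof -
    have "L * (norm w)\<^sup>2 + M \<le> L * (japanese w)\<^sup>2 + M * (japanese w)\<^sup>2"
      using M(1) by (intro add_mono mult_left_mono) (auto simp: L_def japanese_sq mult_le_cancel_left1)
    then have "k w \<le> (L * (japanese w)\<^sup>2 + M * (japanese w)\<^sup>2) * gaussian w"
      unfolding k_def by (intro mult_right_mono less_imp_le[OF gaussian_pos])
    then have "k w * japanese w ^ (DIM('a) + 2) \<le>
        (L * (japanese w)\<^sup>2 + M * (japanese w)\<^sup>2) * gaussian w * japanese w ^ (DIM('a) + 2)"
      by (rule mult_right_mono) (intro zero_le_power less_imp_le[OF japanese_pos])
    also have "\<dots> = (L + M) * (gaussian w * (japanese w ^ (DIM('a) + 2) * (japanese w)\<^sup>2))"
      by (simp add: algebra_simps)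
    also have "japanese w ^ (DIM('a) + 2) * (japanese w)\<^sup>2 = japanese w ^ (DIM('a) + 4)"
    proof -
      have "DIM('a) + 4 = (DIM('a) + 2) + 2" by simp
      then show ?thesis by (simp only: power_add)
    qed
    also have "(L + M) * (gaussian w * japanese w ^ (DIM('a) + 4)) \<le> (L + M) * C"
      using C[of w] gaussian_pos[of w] M(1) by (intro mult_left_mono) (auto simp: L_def)
    finally show ?thesis using k0[of w] by simp
  qed
  have k_int: "integrable lborel k" by (rule integrable_if_decay(1)[OF k_meas k_dec])
  have k_le: "k w \<le> (L + M) * C" for w
  proof -
    have "k w * 1 \<le> norm (k w) * japanese w ^ (DIM('a) + 2)"
      using k0[of w] by (intro mult_mono one_le_power japanese_ge_1) auto
    then show ?thesis using k_dec[of w] by simp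
  qed
  have main: "(\<forall>x. integrable lborel (\<lambda>y. commutator_kernel n x y * v y)) \<and>
      commutator n v \<in> L2 \<and> l2norm (commutator n v) \<le> (LINT w|lborel. k w) * l2norm v"
    if v: "v \<in> L2" for n v
  proof -
    define c where "c = real (Suc n)"
    have c: "0 < c" by (simp add: c_def)
    define kn where "kn z = c ^ DIM('a) * k (c *\<^sub>R z)" for z
    have kn_meas: "kn \<in> borel_measurable borel" unfolding kn_def by measurable
    have kn0: "0 \<le> kn z" for z unfolding kn_def using c k0 by simp
    have kn_le: "kn z \<le> c ^ DIM('a) * ((L + M) * C)" for z
      unfolding kn_def using c by (intro mult_left_mono k_le) auto
    have kn_integral: "(LINT z|lborel. kn z) = (LINT w|lborel. k w)"
      unfolding kn_def using c by (simp add: integral_scale[OF k_meas c])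
    have kn_int: "integrable lborel kn"
    proof -
      have "lborel = density (distr lborel borel (\<lambda>x. 0 + c *\<^sub>R x)) (\<lambda>_::'a. ennreal (\<bar>c\<bar> ^ DIM('a)))"
        using lborel_affine[of c "0::'a"] c by simp
      then have "integrable (density (distr lborel borel (\<lambda>x. 0 + c *\<^sub>R x)) (\<lambda>_::'a. ennreal (\<bar>c\<bar> ^ DIM('a)))) k"
        using k_int by simp
      then have "integrable (distr lborel borel (\<lambda>x. 0 + c *\<^sub>R x)) (\<lambda>x. c ^ DIM('a) *\<^sub>R k x)"
        using c by (subst (asm) integrable_density) auto
      then have "integrable lborel (\<lambda>x. c ^ DIM('a) *\<^sub>R k (0 + c *\<^sub>R x))"
        by (subst (asm) integrable_distr_eq) auto
      then show ?thesis unfolding kn_def[abs_def] by simp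
    qed
    have bound: "cmod (commutator_kernel n x y) \<le> kn (x - y)" for x y
    proof -
      let ?z = "x - y"
      have g: "0 \<le> mollifier n ?z" by (rule less_imp_le[OF mollifier_pos])
      have "\<bar>?z \<bullet> (X x - X y)\<bar> \<le> norm ?z * (L * norm ?z)"
        by (rule order_trans[OF Cauchy_Schwarz_ineq2]) (intro mult_left_mono L norm_ge_zero)
      then have b1: "c\<^sup>2 * \<bar>?z \<bullet> (X x - X y)\<bar> * mollifier n ?z \<le> c\<^sup>2 * (norm ?z * (L * norm ?z)) * mollifier n ?z"
        using g by (intro mult_right_mono mult_left_mono) auto
      have e1: "cmod ((1 / \<i>) * of_real (- (c\<^sup>2 * (?z \<bullet> (X x - X y))) * mollifier n ?z)) =
          c\<^sup>2 * \<bar>?z \<bullet> (X x - X y)\<bar> * mollifier n ?z"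
        using g unfolding norm_mult norm_of_real norm_divide by (simp add: abs_mult)
      have b2: "\<bar>vdiv X x + vdiv X y\<bar> * mollifier n ?z \<le> (2 * M) * mollifier n ?z"
        using M(2)[of x] M(2)[of y] g by (intro mult_right_mono) auto
      have e2: "cmod ((1 / (2 * \<i>)) * of_real ((vdiv X x + vdiv X y) * mollifier n ?z)) =
          \<bar>vdiv X x + vdiv X y\<bar> * mollifier n ?z / 2"
        using g unfolding norm_mult norm_of_real norm_divide by (simp add: abs_mult)
      have "cmod (commutator_kernel n x y) \<le> cmod ((1 / \<i>) * of_real (- (c\<^sup>2 * (?z \<bullet> (X x - X y))) * mollifier n ?z)) +
          cmod ((1 / (2 * \<i>)) * of_real ((vdiv X x + vdiv X y) * mollifier n ?z))"
        unfolding commutator_kernel_def c_def by (rule norm_triangle_ineq)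
      also have "\<dots> \<le> c\<^sup>2 * (norm ?z * (L * norm ?z)) * mollifier n ?z + M * mollifier n ?z"
        unfolding e1 e2 using b1 b2 by linarith
      also have "\<dots> = kn ?z"
      proof -
        have "norm (c *\<^sub>R ?z) = c * norm ?z" using c by simp
        then show ?thesis
          unfolding kn_def k_def mollifier_def c_def[symmetric] power2_eq_square
          by (simp only: distrib_left distrib_right ac_simps)
      qed
      finally show ?thesis .
    qed
    have meas: "(\<lambda>(x, y). commutator_kernel n x y) \<in> borel_measurable borel"
    proof -
      note cont = smooth_continuous[OF tame_smooth[OF X], of UNIV]
        smooth_continuous[OF smooth_ddir[OF tame_smooth[OF X]], of UNIV]
        smooth_continuous[OF tame_smooth[OF mollifier_rapid], of UNIV]
      have "continuous_on UNIV (\<lambda>p::'a \<times> 'a. commutator_kernel n (fst p) (snd p))"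
        unfolding commutator_kernel_def vdiv_def
        by (intro continuous_intros continuous_on_compose2[OF cont(1)] continuous_on_compose2[OF cont(2)]
            continuous_on_compose2[OF cont(3)]) auto
      then show ?thesis unfolding case_prod_unfold by (rule borel_measurable_continuous_onI)
    qed
    note schur = schur_bound[OF kn_meas kn0 kn_le kn_int meas bound v]
    show ?thesis using schur unfolding commutator_def[abs_def] kn_integral by blast
  qed
  then show ?thesis by blast
qed

lemma commutator_L2: "v \<in> L2 \<Longrightarrow> commutator n v \<in> L2"
  using commutator_bound by blast

text \<open>Friedrichs' commutator identity; testing the adjoint relation with a translated mollifier
  moves the derivative away from v.\<close>

lemma transport_mollify:
  assumes v: "v \<in> L2" and w: "w \<in> L2"
    and adj: "\<And>u. rapid u \<Longrightarrow> L2_inner (transport X u) v = L2_inner u w"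
  shows "transport X (mollify n v) x = mollify n w x + commutator n v x"
proof -
  let ?G = "\<lambda>z::'a. complex_of_real (mollifier n z)"
  let ?\<phi> = "\<lambda>y. ?G (x - y)"
  have G: "rapid ?G" by (rule complex_mollifier_rapid)
  have \<phi>: "rapid ?\<phi>" by (rule rapid_reflect[OF G])
  have d\<phi>: "ddir a ?\<phi> y = - ddir a ?G (x - y)" for a y
    using fun_cong[OF ddir_scale[OF tame_smooth[OF G], of a "-1" x], of y] by simp
  have "(LINT y|lborel. transport X ?\<phi> y * cnj (v y)) = (LINT y|lborel. ?\<phi> y * cnj (w y))"
    using adj[OF \<phi>] by (simp add: L2_inner_def)
  \<comment> \<open>Conjugation turns the inner products with v and w into integrals of v and w
    themselves; as the mollifier is real, the right side becomes a convolution.\<close>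
  then have "cnj (LINT y|lborel. transport X ?\<phi> y * cnj (v y)) = cnj (LINT y|lborel. ?\<phi> y * cnj (w y))"
    by (rule arg_cong)
  then have adj': "(LINT y|lborel. cnj (transport X ?\<phi> y) * v y) = mollify n w x"
    unfolding Bochner_Integration.integral_cnj[symmetric]
    by (simp only: mollify_def convolution_def complex_cnj_mult complex_cnj_cnj complex_cnj_complex_of_real)
  have i1: "integrable lborel (\<lambda>y. ddir (X x) ?G (x - y) * v y)"
    by (rule convolution_integrable(1)[OF tame_ddir[OF G] v])
  have i2: "integrable lborel (\<lambda>y. ?G (x - y) * v y)"
    by (rule convolution_integrable(1)[OF G v])
  have i3: "integrable lborel (\<lambda>y. cnj (transport X ?\<phi> y) * v y)"
    by (rule L2_mult_integrable(2)[OF L2_cnj[OF rapid_L2[OF rapid_transport[OF X \<phi>]]] v])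
  have kernel: "commutator_kernel n x y * v y =
      (1 / \<i>) * (ddir (X x) ?G (x - y) * v y) + (1 / (2 * \<i>)) * of_real (vdiv X x) * (?G (x - y) * v y) -
      cnj (transport X ?\<phi> y) * v y" for y
  proof -
    \<comment> \<open>Two signs meet in the derivative term, from the reflection y to x - y and from
      conjugating 1 / \<i>; the divergence term only takes the second.\<close>
    have A: "cnj (transport X ?\<phi> y) = (1 / \<i>) * ddir (X y) ?G (x - y) - (1 / (2 * \<i>)) * of_real (vdiv X y) * ?G (x - y)"
      unfolding transport_def d\<phi> ddir_complex_mollifier by simp
    have B: "commutator_kernel n x y = (1 / \<i>) * (ddir (X x) ?G (x - y) - ddir (X y) ?G (x - y)) +
        (1 / (2 * \<i>)) * (of_real (vdiv X x) + of_real (vdiv X y)) * ?G (x - y)"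
      unfolding commutator_kernel_def ddir_complex_mollifier
      by (simp add: inner_diff_right algebra_simps del: of_nat_Suc)
    show ?thesis unfolding A B by (simp add: algebra_simps)
  qed
  have "commutator n v x = (1 / \<i>) * (LINT y|lborel. ddir (X x) ?G (x - y) * v y) +
      (1 / (2 * \<i>)) * of_real (vdiv X x) * (LINT y|lborel. ?G (x - y) * v y) - mollify n w x"
    unfolding commutator_def kernel using i1 i2 i3 by (simp add: adj')
  moreover have "ddir (X x) (mollify n v) x = (LINT y|lborel. ddir (X x) ?G (x - y) * v y)"
    unfolding mollify_def ddir_convolution[OF G v] convolution_def ..
  ultimately show ?thesis
    unfolding transport_def by (simp add: mollify_def convolution_def)
qed

lemma bounded_mult_tendsto:
  assumes f: "\<And>n. f n \<in> L2" and lim: "(\<lambda>n. l2norm (f n)) \<longlonglongrightarrow> 0"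
    and c: "c \<in> borel_measurable borel" "\<And>x. cmod (c x) \<le> B"
  shows "(\<lambda>x. c x * f n x) \<in> L2" "(\<lambda>n. l2norm (\<lambda>x. c x * f n x)) \<longlonglongrightarrow> 0"
proof -
  have B: "0 \<le> B" by (rule order_trans[OF norm_ge_zero c(2)])
  have m: "(\<lambda>x. c x * f n x) \<in> borel_measurable borel" for n
    using c(1) L2_borel[OF f] by measurable
  have le: "cmod (c x * f n x) \<le> B * cmod (f n x)" for n x
    unfolding norm_mult by (intro mult_right_mono c) simp
  show "(\<lambda>x. c x * f n x) \<in> L2" by (rule L2_dominated(1)[OF m f B le])
  show "(\<lambda>n. l2norm (\<lambda>x. c x * f n x)) \<longlonglongrightarrow> 0"
  proof (rule tendsto_sandwich[OF _ _ tendsto_const])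
    show "(\<lambda>n. B * l2norm (f n)) \<longlonglongrightarrow> 0" using tendsto_mult[OF tendsto_const lim, of B] by simp
    show "\<forall>\<^sub>F n in sequentially. l2norm (\<lambda>x. c x * f n x) \<le> B * l2norm (f n)"
      by (intro always_eventually allI L2_dominated(2)[OF m f B le])
  qed (simp add: l2norm_nonneg)
qed

lemma l2norm_add_tendsto:
  assumes f: "\<And>n. f n \<in> L2" "(\<lambda>n. l2norm (f n)) \<longlonglongrightarrow> 0" and g: "\<And>n. g n \<in> L2" "(\<lambda>n. l2norm (g n)) \<longlonglongrightarrow> 0"
  shows "(\<lambda>n. l2norm (\<lambda>x. f n x + g n x)) \<longlonglongrightarrow> 0"
proof (rule tendsto_sandwich[OF _ _ tendsto_const])
  show "(\<lambda>n. l2norm (f n) + l2norm (g n)) \<longlonglongrightarrow> 0" using tendsto_add[OF f(2) g(2)] by simp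
  show "\<forall>\<^sub>F n in sequentially. l2norm (\<lambda>x. f n x + g n x) \<le> l2norm (f n) + l2norm (g n)"
    by (intro always_eventually allI L2_add(2) f g)
qed (simp add: l2norm_nonneg)

text \<open>For rapid s derivatives commute with mollification, so the difference is a finite sum of
  bounded coefficients times mollification errors of s and of its derivatives.\<close>

lemma transport_mollify_tendsto:
  assumes s: "rapid s"
  shows "(\<lambda>x. transport X (mollify n s) x - transport X s x) \<in> L2"
    "(\<lambda>n. l2norm (\<lambda>x. transport X (mollify n s) x - transport X s x)) \<longlonglongrightarrow> 0"
proof -
  obtain B where B: "\<And>x. norm (X x) \<le> B" using X_bounded by blast
  obtain M where M: "\<And>x. \<bar>vdiv X x\<bar> \<le> M" using vdiv_bounded by blast
  let ?d = "\<lambda>b n x. mollify n (ddir b s) x - ddir b s x"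
  let ?e = "\<lambda>n x. mollify n s x - s x"
  have J: "ddir b (mollify n s) = mollify n (ddir b s)" for b n
    unfolding mollify_def ddir_convolution[OF complex_mollifier_rapid rapid_L2[OF s]]
    by (rule convolution_ddir_swap[OF complex_mollifier_rapid s])
  have diffJ: "mollify n s differentiable (at x)" for n x
    by (intro smooth_differentiable tame_smooth[OF bounded_smooth_mollify] rapid_L2 s)
  have eq: "transport X (mollify n s) x - transport X s x =
      (\<Sum>b\<in>Basis. ((1 / \<i>) * of_real (X x \<bullet> b)) * ?d b n x) + ((1 / (2 * \<i>)) * of_real (vdiv X x)) * ?e n x" for n x
  proof -
    have "ddir (X x) (mollify n s) x = (\<Sum>b\<in>Basis. of_real (X x \<bullet> b) * mollify n (ddir b s) x)"
      unfolding ddir_expand[OF diffJ, of "X x"] by (simp add: J scaleR_conv_of_real)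
    then have "ddir (X x) (mollify n s) x - ddir (X x) s x = (\<Sum>b\<in>Basis. of_real (X x \<bullet> b) * ?d b n x)"
      unfolding ddir_along[OF X s] by (simp add: sum_subtractf right_diff_distrib)
    moreover have "transport X (mollify n s) x - transport X s x =
        (1 / \<i>) * (ddir (X x) (mollify n s) x - ddir (X x) s x) + ((1 / (2 * \<i>)) * of_real (vdiv X x)) * ?e n x"
      unfolding transport_def by (simp add: right_diff_distrib)
    ultimately show ?thesis by (simp only: sum_distrib_left mult.assoc)
  qed
  have d: "?d b n \<in> L2" "(\<lambda>n. l2norm (?d b n)) \<longlonglongrightarrow> 0" for b n
    by (intro L2_diff(1) mollify_L2(1) mollify_tendsto rapid_L2 tame_ddir s)+
  have e: "?e n \<in> L2" "(\<lambda>n. l2norm (?e n)) \<longlonglongrightarrow> 0" for n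
    by (intro L2_diff(1) mollify_L2(1) mollify_tendsto rapid_L2 s)+
  have mX: "(\<lambda>x. (1 / \<i>) * complex_of_real (X x \<bullet> b)) \<in> borel_measurable borel" for b
    using smooth_borel[OF tame_smooth[OF bounded_smooth_component[OF X, of b]]] by measurable
  have mv: "(\<lambda>x. (1 / (2 * \<i>)) * complex_of_real (vdiv X x)) \<in> borel_measurable borel"
    using smooth_borel[OF tame_smooth[OF bounded_smooth_vdiv[OF X]]] by measurable
  have bX: "cmod ((1 / \<i>) * complex_of_real (X x \<bullet> b)) \<le> B" if "b \<in> Basis" for b x
    using Basis_le_norm[OF that, of "X x"] B[of x] by (simp add: norm_mult norm_divide)
  have bv: "cmod ((1 / (2 * \<i>)) * complex_of_real (vdiv X x)) \<le> M" for x
    using M[of x] abs_ge_zero[of "vdiv X x"] by (simp add: norm_mult norm_divide)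
  note tX = bounded_mult_tendsto[OF d mX bX]
  note tv = bounded_mult_tendsto[OF e mv bv]
  have sumL: "(\<lambda>x. \<Sum>b\<in>Basis. ((1 / \<i>) * of_real (X x \<bullet> b)) * ?d b n x) \<in> L2" for n
    by (intro L2_sum(1) tX(1)) auto
  have sum_lim: "(\<lambda>n. l2norm (\<lambda>x. \<Sum>b\<in>Basis. ((1 / \<i>) * of_real (X x \<bullet> b)) * ?d b n x)) \<longlonglongrightarrow> 0"
  proof (rule tendsto_sandwich[OF _ _ tendsto_const])
    show "(\<lambda>n. \<Sum>b\<in>Basis. l2norm (\<lambda>x. ((1 / \<i>) * of_real (X x \<bullet> b)) * ?d b n x)) \<longlonglongrightarrow> 0"
      by (intro tendsto_null_sum tX(2))
    show "\<forall>\<^sub>F n in sequentially. l2norm (\<lambda>x. \<Sum>b\<in>Basis. ((1 / \<i>) * of_real (X x \<bullet> b)) * ?d b n x) \<le>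
        (\<Sum>b\<in>Basis. l2norm (\<lambda>x. ((1 / \<i>) * of_real (X x \<bullet> b)) * ?d b n x))"
      by (intro always_eventually allI L2_sum(2) tX(1)) auto
  qed (simp add: l2norm_nonneg)
  show "(\<lambda>x. transport X (mollify n s) x - transport X s x) \<in> L2"
    unfolding eq by (intro L2_add(1) sumL tv(1))
  show "(\<lambda>n. l2norm (\<lambda>x. transport X (mollify n s) x - transport X s x)) \<longlonglongrightarrow> 0"
    unfolding eq by (rule l2norm_add_tendsto[OF sumL sum_lim tv])
qed

lemma l2norm_minus_commute: "l2norm (\<lambda>x. f x - g x) = l2norm (\<lambda>x. g x - f x)"
  by (simp add: l2norm_def norm_minus_commute)

text \<open>Symmetry supplies the adjoint relation with w = transport X s, so the commutator is an
  honest difference of two functions, both converging to transport X s.\<close>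

lemma commutator_tendsto_rapid:
  assumes s: "rapid s"
  shows "(\<lambda>n. l2norm (commutator n s)) \<longlonglongrightarrow> 0"
proof -
  have Ps: "transport X s \<in> L2" by (intro rapid_L2 rapid_transport X s)
  have eq: "commutator n s = (\<lambda>x. (transport X (mollify n s) x - transport X s x) +
      (transport X s x - mollify n (transport X s) x))" for n
    using transport_mollify[OF rapid_L2[OF s] Ps transport_symmetric[OF _ s], of n] by auto
  have "(\<lambda>n. l2norm (\<lambda>x. transport X s x - mollify n (transport X s) x)) \<longlonglongrightarrow> 0"
    using mollify_tendsto[OF Ps] by (subst l2norm_minus_commute)
  then show ?thesis
    unfolding eq
    by (intro l2norm_add_tendsto transport_mollify_tendsto s L2_diff(1) Ps mollify_L2(1))
qed

text \<open>Density and uniform boundedness: the commutators have norms bounded independently of n,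
  and rapid functions approximate v.\<close>

lemma commutator_tendsto:
  assumes v: "v \<in> L2"
  shows "(\<lambda>n. l2norm (commutator n v)) \<longlonglongrightarrow> 0"
proof (rule LIMSEQ_I)
  fix r :: real assume r: "0 < r"
  obtain \<kappa> where \<kappa>: "\<And>n v x. v \<in> L2 \<Longrightarrow> integrable lborel (\<lambda>y. commutator_kernel n x y * v y)"
      "\<And>n v. v \<in> L2 \<Longrightarrow> l2norm (commutator n v) \<le> \<kappa> * l2norm v"
    using commutator_bound by blast
  have "(\<lambda>m. \<kappa> * l2norm (\<lambda>x. regularize m v x - v x)) \<longlonglongrightarrow> 0"
    using tendsto_mult[OF tendsto_const regularize_tendsto[OF v], of \<kappa>] by simp
  then have "\<forall>\<^sub>F m in sequentially. \<kappa> * l2norm (\<lambda>x. regularize m v x - v x) < r / 2"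
    using r by (intro order_tendstoD(2)) auto
  then obtain m where m: "\<kappa> * l2norm (\<lambda>x. regularize m v x - v x) < r / 2"
    using eventually_happens' sequentially_bot by blast
  define s where "s = regularize m v"
  have s: "rapid s" unfolding s_def by (rule regularize_rapid[OF v])
  have sL: "s \<in> L2" by (rule rapid_L2[OF s])
  have "\<forall>\<^sub>F n in sequentially. l2norm (commutator n s) < r / 2"
    using commutator_tendsto_rapid[OF s] r by (intro order_tendstoD(2)) auto
  then obtain N where N: "\<And>n. N \<le> n \<Longrightarrow> l2norm (commutator n s) < r / 2"
    by (auto simp: eventually_sequentially)
  have "norm (l2norm (commutator n v) - 0) < r" if "N \<le> n" for n
  proof -
    have vs: "(\<lambda>x. v x - s x) \<in> L2" by (rule L2_diff(1)[OF v sL])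
    have "commutator n v = (\<lambda>x. commutator n (\<lambda>x. v x - s x) x + commutator n s x)"
      unfolding commutator_def by (simp add: right_diff_distrib \<kappa>(1)[OF v] \<kappa>(1)[OF sL])
    then have "l2norm (commutator n v) \<le> l2norm (commutator n (\<lambda>x. v x - s x)) + l2norm (commutator n s)"
      using L2_add(2)[OF commutator_L2[OF vs] commutator_L2[OF sL]] by simp
    moreover have "l2norm (commutator n (\<lambda>x. v x - s x)) < r / 2"
      using \<kappa>(2)[OF vs, of n] m l2norm_minus_commute[of v s] by (simp add: s_def)
    ultimately show ?thesis using N[OF that] by (simp add: l2norm_nonneg)
  qed
  then show "\<exists>N. \<forall>n\<ge>N. norm (l2norm (commutator n v) - 0) < r" by blast
qed

text \<open>By the product rule three errors remain: that of mollifying and cutting off w, the cut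
  off commutator, and the derivative of the cutoff along X. The last is of order 1 / (n + 1) times
  the norm of v because X is bounded.\<close>

lemma transport_regularize_tendsto:
  assumes v: "v \<in> L2" and w: "w \<in> L2"
    and adj: "\<And>u. rapid u \<Longrightarrow> L2_inner (transport X u) v = L2_inner u w"
  shows "(\<lambda>n. l2norm (\<lambda>x. transport X (regularize n v) x - w x)) \<longlonglongrightarrow> 0"
proof -
  obtain B where B: "0 \<le> B" "\<And>x. norm (X x) \<le> B" using X_bounded by blast
  let ?c = "\<lambda>n x. (1 / \<i>) * ddir (X x) (cutoff n) x"
  have reg: "transport X (regularize n v) x - w x =
      (cutoff n x * mollify n w x - w x) + (cutoff n x * commutator n v x + ?c n x * mollify n v x)" for n x
  proof -
    have "ddir (X x) (regularize n v) x = cutoff n x * ddir (X x) (mollify n v) x + ddir (X x) (cutoff n) x * mollify n v x"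
      unfolding regularize_def[abs_def]
      by (subst ddir_mult[OF tame_smooth[OF cutoff_rapid] tame_smooth[OF bounded_smooth_mollify[OF v]]]) simp
    then have "transport X (regularize n v) x = cutoff n x * transport X (mollify n v) x + ?c n x * mollify n v x"
      unfolding transport_def by (simp add: regularize_def algebra_simps)
    then show ?thesis
      using transport_mollify[OF v w adj, of n x] by (simp add: algebra_simps)
  qed
  have A: "(\<lambda>x. cutoff n x * mollify n w x - w x) \<in> L2" for n
    by (intro L2_diff(1) cutoff_mult_L2(1) mollify_L2(1) w)
  have A': "(\<lambda>n. l2norm (\<lambda>x. cutoff n x * mollify n w x - w x)) \<longlonglongrightarrow> 0"
    by (rule cutoff_diff_tendsto[OF mollify_L2(1)[OF w] w mollify_tendsto[OF w]])
  have B2: "(\<lambda>x. cutoff n x * commutator n v x) \<in> L2" for n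
    by (intro cutoff_mult_L2(1) commutator_L2 v)
  have B2': "(\<lambda>n. l2norm (\<lambda>x. cutoff n x * commutator n v x)) \<longlonglongrightarrow> 0"
    by (rule tendsto_sandwich[OF _ _ tendsto_const commutator_tendsto[OF v]])
      (simp_all add: l2norm_nonneg cutoff_mult_L2(2)[OF commutator_L2[OF v]])
  have c_meas: "(\<lambda>x. ?c n x * mollify n v x) \<in> borel_measurable borel" for n
  proof -
    have "rapid (\<lambda>x. ddir (X x) (cutoff n) x)" by (rule rapid_ddir_along[OF X cutoff_rapid])
    from borel_rapid[OF this] show ?thesis using L2_borel[OF mollify_L2(1)[OF v]] by measurable
  qed
  have c_le: "cmod (?c n x * mollify n v x) \<le> (2 * B / real (Suc n)) * cmod (mollify n v x)" for n x
  proof -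
    have "cmod (?c n x) = cmod (ddir (X x) (cutoff n) x)" by (simp add: norm_mult norm_divide)
    also have "\<dots> \<le> 2 * norm (X x) / real (Suc n)" by (rule cutoff_derivative_bound)
    also have "\<dots> \<le> 2 * B / real (Suc n)" using B by (intro divide_right_mono mult_left_mono) auto
    finally show ?thesis unfolding norm_mult by (intro mult_right_mono) auto
  qed
  have c0: "0 \<le> 2 * B / real (Suc n)" for n using B(1) by simp
  note C3 = L2_dominated[OF c_meas mollify_L2(1)[OF v] c0 c_le]
  have C3': "(\<lambda>n. l2norm (\<lambda>x. ?c n x * mollify n v x)) \<longlonglongrightarrow> 0"
  proof (rule tendsto_sandwich[OF _ _ tendsto_const])
    show "(\<lambda>n. (2 * B * l2norm v) * (1 / real (Suc n))) \<longlonglongrightarrow> 0"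
      using tendsto_mult[OF tendsto_const LIMSEQ_Suc[OF lim_const_over_n[of 1]], of "2 * B * l2norm v"] by simp
    show "\<forall>\<^sub>F n in sequentially. l2norm (\<lambda>x. ?c n x * mollify n v x) \<le> (2 * B * l2norm v) * (1 / real (Suc n))"
    proof (intro always_eventually allI)
      fix n
      have "l2norm (\<lambda>x. ?c n x * mollify n v x) \<le> (2 * B / real (Suc n)) * l2norm (mollify n v)" by (rule C3(2))
      also have "\<dots> \<le> (2 * B / real (Suc n)) * l2norm v" by (intro mult_left_mono mollify_L2(2) v c0)
      finally show "l2norm (\<lambda>x. ?c n x * mollify n v x) \<le> (2 * B * l2norm v) * (1 / real (Suc n))" by simp
    qed
  qed (simp add: l2norm_nonneg)
  show ?thesis
    unfolding reg by (intro l2norm_add_tendsto L2_add(1) A A' B2 B2' C3(1) C3')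
qed

section \<open>From the adjoint relation to the closure of the graph\<close>

lemma L2_inner_tendsto:
  assumes f: "\<And>n. f n \<in> L2" "g \<in> L2" "(\<lambda>n. L2_dist (f n) g) \<longlonglongrightarrow> 0"
    and u: "\<And>n. u n \<in> L2" "v \<in> L2" "(\<lambda>n. L2_dist (u n) v) \<longlonglongrightarrow> 0"
  shows "(\<lambda>n. L2_inner (f n) (u n)) \<longlonglongrightarrow> L2_inner g v"
proof -
  have bound: "cmod (L2_inner (f n) (u n) - L2_inner g v) \<le>
      L2_dist (f n) g * (l2norm v + L2_dist (u n) v) + l2norm g * L2_dist (u n) v" for n
  proof -
    note d = L2_diff(1)[OF f(1)[of n] f(2)] L2_diff(1)[OF u(1)[of n] u(2)]
    have i: "integrable lborel (\<lambda>x. f n x * cnj (u n x))" "integrable lborel (\<lambda>x. g x * cnj (v x))"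
      "integrable lborel (\<lambda>x. (f n x - g x) * cnj (u n x))" "integrable lborel (\<lambda>x. g x * cnj (u n x - v x))"
      by (intro L2_mult_integrable(2) L2_cnj d f(1,2) u(1,2))+
    have "L2_inner (f n) (u n) - L2_inner g v = (LINT x|lborel. f n x * cnj (u n x) - g x * cnj (v x))"
      using i by (simp add: L2_inner_def)
    also have "\<dots> = (LINT x|lborel. (f n x - g x) * cnj (u n x) + g x * cnj (u n x - v x))"
      by (simp add: algebra_simps)
    also have "\<dots> = (LINT x|lborel. (f n x - g x) * cnj (u n x)) + (LINT x|lborel. g x * cnj (u n x - v x))"
      by (rule Bochner_Integration.integral_add[OF i(3,4)])
    also have "cmod \<dots> \<le> L2_dist (f n) g * l2norm (u n) + l2norm g * L2_dist (u n) v"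
      using L2_cauchy_schwarz(2)[OF d(1) L2_cnj[OF u(1)]] L2_cauchy_schwarz(2)[OF f(2) L2_cnj[OF d(2)]]
      unfolding l2norm_cnj L2_dist_eq by (intro norm_triangle_le add_mono) auto
    also have "\<dots> \<le> L2_dist (f n) g * (l2norm v + L2_dist (u n) v) + l2norm g * L2_dist (u n) v"
    proof -
      have "l2norm (u n) \<le> l2norm v + L2_dist (u n) v"
        using L2_add(2)[OF u(2) d(2)] by (simp add: L2_dist_eq)
      then show ?thesis by (intro add_right_mono mult_left_mono) (auto simp: L2_dist_eq l2norm_nonneg)
    qed
    finally show ?thesis .
  qed
  have "(\<lambda>n. L2_dist (f n) g * (l2norm v + L2_dist (u n) v) + l2norm g * L2_dist (u n) v) \<longlonglongrightarrow>
      0 * (l2norm v + 0) + l2norm g * 0"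
    by (intro tendsto_intros f u)
  then have lim: "(\<lambda>n. L2_dist (f n) g * (l2norm v + L2_dist (u n) v) + l2norm g * L2_dist (u n) v) \<longlonglongrightarrow> 0"
    by simp
  have "(\<lambda>n. L2_inner (f n) (u n) - L2_inner g v) \<longlonglongrightarrow> 0"
    by (rule Lim_null_comparison[OF always_eventually lim]) (use bound in blast)
  then show ?thesis by (rule LIM_zero_cancel)
qed

lemma weyl_graph_linear_distribution:
  "(u, f) \<in> weyl_graph (linear_distribution X) \<longleftrightarrow>
    rapid u \<and> f \<in> L2 \<and> (\<forall>v. rapid v \<longrightarrow> (LINT x|lborel. transport X u x * v x) = (LINT x|lborel. f x * v x))"
  unfolding weyl_graph_def by (auto simp: schwartz_iff_rapid weyl_op_linear_distribution[OF X])

lemma transport_in_weyl_graph: "rapid u \<Longrightarrow> (u, transport X u) \<in> weyl_graph (linear_distribution X)"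
  unfolding weyl_graph_linear_distribution by (auto intro: rapid_L2 rapid_transport X)

text \<open>The second component of a graph element is prescribed only through its integrals against
  Schwartz functions, so it is replaced by the transport operator inside pairings, never
  pointwise.\<close>

lemma weyl_graph_symmetric:
  assumes u: "(u, f) \<in> weyl_graph (linear_distribution X)" and v: "(v, w) \<in> weyl_graph (linear_distribution X)"
  shows "L2_inner f v = L2_inner u w"
proof -
  have ru: "rapid u" and rv: "rapid v" using u v by (auto simp: weyl_graph_linear_distribution)
  have "L2_inner f v = L2_inner (transport X u) v"
    using u rapid_cnj[OF rv] by (simp add: weyl_graph_linear_distribution L2_inner_def)
  also have "\<dots> = L2_inner u (transport X v)" by (rule transport_symmetric[OF ru rv])
  also have "\<dots> = cnj (LINT x|lborel. transport X v x * cnj (u x))"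
    unfolding L2_inner_def Bochner_Integration.integral_cnj[symmetric]
    by (simp only: complex_cnj_mult complex_cnj_cnj mult.commute)
  also have "\<dots> = cnj (LINT x|lborel. w x * cnj (u x))"
    using v rapid_cnj[OF ru] by (simp add: weyl_graph_linear_distribution)
  also have "\<dots> = L2_inner u w"
    unfolding L2_inner_def Bochner_Integration.integral_cnj[symmetric]
    by (simp only: complex_cnj_mult complex_cnj_cnj mult.commute)
  finally show ?thesis .
qed

lemma Domain_weyl_graph: "Domain (weyl_graph (linear_distribution X)) = schwartz"
proof
  show "Domain (weyl_graph (linear_distribution X)) \<subseteq> schwartz"
    by (auto simp: weyl_graph_linear_distribution schwartz_iff_rapid)
  show "schwartz \<subseteq> Domain (weyl_graph (linear_distribution X))"
    using DomainI[OF transport_in_weyl_graph] by (auto simp: schwartz_iff_rapid)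
qed

text \<open>Symmetry passes to the closure by continuity of the inner product, so the closure lies
  in its adjoint. Conversely a pair in the adjoint is the limit of the regularizations of its first
  component with their images, which are in the graph. Deficiency subspaces are not
  involved.\<close>

theorem essentially_self_adjoint_weyl_graph: "essentially_self_adjoint (weyl_graph (linear_distribution X))"
proof -
  let ?G = "weyl_graph (linear_distribution X)"
  have G_L2: "u \<in> L2" "f \<in> L2" if "(u, f) \<in> ?G" for u f
    using that by (auto simp: weyl_graph_linear_distribution intro: rapid_L2)
  have G_sub: "?G \<subseteq> graph_closure ?G"
  proof clarify
    fix u f assume uf: "(u, f) \<in> ?G"
    have "L2_dist g g = 0" for g :: "'a \<Rightarrow> complex" by (simp add: L2_dist_def)
    then have "\<exists>us fs. (\<forall>n. (us n, fs n) \<in> ?G) \<and>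
        (\<lambda>n::nat. L2_dist (us n) u) \<longlonglongrightarrow> 0 \<and> (\<lambda>n. L2_dist (fs n) f) \<longlonglongrightarrow> 0"
      using uf by (intro exI[of _ "\<lambda>n. u"] exI[of _ "\<lambda>n. f"]) simp
    then show "(u, f) \<in> graph_closure ?G"
      using G_L2[OF uf] by (simp add: graph_closure_def)
  qed
  have "graph_adjoint (graph_closure ?G) = graph_closure ?G"
  proof (intro equalityI subrelI)
    fix v w assume "(v, w) \<in> graph_adjoint (graph_closure ?G)"
    then have v: "v \<in> L2" and w: "w \<in> L2" and adj: "\<And>u f. (u, f) \<in> graph_closure ?G \<Longrightarrow> L2_inner f v = L2_inner u w"
      by (auto simp: graph_adjoint_def)
    have adj': "L2_inner (transport X u) v = L2_inner u w" if "rapid u" for u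
      using adj G_sub transport_in_weyl_graph[OF that] by blast
    have "\<exists>us fs. (\<forall>n. (us n, fs n) \<in> ?G) \<and>
        (\<lambda>n::nat. L2_dist (us n) v) \<longlonglongrightarrow> 0 \<and> (\<lambda>n. L2_dist (fs n) w) \<longlonglongrightarrow> 0"
      unfolding L2_dist_eq
      by (intro exI[of _ "\<lambda>n. regularize n v"] exI[of _ "\<lambda>n. transport X (regularize n v)"] conjI allI
          transport_in_weyl_graph regularize_rapid regularize_tendsto transport_regularize_tendsto adj' v w)
    then show "(v, w) \<in> graph_closure ?G"
      using v w by (simp add: graph_closure_def)
  next
    fix v w assume "(v, w) \<in> graph_closure ?G"
    then obtain vs ws where v: "v \<in> L2" "w \<in> L2" "\<And>n. (vs n, ws n) \<in> ?G"
        "(\<lambda>n::nat. L2_dist (vs n) v) \<longlonglongrightarrow> 0" "(\<lambda>n. L2_dist (ws n) w) \<longlonglongrightarrow> 0"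
      by (auto simp: graph_closure_def)
    have "L2_inner f v = L2_inner u w" if "(u, f) \<in> graph_closure ?G" for u f
    proof -
      obtain us fs where u: "u \<in> L2" "f \<in> L2" "\<And>n. (us n, fs n) \<in> ?G"
          "(\<lambda>n::nat. L2_dist (us n) u) \<longlonglongrightarrow> 0" "(\<lambda>n. L2_dist (fs n) f) \<longlonglongrightarrow> 0"
        using \<open>(u, f) \<in> graph_closure ?G\<close> by (auto simp: graph_closure_def)
      have "(\<lambda>n. L2_inner (fs n) (vs n)) \<longlonglongrightarrow> L2_inner f v"
        by (rule L2_inner_tendsto[OF G_L2(2)[OF u(3)] u(2,5) G_L2(1)[OF v(3)] v(1,4)])
      moreover have "(\<lambda>n. L2_inner (us n) (ws n)) \<longlonglongrightarrow> L2_inner u w"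
        by (rule L2_inner_tendsto[OF G_L2(1)[OF u(3)] u(1,4) G_L2(2)[OF v(3)] v(2,5)])
      ultimately show ?thesis
        unfolding weyl_graph_symmetric[OF u(3) v(3)] by (rule LIMSEQ_unique)
    qed
    then show "(v, w) \<in> graph_adjoint (graph_closure ?G)"
      using v(1,2) by (auto simp: graph_adjoint_def)
  qed
  moreover have "L2_dense (Domain (graph_closure ?G))"
    unfolding L2_dense_def
  proof
    show "Domain (graph_closure ?G) \<subseteq> L2" by (auto simp: graph_closure_def)
    have "schwartz \<subseteq> Domain (graph_closure ?G)"
      using Domain_mono[OF G_sub] by (simp add: Domain_weyl_graph)
    moreover have "\<forall>u\<in>L2. \<exists>us. (\<forall>n. us n \<in> schwartz) \<and> (\<lambda>n. L2_dist (us n) (u :: 'a \<Rightarrow> complex)) \<longlonglongrightarrow> 0"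
      using schwartz_L2_dense unfolding L2_dense_def by blast
    ultimately show "\<forall>u\<in>L2. \<exists>us. (\<forall>n. us n \<in> Domain (graph_closure ?G)) \<and> (\<lambda>n. L2_dist (us n) u) \<longlonglongrightarrow> 0"
      by (metis subsetD)
  qed
  ultimately show ?thesis
    unfolding essentially_self_adjoint_def self_adjoint_def Domain_weyl_graph
    using schwartz_L2_dense by blast
qed

theorem assumption_A_linear_symbol: "assumption_A (linear_symbol X)"
  unfolding assumption_A_def
proof (intro conjI exI)
  show "smooth (linear_symbol X)" by (rule smooth_linear_symbol[OF tame_smooth[OF X]])
  show "hamiltonian_flow (linear_symbol X) (SOME \<Phi>. hamiltonian_flow (linear_symbol X) \<Phi>)"
    using cotangent_flow_exists[OF X]
    unfolding hamiltonian_flow_linear_symbol[OF tame_smooth[OF X]] by (rule someI_ex)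
  show "is_distribution_of (linear_distribution X) (\<lambda>\<rho>. complex_of_real (linear_symbol X \<rho>))"
    by (rule linear_distribution_tempered[OF X])
qed (rule Domain_weyl_graph essentially_self_adjoint_weyl_graph)+

end

section \<open>Specialization to real coordinate space\<close>

lemma divergence_eq_vdiv:
  fixes X :: "real ^ 'd \<Rightarrow> real ^ 'd"
  shows "divergence X x = vdiv X x"
proof -
  have B: "(Basis :: (real ^ 'd) set) = range (\<lambda>i. axis i 1)"
    by (auto simp: Basis_vec_def)
  have inj: "inj (\<lambda>i::'d. axis i (1::real))"
    by (auto simp: inj_def axis_eq_axis)
  have "vdiv X x = (\<Sum>i\<in>UNIV. ddir (axis i 1) X x \<bullet> axis i 1)"
    unfolding vdiv_def B sum.reindex[OF inj] o_def ..
  then show ?thesis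
    by (simp add: divergence_def trace_def jacobian_def matrix_def ddir_def inner_axis)
qed

lemma vector_field_op_eq_transport: "vector_field_op X = transport X"
  by (auto simp: fun_eq_iff vector_field_op_def transport_def divergence_eq_vdiv ddir_def)

lemma vector_field_symbol_eq: "vector_field_symbol X = linear_symbol X"
  by (auto simp: fun_eq_iff vector_field_symbol_def linear_symbol_def)

theorem proposition1p24:
  fixes X :: "real ^ 'd \<Rightarrow> real ^ 'd"
    and e :: "(real ^ 'd) \<times> (real ^ 'd) \<Rightarrow> (real ^ 'd) \<times> (real ^ 'd) \<Rightarrow> real"
  assumes "smooth X"
    and "\<forall>k. bdd_above (range (tensor_norm (\<lambda>_. inner) k (nabla_pow k X)))"
    and "self_dual_form e"
  shows "(\<exists>T. is_distribution_of T (\<lambda>\<rho>. complex_of_real (vector_field_symbol X \<rho>)) \<and>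
            (\<forall>u\<in>schwartz. \<forall>v\<in>schwartz.
               weyl_op T u v = (LINT x|lborel. vector_field_op X u x * v x))) \<and>
         assumption_A (vector_field_symbol X) \<and>
         (\<forall>\<alpha>\<^sub>1 \<alpha>\<^sub>2. 0 \<le> \<alpha>\<^sub>1 \<and> \<alpha>\<^sub>1 \<le> \<alpha>\<^sub>2 \<and> \<alpha>\<^sub>2 \<le> 1 \<and> \<alpha>\<^sub>1 + \<alpha>\<^sub>2 \<ge> 1 \<and> \<alpha>\<^sub>1 < 1 \<longrightarrow>
            assumption_B e (vector_field_symbol X) (anisotropic_metric \<alpha>\<^sub>1 \<alpha>\<^sub>2))"
proof -
  \<comment> \<open>With the constant weight 1, the assumed bounds on tensor norms give bounds for
    all iterated directional derivatives of X.\<close>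
  have X: "bounded_smooth X"
    by (rule tame_if_tensor_norm[OF assms(1)]) (use assms(2) in auto)
  have e: "euclidean_form e" using assms(3) by (simp add: self_dual_form_def)
  show ?thesis
    unfolding vector_field_symbol_eq vector_field_op_eq_transport
  proof (intro conjI exI[of _ "linear_distribution X"] ballI allI impI)
    show "is_distribution_of (linear_distribution X) (\<lambda>\<rho>. complex_of_real (linear_symbol X \<rho>))"
      by (rule linear_distribution_tempered[OF X])
    show "weyl_op (linear_distribution X) u v = (LINT x|lborel. transport X u x * v x)"
      if "u \<in> schwartz" "v \<in> schwartz" for u v
      using that by (intro weyl_op_linear_distribution X) (simp_all add: schwartz_iff_rapid)
    show "assumption_A (linear_symbol X)" by (rule assumption_A_linear_symbol[OF X])
    show "assumption_B e (linear_symbol X) (anisotropic_metric \<alpha>\<^sub>1 \<alpha>\<^sub>2)"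
      if "0 \<le> \<alpha>\<^sub>1 \<and> \<alpha>\<^sub>1 \<le> \<alpha>\<^sub>2 \<and> \<alpha>\<^sub>2 \<le> 1 \<and> \<alpha>\<^sub>1 + \<alpha>\<^sub>2 \<ge> 1 \<and> \<alpha>\<^sub>1 < 1" for \<alpha>\<^sub>1 \<alpha>\<^sub>2
      using that by (intro anisotropy.assumption_B_linear_symbol X e) (auto simp: anisotropy_def)
  qed
qed

end
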